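(* Let $\ell\ge1$ and $C^\infty_{eq}(S_0^{2\ell+1})=\{a\otimes I:\ a\in\mathcal A_\ell^\infty\}\subset\mathcal L(\mathcal H_\Sigma)$. The triple $(C^\infty_{eq}(S_0^{2\ell+1}),\mathcal H_\Sigma,D_{eq})$ is a regular spectral triple with simple dimension spectrum $\{1,2,\ldots,2\ell+1\}$.
   Context: **Basic notation.** $\mathbb N=\{0,1,2,\dots\}$. On $\ell_2(\mathbb N)$ and $\ell_2(\mathbb Z)$, with standard basis $(e_n)$, $S$ is the left shift $Se_n=e_{n-1}$ (with $Se_0=0$ on $\ell_2(\mathbb N)$); $p_0$ is the projection onto $\mathbb C e_0$. Put $\mathcal H_\ell=\ell_2(\mathbb N)^{\otimes \ell}\otimes\ell_2(\mathbb Z)$ and $\mathcal H_\Sigma=\mathcal H_\ell\otimes\ell_2(\mathbb N)^{\otimes\ell}=\ell_2(\Gamma)$, $\Gamma=\mathbb N^\ell\times\mathbb Z\times\mathbb N^\ell$, with standard basis $(e_\gamma)_{\gamma\in\Gamma}$. In $a\otimes I$, $a$ acts on $\mathcal H_\ell$ and $I$ on $\ell_2(\mathbb N)^{\otimes\ell}$. **The algebra $\mathcal A_\ell^\infty$.** Define Fréchet algebras $(\mathcal A_\ell^\infty,(\|\cdot\|_m)_{m\in\mathbb N})$ of operators on $\mathcal H_\ell$ inductively: $\mathcal A_0^\infty=C^\infty(\mathbb T)$ acting on $\ell_2(\mathbb Z)$, i.e. all $\sum_{n\in\mathbb Z}a_n\mathbf z^n$ with $(a_n)$ rapidly decreasing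 and $\mathbf z=S^*$ the right shift, with $\|\sum a_n\mathbf z^n\|_m=\sum(1+|n|)^m|a_n|$. For $\ell\ge1$, with $\alpha_1=S\otimes I$, $\mathcal A_\ell^\infty$ is the set of all $$a=\sum_{j,k\in\mathbb N}\alpha_1^{*j}(p_0\otimes a_{jk})\alpha_1^k+\sum_{k\ge0}\lambda_k\alpha_1^k+\sum_{k>0}\lambda_{-k}\alpha_1^{*k}$$ with $a_{jk}\in\mathcal A_{\ell-1}^\infty$, $\sum_{j,k}(1+j+k)^n\|a_{jk}\|_m<\infty$ for all $n,m$, and $(\lambda_k)_{k\in\mathbb Z}$ rapidly decreasing; $\|a\|_m=\max_{r,s\le m}\big(\sum_{j,k}(1+j+k)^r\|a_{jk}\|_s\big)+\sum_{k\in\mathbb Z}(1+|k|)^m|\lambda_k|$. **The operator $D_{eq}$.** $D_{eq}e_\gamma=\big(\sum_{i=1}^{2\ell+1}|\gamma_i|\big)e_\gamma$ if $\gamma_{\ell+1}\ge0$ and $\gamma_{\ell+2}=\dots=\gamma_{2\ell+1}=0$, and $D_{eq}e_\gamma=-\big(\sum_{i=1}^{2\ell+1}|\gamma_i|\big)e_\gamma$ otherwise. (This is the $SU_q(\ell+1)$-equivariant operator transported from $L_2(S_q^{2\ell+1})$ to $\mathcal H_\Sigma$.) **Spectral triples.** A spectral triple $(\mathcal A,\mathcal H,D)$ consists of a unital $*$-algebra $\mathcal A$ faithfully represented on a separable Hilbert space $\mathcal H$ and a self-adjoint $D$ with compact resolvent such that $[D,a]$ is bounded for all $a\in\mathcal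 A$. $\delta=[|D|,\cdot]$, with $Dom(\delta)$ the set of bounded $T$ leaving $Dom(|D|)$ invariant with $[|D|,T]$ extending to a bounded operator $\delta(T)$; $OP^0=\bigcap_nDom(\delta^n)$. The triple is regular if $\mathcal A+[D,\mathcal A]\subset OP^0$. If it is regular and $|D|^{-p}\in\mathcal L^{(1,\infty)}$ for some $p$, let $\mathcal B$ be the algebra generated by $\delta^n(\mathcal A)$ and $\delta^n([D,\mathcal A])$, $n\ge0$; it has discrete dimension spectrum $\Sigma\subset\mathbb C$ if $\Sigma$ is discrete and for every $b\in\mathcal B$ the function $Trace(b|D|^{-z})$, defined for $\mathrm{Re}\,z>p$, extends to a meromorphic function on $\mathbb C$ with poles only in $\Sigma$; that a given set is the dimension spectrum also means that each of its points is a pole for some $b\in\mathcal B$. The dimension spectrum is simple if all these poles are simple. Since $\ker D$ is finite dimensional, $|D|^{-z}$ is understood to be $0$ on $\ker D$. *)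

theory Defs
  imports "HOL-Complex_Analysis.Complex_Analysis" "HOL-Library.Function_Algebras"
begin

section \<open>The Hilbert space of square-summable functions on an index set\<close>

text \<open>
  Sizes such as \<open>\<nat>\<^sup>l \<times> \<int>\<close> depend on a natural number \<open>l\<close>, so index sets are sets rather than types.
  The Hilbert space over \<open>X\<close> consists of functions on the whole index type that vanish outside \<open>X\<close>;
  hence norms and inner products need not mention \<open>X\<close>. Sums, differences and zero of vectors and of
  operators are the pointwise ones of \<^theory>\<open>HOL-Library.Function_Algebras\<close>.
\<close>

type_synonym 'i vec = "'i \<Rightarrow> complex"
type_synonym 'i oper = "'i vec \<Rightarrow> 'i vec"

definition ell2 :: "'i set \<Rightarrow> 'i vec set" where
  "ell2 X = {\<xi>. (\<forall>x. x \<notin> X \<longrightarrow> \<xi> x = 0) \<and> (\<lambda>x. (cmod (\<xi> x))\<^sup>2) summable_on UNIV}"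

definition l2norm :: "'i vec \<Rightarrow> real" where
  "l2norm \<xi> = sqrt (\<Sum>\<^sub>\<infinity>x. (cmod (\<xi> x))\<^sup>2)"

definition ip :: "'i vec \<Rightarrow> 'i vec \<Rightarrow> complex" where
  "ip \<xi> \<eta> = (\<Sum>\<^sub>\<infinity>x. \<xi> x * cnj (\<eta> x))"

definition basis_vec :: "'i \<Rightarrow> 'i vec" where
  "basis_vec x = (\<lambda>y. if y = x then 1 else 0)"

definition smul :: "complex \<Rightarrow> 'i vec \<Rightarrow> 'i vec" (infixr "*\<^sub>v" 75) where
  "c *\<^sub>v \<xi> = (\<lambda>x. c * \<xi> x)"

definition osmul :: "complex \<Rightarrow> 'i oper \<Rightarrow> 'i oper" (infixr "*\<^sub>o" 75) where
  "c *\<^sub>o T = (\<lambda>\<xi>. c *\<^sub>v T \<xi>)"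

section \<open>Bounded operators\<close>

text \<open>
  Bounded operators take the value \<open>0\<close> outside the Hilbert space, so that equality
  of HOL functions is equality of operators; sums, scalar multiples and composites stay in the set.
\<close>

definition bop :: "'i set \<Rightarrow> 'i oper set" where
  "bop X = {T. (\<forall>\<xi>\<in>ell2 X. T \<xi> \<in> ell2 X) \<and>
               (\<forall>\<xi>\<in>ell2 X. \<forall>\<eta>\<in>ell2 X. T (\<xi> + \<eta>) = T \<xi> + T \<eta>) \<and>
               (\<forall>c. \<forall>\<xi>\<in>ell2 X. T (c *\<^sub>v \<xi>) = c *\<^sub>v T \<xi>) \<and>
               (\<exists>C. \<forall>\<xi>\<in>ell2 X. l2norm (T \<xi>) \<le> C * l2norm \<xi>) \<and>
               (\<forall>\<xi>. \<xi> \<notin> ell2 X \<longrightarrow> T \<xi> = 0)}"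

definition restrict_op :: "'i set \<Rightarrow> 'i oper \<Rightarrow> 'i oper" where
  "restrict_op X T = (\<lambda>\<xi>. if \<xi> \<in> ell2 X then T \<xi> else 0)"

definition id_op :: "'i set \<Rightarrow> 'i oper" where
  "id_op X = restrict_op X (\<lambda>\<xi>. \<xi>)"

definition opnorm :: "'i set \<Rightarrow> 'i oper \<Rightarrow> real" where
  "opnorm X T = (SUP \<xi>\<in>{\<xi>\<in>ell2 X. l2norm \<xi> \<le> 1}. l2norm (T \<xi>))"

definition is_adjoint :: "'i set \<Rightarrow> 'i oper \<Rightarrow> 'i oper \<Rightarrow> bool" where
  "is_adjoint X S T \<longleftrightarrow> T \<in> bop X \<and> (\<forall>\<xi>\<in>ell2 X. \<forall>\<eta>\<in>ell2 X. ip (S \<xi>) \<eta> = ip \<xi> (T \<eta>))"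

definition adj :: "'i set \<Rightarrow> 'i oper \<Rightarrow> 'i oper" where
  "adj X S = (THE T. is_adjoint X S T)"

text \<open>Unconditional convergence of a family of operators in operator norm. Only the values of the
  \<open>T i\<close> on \<open>ell2 X\<close> matter.\<close>

definition has_op_sum :: "'i set \<Rightarrow> ('j \<Rightarrow> 'i oper) \<Rightarrow> 'j set \<Rightarrow> 'i oper \<Rightarrow> bool" where
  "has_op_sum X T J a \<longleftrightarrow> a \<in> bop X \<and>
     (\<forall>\<epsilon>>0. \<forall>\<^sub>F F in finite_subsets_at_top J.
        \<forall>\<xi>\<in>ell2 X. l2norm (a \<xi> - (\<Sum>i\<in>F. T i \<xi>)) \<le> \<epsilon> * l2norm \<xi>)"

definition compact_op :: "'i set \<Rightarrow> 'i oper \<Rightarrow> bool" where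
  "compact_op X T \<longleftrightarrow> T \<in> bop X \<and>
     (\<forall>\<xi>::nat \<Rightarrow> 'i vec. (\<forall>n. \<xi> n \<in> ell2 X \<and> l2norm (\<xi> n) \<le> 1) \<longrightarrow>
        (\<exists>r \<eta>. strict_mono r \<and> \<eta> \<in> ell2 X \<and> (\<lambda>n. l2norm (T (\<xi> (r n)) - \<eta>)) \<longlonglongrightarrow> 0))"

definition rank_le :: "'i set \<Rightarrow> nat \<Rightarrow> 'i oper set" where
  "rank_le X n = {R \<in> bop X. \<exists>g. \<forall>\<xi>\<in>ell2 X. \<exists>c. R \<xi> = (\<Sum>i<n. c i *\<^sub>v g i)}"

text \<open>The singular values \<open>\<mu>\<^sub>0 \<ge> \<mu>\<^sub>1 \<ge> \<dots>\<close>, as distances to the operators of rank at most \<open>n\<close>.\<close>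

definition sing_val :: "'i set \<Rightarrow> 'i oper \<Rightarrow> nat \<Rightarrow> real" where
  "sing_val X T n = (INF R\<in>rank_le X n. opnorm X (T - R))"

definition trace_class :: "'i set \<Rightarrow> 'i oper \<Rightarrow> bool" where
  "trace_class X T \<longleftrightarrow> compact_op X T \<and> summable (sing_val X T)"

definition op_trace :: "'i set \<Rightarrow> 'i oper \<Rightarrow> complex" where
  "op_trace X T = (\<Sum>\<^sub>\<infinity>x\<in>X. T (basis_vec x) x)"

text \<open>The Dixmier ideal \<open>L\<^sup>(\<^sup>1\<^sup>,\<^sup>\<infinity>\<^sup>)\<close>: partial sums of the singular values are \<open>O(log N)\<close>.\<close>

definition dixmier_ideal :: "'i set \<Rightarrow> 'i oper set" where
  "dixmier_ideal X = {T. compact_op X T \<and>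
     (\<exists>C. \<forall>N\<ge>2. (\<Sum>n<N. sing_val X T n) \<le> C * ln (real N))}"

section \<open>Unbounded operators\<close>

text \<open>
  An unbounded operator is given by its graph: \<open>(\<xi>, \<eta>) \<in> D\<close> means that \<open>\<xi>\<close> lies in the domain and
  \<open>D \<xi> = \<eta>\<close>. The product of two operators, with its natural domain, is then \<^term>\<open>(O)\<close>.
\<close>

type_synonym 'i uop = "('i vec \<times> 'i vec) set"

definition dense_in :: "'i set \<Rightarrow> 'i vec set \<Rightarrow> bool" where
  "dense_in X S \<longleftrightarrow> (\<forall>\<eta>\<in>ell2 X. \<forall>\<epsilon>>0. \<exists>\<xi>\<in>S. l2norm (\<eta> - \<xi>) < \<epsilon>)"

definition adjoint_graph :: "'i set \<Rightarrow> 'i uop \<Rightarrow> 'i uop" where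
  "adjoint_graph X D = {(\<eta>, \<zeta>) \<in> ell2 X \<times> ell2 X. \<forall>(\<xi>, \<xi>')\<in>D. ip \<xi>' \<eta> = ip \<xi> \<zeta>}"

text \<open>Linearity and, by density of the domain, single-valuedness of the graph follow from the
  second conjunct.\<close>

definition selfadjoint :: "'i set \<Rightarrow> 'i uop \<Rightarrow> bool" where
  "selfadjoint X D \<longleftrightarrow> dense_in X (Domain D) \<and> adjoint_graph X D = D"

definition is_resolvent :: "'i set \<Rightarrow> 'i uop \<Rightarrow> complex \<Rightarrow> 'i oper \<Rightarrow> bool" where
  "is_resolvent X D \<mu> R \<longleftrightarrow> R \<in> bop X \<and>
     (\<forall>\<xi>\<in>ell2 X. (R \<xi>, \<xi> + \<mu> *\<^sub>v R \<xi>) \<in> D) \<and> (\<forall>(\<xi>, \<eta>)\<in>D. R (\<eta> - \<mu> *\<^sub>v \<xi>) = \<xi>)"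

definition compact_resolvent :: "'i set \<Rightarrow> 'i uop \<Rightarrow> bool" where
  "compact_resolvent X D \<longleftrightarrow> (\<forall>\<mu>. \<mu> \<notin> \<real> \<longrightarrow> (\<exists>R. is_resolvent X D \<mu> R \<and> compact_op X R))"

text \<open>The absolute value is the unique positive self-adjoint square root of \<open>D\<^sup>2\<close>.\<close>

definition abs_uop :: "'i set \<Rightarrow> 'i uop \<Rightarrow> 'i uop" where
  "abs_uop X D = (THE E. selfadjoint X E \<and>
     (\<forall>(\<xi>, \<eta>)\<in>E. Im (ip \<eta> \<xi>) = 0 \<and> 0 \<le> Re (ip \<eta> \<xi>)) \<and> E O E = D O D)"

text \<open>
  \<open>|D|\<^sup>-\<^sup>z\<close> for a self-adjoint \<open>D\<close> with compact resolvent and \<open>Re z \<ge> 0\<close>; such a \<open>|D|\<close> has an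
  orthonormal basis of eigenvectors, which determines the bounded operator. It is \<open>0\<close> on \<open>ker D\<close>.
\<close>

definition abs_neg_power :: "'i set \<Rightarrow> 'i uop \<Rightarrow> complex \<Rightarrow> 'i oper" where
  "abs_neg_power X D z = (THE T. T \<in> bop X \<and>
     (\<forall>\<mu>::real. \<forall>\<xi>. (\<xi>, complex_of_real \<mu> *\<^sub>v \<xi>) \<in> abs_uop X D \<longrightarrow>
        T \<xi> = (if \<mu> = 0 then 0 else (complex_of_real \<mu> powr (- z)) *\<^sub>v \<xi>)))"

text \<open>\<open>a\<close> leaves the domain of \<open>D\<close> invariant and \<open>T\<close> is the bounded extension of \<open>[D, a]\<close>, that is,
  \<open>D (a \<xi>) = T \<xi> + a (D \<xi>)\<close> on the domain of \<open>D\<close>.\<close>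

definition is_commutator :: "'i set \<Rightarrow> 'i uop \<Rightarrow> 'i oper \<Rightarrow> 'i oper \<Rightarrow> bool" where
  "is_commutator X D a T \<longleftrightarrow> T \<in> bop X \<and> (\<forall>(\<xi>, \<eta>)\<in>D. (a \<xi>, T \<xi> + a \<eta>) \<in> D)"

definition commutator :: "'i set \<Rightarrow> 'i uop \<Rightarrow> 'i oper \<Rightarrow> 'i oper" where
  "commutator X D a = (THE T. is_commutator X D a T)"

section \<open>Spectral triples\<close>

definition unital_star_algebra :: "'i set \<Rightarrow> 'i oper set \<Rightarrow> bool" where
  "unital_star_algebra X A \<longleftrightarrow> A \<subseteq> bop X \<and> id_op X \<in> A \<and>
     (\<forall>a\<in>A. \<forall>b\<in>A. a + b \<in> A \<and> a \<circ> b \<in> A) \<and> (\<forall>c. \<forall>a\<in>A. c *\<^sub>o a \<in> A) \<and>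
     (\<forall>a\<in>A. adj X a \<in> A)"

text \<open>The algebra is represented faithfully because it consists of operators;
  countability of \<open>X\<close> is separability of \<open>ell2 X\<close>.\<close>

definition spectral_triple :: "'i set \<Rightarrow> 'i oper set \<Rightarrow> 'i uop \<Rightarrow> bool" where
  "spectral_triple X A D \<longleftrightarrow> countable X \<and> unital_star_algebra X A \<and>
     selfadjoint X D \<and> compact_resolvent X D \<and> (\<forall>a\<in>A. \<exists>T. is_commutator X D a T)"

definition delta :: "'i set \<Rightarrow> 'i uop \<Rightarrow> 'i oper \<Rightarrow> 'i oper" where
  "delta X D = commutator X (abs_uop X D)"

definition delta_dom :: "'i set \<Rightarrow> 'i uop \<Rightarrow> 'i oper set" where
  "delta_dom X D = {T \<in> bop X. \<exists>T'. is_commutator X (abs_uop X D) T T'}"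

primrec delta_pow_dom :: "'i set \<Rightarrow> 'i uop \<Rightarrow> nat \<Rightarrow> 'i oper set" where
  "delta_pow_dom X D 0 = bop X"
| "delta_pow_dom X D (Suc n) = {T \<in> delta_dom X D. delta X D T \<in> delta_pow_dom X D n}"

definition OP0 :: "'i set \<Rightarrow> 'i uop \<Rightarrow> 'i oper set" where
  "OP0 X D = (\<Inter>n. delta_pow_dom X D n)"

definition regular_triple :: "'i set \<Rightarrow> 'i oper set \<Rightarrow> 'i uop \<Rightarrow> bool" where
  "regular_triple X A D \<longleftrightarrow> (\<forall>a\<in>A. a \<in> OP0 X D \<and> commutator X D a \<in> OP0 X D)"

inductive_set generated_algebra :: "'i oper set \<Rightarrow> 'i oper set" for G where
  gen: "a \<in> G \<Longrightarrow> a \<in> generated_algebra G"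
| add: "a \<in> generated_algebra G \<Longrightarrow> b \<in> generated_algebra G \<Longrightarrow> a + b \<in> generated_algebra G"
| scale: "a \<in> generated_algebra G \<Longrightarrow> c *\<^sub>o a \<in> generated_algebra G"
| mult: "a \<in> generated_algebra G \<Longrightarrow> b \<in> generated_algebra G \<Longrightarrow> a \<circ> b \<in> generated_algebra G"

definition B_alg :: "'i set \<Rightarrow> 'i oper set \<Rightarrow> 'i uop \<Rightarrow> 'i oper set" where
  "B_alg X A D = generated_algebra
     (\<Union>n. (delta X D ^^ n) ` A \<union> (delta X D ^^ n) ` (commutator X D ` A))"

definition finitely_summable :: "'i set \<Rightarrow> 'i uop \<Rightarrow> real \<Rightarrow> bool" where
  "finitely_summable X D p \<longleftrightarrow> p > 0 \<and> abs_neg_power X D (of_real p) \<in> dixmier_ideal X"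

definition zeta_extension ::
  "'i set \<Rightarrow> 'i uop \<Rightarrow> real \<Rightarrow> 'i oper \<Rightarrow> (complex \<Rightarrow> complex) \<Rightarrow> bool" where
  "zeta_extension X D p b f \<longleftrightarrow> f meromorphic_on UNIV \<and>
     (\<forall>z. Re z > p \<longrightarrow> trace_class X (b \<circ> abs_neg_power X D z) \<and>
                       f z = op_trace X (b \<circ> abs_neg_power X D z))"

definition has_dimension_spectrum ::
  "'i set \<Rightarrow> 'i oper set \<Rightarrow> 'i uop \<Rightarrow> complex set \<Rightarrow> bool" where
  "has_dimension_spectrum X A D \<Sigma> \<longleftrightarrow> discrete \<Sigma> \<and>
     (\<exists>p. finitely_summable X D p \<and>
        (\<forall>b\<in>B_alg X A D. \<exists>f. zeta_extension X D p b f \<and> {z. is_pole f z} \<subseteq> \<Sigma>) \<and>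
        (\<forall>s\<in>\<Sigma>. \<exists>b\<in>B_alg X A D. \<exists>f. zeta_extension X D p b f \<and> is_pole f s))"

definition simple_dimension_spectrum :: "'i set \<Rightarrow> 'i oper set \<Rightarrow> 'i uop \<Rightarrow> bool" where
  "simple_dimension_spectrum X A D \<longleftrightarrow>
     (\<forall>p. finitely_summable X D p \<longrightarrow>
        (\<forall>b\<in>B_alg X A D. \<forall>f. zeta_extension X D p b f \<longrightarrow>
           (\<forall>s. is_pole f s \<longrightarrow> zorder f s = -1)))"

section \<open>The smooth algebras\<close>

definition idx :: "nat \<Rightarrow> (nat list \<times> int) set" where
  "idx l = {(v, n). length v = l}"

text \<open>Operators act on coordinates: \<open>z e\<^sub>n = e\<^sub>n\<^sub>+\<^sub>1\<close> becomes \<open>(z \<xi>) n = \<xi> (n - 1)\<close>, and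
  \<open>S e\<^sub>n = e\<^sub>n\<^sub>-\<^sub>1\<close>, \<open>S e\<^sub>0 = 0\<close> becomes \<open>(S \<xi>) k = \<xi> (k + 1)\<close>.\<close>

definition z_pow :: "int \<Rightarrow> (nat list \<times> int) oper" where
  "z_pow k = restrict_op (idx 0) (\<lambda>\<xi> (v, n). \<xi> (v, n - k))"

definition alpha1 :: "nat \<Rightarrow> (nat list \<times> int) oper" where
  "alpha1 l = restrict_op (idx l)
     (\<lambda>\<xi> (v, n). case v of [] \<Rightarrow> 0 | k # w \<Rightarrow> \<xi> (Suc k # w, n))"

text \<open>\<open>p\<^sub>0 \<otimes> a\<close> on \<open>ell2 (idx (Suc l))\<close> for \<open>a\<close> on \<open>ell2 (idx l)\<close>.\<close>

definition p0_tensor :: "nat \<Rightarrow> (nat list \<times> int) oper \<Rightarrow> (nat list \<times> int) oper" where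
  "p0_tensor l a = restrict_op (idx (Suc l))
     (\<lambda>\<xi> (v, n). case v of [] \<Rightarrow> 0
        | k # w \<Rightarrow> if k = 0 then a (\<lambda>(w', n'). \<xi> (0 # w', n')) (w, n) else 0)"

definition rapidly_decreasing :: "(int \<Rightarrow> complex) \<Rightarrow> bool" where
  "rapidly_decreasing c \<longleftrightarrow> (\<forall>m. \<exists>C. \<forall>n. (1 + \<bar>real_of_int n\<bar>) ^ m * cmod (c n) \<le> C)"

text \<open>
  \<open>smooth_elem l a N\<close>: the operator \<open>a\<close> belongs to the algebra of level \<open>l\<close> and its \<open>m\<close>-th norm
  is \<open>N m\<close>. The two are defined together because membership at level \<open>l + 1\<close> involves the norms of
  level \<open>l\<close>. The coefficients, hence \<open>N\<close>, are uniquely determined by \<open>a\<close>.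
\<close>

inductive smooth_elem :: "nat \<Rightarrow> (nat list \<times> int) oper \<Rightarrow> (nat \<Rightarrow> real) \<Rightarrow> bool" where
  base: "rapidly_decreasing c \<Longrightarrow>
    has_op_sum (idx 0) (\<lambda>n. c n *\<^sub>o z_pow n) UNIV a \<Longrightarrow>
    smooth_elem 0 a (\<lambda>m. \<Sum>\<^sub>\<infinity>n. (1 + \<bar>real_of_int n\<bar>) ^ m * cmod (c n))"
| step: "(\<And>j k. smooth_elem l (A j k) (N j k)) \<Longrightarrow>
    (\<And>n m. (\<lambda>(j, k). (1 + real j + real k) ^ n * N j k m) summable_on UNIV) \<Longrightarrow>
    rapidly_decreasing c \<Longrightarrow>
    has_op_sum (idx (Suc l))
      (\<lambda>(j, k). (adj (idx (Suc l)) (alpha1 (Suc l)) ^^ j) \<circ> p0_tensor l (A j k) \<circ> (alpha1 (Suc l) ^^ k))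
      UNIV a0 \<Longrightarrow>
    has_op_sum (idx (Suc l)) (\<lambda>k. c (int k) *\<^sub>o (alpha1 (Suc l) ^^ k)) UNIV a1 \<Longrightarrow>
    has_op_sum (idx (Suc l))
      (\<lambda>k. c (- int k) *\<^sub>o (adj (idx (Suc l)) (alpha1 (Suc l)) ^^ k)) {k. k > 0} a2 \<Longrightarrow>
    smooth_elem (Suc l) (a0 + a1 + a2)
      (\<lambda>m. Max ((\<lambda>(r, s). \<Sum>\<^sub>\<infinity>(j, k). (1 + real j + real k) ^ r * N j k s) ` ({..m} \<times> {..m}))
           + (\<Sum>\<^sub>\<infinity>k. (1 + \<bar>real_of_int k\<bar>) ^ m * cmod (c k)))"

definition A_smooth :: "nat \<Rightarrow> (nat list \<times> int) oper set" where
  "A_smooth l = {a. \<exists>N. smooth_elem l a N}"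

section \<open>The equivariant triple\<close>

definition Gam :: "nat \<Rightarrow> ((nat list \<times> int) \<times> nat list) set" where
  "Gam l = idx l \<times> {w. length w = l}"

definition tensor_id ::
  "nat \<Rightarrow> (nat list \<times> int) oper \<Rightarrow> ((nat list \<times> int) \<times> nat list) oper" where
  "tensor_id l a = restrict_op (Gam l) (\<lambda>\<xi> (x, w). a (\<lambda>x'. \<xi> (x', w)) x)"

definition C_eq :: "nat \<Rightarrow> ((nat list \<times> int) \<times> nat list) oper set" where
  "C_eq l = tensor_id l ` A_smooth l"

definition d_eq :: "(nat list \<times> int) \<times> nat list \<Rightarrow> real" where
  "d_eq = (\<lambda>((v, n), w).
     let r = real (sum_list v) + \<bar>real_of_int n\<bar> + real (sum_list w)
     in if n \<ge> 0 \<and> (\<forall>i\<in>set w. i = 0) then r else - r)"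

text \<open>The self-adjoint diagonal operator, on its maximal domain, with eigenvalues \<^const>\<open>d_eq\<close>
  on the standard basis.\<close>

definition D_eq :: "nat \<Rightarrow> ((nat list \<times> int) \<times> nat list) uop" where
  "D_eq l = {(\<xi>, \<eta>) \<in> ell2 (Gam l) \<times> ell2 (Gam l). \<forall>\<gamma>. \<eta> \<gamma> = complex_of_real (d_eq \<gamma>) * \<xi> \<gamma>}"

end

theory Submission
  imports Defs
begin

text \<open>
  Operators are studied through their matrices \<open>K x y\<close> in the standard basis. Smooth elements are exactly
  the rapidly convergent sums of operators whose matrix of radius \<open>n\<close> lives within distance \<open>n\<close> of the
  diagonal and is invariant under translations, as long as the coordinates are compared only up to the
  first one that is at least \<open>n\<close>. Allowing all coordinates to be compared up to truncation at \<open>n\<close> gives a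
  larger class that is closed under products and under \<open>\<delta>\<close>, because \<open>|D|\<close> is the \<open>\<ell>\<^sub>1\<close>-norm of the index. It
  also contains \<open>[D, a]\<close>: the sign of \<open>D\<close> changes along a nonzero matrix entry only near the origin.
  This gives regularity, and every \<open>b\<close> in the algebra \<open>\<B>\<close> lies in the class.

  If the diagonal of \<open>b\<close> is eventually constant in each of the \<open>2l + 1\<close> coordinates, the generating function
  of its sums over the spheres \<open>|D| = r\<close> is a polynomial times \<open>(1 - X)\<^sup>-\<^sup>(\<^sup>2\<^sup>l\<^sup>+\<^sup>1\<^sup>)\<close>; for rapidly
  convergent sums of such \<open>b\<close> the polynomial becomes a power series with rapidly decreasing coefficients.
  Hence the sum over the sphere of radius \<open>r\<close> is a polynomial in \<open>r\<close> of degree at most \<open>2l\<close> plus a rapidly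
  decreasing term, and \<open>Trace (b |D|\<^sup>-\<^sup>z)\<close> is a combination of \<open>\<zeta>(z), \<dots>, \<zeta>(z - 2l)\<close> plus an entire function.
  The poles at \<open>l + 1, \<dots>, 2l + 1\<close> come from the projections onto \<open>\<gamma>\<^sub>1 = \<dots> = \<gamma>\<^sub>i = 0\<close>; the others come from
  these multiplied by the positive spectral projection of \<open>D\<close>, which \<open>[D, \<alpha>\<^sub>1] \<alpha>\<^sub>1\<^sup>*\<close> provides.
\<close>

text \<open>The algebra is given by nested operator series, in which products and adjoints of
  elements are not visibly series of the same kind. Kernels remove the nesting, but only if the
  correspondence is an equivalence: the norms of the definition and weighted sums of Schur bounds
  must dominate each other, with constants depending on the level alone, because each level sums
  infinitely many coefficients from the level below.

  The first class is too small for the calculus. Already |n + 1| - |n| is not translation invariant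
  on \<int>, so the commutator of |D| with the shift leaves it; and the sign of D depends on the
  last l coordinates, on which the algebra acts as the identity. Truncating every coordinate, the
  integer one on both sides, repairs both defects, and the diagonal of b then still has computable
  generating functions.

  Traces are first taken on a half-plane where crude counting in cubes gives absolute convergence;
  the exponent 2l + 2 comes from there. The location of the poles comes from the generating
  functions.\<close>

lemma norm_summable_comparison:
  assumes "g summable_on A" "\<And>x. x \<in> A \<Longrightarrow> norm (f x) \<le> (g x :: real)"
  shows "(\<lambda>x. norm (f x)) summable_on A"
  by (rule summable_on_comparison_test[OF assms(1)]) (use assms(2) in auto)

lemma ell2_finite_bound:
  assumes "\<xi> \<in> ell2 X" "finite F"
  shows "L2_set (\<lambda>x. cmod (\<xi> x)) F \<le> l2norm \<xi>"
  unfolding L2_set_def l2norm_def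
  using assms by (auto simp: ell2_def intro!: real_sqrt_le_mono finite_sum_le_infsum)

text \<open>A single bound on all finite partial sums yields square summability and the norm
  estimate together. Later estimates in the space are reduced to finite sums in this way.\<close>

lemma ell2_intro:
  assumes "\<And>x. x \<notin> X \<Longrightarrow> \<xi> x = 0" and bd: "\<And>F. finite F \<Longrightarrow> L2_set (\<lambda>x. cmod (\<xi> x)) F \<le> c"
  shows "\<xi> \<in> ell2 X" and "l2norm \<xi> \<le> c"
proof -
  have c0: "0 \<le> c" using bd[of "{}"] by simp
  have b: "(\<Sum>x\<in>F. (cmod (\<xi> x))\<^sup>2) \<le> c\<^sup>2" if "finite F" for F
    using bd[OF that] unfolding L2_set_def by (rule sqrt_le_D)
  have s: "(\<lambda>x. (cmod (\<xi> x))\<^sup>2) summable_on UNIV"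
    by (rule nonneg_bdd_above_summable_on) (auto intro!: bdd_aboveI2[where M="c\<^sup>2"] b)
  show "\<xi> \<in> ell2 X" using s assms(1) by (auto simp: ell2_def)
  have "(\<Sum>\<^sub>\<infinity>x. (cmod (\<xi> x))\<^sup>2) \<le> c\<^sup>2" by (rule infsum_le_finite_sums[OF s]) (auto intro: b)
  thus "l2norm \<xi> \<le> c" unfolding l2norm_def using c0 by (simp add: real_le_lsqrt)
qed

lemma ell2_outside: "\<xi> \<in> ell2 X \<Longrightarrow> x \<notin> X \<Longrightarrow> \<xi> x = 0"
  by (auto simp: ell2_def)

lemma l2norm_nonneg [simp]: "0 \<le> l2norm \<xi>"
  unfolding l2norm_def by (auto intro!: real_sqrt_ge_zero infsum_nonneg)

lemma coord_le_l2norm: "\<xi> \<in> ell2 X \<Longrightarrow> cmod (\<xi> x) \<le> l2norm \<xi>"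
  using ell2_finite_bound[of \<xi> X "{x}"] by simp

lemma ell2_eq0I: "\<xi> \<in> ell2 X \<Longrightarrow> l2norm \<xi> \<le> 0 \<Longrightarrow> \<xi> = 0"
proof (rule ext)
  fix x assume "\<xi> \<in> ell2 X" "l2norm \<xi> \<le> 0"
  hence "cmod (\<xi> x) \<le> 0" using coord_le_l2norm[of \<xi> X x] by linarith
  thus "\<xi> x = 0 x" by simp
qed

lemma ell2_zero [simp]: "0 \<in> ell2 X" and l2norm_zero [simp]: "l2norm 0 = 0"
  by (auto simp: ell2_def l2norm_def)

lemma
  assumes "\<xi> \<in> ell2 X" "\<eta> \<in> ell2 X"
  shows ell2_add: "\<xi> + \<eta> \<in> ell2 X" and l2norm_triangle: "l2norm (\<xi> + \<eta>) \<le> l2norm \<xi> + l2norm \<eta>"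
proof -
  have *: "L2_set (\<lambda>x. cmod ((\<xi> + \<eta>) x)) F \<le> l2norm \<xi> + l2norm \<eta>" if "finite F" for F
  proof -
    have "L2_set (\<lambda>x. cmod ((\<xi> + \<eta>) x)) F \<le> L2_set (\<lambda>x. cmod (\<xi> x) + cmod (\<eta> x)) F"
      by (intro L2_set_mono) (auto intro: norm_triangle_ineq)
    also have "\<dots> \<le> L2_set (\<lambda>x. cmod (\<xi> x)) F + L2_set (\<lambda>x. cmod (\<eta> x)) F"
      by (rule L2_set_triangle_ineq)
    finally show ?thesis
      using ell2_finite_bound[OF assms(1) that] ell2_finite_bound[OF assms(2) that] by simp
  qed
  show "\<xi> + \<eta> \<in> ell2 X" "l2norm (\<xi> + \<eta>) \<le> l2norm \<xi> + l2norm \<eta>"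
    using ell2_intro[of X "\<xi> + \<eta>", OF _ *] assms by (auto simp: ell2_outside)
qed

lemma
  assumes "\<xi> \<in> ell2 X"
  shows ell2_smul: "c *\<^sub>v \<xi> \<in> ell2 X" and l2norm_smul_le: "l2norm (c *\<^sub>v \<xi>) \<le> cmod c * l2norm \<xi>"
proof -
  have *: "L2_set (\<lambda>x. cmod ((c *\<^sub>v \<xi>) x)) F \<le> cmod c * l2norm \<xi>" if "finite F" for F
    using mult_left_mono[OF ell2_finite_bound[OF assms that], of "cmod c"]
      L2_set_right_distrib[of "cmod c" "\<lambda>x. cmod (\<xi> x)" F]
    by (simp add: smul_def norm_mult)
  show "c *\<^sub>v \<xi> \<in> ell2 X" "l2norm (c *\<^sub>v \<xi>) \<le> cmod c * l2norm \<xi>"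
    using ell2_intro[of X "c *\<^sub>v \<xi>", OF _ *] assms by (auto simp: ell2_outside smul_def)
qed

lemma minus_eq_smul: "\<xi> - \<eta> = \<xi> + (-1) *\<^sub>v \<eta>" for \<xi> \<eta> :: "'i vec"
  by (auto simp: smul_def)

lemma
  assumes "\<xi> \<in> ell2 X" "\<eta> \<in> ell2 X"
  shows ell2_diff: "\<xi> - \<eta> \<in> ell2 X" and l2norm_diff_le: "l2norm (\<xi> - \<eta>) \<le> l2norm \<xi> + l2norm \<eta>"
proof -
  show "\<xi> - \<eta> \<in> ell2 X" unfolding minus_eq_smul by (intro ell2_add ell2_smul assms)
  have "l2norm (\<xi> - \<eta>) \<le> l2norm \<xi> + l2norm ((-1) *\<^sub>v \<eta>)"
    unfolding minus_eq_smul by (rule l2norm_triangle[OF assms(1) ell2_smul[OF assms(2)]])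
  thus "l2norm (\<xi> - \<eta>) \<le> l2norm \<xi> + l2norm \<eta>" using l2norm_smul_le[OF assms(2), of "-1"] by simp
qed

lemma ell2_sum: "(\<And>i. i \<in> F \<Longrightarrow> u i \<in> ell2 X) \<Longrightarrow> (\<Sum>i\<in>F. u i) \<in> ell2 X"
  by (induction F rule: infinite_finite_induct) (auto simp: ell2_add)

lemma basis_vec_ell2: "x \<in> X \<Longrightarrow> basis_vec x \<in> ell2 X"
proof -
  assume "x \<in> X"
  have "(\<lambda>y. (cmod (basis_vec x y))\<^sup>2) summable_on UNIV"
    by (rule finite_nonzero_values_imp_summable_on) (simp add: basis_vec_def)
  thus ?thesis using \<open>x \<in> X\<close> by (auto simp: ell2_def basis_vec_def)
qed

lemma sum_fun_apply: "(\<Sum>i\<in>F. u i) x = (\<Sum>i\<in>F. u i x)" for u :: "'j \<Rightarrow> 'i \<Rightarrow> 'b::comm_monoid_add"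
  by (induction F rule: infinite_finite_induct) auto

definition trunc :: "'i set \<Rightarrow> 'i vec \<Rightarrow> 'i vec" where
  "trunc F \<xi> = (\<lambda>x. if x \<in> F then \<xi> x else 0)"

lemma trunc_eq_sum: "finite F \<Longrightarrow> trunc F \<xi> = (\<Sum>x\<in>F. \<xi> x *\<^sub>v basis_vec x)"
  by (auto simp: trunc_def sum_fun_apply smul_def basis_vec_def fun_eq_iff if_distrib[of "\<lambda>t. _ * t"] cong: if_cong)

lemma
  assumes "\<xi> \<in> ell2 X"
  shows trunc_ell2: "trunc F \<xi> \<in> ell2 X" and l2norm_trunc_le: "l2norm (trunc F \<xi>) \<le> l2norm \<xi>"
proof -
  have "L2_set (\<lambda>x. cmod (trunc F \<xi> x)) G \<le> l2norm \<xi>" if "finite G" for G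
    by (rule order_trans[OF L2_set_mono ell2_finite_bound[OF assms that]]) (auto simp: trunc_def)
  from ell2_intro[of X, OF _ this] show "trunc F \<xi> \<in> ell2 X" "l2norm (trunc F \<xi>) \<le> l2norm \<xi>"
    using assms by (auto simp: trunc_def ell2_outside)
qed

lemma trunc_approx:
  assumes "\<xi> \<in> ell2 X" "0 < e"
  obtains F where "finite F" "F \<subseteq> X" "l2norm (\<xi> - trunc F \<xi>) \<le> e"
proof -
  let ?f = "\<lambda>x. (cmod (\<xi> x))\<^sup>2"
  have s: "?f summable_on UNIV" using assms by (auto simp: ell2_def)
  obtain F where F: "finite F" "dist (sum ?f F) (infsum ?f UNIV) \<le> e\<^sup>2"
    using infsum_finite_approximation[OF s, of "e\<^sup>2"] assms by auto
  have "trunc (F \<inter> X) \<xi> = trunc F \<xi>" using assms by (auto simp: trunc_def ell2_outside)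
  moreover have "L2_set (\<lambda>x. cmod ((\<xi> - trunc F \<xi>) x)) G \<le> e" if G: "finite G" for G
  proof -
    have "(\<Sum>x\<in>G. (cmod ((\<xi> - trunc F \<xi>) x))\<^sup>2) = (\<Sum>x\<in>G - F. ?f x)"
      by (rule sum.mono_neutral_cong_right) (use G in \<open>auto simp: trunc_def\<close>)
    also have "\<dots> = (\<Sum>x\<in>(G - F) \<union> F. ?f x) - sum ?f F"
      by (subst sum.union_disjoint) (use F G in auto)
    also have "\<dots> \<le> infsum ?f UNIV - sum ?f F"
      by (intro diff_right_mono finite_sum_le_infsum) (use F G s in auto)
    also have "\<dots> \<le> e\<^sup>2" using F by (simp add: dist_real_def)
    finally show ?thesis unfolding L2_set_def using assms(2) by (simp add: real_le_lsqrt)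
  qed
  ultimately show ?thesis
    using that[of "F \<inter> X"] ell2_intro(2)[of X "\<xi> - trunc F \<xi>" e] F assms by (auto simp: ell2_outside trunc_def)
qed

section \<open>Bounded operators and their values on basis vectors\<close>

lemma bop_ell2: "T \<in> bop X \<Longrightarrow> \<xi> \<in> ell2 X \<Longrightarrow> T \<xi> \<in> ell2 X"
  and bop_add: "T \<in> bop X \<Longrightarrow> \<xi> \<in> ell2 X \<Longrightarrow> \<eta> \<in> ell2 X \<Longrightarrow> T (\<xi> + \<eta>) = T \<xi> + T \<eta>"
  and bop_smul: "T \<in> bop X \<Longrightarrow> \<xi> \<in> ell2 X \<Longrightarrow> T (c *\<^sub>v \<xi>) = c *\<^sub>v T \<xi>"
  and bop_outside: "T \<in> bop X \<Longrightarrow> \<xi> \<notin> ell2 X \<Longrightarrow> T \<xi> = 0"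
  by (auto simp: bop_def)

lemma bop_zero: "T \<in> bop X \<Longrightarrow> T 0 = 0"
proof -
  assume T: "T \<in> bop X"
  have z: "0 *\<^sub>v \<xi> = 0" for \<xi> :: "'a vec" by (auto simp: smul_def)
  show ?thesis using bop_smul[OF T ell2_zero, of 0] unfolding z .
qed

lemma bop_diff: "T \<in> bop X \<Longrightarrow> \<xi> \<in> ell2 X \<Longrightarrow> \<eta> \<in> ell2 X \<Longrightarrow> T (\<xi> - \<eta>) = T \<xi> - T \<eta>"
  using bop_add[of T X \<xi> "(-1) *\<^sub>v \<eta>"] by (simp add: minus_eq_smul[symmetric] bop_smul ell2_smul)

lemma bop_bound:
  assumes "T \<in> bop X" shows "\<exists>C\<ge>0. \<forall>\<xi>\<in>ell2 X. l2norm (T \<xi>) \<le> C * l2norm \<xi>"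
proof -
  obtain C where C: "\<And>\<xi>. \<xi> \<in> ell2 X \<Longrightarrow> l2norm (T \<xi>) \<le> C * l2norm \<xi>"
    using assms unfolding bop_def by blast
  have "l2norm (T \<xi>) \<le> max C 0 * l2norm \<xi>" if "\<xi> \<in> ell2 X" for \<xi>
    using C[OF that] by (meson l2norm_nonneg max.cobounded1 mult_right_mono order_trans)
  thus ?thesis by (intro exI[of _ "max C 0"]) simp
qed

lemma bop_sum:
  assumes "T \<in> bop X" "\<And>i. i \<in> F \<Longrightarrow> u i \<in> ell2 X"
  shows "T (\<Sum>i\<in>F. c i *\<^sub>v u i) = (\<Sum>i\<in>F. c i *\<^sub>v T (u i))"
  using assms(2)
proof (induction F rule: infinite_finite_induct)
  case (insert i F)
  have ins: "sum f (insert i F) = f i + sum f F" for f :: "'b \<Rightarrow> 'a vec"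
    using insert by simp
  have "T (c i *\<^sub>v u i + (\<Sum>i\<in>F. c i *\<^sub>v u i)) = T (c i *\<^sub>v u i) + T (\<Sum>i\<in>F. c i *\<^sub>v u i)"
    by (rule bop_add[OF assms(1)]) (use insert in \<open>auto intro!: ell2_smul ell2_sum\<close>)
  thus ?case unfolding ins using insert by (simp only: bop_smul[OF assms(1)] insertI1 insertI2)
qed (auto simp: bop_zero[OF assms(1)])

text \<open>Linearity gives equality on finite truncations, these are dense, and boundedness carries
  the equality to the limit. Hence a bounded operator is determined by its matrix.\<close>

lemma bop_eqI:
  assumes S: "S \<in> bop X" and T: "T \<in> bop X" and eq: "\<And>x. x \<in> X \<Longrightarrow> S (basis_vec x) = T (basis_vec x)"
  shows "S = T"
proof
  fix \<xi>
  show "S \<xi> = T \<xi>"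
  proof (cases "\<xi> \<in> ell2 X")
    case True
    obtain C where C: "0 \<le> C" "\<And>\<xi>. \<xi> \<in> ell2 X \<Longrightarrow> l2norm (S \<xi>) \<le> C * l2norm \<xi>" using bop_bound[OF S] by blast
    obtain C' where C': "0 \<le> C'" "\<And>\<xi>. \<xi> \<in> ell2 X \<Longrightarrow> l2norm (T \<xi>) \<le> C' * l2norm \<xi>" using bop_bound[OF T] by blast
    have "l2norm (S \<xi> - T \<xi>) \<le> (C + C') * e" if e: "e > 0" for e
    proof -
      obtain F where F: "finite F" "F \<subseteq> X" "l2norm (\<xi> - trunc F \<xi>) \<le> e" by (rule trunc_approx[OF True e])
      have tr: "trunc F \<xi> \<in> ell2 X" by (rule trunc_ell2[OF True])
      let ?d = "\<xi> - trunc F \<xi>"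
      have d: "?d \<in> ell2 X" by (rule ell2_diff[OF True tr])
      have "S (trunc F \<xi>) = T (trunc F \<xi>)"
        unfolding trunc_eq_sum[OF F(1)]
        by (subst (1 2) bop_sum[where X=X]) (use S T F eq in \<open>auto intro!: basis_vec_ell2 sum.cong\<close>)
      hence "S \<xi> - T \<xi> = S ?d - T ?d"
        by (simp add: bop_diff[OF S True tr] bop_diff[OF T True tr])
      hence "l2norm (S \<xi> - T \<xi>) \<le> l2norm (S ?d) + l2norm (T ?d)"
        using l2norm_diff_le[of "S ?d" X "T ?d"] bop_ell2[OF S d] bop_ell2[OF T d] by simp
      also have "\<dots> \<le> C * l2norm ?d + C' * l2norm ?d" using C C' d by (intro add_mono) auto
      also have "\<dots> \<le> C * e + C' * e" using C C' F by (intro add_mono mult_left_mono) auto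
      finally show ?thesis by (simp add: algebra_simps)
    qed
    hence "l2norm (S \<xi> - T \<xi>) \<le> 0"
    proof -
      assume *: "\<And>e. 0 < e \<Longrightarrow> l2norm (S \<xi> - T \<xi>) \<le> (C + C') * e"
      show ?thesis
      proof (rule field_le_epsilon)
        fix e :: real assume "e > 0"
        have "l2norm (S \<xi> - T \<xi>) \<le> (C + C') * (e / (C + C' + 1))"
          by (rule *) (use \<open>e > 0\<close> C C' in auto)
        also have "\<dots> \<le> e" using \<open>e > 0\<close> C C' by (simp add: field_simps)
        finally show "l2norm (S \<xi> - T \<xi>) \<le> 0 + e" by simp
      qed
    qed
    hence "S \<xi> - T \<xi> = 0"
      by (rule ell2_eq0I[OF ell2_diff[OF bop_ell2[OF S True] bop_ell2[OF T True]]])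
    thus ?thesis by simp
  qed (use S T in \<open>simp add: bop_outside\<close>)
qed

section \<open>Operators given by kernels\<close>

type_synonym 'i kern = "'i \<Rightarrow> 'i \<Rightarrow> complex"

text \<open>The hypothesis of the Schur test, with one constant for rows and columns. Finite partial
  sums are used so that summability is a consequence and not a separate assumption.\<close>

definition schur :: "'i set \<Rightarrow> real \<Rightarrow> 'i kern \<Rightarrow> bool" where
  "schur X S K \<longleftrightarrow> (\<forall>x y. K x y \<noteq> 0 \<longrightarrow> x \<in> X \<and> y \<in> X) \<and>
     (\<forall>F x. finite F \<longrightarrow> (\<Sum>y\<in>F. cmod (K x y)) \<le> S) \<and>
     (\<forall>F y. finite F \<longrightarrow> (\<Sum>x\<in>F. cmod (K x y)) \<le> S)"

definition kop :: "'i set \<Rightarrow> 'i kern \<Rightarrow> 'i oper" where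
  "kop X K = restrict_op X (\<lambda>\<xi> x. \<Sum>\<^sub>\<infinity>y. K x y * \<xi> y)"

definition kcomp :: "'i kern \<Rightarrow> 'i kern \<Rightarrow> 'i kern" where
  "kcomp K L = (\<lambda>x y. \<Sum>\<^sub>\<infinity>z. K x z * L z y)"

definition kadj :: "'i kern \<Rightarrow> 'i kern" where
  "kadj K = (\<lambda>x y. cnj (K y x))"

lemma schur_nonneg: "schur X S K \<Longrightarrow> 0 \<le> S"
  using sum.empty[of "\<lambda>y. cmod (K undefined y)"] unfolding schur_def by (metis finite.emptyI)

lemma schur_entry: "schur X S K \<Longrightarrow> cmod (K x y) \<le> S"
  unfolding schur_def by (auto dest!: spec[of _ "{y}"])

lemma schur_row: "schur X S K \<Longrightarrow> finite F \<Longrightarrow> (\<Sum>y\<in>F. cmod (K x y)) \<le> S"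
  and schur_col: "schur X S K \<Longrightarrow> finite F \<Longrightarrow> (\<Sum>x\<in>F. cmod (K x y)) \<le> S"
  by (simp_all add: schur_def)

lemma schur_supp: "schur X S K \<Longrightarrow> x \<notin> X \<or> y \<notin> X \<Longrightarrow> K x y = 0"
  by (auto simp: schur_def)

lemma schur_mono: "schur X S K \<Longrightarrow> S \<le> S' \<Longrightarrow> schur X S' K"
  unfolding schur_def by (meson order_trans)

lemma schur_add: "schur X S K \<Longrightarrow> schur X S' L \<Longrightarrow> schur X (S + S') (K + L)"
proof -
  assume K: "schur X S K" and L: "schur X S' L"
  have "(\<Sum>y\<in>F. cmod ((K + L) x y)) \<le> S + S'" if "finite F" for F x
  proof -
    have "(\<Sum>y\<in>F. cmod ((K + L) x y)) \<le> (\<Sum>y\<in>F. cmod (K x y) + cmod (L x y))"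
      by (intro sum_mono) (simp add: norm_triangle_ineq)
    thus ?thesis using schur_row[OF K that, of x] schur_row[OF L that, of x] by (simp add: sum.distrib)
  qed
  moreover have "(\<Sum>x\<in>F. cmod ((K + L) x y)) \<le> S + S'" if "finite F" for F y
  proof -
    have "(\<Sum>x\<in>F. cmod ((K + L) x y)) \<le> (\<Sum>x\<in>F. cmod (K x y) + cmod (L x y))"
      by (intro sum_mono) (simp add: norm_triangle_ineq)
    thus ?thesis using schur_col[OF K that, of y] schur_col[OF L that, of y] by (simp add: sum.distrib)
  qed
  moreover have "(K + L) x y = 0" if "x \<notin> X \<or> y \<notin> X" for x y
    using schur_supp[OF K that] schur_supp[OF L that] by simp
  ultimately show ?thesis unfolding schur_def by blast
qed

text \<open>Commutators with diagonal operators multiply a kernel entrywise; a bound on the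
  multiplier over the support of the kernel is then all that has to be found.\<close>

lemma schur_dominated:
  assumes "schur X S K" "\<And>x y. cmod (L x y) \<le> c * cmod (K x y)" "0 \<le> c"
  shows "schur X (c * S) L"
proof -
  have "(\<Sum>y\<in>F. cmod (L x y)) \<le> c * S" if "finite F" for F x
  proof -
    have "(\<Sum>y\<in>F. cmod (L x y)) \<le> c * (\<Sum>y\<in>F. cmod (K x y))"
      unfolding sum_distrib_left by (intro sum_mono assms)
    also have "\<dots> \<le> c * S" using assms that by (intro mult_left_mono) (auto simp: schur_def)
    finally show ?thesis .
  qed
  moreover have "(\<Sum>x\<in>F. cmod (L x y)) \<le> c * S" if "finite F" for F y
  proof -
    have "(\<Sum>x\<in>F. cmod (L x y)) \<le> c * (\<Sum>x\<in>F. cmod (K x y))"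
      unfolding sum_distrib_left by (intro sum_mono assms)
    also have "\<dots> \<le> c * S" using assms that by (intro mult_left_mono) (auto simp: schur_def)
    finally show ?thesis .
  qed
  moreover have "L x y = 0" if "x \<notin> X \<or> y \<notin> X" for x y
    using assms(2)[of x y] schur_supp[OF assms(1) that] by simp
  ultimately show ?thesis unfolding schur_def by blast
qed

lemma schur_scale: "schur X S K \<Longrightarrow> schur X (cmod c * S) (\<lambda>x y. c * K x y)"
  by (rule schur_dominated) (auto simp: norm_mult)

lemma schur_kadj: "schur X S K \<Longrightarrow> schur X S (kadj K)"
  by (auto simp: schur_def kadj_def)

lemma schur_zero: "0 \<le> S \<Longrightarrow> schur X S (\<lambda>x y. 0)"
  by (auto simp: schur_def)

text \<open>Every row and column has at most one nonzero entry, so each sum collapses to one term.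
  Shifts and diagonal operators are of this form.\<close>

lemma schur_partial_injection:
  assumes "\<And>x y. K x y \<noteq> 0 \<Longrightarrow> x \<in> X \<and> y \<in> X \<and> cmod (K x y) \<le> S"
    and "\<And>x y y'. K x y \<noteq> 0 \<Longrightarrow> K x y' \<noteq> 0 \<Longrightarrow> y = y'"
    and "\<And>x x' y. K x y \<noteq> 0 \<Longrightarrow> K x' y \<noteq> 0 \<Longrightarrow> x = x'" and "0 \<le> S"
  shows "schur X S K"
proof -
  have *: "(\<Sum>y\<in>F. cmod (f y)) \<le> S"
    if "finite F" "\<And>y. f y \<noteq> 0 \<Longrightarrow> cmod (f y) \<le> S" "\<And>y y'. f y \<noteq> 0 \<Longrightarrow> f y' \<noteq> 0 \<Longrightarrow> y = y'"
    for F and f :: "'b \<Rightarrow> complex"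
  proof (cases "\<exists>y\<in>F. f y \<noteq> 0")
    case True
    then obtain y where y: "y \<in> F" "f y \<noteq> 0" by blast
    have "(\<Sum>y\<in>F. cmod (f y)) = (\<Sum>y\<in>{y}. cmod (f y))"
      by (rule sum.mono_neutral_right) (use that y in auto)
    thus ?thesis using that y by simp
  next
    case False
    hence "(\<Sum>y\<in>F. cmod (f y)) = 0" by simp
    thus ?thesis using assms(4) by simp
  qed
  show ?thesis unfolding schur_def
  proof (intro conjI allI impI)
    fix F x show "finite F \<Longrightarrow> (\<Sum>y\<in>F. cmod (K x y)) \<le> S" by (rule *) (use assms in blast)+
  next
    fix F y show "finite F \<Longrightarrow> (\<Sum>x\<in>F. cmod (K x y)) \<le> S" by (rule *) (use assms in blast)+
  qed (use assms in blast)+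
qed

lemma schur_row_summable: "schur X S K \<Longrightarrow> (\<lambda>y. cmod (K x y)) summable_on UNIV"
  by (rule nonneg_bdd_above_summable_on) (auto simp: schur_def intro!: bdd_aboveI2[where M=S])

lemma kop_summable:
  assumes "schur X S K" "\<xi> \<in> ell2 Y"
  shows "(\<lambda>y. K x y * \<xi> y) summable_on UNIV"
proof -
  have "(\<lambda>y. norm (K x y * \<xi> y)) summable_on UNIV"
  proof (rule norm_summable_comparison)
    show "(\<lambda>y. cmod (K x y) * l2norm \<xi>) summable_on UNIV"
      by (intro summable_on_cmult_left schur_row_summable[OF assms(1)])
  qed (auto simp: norm_mult intro!: mult_left_mono coord_le_l2norm[OF assms(2)])
  thus ?thesis by (rule abs_summable_summable)
qed

text \<open>Split |K| into two factors sqrt |K| and apply Cauchy-Schwarz: the row sums bound one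
  factor, and after exchanging the order of summation the column sums bound the other.\<close>

lemma schur_test_finite:
  assumes K: "schur X S K" and \<xi>: "\<xi> \<in> ell2 X" and F: "finite F" and G: "finite G"
  shows "L2_set (\<lambda>x. cmod (\<Sum>y\<in>G. K x y * \<xi> y)) F \<le> S * l2norm \<xi>"
proof -
  have S0: "0 \<le> S" by (rule schur_nonneg[OF K])
  have pt: "(cmod (\<Sum>y\<in>G. K x y * \<xi> y))\<^sup>2 \<le> S * (\<Sum>y\<in>G. cmod (K x y) * (cmod (\<xi> y))\<^sup>2)" for x
  proof -
    have "cmod (\<Sum>y\<in>G. K x y * \<xi> y) \<le> (\<Sum>y\<in>G. sqrt (cmod (K x y)) * (sqrt (cmod (K x y)) * cmod (\<xi> y)))"
      by (rule order_trans[OF norm_sum]) (simp add: norm_mult mult.assoc[symmetric])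
    hence "(cmod (\<Sum>y\<in>G. K x y * \<xi> y))\<^sup>2 \<le> (\<Sum>y\<in>G. sqrt (cmod (K x y)) * (sqrt (cmod (K x y)) * cmod (\<xi> y)))\<^sup>2"
      by (intro power_mono) auto
    also have "\<dots> \<le> (\<Sum>y\<in>G. (sqrt (cmod (K x y)))\<^sup>2) * (\<Sum>y\<in>G. (sqrt (cmod (K x y)) * cmod (\<xi> y))\<^sup>2)"
      by (rule Cauchy_Schwarz_ineq_sum)
    also have "\<dots> = (\<Sum>y\<in>G. cmod (K x y)) * (\<Sum>y\<in>G. cmod (K x y) * (cmod (\<xi> y))\<^sup>2)"
      by (simp add: power_mult_distrib)
    also have "\<dots> \<le> S * (\<Sum>y\<in>G. cmod (K x y) * (cmod (\<xi> y))\<^sup>2)"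
      using K G by (intro mult_right_mono) (auto simp: schur_def intro!: sum_nonneg)
    finally show ?thesis .
  qed
  have "(\<Sum>x\<in>F. (cmod (\<Sum>y\<in>G. K x y * \<xi> y))\<^sup>2) \<le> (\<Sum>x\<in>F. S * (\<Sum>y\<in>G. cmod (K x y) * (cmod (\<xi> y))\<^sup>2))"
    by (intro sum_mono pt)
  also have "\<dots> = S * (\<Sum>y\<in>G. (\<Sum>x\<in>F. cmod (K x y)) * (cmod (\<xi> y))\<^sup>2)"
    unfolding sum_distrib_left[symmetric] sum_distrib_right by (subst sum.swap) simp
  also have "\<dots> \<le> S * (\<Sum>y\<in>G. S * (cmod (\<xi> y))\<^sup>2)"
    using K F S0 by (intro mult_left_mono sum_mono mult_right_mono) (auto simp: schur_def)
  also have "\<dots> = S\<^sup>2 * (L2_set (\<lambda>y. cmod (\<xi> y)) G)\<^sup>2"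
    by (simp add: L2_set_def sum_distrib_left power2_eq_square sum_nonneg mult.assoc)
  also have "\<dots> \<le> S\<^sup>2 * (l2norm \<xi>)\<^sup>2"
    by (intro mult_left_mono power_mono ell2_finite_bound[OF \<xi> G]) auto
  finally have "(\<Sum>x\<in>F. (cmod (\<Sum>y\<in>G. K x y * \<xi> y))\<^sup>2) \<le> (S * l2norm \<xi>)\<^sup>2"
    by (simp add: power_mult_distrib)
  thus ?thesis unfolding L2_set_def using S0 by (simp add: real_le_lsqrt)
qed

lemma
  assumes K: "schur X S K" and \<xi>: "\<xi> \<in> ell2 X"
  shows kop_ell2: "kop X K \<xi> \<in> ell2 X" and l2norm_kop: "l2norm (kop X K \<xi>) \<le> S * l2norm \<xi>"
proof -
  \<comment> \<open>The finite estimate is uniform in the set of columns, so it survives the limit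
    along finite column sets.\<close>
  have "L2_set (\<lambda>x. cmod (kop X K \<xi> x)) F \<le> S * l2norm \<xi>" if F: "finite F" for F
  proof (rule tendsto_upperbound)
    show "((\<lambda>G. L2_set (\<lambda>x. cmod (\<Sum>y\<in>G. K x y * \<xi> y)) F) \<longlongrightarrow> L2_set (\<lambda>x. cmod (kop X K \<xi> x)) F)
       (finite_subsets_at_top UNIV)"
      unfolding L2_set_def using \<xi>
      by (auto simp: kop_def restrict_op_def intro!: tendsto_intros infsum_tendsto kop_summable[OF K \<xi>])
    show "\<forall>\<^sub>F G in finite_subsets_at_top UNIV. L2_set (\<lambda>x. cmod (\<Sum>y\<in>G. K x y * \<xi> y)) F \<le> S * l2norm \<xi>"
      by (rule eventually_finite_subsets_at_top_weakI) (auto intro: schur_test_finite[OF K \<xi> F])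
  qed auto
  moreover have "kop X K \<xi> x = 0" if "x \<notin> X" for x
    using \<xi> that K by (auto simp: kop_def restrict_op_def schur_supp intro!: infsum_0)
  ultimately show "kop X K \<xi> \<in> ell2 X" "l2norm (kop X K \<xi>) \<le> S * l2norm \<xi>"
    using ell2_intro[of X "kop X K \<xi>"] by auto
qed

lemma kop_apply: "\<xi> \<in> ell2 X \<Longrightarrow> kop X K \<xi> x = (\<Sum>\<^sub>\<infinity>y. K x y * \<xi> y)"
  by (simp add: kop_def restrict_op_def)

lemma kop_bop:
  assumes K: "schur X S K" shows "kop X K \<in> bop X"
proof -
  have "kop X K (\<xi> + \<eta>) = kop X K \<xi> + kop X K \<eta>" if "\<xi> \<in> ell2 X" "\<eta> \<in> ell2 X" for \<xi> \<eta>
    using that by (auto simp: kop_apply ell2_add fun_eq_iff distrib_left intro!: infsum_add kop_summable[OF K])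
  moreover have "kop X K (c *\<^sub>v \<xi>) = c *\<^sub>v kop X K \<xi>" if "\<xi> \<in> ell2 X" for c \<xi>
    using that ell2_smul[OF that, of c] by (auto simp: kop_apply fun_eq_iff smul_def mult.left_commute[of _ c] infsum_cmult_right')
  moreover have "kop X K \<xi> = 0" if "\<xi> \<notin> ell2 X" for \<xi> using that by (simp add: kop_def restrict_op_def)
  ultimately show ?thesis
    unfolding bop_def using kop_ell2[OF K] l2norm_kop[OF K] by blast
qed

lemma kop_basis: "y \<in> X \<Longrightarrow> kop X K (basis_vec y) x = K x y"
proof -
  assume "y \<in> X"
  hence "kop X K (basis_vec y) x = (\<Sum>\<^sub>\<infinity>z. K x z * basis_vec y z)" by (simp add: kop_apply basis_vec_ell2)
  also have "\<dots> = (\<Sum>\<^sub>\<infinity>z\<in>{y}. K x z * basis_vec y z)" by (rule infsum_cong_neutral) (auto simp: basis_vec_def)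
  finally show ?thesis by (simp add: basis_vec_def)
qed

lemma kop_eqI:
  assumes "schur X S K" "T \<in> bop X" "\<And>x y. y \<in> X \<Longrightarrow> T (basis_vec y) x = K x y"
  shows "T = kop X K"
  by (rule bop_eqI[OF assms(2) kop_bop[OF assms(1)]]) (auto simp: kop_basis assms(3) fun_eq_iff)

lemma kop_add: "schur X S K \<Longrightarrow> schur X S' L \<Longrightarrow> kop X (K + L) = kop X K + kop X L"
  by (auto simp: kop_def restrict_op_def fun_eq_iff distrib_right intro!: infsum_add kop_summable)

lemma kop_scale: "kop X (\<lambda>x y. c * K x y) = c *\<^sub>o kop X K"
  by (auto simp: kop_def restrict_op_def fun_eq_iff osmul_def smul_def mult.assoc infsum_cmult_right')

lemma kop_zero: "kop X (\<lambda>x y. 0) = 0"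
  by (auto simp: kop_def restrict_op_def fun_eq_iff)

lemma kop_diff: "schur X S K \<Longrightarrow> schur X S' L \<Longrightarrow> kop X (K - L) = kop X K - kop X L"
  using kop_add[of X S K "cmod (-1) * S'" "\<lambda>x y. - 1 * L x y"] schur_scale[of X S' L "-1"] kop_scale[of X "-1" L]
  by (auto simp: fun_eq_iff osmul_def smul_def plus_fun_def fun_diff_def)

lemma schur_sum: "(\<And>i. i \<in> F \<Longrightarrow> schur X (s i) (K i)) \<Longrightarrow> schur X (sum s F) (\<lambda>x y. \<Sum>i\<in>F. K i x y)"
proof (induction F rule: infinite_finite_induct)
  case (insert i F)
  have "schur X (s i + sum s F) (K i + (\<lambda>x y. \<Sum>i\<in>F. K i x y))" by (rule schur_add) (use insert in auto)
  thus ?case using insert by (simp add: plus_fun_def)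
qed (auto intro: schur_zero)

lemma kop_sum: "(\<And>i. i \<in> F \<Longrightarrow> schur X (s i) (K i)) \<Longrightarrow> kop X (\<lambda>x y. \<Sum>i\<in>F. K i x y) = (\<Sum>i\<in>F. kop X (K i))"
proof (induction F rule: infinite_finite_induct)
  case (insert i F)
  have "kop X (K i + (\<lambda>x y. \<Sum>i\<in>F. K i x y)) = kop X (K i) + kop X (\<lambda>x y. \<Sum>i\<in>F. K i x y)"
    by (rule kop_add[of _ "s i" _ "sum s F"]) (use insert in \<open>auto intro: schur_sum\<close>)
  thus ?case using insert by (simp add: plus_fun_def)
qed (auto simp: kop_zero)

text \<open>Bounds over rectangles suffice, because a finite set of pairs lies in the product of its
  two projections.\<close>

lemma double_summable:
  fixes f :: "'a \<Rightarrow> 'b \<Rightarrow> complex"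
  assumes "\<And>F G. finite F \<Longrightarrow> finite G \<Longrightarrow> (\<Sum>x\<in>F. \<Sum>y\<in>G. cmod (f x y)) \<le> C"
  shows "(\<lambda>(x, y). f x y) summable_on UNIV \<times> UNIV"
proof -
  have "sum (\<lambda>p. norm (case p of (x, y) \<Rightarrow> f x y)) H \<le> C" if "finite H" for H
  proof -
    have "sum (\<lambda>p. norm (case p of (x, y) \<Rightarrow> f x y)) H \<le> sum (\<lambda>p. norm (case p of (x, y) \<Rightarrow> f x y)) (fst ` H \<times> snd ` H)"
      by (rule sum_mono2) (use that in \<open>auto intro: rev_image_eqI\<close>)
    also have "\<dots> = (\<Sum>x\<in>fst ` H. \<Sum>y\<in>snd ` H. cmod (f x y))" by (simp add: sum.cartesian_product case_prod_beta)
    also have "\<dots> \<le> C" using assms that by simp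
    finally show ?thesis .
  qed
  hence "(\<lambda>p. norm (case p of (x, y) \<Rightarrow> f x y)) summable_on UNIV \<times> UNIV"
    by (intro nonneg_bdd_above_summable_on) (auto intro!: bdd_aboveI2)
  thus ?thesis by (rule abs_summable_summable)
qed

lemma kcomp_summable: "schur X S K \<Longrightarrow> schur X' S' L \<Longrightarrow> (\<lambda>z. K x z * L z y) summable_on UNIV"
proof -
  assume *: "schur X S K" "schur X' S' L"
  have "(\<lambda>z. norm (K x z * L z y)) summable_on UNIV"
  proof (rule norm_summable_comparison)
    show "(\<lambda>z. cmod (K x z) * S') summable_on UNIV"
      by (intro summable_on_cmult_left schur_row_summable[OF *(1)])
    show "norm (K x z * L z y) \<le> cmod (K x z) * S'" for z
      using schur_entry[OF *(2)] by (auto simp: norm_mult intro!: mult_left_mono)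
  qed
  thus ?thesis by (rule abs_summable_summable)
qed

text \<open>For finite intermediate sets the sums factor into a sum for K and a sum for L. The
  infinite intermediate sum is reached as a limit, which keeps the bound.\<close>

lemma schur_kcomp:
  assumes K: "schur X S K" and L: "schur X S' L"
  shows "schur X (S * S') (kcomp K L)"
proof -
  have S0: "0 \<le> S" "0 \<le> S'" using schur_nonneg K L by auto
  have r: "(\<Sum>y\<in>F. cmod (kcomp K L x y)) \<le> S * S'" if F: "finite F" for F x
  proof (rule tendsto_upperbound)
    show "((\<lambda>G. \<Sum>y\<in>F. cmod (\<Sum>z\<in>G. K x z * L z y)) \<longlongrightarrow> (\<Sum>y\<in>F. cmod (kcomp K L x y))) (finite_subsets_at_top UNIV)"
      unfolding kcomp_def by (intro tendsto_intros infsum_tendsto kcomp_summable[OF K L])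
    have "(\<Sum>y\<in>F. cmod (\<Sum>z\<in>G. K x z * L z y)) \<le> S * S'" if G: "finite G" for G
    proof -
      have "(\<Sum>y\<in>F. cmod (\<Sum>z\<in>G. K x z * L z y)) \<le> (\<Sum>y\<in>F. \<Sum>z\<in>G. cmod (K x z) * cmod (L z y))"
        by (intro sum_mono order_trans[OF norm_sum]) (simp add: norm_mult)
      also have "\<dots> = (\<Sum>z\<in>G. cmod (K x z) * (\<Sum>y\<in>F. cmod (L z y)))"
        by (subst sum.swap) (simp add: sum_distrib_left)
      also have "\<dots> \<le> (\<Sum>z\<in>G. cmod (K x z) * S')"
        using L F by (intro sum_mono mult_left_mono) (auto simp: schur_def)
      also have "\<dots> \<le> S * S'" unfolding sum_distrib_right[symmetric]
        using K G S0 by (intro mult_right_mono) (auto simp: schur_def)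
      finally show ?thesis .
    qed
    thus "\<forall>\<^sub>F G in finite_subsets_at_top UNIV. (\<Sum>y\<in>F. cmod (\<Sum>z\<in>G. K x z * L z y)) \<le> S * S'"
      by (intro eventually_finite_subsets_at_top_weakI)
  qed auto
  have c: "(\<Sum>x\<in>F. cmod (kcomp K L x y)) \<le> S * S'" if F: "finite F" for F y
  proof (rule tendsto_upperbound)
    show "((\<lambda>G. \<Sum>x\<in>F. cmod (\<Sum>z\<in>G. K x z * L z y)) \<longlongrightarrow> (\<Sum>x\<in>F. cmod (kcomp K L x y))) (finite_subsets_at_top UNIV)"
      unfolding kcomp_def by (intro tendsto_intros infsum_tendsto kcomp_summable[OF K L])
    have "(\<Sum>x\<in>F. cmod (\<Sum>z\<in>G. K x z * L z y)) \<le> S * S'" if G: "finite G" for G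
    proof -
      have "(\<Sum>x\<in>F. cmod (\<Sum>z\<in>G. K x z * L z y)) \<le> (\<Sum>x\<in>F. \<Sum>z\<in>G. cmod (K x z) * cmod (L z y))"
        by (intro sum_mono order_trans[OF norm_sum]) (simp add: norm_mult)
      also have "\<dots> = (\<Sum>z\<in>G. (\<Sum>x\<in>F. cmod (K x z)) * cmod (L z y))"
        by (subst sum.swap) (simp add: sum_distrib_right)
      also have "\<dots> \<le> (\<Sum>z\<in>G. S * cmod (L z y))"
        using K F by (intro sum_mono mult_right_mono) (auto simp: schur_def)
      also have "\<dots> \<le> S * S'" unfolding sum_distrib_left[symmetric]
        using L G S0 by (intro mult_left_mono) (auto simp: schur_def)
      finally show ?thesis .
    qed
    thus "\<forall>\<^sub>F G in finite_subsets_at_top UNIV. (\<Sum>x\<in>F. cmod (\<Sum>z\<in>G. K x z * L z y)) \<le> S * S'"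
      by (intro eventually_finite_subsets_at_top_weakI)
  qed auto
  have "kcomp K L x y = 0" if "x \<notin> X \<or> y \<notin> X" for x y
  proof -
    have "K x z * L z y = 0" for z using that schur_supp[OF K] schur_supp[OF L] by auto
    thus ?thesis unfolding kcomp_def by (intro infsum_0) blast
  qed
  thus ?thesis using r c by (auto simp: schur_def)
qed

text \<open>This is Fubini: the coordinates of \<xi> are bounded by its norm, so the double family
  is absolutely summable with bound \<open>S * (S' * l2norm \<xi>)\<close>.\<close>

lemma kop_kcomp:
  assumes K: "schur X S K" and L: "schur X S' L"
  shows "kop X K \<circ> kop X L = kop X (kcomp K L)"
proof
  fix \<xi>
  have S0: "0 \<le> S" "0 \<le> S'" using schur_nonneg K L by auto
  show "(kop X K \<circ> kop X L) \<xi> = kop X (kcomp K L) \<xi>"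
  proof (cases "\<xi> \<in> ell2 X")
    case True
    have "kop X K (kop X L \<xi>) x = kop X (kcomp K L) \<xi> x" for x
    proof -
      have sm: "(\<lambda>(y, z). K x y * (L y z * \<xi> z)) summable_on UNIV \<times> UNIV"
      proof (rule double_summable)
        fix F :: "'a set" and G :: "'a set" assume F: "finite F" and G: "finite G"
        have "(\<Sum>y\<in>F. \<Sum>z\<in>G. cmod (K x y * (L y z * \<xi> z))) \<le> (\<Sum>y\<in>F. \<Sum>z\<in>G. cmod (K x y) * (cmod (L y z) * l2norm \<xi>))"
          by (auto simp: norm_mult intro!: sum_mono mult_left_mono coord_le_l2norm[OF True])
        also have "\<dots> = (\<Sum>y\<in>F. cmod (K x y) * ((\<Sum>z\<in>G. cmod (L y z)) * l2norm \<xi>))"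
          by (simp add: sum_distrib_left sum_distrib_right)
        also have "\<dots> \<le> (\<Sum>y\<in>F. cmod (K x y) * (S' * l2norm \<xi>))"
          using L G by (intro sum_mono mult_left_mono mult_right_mono) (auto simp: schur_def)
        also have "\<dots> \<le> S * (S' * l2norm \<xi>)" unfolding sum_distrib_right[symmetric]
          using K F S0 by (intro mult_right_mono) (auto simp: schur_def)
        finally show "(\<Sum>y\<in>F. \<Sum>z\<in>G. cmod (K x y * (L y z * \<xi> z))) \<le> S * (S' * l2norm \<xi>)" .
      qed
      have "kop X K (kop X L \<xi>) x = (\<Sum>\<^sub>\<infinity>y. \<Sum>\<^sub>\<infinity>z. K x y * (L y z * \<xi> z))"
        by (simp add: kop_apply True kop_ell2[OF L True] infsum_cmult_right')
      also have "\<dots> = (\<Sum>\<^sub>\<infinity>z. \<Sum>\<^sub>\<infinity>y. K x y * (L y z * \<xi> z))"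
        by (rule infsum_swap_banach[OF sm])
      also have "\<dots> = (\<Sum>\<^sub>\<infinity>z. kcomp K L x z * \<xi> z)"
        by (simp add: kcomp_def infsum_cmult_left' mult.assoc[symmetric])
      finally show ?thesis by (simp add: kop_apply True)
    qed
    thus ?thesis by auto
  next
    case False
    have "kop X K 0 = 0" by (rule bop_zero[OF kop_bop[OF K]])
    moreover have "kop X M \<xi> = 0" for M using False by (simp add: kop_def restrict_op_def)
    ultimately show ?thesis by simp
  qed
qed

section \<open>Adjoints and the identity as kernel operators\<close>

lemma ip_basis_left: "ip (basis_vec x) \<eta> = cnj (\<eta> x)"
proof -
  have "ip (basis_vec x) \<eta> = (\<Sum>\<^sub>\<infinity>y\<in>{x}. basis_vec x y * cnj (\<eta> y))"
    unfolding ip_def by (rule infsum_cong_neutral) (auto simp: basis_vec_def)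
  thus ?thesis by (simp add: basis_vec_def)
qed

lemma is_adjoint_kop:
  assumes K: "schur X S K" shows "is_adjoint X (kop X K) (kop X (kadj K))"
proof -
  have S0: "0 \<le> S" using schur_nonneg K by auto
  have "ip (kop X K \<xi>) \<eta> = ip \<xi> (kop X (kadj K) \<eta>)" if \<xi>: "\<xi> \<in> ell2 X" and \<eta>: "\<eta> \<in> ell2 X" for \<xi> \<eta>
  proof -
    have sm: "(\<lambda>(x, y). K x y * \<xi> y * cnj (\<eta> x)) summable_on UNIV \<times> UNIV"
    proof (rule double_summable)
      fix F :: "'a set" and G :: "'a set" assume F: "finite F" and G: "finite G"
      \<comment> \<open>Splitting the product of the two coordinates lets the column sums act on
        \<xi> and the row sums on \<eta>, each against a square-summable weight.\<close>
      have am: "a * b \<le> a\<^sup>2 + b\<^sup>2" if "a \<ge> 0" "b \<ge> 0" for a b :: real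
      proof -
        have "0 \<le> (a - b)\<^sup>2 + a * b" using that by simp
        moreover have "0 \<le> a * b" using that by simp
        ultimately show ?thesis by (simp add: power2_eq_square algebra_simps)
      qed
      have "(\<Sum>x\<in>F. \<Sum>y\<in>G. cmod (K x y * \<xi> y * cnj (\<eta> x))) \<le> (\<Sum>x\<in>F. \<Sum>y\<in>G. cmod (K x y) * ((cmod (\<xi> y))\<^sup>2 + (cmod (\<eta> x))\<^sup>2))"
        by (auto simp: norm_mult mult.assoc intro!: sum_mono mult_left_mono am)
      also have "\<dots> = (\<Sum>y\<in>G. (\<Sum>x\<in>F. cmod (K x y)) * (cmod (\<xi> y))\<^sup>2) + (\<Sum>x\<in>F. (\<Sum>y\<in>G. cmod (K x y)) * (cmod (\<eta> x))\<^sup>2)"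
        by (simp add: distrib_left sum.distrib sum_distrib_right sum.swap[of _ F G])
      also have "\<dots> \<le> (\<Sum>y\<in>G. S * (cmod (\<xi> y))\<^sup>2) + (\<Sum>x\<in>F. S * (cmod (\<eta> x))\<^sup>2)"
        using K F G by (intro add_mono sum_mono mult_right_mono) (auto simp: schur_def)
      also have "\<dots> = S * (L2_set (\<lambda>y. cmod (\<xi> y)) G)\<^sup>2 + S * (L2_set (\<lambda>y. cmod (\<eta> y)) F)\<^sup>2"
        by (simp add: L2_set_def sum_distrib_left sum_nonneg)
      also have "\<dots> \<le> S * (l2norm \<xi>)\<^sup>2 + S * (l2norm \<eta>)\<^sup>2"
        using S0 by (intro add_mono mult_left_mono power_mono ell2_finite_bound[OF \<xi> G] ell2_finite_bound[OF \<eta> F]) auto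
      finally show "(\<Sum>x\<in>F. \<Sum>y\<in>G. cmod (K x y * \<xi> y * cnj (\<eta> x))) \<le> S * (l2norm \<xi>)\<^sup>2 + S * (l2norm \<eta>)\<^sup>2" .
    qed
    have "ip (kop X K \<xi>) \<eta> = (\<Sum>\<^sub>\<infinity>x. \<Sum>\<^sub>\<infinity>y. K x y * \<xi> y * cnj (\<eta> x))"
      by (simp add: ip_def kop_apply \<xi> infsum_cmult_left')
    also have "\<dots> = (\<Sum>\<^sub>\<infinity>y. \<Sum>\<^sub>\<infinity>x. K x y * \<xi> y * cnj (\<eta> x))" by (rule infsum_swap_banach[OF sm])
    also have "\<dots> = (\<Sum>\<^sub>\<infinity>y. \<xi> y * (\<Sum>\<^sub>\<infinity>x. K x y * cnj (\<eta> x)))"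
      by (simp add: infsum_cmult_right'[symmetric] mult_ac)
    also have "\<dots> = ip \<xi> (kop X (kadj K) \<eta>)"
      by (simp add: ip_def kop_apply \<eta> kadj_def infsum_cnj[symmetric])
    finally show ?thesis .
  qed
  thus ?thesis unfolding is_adjoint_def using kop_bop[OF schur_kadj[OF K]] by auto
qed

lemma is_adjoint_unique: "is_adjoint X S T \<Longrightarrow> is_adjoint X S T' \<Longrightarrow> T = T'"
proof
  fix \<eta> assume *: "is_adjoint X S T" "is_adjoint X S T'"
  hence T: "T \<in> bop X" "T' \<in> bop X" by (auto simp: is_adjoint_def)
  show "T \<eta> = T' \<eta>"
  proof (cases "\<eta> \<in> ell2 X")
    case True
    show ?thesis
    proof
      fix x
      show "T \<eta> x = T' \<eta> x"
      proof (cases "x \<in> X")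
        case x: True
        hence "ip (basis_vec x) (T \<eta>) = ip (basis_vec x) (T' \<eta>)"
          using * True basis_vec_ell2[OF x] unfolding is_adjoint_def by metis
        thus ?thesis by (simp add: ip_basis_left)
      next
        case False
        have "T \<eta> \<in> ell2 X" "T' \<eta> \<in> ell2 X" using T True by (auto intro: bop_ell2)
        thus ?thesis using False by (simp add: ell2_outside)
      qed
    qed
  qed (use T in \<open>simp add: bop_outside\<close>)
qed

lemma adj_kop: "schur X S K \<Longrightarrow> adj X (kop X K) = kop X (kadj K)"
  unfolding adj_def using is_adjoint_kop is_adjoint_unique by (metis (no_types, lifting) the_equality)

lemma id_op_kop: "id_op X = kop X (\<lambda>x y. if x = y \<and> x \<in> X then 1 else 0)"
proof
  fix \<xi>
  have "kop X (\<lambda>x y. if x = y \<and> x \<in> X then 1 else 0) \<xi> x = \<xi> x" if "\<xi> \<in> ell2 X" for x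
  proof -
    have "kop X (\<lambda>x y. if x = y \<and> x \<in> X then 1 else 0) \<xi> x = (\<Sum>\<^sub>\<infinity>y\<in>{x}. \<xi> y)"
      unfolding kop_apply[OF that] by (rule infsum_cong_neutral) (use that in \<open>auto simp: ell2_outside\<close>)
    thus ?thesis by simp
  qed
  thus "id_op X \<xi> = kop X (\<lambda>x y. if x = y \<and> x \<in> X then 1 else 0) \<xi>"
    by (cases "\<xi> \<in> ell2 X") (auto simp: id_op_def restrict_op_def kop_def)
qed

section \<open>Norm-convergent sums of kernel operators\<close>

text \<open>Smooth elements are given only as norm limits of series. Two limits of one series are
  close to a common partial sum, hence equal; this identifies such a limit with the kernel operator
  computed for the series.\<close>

lemma has_op_sum_unique:
  assumes a: "has_op_sum X T J a" and b: "has_op_sum X T J b"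
    and T: "\<And>i \<xi>. i \<in> J \<Longrightarrow> \<xi> \<in> ell2 X \<Longrightarrow> T i \<xi> \<in> ell2 X"
  shows "a = b"
proof
  fix \<xi>
  have ab: "a \<in> bop X" "b \<in> bop X" using a b by (auto simp: has_op_sum_def)
  show "a \<xi> = b \<xi>"
  proof (cases "\<xi> \<in> ell2 X")
    case True
    have mem: "a \<xi> \<in> ell2 X" "b \<xi> \<in> ell2 X" using ab True by (auto simp: bop_ell2)
    have "l2norm (a \<xi> - b \<xi>) \<le> 0"
    proof (rule field_le_epsilon)
      fix e :: real assume e: "e > 0"
      \<comment> \<open>Half of e, rescaled by the norm of \<xi>, so that the two errors together
        stay below e; the added 1 avoids a division by zero.\<close>
      define d where "d = e / (2 * (l2norm \<xi> + 1))"
      have l1: "0 < l2norm \<xi> + 1" using l2norm_nonneg[of \<xi>] by linarith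
      have d: "d > 0" using e l1 by (auto simp: d_def)
      have "\<forall>\<^sub>F F in finite_subsets_at_top J. l2norm (a \<xi> - (\<Sum>i\<in>F. T i \<xi>)) \<le> d * l2norm \<xi>"
        using a d True unfolding has_op_sum_def by (auto elim!: eventually_mono dest!: spec[of _ d])
      moreover have "\<forall>\<^sub>F F in finite_subsets_at_top J. l2norm (b \<xi> - (\<Sum>i\<in>F. T i \<xi>)) \<le> d * l2norm \<xi>"
        using b d True unfolding has_op_sum_def by (auto elim!: eventually_mono dest!: spec[of _ d])
      moreover have "\<forall>\<^sub>F F in finite_subsets_at_top J. F \<subseteq> J"
        by (rule eventually_finite_subsets_at_top_weakI)
      ultimately have "\<forall>\<^sub>F F in finite_subsets_at_top J. F \<subseteq> J \<and> l2norm (a \<xi> - (\<Sum>i\<in>F. T i \<xi>)) \<le> d * l2norm \<xi> \<and>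
               l2norm (b \<xi> - (\<Sum>i\<in>F. T i \<xi>)) \<le> d * l2norm \<xi>"
        by eventually_elim simp
      then obtain F where F: "F \<subseteq> J" "l2norm (a \<xi> - (\<Sum>i\<in>F. T i \<xi>)) \<le> d * l2norm \<xi>"
               "l2norm (b \<xi> - (\<Sum>i\<in>F. T i \<xi>)) \<le> d * l2norm \<xi>"
        using eventually_happens'[OF finite_subsets_at_top_neq_bot] by blast
      let ?s = "\<Sum>i\<in>F. T i \<xi>"
      have s: "?s \<in> ell2 X" using T True F by (intro ell2_sum) auto
      have "l2norm (a \<xi> - b \<xi>) \<le> l2norm (a \<xi> - ?s) + l2norm (b \<xi> - ?s)"
        using l2norm_diff_le[OF ell2_diff[OF mem(1) s] ell2_diff[OF mem(2) s]] by (simp add: fun_diff_def)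
      also have "\<dots> \<le> d * l2norm \<xi> + d * l2norm \<xi>" using F by (intro add_mono)
      also have "\<dots> = e * (l2norm \<xi> / (l2norm \<xi> + 1))" 
        using l1 unfolding d_def by (metis (no_types, lifting) field_sum_of_halves mult.commute times_divide_eq_left divide_divide_eq_left)
      also have "\<dots> \<le> e * 1" using e l1 by (intro mult_left_mono) (auto simp: divide_simps)
      finally show "l2norm (a \<xi> - b \<xi>) \<le> 0 + e" by simp
    qed
    hence "a \<xi> - b \<xi> = 0" by (intro ell2_eq0I[of _ X] ell2_diff mem)
    thus ?thesis by simp
  qed (use ab in \<open>simp add: bop_outside\<close>)
qed

lemma schur_infsum:
  assumes K: "\<And>i. i \<in> J \<Longrightarrow> schur X (s i) (K i)" and s: "s summable_on J"
  shows "(\<lambda>i. K i x y) summable_on J" and "schur X (infsum s J) (\<lambda>x y. \<Sum>\<^sub>\<infinity>i\<in>J. K i x y)"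
proof -
  have sm: "(\<lambda>i. K i x y) summable_on J" for x y
    by (rule abs_summable_summable[OF norm_summable_comparison[OF s]]) (auto intro: schur_entry K)
  show "(\<lambda>i. K i x y) summable_on J" by (rule sm)
  have s0: "i \<in> J \<Longrightarrow> 0 \<le> s i" for i using K schur_nonneg by blast
  have *: "(\<Sum>p\<in>G. cmod (\<Sum>\<^sub>\<infinity>i\<in>J. K i (f p) (g p))) \<le> infsum s J"
    if bd: "\<And>i. i \<in> J \<Longrightarrow> (\<Sum>p\<in>G. cmod (K i (f p) (g p))) \<le> s i" for G :: "'b set" and f g
  proof (rule tendsto_upperbound)
    show "((\<lambda>F. \<Sum>p\<in>G. cmod (\<Sum>i\<in>F. K i (f p) (g p))) \<longlongrightarrow> (\<Sum>p\<in>G. cmod (\<Sum>\<^sub>\<infinity>i\<in>J. K i (f p) (g p))))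
      (finite_subsets_at_top J)"
      by (intro tendsto_intros infsum_tendsto sm)
    have "(\<Sum>p\<in>G. cmod (\<Sum>i\<in>F. K i (f p) (g p))) \<le> infsum s J" if F: "finite F" "F \<subseteq> J" for F
    proof -
      have "(\<Sum>p\<in>G. cmod (\<Sum>i\<in>F. K i (f p) (g p))) \<le> (\<Sum>p\<in>G. \<Sum>i\<in>F. cmod (K i (f p) (g p)))"
        by (intro sum_mono norm_sum)
      also have "\<dots> = (\<Sum>i\<in>F. \<Sum>p\<in>G. cmod (K i (f p) (g p)))" by (rule sum.swap)
      also have "\<dots> \<le> sum s F" using F by (intro sum_mono bd) auto
      also have "\<dots> \<le> infsum s J" by (rule finite_sum_le_infsum[OF s]) (use F s0 in auto)
      finally show ?thesis .
    qed
    thus "\<forall>\<^sub>F F in finite_subsets_at_top J. (\<Sum>p\<in>G. cmod (\<Sum>i\<in>F. K i (f p) (g p))) \<le> infsum s J"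
      by (intro eventually_finite_subsets_at_top_weakI)
  qed auto
  have "(\<Sum>\<^sub>\<infinity>i\<in>J. K i x y) = 0" if "x \<notin> X \<or> y \<notin> X" for x y
    using that schur_supp[OF K] by (intro infsum_0) blast
  moreover have "(\<Sum>y\<in>F. cmod (\<Sum>\<^sub>\<infinity>i\<in>J. K i x y)) \<le> infsum s J" if "finite F" for F x
    by (rule *) (rule schur_row[OF K that])
  moreover have "(\<Sum>x\<in>F. cmod (\<Sum>\<^sub>\<infinity>i\<in>J. K i x y)) \<le> infsum s J" if "finite F" for F y
    by (rule *) (rule schur_col[OF K that])
  ultimately show "schur X (infsum s J) (\<lambda>x y. \<Sum>\<^sub>\<infinity>i\<in>J. K i x y)"
    unfolding schur_def by blast
qed

text \<open>The remainder after a finite partial sum is again a kernel operator, and its Schur bound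
  is the tail of \<open>s\<close>, which tends to zero.\<close>

lemma has_op_sum_kop:
  fixes J :: "'a set"
  assumes K: "\<And>i. i \<in> J \<Longrightarrow> schur X (s i) (K i)" and s: "s summable_on J"
    and T: "\<And>i \<xi>. i \<in> J \<Longrightarrow> \<xi> \<in> ell2 X \<Longrightarrow> T i \<xi> = kop X (K i) \<xi>"
  shows "has_op_sum X T J (kop X (\<lambda>x y. \<Sum>\<^sub>\<infinity>i\<in>J. K i x y))"
proof -
  define K0 where "K0 = (\<lambda>x y. \<Sum>\<^sub>\<infinity>i\<in>J. K i x y)"
  have K0: "schur X (infsum s J) K0" unfolding K0_def by (rule schur_infsum(2)[OF K s])
  have *: "l2norm (kop X K0 \<xi> - (\<Sum>i\<in>F. T i \<xi>)) \<le> (infsum s J - sum s F) * l2norm \<xi>"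
    if F: "finite F" "F \<subseteq> J" and \<xi>: "\<xi> \<in> ell2 X" for F :: "'a set" and \<xi>
  proof -
    have dec: "infsum f J = infsum f (J - F) + sum f F"
      if "f summable_on J" for f :: "'a \<Rightarrow> 'c :: banach"
    proof -
      have "infsum f ((J - F) \<union> F) = infsum f (J - F) + infsum f F"
        by (rule infsum_Un_disjoint) (use F that in \<open>auto intro: summable_on_subset_banach\<close>)
      moreover have "(J - F) \<union> F = J" using F by auto
      ultimately show ?thesis using F by simp
    qed
    have sF: "schur X (sum s F) (\<lambda>x y. \<Sum>i\<in>F. K i x y)" by (rule schur_sum) (use F K in auto)
    have "(\<Sum>i\<in>F. T i \<xi>) = (\<Sum>i\<in>F. kop X (K i)) \<xi>"
      using F T \<xi> by (auto simp: sum_fun_apply fun_eq_iff intro!: sum.cong)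
    also have "(\<Sum>i\<in>F. kop X (K i)) = kop X (\<lambda>x y. \<Sum>i\<in>F. K i x y)"
      by (rule kop_sum[symmetric]) (use F K in auto)
    finally have "kop X K0 \<xi> - (\<Sum>i\<in>F. T i \<xi>) = kop X (K0 - (\<lambda>x y. \<Sum>i\<in>F. K i x y)) \<xi>"
      by (simp add: kop_diff[OF K0 sF])
    also have "K0 - (\<lambda>x y. \<Sum>i\<in>F. K i x y) = (\<lambda>x y. \<Sum>\<^sub>\<infinity>i\<in>J - F. K i x y)"
      by (auto simp: fun_eq_iff K0_def dec schur_infsum(1)[OF K s])
    finally have eq: "kop X K0 \<xi> - (\<Sum>i\<in>F. T i \<xi>) = kop X (\<lambda>x y. \<Sum>\<^sub>\<infinity>i\<in>J - F. K i x y) \<xi>" .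
    have "schur X (infsum s (J - F)) (\<lambda>x y. \<Sum>\<^sub>\<infinity>i\<in>J - F. K i x y)"
      by (rule schur_infsum(2)) (use K s in \<open>auto intro: summable_on_subset_banach\<close>)
    from l2norm_kop[OF this \<xi>] show ?thesis unfolding eq using dec[OF s] by simp
  qed
  have "\<forall>\<^sub>F F in finite_subsets_at_top J. \<forall>\<xi>\<in>ell2 X. l2norm (kop X K0 \<xi> - (\<Sum>i\<in>F. T i \<xi>)) \<le> e * l2norm \<xi>"
    if e: "e > 0" for e
  proof -
    have "\<forall>\<^sub>F F in finite_subsets_at_top J. dist (sum s F) (infsum s J) < e"
      using infsum_tendsto[OF s] e by (rule tendstoD)
    moreover have "\<forall>\<^sub>F F in finite_subsets_at_top J. finite F \<and> F \<subseteq> J"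
      by (rule eventually_finite_subsets_at_top_weakI) auto
    ultimately show ?thesis
    proof eventually_elim
      case (elim F)
      show ?case
      proof
        fix \<xi> assume \<xi>: "\<xi> \<in> ell2 X"
        have "l2norm (kop X K0 \<xi> - (\<Sum>i\<in>F. T i \<xi>)) \<le> (infsum s J - sum s F) * l2norm \<xi>"
          by (rule *) (use elim \<xi> in auto)
        also have "\<dots> \<le> e * l2norm \<xi>" using elim by (intro mult_right_mono) (auto simp: dist_real_def)
        finally show "l2norm (kop X K0 \<xi> - (\<Sum>i\<in>F. T i \<xi>)) \<le> e * l2norm \<xi>" .
      qed
    qed
  qed
  thus ?thesis unfolding has_op_sum_def K0_def[symmetric] using kop_bop[OF K0] by blast
qed

lemma ell2_const_zero [simp]: "(\<lambda>_. 0) \<in> ell2 X" and l2norm_const_zero [simp]: "l2norm (\<lambda>_. 0) = 0"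
  by (auto simp: ell2_def l2norm_def)

section \<open>Diagonal unbounded operators\<close>

definition diag_uop :: "'i set \<Rightarrow> ('i \<Rightarrow> real) \<Rightarrow> 'i uop" where
  "diag_uop X d = {(\<xi>, \<eta>) \<in> ell2 X \<times> ell2 X. \<forall>x. \<eta> x = complex_of_real (d x) * \<xi> x}"

definition diag_kern :: "'i set \<Rightarrow> ('i \<Rightarrow> complex) \<Rightarrow> 'i kern" where
  "diag_kern X f = (\<lambda>x y. if x = y \<and> x \<in> X then f x else 0)"

lemma schur_diag_kern: "(\<And>x. x \<in> X \<Longrightarrow> cmod (f x) \<le> S) \<Longrightarrow> 0 \<le> S \<Longrightarrow> schur X S (diag_kern X f)"
  by (rule schur_partial_injection) (auto simp: diag_kern_def split: if_splits)

lemma kop_diag_kern: "\<xi> \<in> ell2 X \<Longrightarrow> kop X (diag_kern X f) \<xi> x = f x * \<xi> x"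
proof -
  assume \<xi>: "\<xi> \<in> ell2 X"
  have "kop X (diag_kern X f) \<xi> x = (\<Sum>\<^sub>\<infinity>y\<in>{x}. f x * \<xi> y)"
    unfolding kop_apply[OF \<xi>]
    by (rule infsum_cong_neutral) (use \<xi> in \<open>auto simp: diag_kern_def ell2_outside\<close>)
  thus ?thesis by simp
qed

lemma kcomp_diag_right: "schur X S K \<Longrightarrow> kcomp K (diag_kern X f) = (\<lambda>x y. K x y * f y)"
proof (intro ext)
  fix x y assume K: "schur X S K"
  have "kcomp K (diag_kern X f) x y = (\<Sum>\<^sub>\<infinity>z\<in>{y}. K x z * f z)"
    unfolding kcomp_def by (rule infsum_cong_neutral) (use schur_supp[OF K] in \<open>auto simp: diag_kern_def\<close>)
  thus "kcomp K (diag_kern X f) x y = K x y * f y" by simp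
qed

section \<open>Self-adjointness and absolute value of diagonal operators\<close>

lemma ell2_dominated:
  assumes "\<xi> \<in> ell2 X" "\<And>x. cmod (\<eta> x) \<le> cmod (\<xi> x)"
  shows "\<eta> \<in> ell2 X"
proof (rule ell2_intro(1)[where c="l2norm \<xi>"])
  show "\<eta> x = 0" if "x \<notin> X" for x using assms(2)[of x] ell2_outside[OF assms(1) that] by simp
  show "L2_set (\<lambda>x. cmod (\<eta> x)) F \<le> l2norm \<xi>" if "finite F" for F
    by (rule order_trans[OF L2_set_mono ell2_finite_bound[OF assms(1) that]]) (use assms in auto)
qed

lemma ip_summable:
  assumes "\<xi> \<in> ell2 X" "\<eta> \<in> ell2 X" shows "(\<lambda>x. \<xi> x * cnj (\<eta> x)) summable_on UNIV"
proof -
  have am: "a * b \<le> a\<^sup>2 + b\<^sup>2" if "a \<ge> 0" "b \<ge> 0" for a b :: real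
  proof -
    have "0 \<le> (a - b)\<^sup>2 + a * b" using that by simp
    thus ?thesis by (simp add: power2_eq_square algebra_simps)
  qed
  have "(\<lambda>x. norm (\<xi> x * cnj (\<eta> x))) summable_on UNIV"
  proof (rule norm_summable_comparison)
    show "(\<lambda>x. (cmod (\<xi> x))\<^sup>2 + (cmod (\<eta> x))\<^sup>2) summable_on UNIV"
      using assms by (intro summable_on_add) (auto simp: ell2_def)
  qed (auto simp: norm_mult am)
  thus ?thesis by (rule abs_summable_summable)
qed

lemma ip_add_right: "\<xi> \<in> ell2 X \<Longrightarrow> \<eta> \<in> ell2 X \<Longrightarrow> \<zeta> \<in> ell2 X \<Longrightarrow> ip \<xi> (\<eta> + c *\<^sub>v \<zeta>) = ip \<xi> \<eta> + cnj c * ip \<xi> \<zeta>"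
proof -
  assume *: "\<xi> \<in> ell2 X" "\<eta> \<in> ell2 X" "\<zeta> \<in> ell2 X"
  have "ip \<xi> (\<eta> + c *\<^sub>v \<zeta>) = (\<Sum>\<^sub>\<infinity>x. \<xi> x * cnj (\<eta> x) + cnj c * (\<xi> x * cnj (\<zeta> x)))"
    by (simp add: ip_def smul_def distrib_left mult_ac)
  also have "\<dots> = ip \<xi> \<eta> + (\<Sum>\<^sub>\<infinity>x. cnj c * (\<xi> x * cnj (\<zeta> x)))"
    unfolding ip_def by (intro infsum_add summable_on_cmult_right ip_summable[OF *(1,2)] ip_summable[OF *(1,3)])
  finally show ?thesis by (simp add: ip_def infsum_cmult_right')
qed

lemma ip_smul_left: "ip (c *\<^sub>v \<xi>) \<eta> = c * ip \<xi> \<eta>"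
  by (simp add: ip_def smul_def mult.assoc infsum_cmult_right')

lemma ip_self: "\<xi> \<in> ell2 X \<Longrightarrow> ip \<xi> \<xi> = complex_of_real ((l2norm \<xi>)\<^sup>2)"
proof -
  assume \<xi>: "\<xi> \<in> ell2 X"
  have "ip \<xi> \<xi> = (\<Sum>\<^sub>\<infinity>x. complex_of_real ((cmod (\<xi> x))\<^sup>2))" by (simp only: ip_def complex_norm_square)
  also have "\<dots> = complex_of_real (\<Sum>\<^sub>\<infinity>x. (cmod (\<xi> x))\<^sup>2)"
    using \<xi> by (intro infsumI has_sum_of_real has_sum_infsum) (auto simp: ell2_def)
  also have "(\<Sum>\<^sub>\<infinity>x. (cmod (\<xi> x))\<^sup>2) = (l2norm \<xi>)\<^sup>2"
    by (simp add: l2norm_def infsum_nonneg)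
  finally show ?thesis .
qed

lemma diag_uop_basis: "x \<in> X \<Longrightarrow> (basis_vec x, complex_of_real (d x) *\<^sub>v basis_vec x) \<in> diag_uop X d"
  by (auto simp: diag_uop_def basis_vec_ell2 ell2_smul) (auto simp: smul_def basis_vec_def)

lemma ip_diag_swap:
  "(\<xi>, \<xi>') \<in> diag_uop X d \<Longrightarrow> (\<eta>, \<eta>') \<in> diag_uop X d \<Longrightarrow> ip \<xi>' \<eta> = ip \<xi> \<eta>'"
  by (simp add: diag_uop_def ip_def mult_ac)

lemma dense_diag: "dense_in X (Domain (diag_uop X d))"
  unfolding dense_in_def
proof (intro ballI allI impI)
  fix \<eta> and e :: real assume \<eta>: "\<eta> \<in> ell2 X" and e: "e > 0"
  obtain F where F: "finite F" "F \<subseteq> X" "l2norm (\<eta> - trunc F \<eta>) \<le> e / 2"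
    using trunc_approx[OF \<eta>, of "e/2"] e by auto
  define \<zeta> where "\<zeta> = (\<Sum>x\<in>F. (complex_of_real (d x) * \<eta> x) *\<^sub>v basis_vec x)"
  have "\<zeta> \<in> ell2 X" unfolding \<zeta>_def using F by (intro ell2_sum ell2_smul basis_vec_ell2) auto
  moreover have "\<zeta> x = complex_of_real (d x) * trunc F \<eta> x" for x
    using F by (auto simp: \<zeta>_def sum_fun_apply smul_def basis_vec_def trunc_def if_distrib[of "\<lambda>t. _ * t"] cong: if_cong)
  ultimately have "(trunc F \<eta>, \<zeta>) \<in> diag_uop X d" using trunc_ell2[OF \<eta>] by (auto simp: diag_uop_def)
  moreover have "l2norm (\<eta> - trunc F \<eta>) < e" using F e by linarith
  ultimately show "\<exists>\<xi>\<in>Domain (diag_uop X d). l2norm (\<eta> - \<xi>) < e" by blast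
qed

text \<open>Testing the adjoint relation against a basis vector that is an eigenvector reads off one
  coordinate. Both self-adjointness and the uniqueness of the positive root rest on this.\<close>

lemma adjoint_graph_basisD:
  assumes "(\<eta>, \<zeta>) \<in> adjoint_graph X E" "(basis_vec x, complex_of_real m *\<^sub>v basis_vec x) \<in> E"
  shows "\<zeta> x = complex_of_real m * \<eta> x"
proof -
  have "ip (complex_of_real m *\<^sub>v basis_vec x) \<eta> = ip (basis_vec x) \<zeta>"
    using assms by (auto simp: adjoint_graph_def)
  hence "cnj (\<zeta> x) = cnj (complex_of_real m * \<eta> x)" by (simp add: ip_smul_left ip_basis_left)
  thus ?thesis by (simp only: complex_cnj_cancel_iff)
qed

lemma selfadjoint_diag: "selfadjoint X (diag_uop X d)"
proof -
  have "adjoint_graph X (diag_uop X d) = diag_uop X d"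
  proof (intro equalityI subsetI)
    fix p assume p: "p \<in> adjoint_graph X (diag_uop X d)"
    obtain \<eta> \<zeta> where [simp]: "p = (\<eta>, \<zeta>)" by (cases p)
    have mem: "\<eta> \<in> ell2 X" "\<zeta> \<in> ell2 X" using p by (auto simp: adjoint_graph_def)
    have "\<zeta> x = complex_of_real (d x) * \<eta> x" for x
    proof (cases "x \<in> X")
      case True
      show ?thesis by (rule adjoint_graph_basisD[where X=X and E="diag_uop X d"]) (use p diag_uop_basis[OF True, of d] in auto)
    qed (use mem in \<open>simp add: ell2_outside\<close>)
    thus "p \<in> diag_uop X d" using mem by (auto simp: diag_uop_def)
  next
    fix p assume p: "p \<in> diag_uop X d"
    thus "p \<in> adjoint_graph X (diag_uop X d)"
      by (auto simp: adjoint_graph_def intro: ip_diag_swap) (auto simp: diag_uop_def)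
  qed
  thus ?thesis by (simp add: selfadjoint_def dense_diag)
qed

text \<open>The intermediate vector of the product may be replaced by one with the same moduli,
  which remains square summable. Thus the square, with its domain, depends only on the absolute
  values of the eigenvalues.\<close>

lemma diag_uop_square_mono:
  assumes "\<And>x. \<bar>e x\<bar> = \<bar>e' x\<bar>" shows "diag_uop X e O diag_uop X e \<subseteq> diag_uop X e' O diag_uop X e'"
proof
  fix p assume "p \<in> diag_uop X e O diag_uop X e"
  then obtain \<xi> \<eta> \<zeta> where p: "p = (\<xi>, \<zeta>)" and h: "(\<xi>, \<eta>) \<in> diag_uop X e" "(\<eta>, \<zeta>) \<in> diag_uop X e" by auto
  define \<eta>' where "\<eta>' = (\<lambda>x. complex_of_real (e' x) * \<xi> x)"
  have "\<eta>' \<in> ell2 X"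
    by (rule ell2_dominated[of \<eta>]) (use h assms in \<open>auto simp: diag_uop_def \<eta>'_def norm_mult\<close>)
  moreover have "\<zeta> x = complex_of_real (e' x) * \<eta>' x" for x
  proof -
    have "e x * e x = e' x * e' x" using assms[of x] by (metis abs_mult_self_eq)
    hence "complex_of_real (e x) * complex_of_real (e x) = complex_of_real (e' x) * complex_of_real (e' x)"
      by (simp only: of_real_mult[symmetric])
    thus ?thesis using h by (simp add: diag_uop_def \<eta>'_def mult.assoc[symmetric])
  qed
  ultimately have "(\<xi>, \<eta>') \<in> diag_uop X e'" "(\<eta>', \<zeta>) \<in> diag_uop X e'"
    using h by (auto simp: diag_uop_def \<eta>'_def)
  thus "p \<in> diag_uop X e' O diag_uop X e'" using p by auto
qed

text \<open>A self-adjoint operator is given only as a set of pairs; its linearity has to be drawn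
  from the defining relation of the adjoint.\<close>

lemma adjoint_graph_lin:
  assumes E: "\<And>\<xi> \<xi>'. (\<xi>, \<xi>') \<in> E \<Longrightarrow> \<xi> \<in> ell2 X \<and> \<xi>' \<in> ell2 X"
    and a: "(\<eta>, \<zeta>) \<in> adjoint_graph X E" "(\<eta>', \<zeta>') \<in> adjoint_graph X E"
  shows "(\<eta> + c *\<^sub>v \<eta>', \<zeta> + c *\<^sub>v \<zeta>') \<in> adjoint_graph X E"
proof -
  have mem: "\<eta> \<in> ell2 X" "\<zeta> \<in> ell2 X" "\<eta>' \<in> ell2 X" "\<zeta>' \<in> ell2 X" using a by (auto simp: adjoint_graph_def)
  have "ip \<xi>' (\<eta> + c *\<^sub>v \<eta>') = ip \<xi> (\<zeta> + c *\<^sub>v \<zeta>')" if "(\<xi>, \<xi>') \<in> E" for \<xi> \<xi>'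
  proof -
    have m: "\<xi> \<in> ell2 X" "\<xi>' \<in> ell2 X" using E that by auto
    have "ip \<xi>' \<eta> = ip \<xi> \<zeta>" "ip \<xi>' \<eta>' = ip \<xi> \<zeta>'" using a that unfolding adjoint_graph_def by blast+
    thus ?thesis by (simp add: ip_add_right[OF m(2) mem(1,3)] ip_add_right[OF m(1) mem(2,4)])
  qed
  thus ?thesis using mem by (auto simp: adjoint_graph_def intro!: ell2_add ell2_smul)
qed

text \<open>If \<open>E\<^sup>2 = d\<^sup>2\<close> then \<open>(E + m) (E - m) e\<^sub>x = 0\<close> for \<open>m = \<bar>d x\<bar>\<close>, and \<open>E + m\<close> is injective for \<open>m > 0\<close>.\<close>

lemma positive_root_basis:
  assumes E: "selfadjoint X E" and pos: "\<forall>(\<xi>, \<eta>)\<in>E. Im (ip \<eta> \<xi>) = 0 \<and> 0 \<le> Re (ip \<eta> \<xi>)"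
    and sq: "E O E = diag_uop X d O diag_uop X d" and x: "x \<in> X"
  shows "(basis_vec x, complex_of_real \<bar>d x\<bar> *\<^sub>v basis_vec x) \<in> E"
proof -
  define m where "m = \<bar>d x\<bar>"
  have adj: "adjoint_graph X E = E" using E by (simp add: selfadjoint_def)
  hence mem: "(\<xi>, \<xi>') \<in> E \<Longrightarrow> \<xi> \<in> ell2 X \<and> \<xi>' \<in> ell2 X" for \<xi> \<xi>' by (auto simp: adjoint_graph_def)
  let ?e = "basis_vec x" and ?dx = "complex_of_real (d x)" and ?m = "complex_of_real m"
  have "(?dx *\<^sub>v ?e, ?dx *\<^sub>v (?dx *\<^sub>v ?e)) \<in> diag_uop X d"
    using x by (auto simp: diag_uop_def basis_vec_ell2 ell2_smul) (auto simp: smul_def basis_vec_def)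
  hence "(?e, ?dx *\<^sub>v (?dx *\<^sub>v ?e)) \<in> E O E" unfolding sq using diag_uop_basis[OF x, of d] by blast
  moreover have "?dx *\<^sub>v (?dx *\<^sub>v ?e) = ?m *\<^sub>v (?m *\<^sub>v ?e)"
  proof -
    have "?dx * ?dx = ?m * ?m" unfolding m_def by (simp only: of_real_mult[symmetric] abs_mult_self_eq)
    thus ?thesis by (simp add: smul_def mult.assoc[symmetric])
  qed
  ultimately obtain u where u: "(?e, u) \<in> E" "(u, ?m *\<^sub>v (?m *\<^sub>v ?e)) \<in> E" by auto
  have u2: "u \<in> ell2 X" using mem[OF u(1)] by simp
  have "u = ?m *\<^sub>v ?e"
  proof (cases "m = 0")
    case True
    have "?m *\<^sub>v (?m *\<^sub>v ?e) = 0" using True by (auto simp: smul_def)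
    \<comment> \<open>For m = 0 self-adjointness moves the operator from the basis vector to u, so
      the square of the norm of u is the inner product of the basis vector with zero.\<close>
    hence "(u, 0) \<in> adjoint_graph X E" using u(2) adj by simp
    hence "ip u u = ip ?e 0" using u(1) by (auto simp: adjoint_graph_def)
    hence "l2norm u = 0" by (simp add: ip_self[OF u2]) (simp add: ip_def)
    hence "u = 0" by (intro ell2_eq0I[OF u2]) simp
    thus ?thesis using True by (auto simp: smul_def)
  next
    case False
    hence m: "m > 0" by (simp add: m_def)
    define \<eta> where "\<eta> = u + (- ?m) *\<^sub>v ?e"
    have "(\<eta>, ?m *\<^sub>v (?m *\<^sub>v ?e) + (- ?m) *\<^sub>v u) \<in> E"
      unfolding \<eta>_def using adjoint_graph_lin[of E X, OF mem] u adj by auto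
    also have "?m *\<^sub>v (?m *\<^sub>v ?e) + (- ?m) *\<^sub>v u = (- ?m) *\<^sub>v \<eta>"
      by (auto simp: \<eta>_def smul_def fun_eq_iff algebra_simps)
    finally have \<eta>E: "(\<eta>, (- ?m) *\<^sub>v \<eta>) \<in> E" .
    have \<eta>: "\<eta> \<in> ell2 X" using mem[OF \<eta>E] by simp
    \<comment> \<open>\<eta> would be an eigenvector for the negative eigenvalue -m, which
      positivity excludes unless it vanishes.\<close>
    have "0 \<le> Re (ip ((- ?m) *\<^sub>v \<eta>) \<eta>)" using pos \<eta>E by auto
    hence "0 \<le> - (m * (l2norm \<eta>)\<^sup>2)" by (simp only: ip_smul_left ip_self[OF \<eta>]) (simp del: of_real_power)
    hence "l2norm \<eta> = 0" using m by (simp add: mult_le_0_iff)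
    hence "\<eta> = 0" by (intro ell2_eq0I[OF \<eta>]) simp
    show ?thesis
    proof
      fix y have "\<eta> y = 0" using \<open>\<eta> = 0\<close> by simp
      thus "u y = (?m *\<^sub>v ?e) y" by (simp add: \<eta>_def smul_def)
    qed
  qed
  thus ?thesis using u(1) by (simp add: m_def)
qed

text \<open>For uniqueness, the basis eigenpairs belong to any positive root E and force E into the
  diagonal operator. By the symmetry of the latter, its pairs satisfy the adjoint relation with E,
  so self-adjointness of E gives the reverse inclusion.\<close>

lemma abs_uop_diag: "abs_uop X (diag_uop X d) = diag_uop X (\<lambda>x. \<bar>d x\<bar>)"
  unfolding abs_uop_def
proof (rule the_equality)
  let ?E = "diag_uop X (\<lambda>x. \<bar>d x\<bar>)"
  have "Im (ip \<eta> \<xi>) = 0 \<and> 0 \<le> Re (ip \<eta> \<xi>)" if h: "(\<xi>, \<eta>) \<in> ?E" for \<xi> \<eta>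
  proof -
    have eq: "\<eta> x * cnj (\<xi> x) = complex_of_real (\<bar>d x\<bar> * (cmod (\<xi> x))\<^sup>2)" for x
    proof -
      have "\<eta> x = complex_of_real \<bar>d x\<bar> * \<xi> x" using h by (simp add: diag_uop_def)
      thus ?thesis by (simp only: of_real_mult complex_norm_square mult.assoc)
    qed
    have "\<eta> \<in> ell2 X" "\<xi> \<in> ell2 X" using h unfolding diag_uop_def by blast+
    hence s: "(\<lambda>x. \<eta> x * cnj (\<xi> x)) summable_on UNIV" by (rule ip_summable)
    have "Im (ip \<eta> \<xi>) = (\<Sum>\<^sub>\<infinity>x. Im (\<eta> x * cnj (\<xi> x)))" "Re (ip \<eta> \<xi>) = (\<Sum>\<^sub>\<infinity>x. Re (\<eta> x * cnj (\<xi> x)))"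
      unfolding ip_def by (simp_all only: infsum_Im[OF s] infsum_Re[OF s])
    thus ?thesis unfolding eq by (auto intro!: infsum_nonneg infsum_0 simp del: of_real_mult)
  qed
  moreover have "?E O ?E = diag_uop X d O diag_uop X d"
    by (intro equalityI diag_uop_square_mono) auto
  ultimately show "selfadjoint X ?E \<and> (\<forall>(\<xi>, \<eta>)\<in>?E. Im (ip \<eta> \<xi>) = 0 \<and> 0 \<le> Re (ip \<eta> \<xi>)) \<and> ?E O ?E = diag_uop X d O diag_uop X d"
    using selfadjoint_diag by blast
next
  let ?F = "diag_uop X (\<lambda>x. \<bar>d x\<bar>)"
  fix E assume E: "selfadjoint X E \<and> (\<forall>(\<xi>, \<eta>)\<in>E. Im (ip \<eta> \<xi>) = 0 \<and> 0 \<le> Re (ip \<eta> \<xi>)) \<and> E O E = diag_uop X d O diag_uop X d"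
  hence bas: "x \<in> X \<Longrightarrow> (basis_vec x, complex_of_real \<bar>d x\<bar> *\<^sub>v basis_vec x) \<in> E" for x
    by (intro positive_root_basis) blast+
  have adj: "adjoint_graph X E = E" using E by (simp add: selfadjoint_def)
  have sub: "(\<xi>, \<eta>) \<in> ?F" if h: "(\<xi>, \<eta>) \<in> E" for \<xi> \<eta>
  proof -
    have mem: "\<xi> \<in> ell2 X" "\<eta> \<in> ell2 X" using h adj by (auto simp: adjoint_graph_def)
    have "\<eta> x = complex_of_real \<bar>d x\<bar> * \<xi> x" for x
    proof (cases "x \<in> X")
      case True
      show ?thesis by (rule adjoint_graph_basisD[where X=X and E=E]) (use h adj bas[OF True] in auto)
    qed (use mem in \<open>simp add: ell2_outside\<close>)
    thus ?thesis using mem by (auto simp: diag_uop_def)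
  qed
  have "(\<xi>, \<eta>) \<in> adjoint_graph X E" if h: "(\<xi>, \<eta>) \<in> ?F" for \<xi> \<eta>
  proof -
    have "ip b \<xi> = ip a \<eta>" if "(a, b) \<in> E" for a b by (rule ip_diag_swap[OF sub[OF that] h])
    moreover have "\<xi> \<in> ell2 X" "\<eta> \<in> ell2 X" using h unfolding diag_uop_def by blast+
    ultimately show ?thesis unfolding adjoint_graph_def by blast
  qed
  thus "E = ?F" using sub adj by auto
qed

text \<open>Entrywise, d x * K x y = (d x - d y) * K x y + K x y * d y. Once the commutator kernel
  passes the Schur test, both series on the right converge to square-summable vectors, and
  invariance of the domain comes with the identity.\<close>

lemma is_commutator_diag:
  assumes K: "schur X S K" and M: "schur X S' (\<lambda>x y. complex_of_real (d x - d y) * K x y)"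
  shows "is_commutator X (diag_uop X d) (kop X K) (kop X (\<lambda>x y. complex_of_real (d x - d y) * K x y))"
  unfolding is_commutator_def
proof (intro conjI)
  let ?M = "\<lambda>x y. complex_of_real (d x - d y) * K x y"
  show "kop X ?M \<in> bop X" by (rule kop_bop[OF M])
  show "\<forall>(\<xi>, \<eta>)\<in>diag_uop X d. (kop X K \<xi>, kop X ?M \<xi> + kop X K \<eta>) \<in> diag_uop X d"
  proof (clarify)
    fix \<xi> \<eta> assume h: "(\<xi>, \<eta>) \<in> diag_uop X d"
    hence mem: "\<xi> \<in> ell2 X" "\<eta> \<in> ell2 X" and eta: "\<And>x. \<eta> x = complex_of_real (d x) * \<xi> x" by (auto simp: diag_uop_def)
    have "(kop X ?M \<xi> + kop X K \<eta>) x = complex_of_real (d x) * kop X K \<xi> x" for x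
    proof -
      have "(kop X ?M \<xi> + kop X K \<eta>) x = (\<Sum>\<^sub>\<infinity>y. ?M x y * \<xi> y + K x y * \<eta> y)"
        unfolding plus_fun_apply kop_apply[OF mem(1)] kop_apply[OF mem(2)]
        by (rule infsum_add[symmetric]) (intro kop_summable[OF M mem(1)] kop_summable[OF K mem(2)])+
      also have "\<dots> = (\<Sum>\<^sub>\<infinity>y. complex_of_real (d x) * (K x y * \<xi> y))"
        by (intro infsum_cong) (simp add: eta algebra_simps)
      finally show ?thesis by (simp add: infsum_cmult_right' kop_apply[OF mem(1)])
    qed
    thus "(kop X K \<xi>, kop X ?M \<xi> + kop X K \<eta>) \<in> diag_uop X d"
      using mem kop_ell2[OF K] kop_ell2[OF M] by (auto simp: diag_uop_def simp del: plus_fun_apply intro!: ell2_add)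
  qed
qed

lemma is_commutator_diag_unique:
  assumes T: "is_commutator X (diag_uop X d) a T" "is_commutator X (diag_uop X d) a T'"
  shows "T = T'"
proof (rule bop_eqI[where X=X])
  fix x assume x: "x \<in> X"
  let ?e = "basis_vec x" and ?f = "complex_of_real (d x) *\<^sub>v basis_vec x"
  have "(a ?e, T ?e + a ?f) \<in> diag_uop X d" "(a ?e, T' ?e + a ?f) \<in> diag_uop X d"
    using T diag_uop_basis[OF x, of d] by (auto simp: is_commutator_def)
  hence "(T ?e + a ?f) y = (T' ?e + a ?f) y" for y by (simp add: diag_uop_def)
  thus "T ?e = T' ?e" by (auto simp: fun_eq_iff)
qed (use T in \<open>auto simp: is_commutator_def\<close>)

lemma commutator_diag:
  assumes "schur X S K" "schur X S' (\<lambda>x y. complex_of_real (d x - d y) * K x y)"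
  shows "commutator X (diag_uop X d) (kop X K) = kop X (\<lambda>x y. complex_of_real (d x - d y) * K x y)"
  unfolding commutator_def
  using is_commutator_diag[OF assms] is_commutator_diag_unique by (metis (no_types, lifting) the_equality)

definition neg_power_symbol :: "('i \<Rightarrow> real) \<Rightarrow> complex \<Rightarrow> 'i \<Rightarrow> complex" where
  "neg_power_symbol d z x = (if d x = 0 then 0 else complex_of_real \<bar>d x\<bar> powr (- z))"

lemma norm_neg_power_symbol: "cmod (neg_power_symbol d z x) = (if d x = 0 then 0 else \<bar>d x\<bar> powr (- Re z))"
  by (simp add: neg_power_symbol_def norm_powr_real_powr)

text \<open>The gap around the eigenvalue 0 keeps the symbol bounded by 1 for nonnegative real part,
  so the inverse power is bounded. Uniqueness holds because every basis vector is an
  eigenvector.\<close>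

lemma abs_neg_power_diag:
  assumes d: "\<And>x. x \<in> X \<Longrightarrow> d x = 0 \<or> 1 \<le> \<bar>d x\<bar>" and z: "0 \<le> Re z"
  shows "abs_neg_power X (diag_uop X d) z = kop X (diag_kern X (neg_power_symbol d z))"
proof -
  have "cmod (neg_power_symbol d z x) \<le> 1" if x: "x \<in> X" for x
    using d[OF x] z powr_mono[of "- Re z" 0 "\<bar>d x\<bar>"] by (auto simp: norm_neg_power_symbol)
  hence sch: "schur X 1 (diag_kern X (neg_power_symbol d z))" by (intro schur_diag_kern) auto
  show ?thesis unfolding abs_neg_power_def abs_uop_diag
  proof (rule the_equality)
    let ?T = "kop X (diag_kern X (neg_power_symbol d z))"
    have "?T \<xi> = (if \<mu> = 0 then 0 else (complex_of_real \<mu> powr - z) *\<^sub>v \<xi>)"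
      if h: "(\<xi>, complex_of_real \<mu> *\<^sub>v \<xi>) \<in> diag_uop X (\<lambda>x. \<bar>d x\<bar>)" for \<mu> \<xi>
    proof
      fix x
      have \<xi>: "\<xi> \<in> ell2 X" and e: "complex_of_real \<mu> * \<xi> x = complex_of_real \<bar>d x\<bar> * \<xi> x"
        using h by (auto simp: diag_uop_def smul_def)
      \<comment> \<open>An eigenvector for \<mu> lives where the diagonal takes the value
        \<mu>.\<close>
      have "\<xi> x = 0 \<or> \<mu> = \<bar>d x\<bar>" using e by (metis mult_cancel_right of_real_eq_iff)
      thus "?T \<xi> x = (if \<mu> = 0 then 0 else (complex_of_real \<mu> powr - z) *\<^sub>v \<xi>) x"
        by (auto simp: kop_diag_kern[OF \<xi>] smul_def neg_power_symbol_def)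
    qed
    thus "?T \<in> bop X \<and> (\<forall>\<mu> \<xi>. (\<xi>, complex_of_real \<mu> *\<^sub>v \<xi>) \<in> diag_uop X (\<lambda>x. \<bar>d x\<bar>) \<longrightarrow>
          ?T \<xi> = (if \<mu> = 0 then 0 else (complex_of_real \<mu> powr - z) *\<^sub>v \<xi>))"
      using kop_bop[OF sch] by blast
  next
    fix T assume T: "T \<in> bop X \<and> (\<forall>\<mu> \<xi>. (\<xi>, complex_of_real \<mu> *\<^sub>v \<xi>) \<in> diag_uop X (\<lambda>x. \<bar>d x\<bar>) \<longrightarrow>
          T \<xi> = (if \<mu> = 0 then 0 else (complex_of_real \<mu> powr - z) *\<^sub>v \<xi>))"
    show "T = kop X (diag_kern X (neg_power_symbol d z))"
    proof (rule kop_eqI[OF sch])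
      fix x y assume y: "y \<in> X"
      have "T (basis_vec y) = (if \<bar>d y\<bar> = 0 then 0 else (complex_of_real \<bar>d y\<bar> powr - z) *\<^sub>v basis_vec y)"
        using T diag_uop_basis[OF y, of "\<lambda>x. \<bar>d x\<bar>"] by blast
      thus "T (basis_vec y) x = diag_kern X (neg_power_symbol d z) x y"
        using y by (auto simp: diag_kern_def neg_power_symbol_def smul_def basis_vec_def)
    qed (use T in blast)
  qed
qed

section \<open>Compactness and singular values\<close>

text \<open>A pointwise convergent subsequence exists because the index set is countable. The symbol
  is small off a finite set, which turns pointwise convergence into norm convergence of the
  images.\<close>

lemma compact_diag:
  assumes X: "countable X" and bd: "\<And>x. x \<in> X \<Longrightarrow> cmod (f x) \<le> S"
    and small: "\<And>e. e > 0 \<Longrightarrow> finite {x\<in>X. e \<le> cmod (f x)}"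
  shows "compact_op X (kop X (diag_kern X f))"
proof -
  have bd': "cmod (f x) \<le> max S 0" if "x \<in> X" for x using bd[OF that] by simp
  have sch: "schur X (max S 0) (diag_kern X f)" by (rule schur_diag_kern) (use bd' in auto)
  have "\<exists>r \<eta>. strict_mono r \<and> \<eta> \<in> ell2 X \<and> (\<lambda>n. l2norm (kop X (diag_kern X f) (\<xi> (r n)) - \<eta>)) \<longlonglongrightarrow> 0"
    if \<xi>: "\<And>n. \<xi> n \<in> ell2 X \<and> l2norm (\<xi> n) \<le> 1" for \<xi> :: "nat \<Rightarrow> 'a vec"
  proof -
    have c1: "norm (\<xi> n x) \<le> 1" for n x
      using coord_le_l2norm[of "\<xi> n" X x] \<xi>[of n] by linarith
    obtain r :: "nat \<Rightarrow> nat" where r: "strict_mono r" "\<And>x. x \<in> X \<Longrightarrow> \<exists>l. (\<lambda>n. \<xi> (r n) x) \<longlonglongrightarrow> l"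
      using function_convergent_subsequence[OF X, of \<xi> 1] c1 by blast
    have conv: "\<exists>l. (\<lambda>n. \<xi> (r n) x) \<longlonglongrightarrow> l" for x
    proof (cases "x \<in> X")
      case False
      have "\<xi> (r n) x = 0" for n using ell2_outside[OF conjunct1[OF \<xi>] False] .
      hence "(\<lambda>n. \<xi> (r n) x) = (\<lambda>n. 0)" by simp
      thus ?thesis by auto
    qed (rule r(2))
    then obtain \<zeta> where \<zeta>: "\<And>x. (\<lambda>n. \<xi> (r n) x) \<longlonglongrightarrow> \<zeta> x" by metis
    have \<zeta>b: "L2_set (\<lambda>x. cmod (\<zeta> x)) F \<le> 1" if F: "finite F" for F
    proof (rule tendsto_upperbound)
      show "((\<lambda>n. L2_set (\<lambda>x. cmod (\<xi> (r n) x)) F) \<longlongrightarrow> L2_set (\<lambda>x. cmod (\<zeta> x)) F) sequentially"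
        unfolding L2_set_def by (intro tendsto_intros \<zeta>)
      show "\<forall>\<^sub>F n in sequentially. L2_set (\<lambda>x. cmod (\<xi> (r n) x)) F \<le> 1"
        by (rule always_eventually) (use ell2_finite_bound[OF _ F] \<xi> in \<open>meson order_trans\<close>)
    qed simp
    have "\<zeta> x = 0" if "x \<notin> X" for x
    proof -
      have "\<xi> (r n) x = 0" for n using ell2_outside[OF conjunct1[OF \<xi>] that] .
      thus ?thesis using \<zeta>[of x] by (simp add: LIMSEQ_const_iff)
    qed
    hence \<zeta>2: "\<zeta> \<in> ell2 X" "l2norm \<zeta> \<le> 1" using ell2_intro[of X \<zeta> 1, OF _ \<zeta>b] by auto
    let ?T = "kop X (diag_kern X f)"
    have "(\<lambda>n. l2norm (?T (\<xi> (r n)) - ?T \<zeta>)) \<longlonglongrightarrow> 0"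
    proof (rule LIMSEQ_I)
      fix e :: real assume e: "e > 0"
      \<comment> \<open>On the finite set G coordinatewise convergence makes the contribution less
        than e/4. Off G the symbol is below e/8 while the difference has norm at most 2, which costs
        another e/4.\<close>
      define G where "G = {x\<in>X. e / 8 \<le> cmod (f x)}"
      have G: "finite G" unfolding G_def using small[of "e/8"] e by simp
      have "(\<lambda>n. \<Sum>x\<in>G. cmod (f x) * cmod (\<xi> (r n) x - \<zeta> x)) \<longlonglongrightarrow> (\<Sum>x\<in>G. cmod (f x) * cmod (\<zeta> x - \<zeta> x))"
        by (intro tendsto_intros \<zeta>)
      hence "\<forall>\<^sub>F n in sequentially. (\<Sum>x\<in>G. cmod (f x) * cmod (\<xi> (r n) x - \<zeta> x)) < e / 4"
        using e by (intro order_tendstoD(2)[where y="\<Sum>x\<in>G. cmod (f x) * cmod (\<zeta> x - \<zeta> x)"]) auto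
      then obtain N where N: "\<And>n. n \<ge> N \<Longrightarrow> (\<Sum>x\<in>G. cmod (f x) * cmod (\<xi> (r n) x - \<zeta> x)) < e / 4"
        by (auto simp: eventually_sequentially)
      have "norm (l2norm (?T (\<xi> (r n)) - ?T \<zeta>) - 0) < e" if n: "n \<ge> N" for n
      proof -
        let ?d = "\<xi> (r n) - \<zeta>"
        have d: "?d \<in> ell2 X" using \<xi> \<zeta>2 by (intro ell2_diff) auto
        have d2: "l2norm ?d \<le> 2" using l2norm_diff_le[of "\<xi> (r n)" X \<zeta>] \<xi>[of "r n"] \<zeta>2 by linarith
        have eq: "?T (\<xi> (r n)) - ?T \<zeta> = ?T ?d" using \<xi> \<zeta>2 by (intro bop_diff[OF kop_bop[OF sch], symmetric]) auto
        have "l2norm (?T ?d) \<le> e / 4 + e / 4"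
        proof (rule ell2_intro(2)[where X=X])
          show "?T ?d x = 0" if "x \<notin> X" for x using kop_ell2[OF sch d] that by (rule ell2_outside)
          fix F :: "'a set" assume F: "finite F"
          have "L2_set (\<lambda>x. cmod (?T ?d x)) F \<le> L2_set (\<lambda>x. (if x \<in> G then cmod (f x) * cmod (?d x) else 0) + e/8 * cmod (?d x)) F"
          proof (rule L2_set_mono)
            fix x
            show "cmod (?T ?d x) \<le> (if x \<in> G then cmod (f x) * cmod (?d x) else 0) + e/8 * cmod (?d x)"
            proof (cases "x \<in> X \<and> x \<notin> G")
              case True
              hence "cmod (f x) \<le> e/8" by (auto simp: G_def)
              hence "cmod (f x) * cmod (?d x) \<le> e/8 * cmod (?d x)" by (rule mult_right_mono) simp
              thus ?thesis using True by (simp add: kop_diag_kern[OF d] norm_mult del: minus_apply)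
            next
              case False
              thus ?thesis using ell2_outside[OF d] e
                by (cases "x \<in> X") (auto simp: kop_diag_kern[OF d] norm_mult simp del: minus_apply)
            qed
          qed simp
          also have "\<dots> \<le> L2_set (\<lambda>x. if x \<in> G then cmod (f x) * cmod (?d x) else 0) F + L2_set (\<lambda>x. e/8 * cmod (?d x)) F"
            by (rule L2_set_triangle_ineq)
          also have "L2_set (\<lambda>x. if x \<in> G then cmod (f x) * cmod (?d x) else 0) F \<le> (\<Sum>x\<in>F. if x \<in> G then cmod (f x) * cmod (?d x) else 0)"
            by (rule L2_set_le_sum) auto
          also have "\<dots> \<le> (\<Sum>x\<in>G. cmod (f x) * cmod (?d x))"
            unfolding sum.inter_restrict[OF F, symmetric] by (rule sum_mono2) (use G in auto)
          also have "\<dots> \<le> e / 4" using N[OF n] by simp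
          also have "L2_set (\<lambda>x. e/8 * cmod (?d x)) F = e/8 * L2_set (\<lambda>x. cmod (?d x)) F"
            using e by (intro L2_set_right_distrib[symmetric]) auto
          also have "\<dots> \<le> e/8 * 2" using e d2 ell2_finite_bound[OF d F] by (intro mult_left_mono) auto
          finally have "L2_set (\<lambda>x. cmod (?T ?d x)) F \<le> e/4 + e/8 * 2" by (simp only: add_mono)
          moreover have "e/8 * 2 = e/4" by simp
          ultimately show "L2_set (\<lambda>x. cmod (?T ?d x)) F \<le> e/4 + e/4" by (simp only:)
        qed
        also have "\<dots> < e" using e by simp
        finally show ?thesis unfolding eq by simp
      qed
      thus "\<exists>N. \<forall>n\<ge>N. norm (l2norm (?T (\<xi> (r n)) - ?T \<zeta>) - 0) < e" by blast
    qed
    thus ?thesis using r(1) kop_ell2[OF sch \<zeta>2(1)] by blast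
  qed
  thus ?thesis unfolding compact_op_def using kop_bop[OF sch] by blast
qed

lemma bop_comp: "S \<in> bop X \<Longrightarrow> T \<in> bop X \<Longrightarrow> S \<circ> T \<in> bop X"
proof -
  assume S: "S \<in> bop X" and T: "T \<in> bop X"
  obtain C where C: "0 \<le> C" "\<And>\<xi>. \<xi> \<in> ell2 X \<Longrightarrow> l2norm (S \<xi>) \<le> C * l2norm \<xi>" using bop_bound[OF S] by blast
  obtain C' where C': "0 \<le> C'" "\<And>\<xi>. \<xi> \<in> ell2 X \<Longrightarrow> l2norm (T \<xi>) \<le> C' * l2norm \<xi>" using bop_bound[OF T] by blast
  have "l2norm (S (T \<xi>)) \<le> (C * C') * l2norm \<xi>" if "\<xi> \<in> ell2 X" for \<xi>
    using order_trans[OF C(2)[OF bop_ell2[OF T that]] mult_left_mono[OF C'(2)[OF that] C(1)]] by (simp add: mult.assoc)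
  thus ?thesis unfolding bop_def using S T
    by (auto simp: bop_ell2 bop_add[OF T] bop_add[OF S] bop_smul[OF T] bop_smul[OF S] bop_outside[OF T] bop_zero[OF S])
qed

lemma compact_op_bop_comp: "b \<in> bop X \<Longrightarrow> compact_op X T \<Longrightarrow> compact_op X (b \<circ> T)"
  unfolding compact_op_def
proof (intro conjI allI impI)
  assume b: "b \<in> bop X" and *: "T \<in> bop X \<and> (\<forall>\<xi> :: nat \<Rightarrow> 'a vec. (\<forall>n. \<xi> n \<in> ell2 X \<and> l2norm (\<xi> n) \<le> 1) \<longrightarrow>
      (\<exists>r \<eta>. strict_mono r \<and> \<eta> \<in> ell2 X \<and> (\<lambda>n. l2norm (T (\<xi> (r n)) - \<eta>)) \<longlonglongrightarrow> 0))"
  show "b \<circ> T \<in> bop X" using b * bop_comp by blast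
  fix \<xi> :: "nat \<Rightarrow> 'a vec" assume \<xi>: "\<forall>n. \<xi> n \<in> ell2 X \<and> l2norm (\<xi> n) \<le> 1"
  from mp[OF spec[OF conjunct2[OF *], of \<xi>] this]
  obtain r \<eta> where r: "strict_mono (r :: nat \<Rightarrow> nat)" "\<eta> \<in> ell2 X" "(\<lambda>n. l2norm (T (\<xi> (r n)) - \<eta>)) \<longlonglongrightarrow> 0"
    by (elim exE conjE)
  obtain C where C: "0 \<le> C" "\<And>\<xi>. \<xi> \<in> ell2 X \<Longrightarrow> l2norm (b \<xi>) \<le> C * l2norm \<xi>" using bop_bound[OF b] by blast
  have T2: "T (\<xi> n) \<in> ell2 X" for n using * \<xi> bop_ell2 by blast
  have "(\<lambda>n. l2norm (b (T (\<xi> (r n))) - b \<eta>)) \<longlonglongrightarrow> 0"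
  proof (rule tendsto_sandwich[where f="\<lambda>_. 0" and h="\<lambda>n. C * l2norm (T (\<xi> (r n)) - \<eta>)"])
    show "(\<lambda>n. C * l2norm (T (\<xi> (r n)) - \<eta>)) \<longlonglongrightarrow> 0" using tendsto_mult_right_zero[OF r(3), of C] by simp
    show "\<forall>\<^sub>F n in sequentially. l2norm (b (T (\<xi> (r n))) - b \<eta>) \<le> C * l2norm (T (\<xi> (r n)) - \<eta>)"
      by (rule always_eventually) (simp add: bop_diff[OF b T2 r(2), symmetric] C(2)[OF ell2_diff[OF T2 r(2)]])
  qed auto
  thus "\<exists>r \<eta>. strict_mono r \<and> \<eta> \<in> ell2 X \<and> (\<lambda>n. l2norm ((b \<circ> T) (\<xi> (r n)) - \<eta>)) \<longlonglongrightarrow> 0"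
    using r bop_ell2[OF b r(2)] by auto
qed

lemma compact_resolvent_diag:
  assumes X: "countable X" and fin: "\<And>r. finite {x\<in>X. \<bar>d x\<bar> \<le> r}"
  shows "compact_resolvent X (diag_uop X d)"
  unfolding compact_resolvent_def
proof (intro allI impI)
  fix \<mu> :: complex assume \<mu>: "\<mu> \<notin> \<real>"
  hence im: "Im \<mu> \<noteq> 0" by (simp add: complex_is_Real_iff)
  define f where "f x = 1 / (complex_of_real (d x) - \<mu>)" for x
  have nz: "complex_of_real (d x) - \<mu> \<noteq> 0" for x using im by (auto simp: complex_eq_iff)
  have im_le: "\<bar>Im \<mu>\<bar> \<le> cmod (complex_of_real (d x) - \<mu>)" for x
    using abs_Im_le_cmod[of "complex_of_real (d x) - \<mu>"] by simp
  have bd: "cmod (f x) \<le> 1 / \<bar>Im \<mu>\<bar>" for x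
    unfolding f_def norm_divide norm_one using im im_le[of x] nz[of x] by (intro divide_left_mono mult_pos_pos) auto
  have sch: "schur X (1 / \<bar>Im \<mu>\<bar>) (diag_kern X f)" by (rule schur_diag_kern) (use bd in auto)
  let ?R = "kop X (diag_kern X f)"
  have comp: "compact_op X ?R"
  proof (rule compact_diag[OF X bd])
    fix e :: real assume e: "e > 0"
    \<comment> \<open>A resolvent symbol of modulus at least e forces the eigenvalue to lie within
      1/e of \<mu>.\<close>
    have "\<bar>d x\<bar> \<le> 1 / e + cmod \<mu>" if "e \<le> cmod (f x)" for x
    proof -
      have "cmod (complex_of_real (d x) - \<mu>) \<le> 1 / e"
        using that e nz[of x] by (simp add: f_def norm_divide field_simps)
      thus ?thesis using norm_triangle_sub[of "complex_of_real (d x)" \<mu>] by simp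
    qed
    thus "finite {x\<in>X. e \<le> cmod (f x)}" by (intro finite_subset[OF _ fin[of "1/e + cmod \<mu>"]]) auto
  qed
  have "is_resolvent X (diag_uop X d) \<mu> ?R"
    unfolding is_resolvent_def
  proof (intro conjI ballI)
    show "?R \<in> bop X" by (rule kop_bop[OF sch])
    fix \<xi> assume \<xi>: "\<xi> \<in> ell2 X"
    have "(\<xi> + \<mu> *\<^sub>v ?R \<xi>) x = complex_of_real (d x) * ?R \<xi> x" for x
      using nz[of x] by (simp add: kop_diag_kern[OF \<xi>] smul_def f_def field_simps)
    thus "(?R \<xi>, \<xi> + \<mu> *\<^sub>v ?R \<xi>) \<in> diag_uop X d"
      using \<xi> kop_ell2[OF sch \<xi>] by (auto simp: diag_uop_def ell2_add ell2_smul simp del: plus_fun_apply)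
  next
    fix p assume "p \<in> diag_uop X d"
    then obtain \<xi> \<eta> where p: "p = (\<xi>, \<eta>)" "\<xi> \<in> ell2 X" "\<eta> \<in> ell2 X" "\<And>x. \<eta> x = complex_of_real (d x) * \<xi> x"
      by (auto simp: diag_uop_def)
    have m: "\<eta> - \<mu> *\<^sub>v \<xi> \<in> ell2 X" using p by (intro ell2_diff ell2_smul)
    have "?R (\<eta> - \<mu> *\<^sub>v \<xi>) = \<xi>"
    proof
      fix x show "?R (\<eta> - \<mu> *\<^sub>v \<xi>) x = \<xi> x"
        unfolding kop_diag_kern[OF m] using nz[of x] p(4)[of x] by (simp add: f_def smul_def field_simps)
    qed
    thus "case p of (\<xi>, \<eta>) \<Rightarrow> ?R (\<eta> - \<mu> *\<^sub>v \<xi>) = \<xi>" using p by simp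
  qed
  thus "\<exists>R. is_resolvent X (diag_uop X d) \<mu> R \<and> compact_op X R" using comp by blast
qed

section \<open>Singular values and the trace class\<close>

lemma opnorm_le: "0 \<le> c \<Longrightarrow> (\<And>\<xi>. \<xi> \<in> ell2 X \<Longrightarrow> l2norm (T \<xi>) \<le> c * l2norm \<xi>) \<Longrightarrow> opnorm X T \<le> c"
  unfolding opnorm_def
proof (rule cSUP_least)
  assume "0 \<le> c" and *: "\<And>\<xi>. \<xi> \<in> ell2 X \<Longrightarrow> l2norm (T \<xi>) \<le> c * l2norm \<xi>"
  show "l2norm (T \<xi>) \<le> c" if "\<xi> \<in> {\<xi>\<in>ell2 X. l2norm \<xi> \<le> 1}" for \<xi>
    using *[of \<xi>] that \<open>0 \<le> c\<close> mult_left_mono[of "l2norm \<xi>" 1 c] by auto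
next
  have "0 \<in> {\<xi>\<in>ell2 X. l2norm \<xi> \<le> 1}" by simp
  thus "{\<xi>\<in>ell2 X. l2norm \<xi> \<le> 1} \<noteq> {}" by blast
qed

lemma opnorm_nonneg: "T \<in> bop X \<Longrightarrow> 0 \<le> opnorm X T"
proof -
  assume T: "T \<in> bop X"
  obtain C where C: "0 \<le> C" "\<And>\<xi>. \<xi> \<in> ell2 X \<Longrightarrow> l2norm (T \<xi>) \<le> C * l2norm \<xi>" using bop_bound[OF T] by blast
  have "l2norm (T 0) \<le> opnorm X T" unfolding opnorm_def
  proof (rule cSUP_upper)
    show "bdd_above ((\<lambda>\<xi>. l2norm (T \<xi>)) ` {\<xi>\<in>ell2 X. l2norm \<xi> \<le> 1})"
    proof (rule bdd_aboveI2[where M=C])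
      fix \<xi> assume "\<xi> \<in> {\<xi>\<in>ell2 X. l2norm \<xi> \<le> 1}"
      thus "l2norm (T \<xi>) \<le> C" using C(2)[of \<xi>] mult_left_mono[of "l2norm \<xi>" 1 C] C(1) by auto
    qed
  qed simp
  thus ?thesis by (simp add: bop_zero[OF T])
qed

lemma bop_diff_mem: "S \<in> bop X \<Longrightarrow> T \<in> bop X \<Longrightarrow> S - T \<in> bop X"
proof -
  assume S: "S \<in> bop X" and T: "T \<in> bop X"
  obtain C where C: "0 \<le> C" "\<And>\<xi>. \<xi> \<in> ell2 X \<Longrightarrow> l2norm (S \<xi>) \<le> C * l2norm \<xi>" using bop_bound[OF S] by blast
  obtain C' where C': "0 \<le> C'" "\<And>\<xi>. \<xi> \<in> ell2 X \<Longrightarrow> l2norm (T \<xi>) \<le> C' * l2norm \<xi>" using bop_bound[OF T] by blast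
  have b: "l2norm (S \<xi> - T \<xi>) \<le> (C + C') * l2norm \<xi>" if "\<xi> \<in> ell2 X" for \<xi>
    using l2norm_diff_le[OF bop_ell2[OF S that] bop_ell2[OF T that]] C(2)[OF that] C'(2)[OF that]
    by (simp add: distrib_right)
  have m: "S \<xi> - T \<xi> \<in> ell2 X" if "\<xi> \<in> ell2 X" for \<xi>
    by (rule ell2_diff[OF bop_ell2[OF S that] bop_ell2[OF T that]])
  have sm: "c *\<^sub>v \<xi> - c *\<^sub>v \<eta> = c *\<^sub>v (\<xi> - \<eta>)" for c and \<xi> \<eta> :: "'a vec" by (auto simp: smul_def algebra_simps)
  show ?thesis unfolding bop_def mem_Collect_eq minus_apply[of S T]
    using b m by (auto simp: bop_add[OF T] bop_add[OF S] bop_smul[OF T] bop_smul[OF S] bop_outside[OF T] bop_outside[OF S] sm)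
qed

lemma zero_rank_le: "0 \<in> rank_le X n"
proof -
  have "0 \<in> bop X" by (auto simp: bop_def smul_def intro: exI[of _ 0])
  thus ?thesis by (auto simp: rank_le_def smul_def sum_fun_apply fun_eq_iff intro!: exI[of _ "\<lambda>_ _. 0"])
qed

lemma sing_val_nonneg: "T \<in> bop X \<Longrightarrow> 0 \<le> sing_val X T n"
  unfolding sing_val_def
proof (rule cINF_greatest)
  show "rank_le X n \<noteq> {}" using zero_rank_le by blast
qed (auto simp: rank_le_def intro!: opnorm_nonneg bop_diff_mem)

text \<open>Cutting the symbol down to F produces an operator of rank at most the size of F. The
  error is b times a diagonal operator bounded by e; the factor b costs only its Schur
  constant.\<close>

lemma sing_val_diag_le:
  assumes b: "schur X S b" and f: "\<And>x. x \<in> X \<Longrightarrow> cmod (f x) \<le> C"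
    and F: "finite F" "F \<subseteq> X" "card F \<le> n" and small: "\<And>x. x \<in> X - F \<Longrightarrow> cmod (f x) \<le> e" and e: "0 \<le> e"
  shows "sing_val X (kop X b \<circ> kop X (diag_kern X f)) n \<le> S * e"
proof -
  have S0: "0 \<le> S" by (rule schur_nonneg[OF b])
  define f1 where "f1 x = (if x \<in> F then f x else 0)" for x
  define f2 where "f2 x = (if x \<in> F then 0 else f x)" for x
  have sf: "schur X (max C 0) (diag_kern X f)" by (rule schur_diag_kern) (use f in force)+
  have s1: "schur X (max C 0) (diag_kern X f1)" by (rule schur_diag_kern) (use f in \<open>force simp: f1_def\<close>)+
  have s2: "schur X e (diag_kern X f2)" by (rule schur_diag_kern) (use small e in \<open>auto simp: f2_def\<close>)
  define R where "R = kop X b \<circ> kop X (diag_kern X f1)"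
  let ?T = "kop X b \<circ> kop X (diag_kern X f)"
  have T: "?T \<in> bop X" and R: "R \<in> bop X" unfolding R_def using bop_comp kop_bop b sf s1 by blast+
  have Rrank: "R \<in> rank_le X n"
  proof -
    obtain h where h: "bij_betw h {..<card F} F" using ex_bij_betw_nat_finite[OF F(1)] by (auto simp: lessThan_atLeast0)
    have "\<exists>c. R \<xi> = (\<Sum>i<n. c i *\<^sub>v kop X b (basis_vec (h i)))" if \<xi>: "\<xi> \<in> ell2 X" for \<xi>
    proof -
      have "kop X (diag_kern X f1) \<xi> = (\<Sum>x\<in>F. (f x * \<xi> x) *\<^sub>v basis_vec x)"
        using F(1) by (auto simp: fun_eq_iff kop_diag_kern[OF \<xi>] f1_def sum_fun_apply smul_def basis_vec_def if_distrib[of "\<lambda>t. _ * t"] cong: if_cong)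
      hence "R \<xi> = (\<Sum>x\<in>F. (f x * \<xi> x) *\<^sub>v kop X b (basis_vec x))"
        unfolding R_def using F(2) by (auto intro!: bop_sum[OF kop_bop[OF b]] basis_vec_ell2)
      also have "\<dots> = (\<Sum>i<card F. (f (h i) * \<xi> (h i)) *\<^sub>v kop X b (basis_vec (h i)))"
        by (rule sum.reindex_bij_betw[OF h, symmetric])
      \<comment> \<open>The rank condition asks for exactly n vectors, so zero coefficients pad the
        sum beyond the size of F.\<close>
      also have "\<dots> = (\<Sum>i<n. (if i < card F then f (h i) * \<xi> (h i) else 0) *\<^sub>v kop X b (basis_vec (h i)))"
        by (rule sum.mono_neutral_cong_left) (use F(3) in \<open>auto simp: smul_def fun_eq_iff\<close>)
      finally show ?thesis by (rule exI[where x="\<lambda>i. if i < card F then f (h i) * \<xi> (h i) else 0"])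
    qed
    hence "\<exists>g. \<forall>\<xi>\<in>ell2 X. \<exists>c. R \<xi> = (\<Sum>i<n. c i *\<^sub>v g i)"
      by (intro exI[of _ "\<lambda>i. kop X b (basis_vec (h i))"] ballI)
    thus ?thesis unfolding rank_le_def using R by simp
  qed
  have "sing_val X ?T n \<le> opnorm X (?T - R)"
    unfolding sing_val_def
    by (rule cINF_lower[OF _ Rrank]) (auto intro!: bdd_belowI2[where m=0] opnorm_nonneg bop_diff_mem[OF T] simp: rank_le_def)
  also have "\<dots> \<le> S * e"
  proof (rule opnorm_le)
    fix \<xi> assume \<xi>: "\<xi> \<in> ell2 X"
    have d: "kop X (diag_kern X f) \<xi> - kop X (diag_kern X f1) \<xi> = kop X (diag_kern X f2) \<xi>"
      by (auto simp: fun_eq_iff kop_diag_kern[OF \<xi>] f1_def f2_def)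
    have eq: "(?T - R) \<xi> = kop X b (kop X (diag_kern X f2) \<xi>)"
      unfolding R_def d[symmetric] by (simp add: bop_diff[OF kop_bop[OF b] kop_ell2[OF sf \<xi>] kop_ell2[OF s1 \<xi>]])
    have "l2norm ((?T - R) \<xi>) \<le> S * l2norm (kop X (diag_kern X f2) \<xi>)" unfolding eq by (rule l2norm_kop[OF b kop_ell2[OF s2 \<xi>]])
    also have "\<dots> \<le> S * (e * l2norm \<xi>)" using S0 by (intro mult_left_mono l2norm_kop[OF s2 \<xi>])
    finally show "l2norm ((?T - R) \<xi>) \<le> S * e * l2norm \<xi>" by (simp add: mult.assoc)
  qed (use S0 e in auto)
  finally show ?thesis .
qed

text \<open>At most (2r + 1)^N eigenvalues lie below r, so the n-th singular value is of order
  n^(-Re z / N), which is summable for Re z > N.\<close>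

lemma trace_class_neg_power:
  assumes X: "countable X" and b: "schur X S b" and N: "N \<ge> 1"
    and d: "\<And>x. x \<in> X \<Longrightarrow> d x = 0 \<or> 1 \<le> \<bar>d x\<bar>"
    and fin: "\<And>r::nat. finite {x\<in>X. \<bar>d x\<bar> < real r}" and card: "\<And>r::nat. card {x\<in>X. \<bar>d x\<bar> < real r} \<le> (2 * r + 1) ^ N"
    and z: "Re z > real N"
  shows "trace_class X (kop X b \<circ> kop X (diag_kern X (neg_power_symbol d z)))"
proof -
  let ?f = "neg_power_symbol d z" and ?\<sigma> = "Re z"
  let ?T = "kop X b \<circ> kop X (diag_kern X ?f)"
  have S0: "0 \<le> S" by (rule schur_nonneg[OF b])
  have \<sigma>: "?\<sigma> > 0" using z by linarith
  have le: "cmod (?f x) \<le> real r powr (- ?\<sigma>)" if "x \<in> X" "real r \<le> \<bar>d x\<bar>" "r \<ge> 1" for x r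
    unfolding norm_neg_power_symbol using that \<sigma> by (auto intro!: powr_mono2')
  have bd: "cmod (?f x) \<le> 1" if x: "x \<in> X" for x
    using le[OF x, of 1] d[OF x] by (auto simp: norm_neg_power_symbol)
  have sf: "schur X 1 (diag_kern X ?f)" by (rule schur_diag_kern) (use bd in auto)
  have comp: "compact_op X (kop X (diag_kern X ?f))"
  proof (rule compact_diag[OF X bd])
    fix e :: real assume e: "e > 0"
    obtain r where r: "real r > e powr (- 1 / ?\<sigma>)" "r \<ge> 1"
      by (metis reals_Archimedean2 less_le_trans max.cobounded1 max.cobounded2 of_nat_mono)
    have "\<bar>d x\<bar> < real r" if x: "x \<in> X" "e \<le> cmod (?f x)" for x
    proof (rule ccontr)
      assume "\<not> \<bar>d x\<bar> < real r"
      hence "cmod (?f x) \<le> real r powr (- ?\<sigma>)" using x r by (intro le) auto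
      also have "\<dots> < (e powr (- 1 / ?\<sigma>)) powr (- ?\<sigma>)" using r e \<sigma> by (intro powr_less_mono2_neg) auto
      also have "\<dots> = e" using e \<sigma> by (simp add: powr_powr)
      finally show False using x by simp
    qed
    thus "finite {x\<in>X. e \<le> cmod (?f x)}" by (intro finite_subset[OF _ fin[of r]]) auto
  qed
  have sv: "sing_val X ?T n \<le> S * 8 powr ?\<sigma> * real n powr (- (?\<sigma> / real N))" if n: "n \<ge> 3 ^ N" for n
  proof -
    \<comment> \<open>The radius r is chosen as the largest integer with 2r + 1 at most n^(1/N), so
      that the ball of radius r has at most n points. From n at least 3^N follows that r is positive
      and comparable to q.\<close>
    define q where "q = real n powr (1 / real N)"
    have n0: "n > 0" using n by (metis gr0I not_le zero_less_numeral zero_less_power)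
    have "real (3 ^ N) powr (1 / real N) \<le> q" unfolding q_def using n by (intro powr_mono2) (auto simp: of_nat_le_iff[symmetric] simp del: of_nat_le_iff)
    moreover have "real (3 ^ N) powr (1 / real N) = 3" using N by (simp add: powr_realpow[symmetric] powr_powr)
    ultimately have q3: "q \<ge> 3" by simp
    define r where "r = nat \<lfloor>(q - 1) / 2\<rfloor>"
    have fl: "1 \<le> \<lfloor>(q - 1) / 2\<rfloor>" using q3 by simp
    have r1: "r \<ge> 1" unfolding r_def using fl by linarith
    have rr: "real r = of_int \<lfloor>(q - 1) / 2\<rfloor>" unfolding r_def using fl by simp
    have r2: "2 * real r + 1 \<le> q" unfolding rr using of_int_floor_le[of "(q-1)/2"] by (simp add: field_simps)
    have r3: "q / 8 \<le> real r" proof -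
      have "(q - 1) / 2 < real r + 1" unfolding rr using floor_correct[of "(q-1)/2"] by simp
      moreover have "1 \<le> real r" using r1 by simp
      ultimately show ?thesis by (simp add: field_simps)
    qed
    have "real ((2 * r + 1) ^ N) \<le> q ^ N" using r2 by (simp add: power_mono add.commute)
    also have "q ^ N = real n" using q3 N n0 unfolding q_def by (subst powr_realpow[symmetric]) (auto simp: powr_powr)
    finally have cn: "(2 * r + 1) ^ N \<le> n" by (simp only: of_nat_le_iff)
    have "sing_val X ?T n \<le> S * real r powr (- ?\<sigma>)"
      by (rule sing_val_diag_le[OF b bd fin[of r]]) (use card[of r] cn r1 in \<open>auto intro: le\<close>)
    also have "\<dots> \<le> S * (q / 8) powr (- ?\<sigma>)"
      using r3 q3 \<sigma> S0 by (intro mult_left_mono powr_mono2') auto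
    also have "(q / 8) powr (- ?\<sigma>) = 8 powr ?\<sigma> * real n powr (- (?\<sigma> / real N))"
      using q3 by (simp add: powr_divide powr_minus_divide) (simp add: q_def powr_powr powr_minus_divide)
    finally show ?thesis by (simp only: mult.assoc)
  qed
  have T: "?T \<in> bop X" using bop_comp kop_bop b sf by blast
  have "summable (\<lambda>n. S * 8 powr ?\<sigma> * real n powr (- (?\<sigma> / real N)))"
    using z N by (intro summable_mult) (simp add: summable_real_powr_iff divide_simps)
  hence "summable (sing_val X ?T)"
    by (rule summable_comparison_test_ev[rotated])
       (auto simp: eventually_sequentially sing_val_nonneg[OF T] intro!: exI[of _ "3 ^ N"] sv)
  thus ?thesis unfolding trace_class_def using compact_op_bop_comp[OF kop_bop[OF b] comp] by blast
qed

text \<open>Bounded partial sums are O(ln N), because ln N is at least ln 2. Finite summability is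
  obtained through this inclusion, at an exponent where the inverse power is already trace
  class.\<close>

lemma dixmier_ideal_trace_class: "trace_class X T \<Longrightarrow> T \<in> dixmier_ideal X"
proof -
  assume T: "trace_class X T"
  have bop: "T \<in> bop X" and s: "summable (sing_val X T)" using T by (auto simp: trace_class_def compact_op_def)
  let ?S = "suminf (sing_val X T)"
  have S0: "0 \<le> ?S" by (rule suminf_nonneg[OF s sing_val_nonneg[OF bop]])
  have "(\<Sum>n<N. sing_val X T n) \<le> (?S / ln 2) * ln (real N)" if "N \<ge> 2" for N
  proof -
    have "(\<Sum>n<N. sing_val X T n) \<le> ?S" by (rule sum_le_suminf[OF s]) (auto simp: sing_val_nonneg[OF bop])
    also have "\<dots> = (?S / ln 2) * ln 2" by simp
    also have "\<dots> \<le> (?S / ln 2) * ln (real N)" using that S0 by (intro mult_left_mono) auto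
    finally show ?thesis .
  qed
  thus ?thesis using T unfolding dixmier_ideal_def trace_class_def by blast
qed

lemma op_trace_kop_diag:
  assumes b: "schur X S b" and f: "\<And>x. x \<in> X \<Longrightarrow> cmod (f x) \<le> C"
  shows "op_trace X (kop X b \<circ> kop X (diag_kern X f)) = (\<Sum>\<^sub>\<infinity>x\<in>X. b x x * f x)"
proof -
  have sf: "schur X (max C 0) (diag_kern X f)" by (rule schur_diag_kern) (use f in force)+
  show ?thesis unfolding op_trace_def kop_kcomp[OF b sf]
    by (rule infsum_cong) (simp add: kop_basis kcomp_diag_right[OF b])
qed

section \<open>Meromorphic continuation of Dirichlet series\<close>

lemma holomorphic_on_suminf:
  fixes f :: "nat \<Rightarrow> complex \<Rightarrow> complex"
  assumes S: "open S" and f: "\<And>n. f n holomorphic_on S"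
    and bd: "\<And>z. z \<in> S \<Longrightarrow> \<exists>d M. 0 < d \<and> summable M \<and> cball z d \<subseteq> S \<and> (\<forall>n. \<forall>w\<in>cball z d. norm (f n w) \<le> M n)"
  shows "(\<lambda>z. \<Sum>n. f n z) holomorphic_on S"
proof (rule holomorphic_uniform_sequence[OF S])
  show "(\<lambda>z. \<Sum>i<n. f i z) holomorphic_on S" for n by (intro holomorphic_intros f)
  fix z assume "z \<in> S"
  then obtain d M where d: "0 < d" "summable M" "cball z d \<subseteq> S" "\<And>n w. w \<in> cball z d \<Longrightarrow> norm (f n w) \<le> M n"
    using bd[of z] by blast
  have "uniform_limit (cball z d) (\<lambda>n w. \<Sum>i<n. f i w) (\<lambda>w. \<Sum>i. f i w) sequentially"
    by (rule Weierstrass_m_test) (use d in auto)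
  thus "\<exists>d>0. cball z d \<subseteq> S \<and> uniform_limit (cball z d) (\<lambda>n w. \<Sum>i<n. f i w) (\<lambda>w. \<Sum>i. f i w) sequentially"
    using d by blast
qed

lemma norm_Suc_powr: "norm (of_nat (Suc n) powr z :: complex) = real (Suc n) powr Re z"
  using norm_powr_real_powr[of "of_nat (Suc n)" z] by (simp del: of_nat_Suc)

text \<open>The Riemann zeta series, indexed from 0 so that its n-th term belongs to the integer n +
  1.\<close>

definition zeta_series :: "complex \<Rightarrow> complex" where
  "zeta_series s = (\<Sum>n. of_nat (Suc n) powr (- s))"

lemma summable_Suc_powr: "a > 1 \<Longrightarrow> summable (\<lambda>n. real (Suc n) powr (- a))"
  using summable_Suc_iff[of "\<lambda>n. real n powr (- a)"] summable_real_powr_iff[of "- a"] by simp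

lemma zeta_series_summable:
  "Re s > 1 \<Longrightarrow> summable (\<lambda>n. of_nat (Suc n) powr (- s) :: complex)"
  by (rule summable_norm_cancel) (use summable_Suc_powr[of "Re s"] in \<open>simp add: norm_Suc_powr del: of_nat_Suc\<close>)

lemma powr_Suc_holomorphic: "(\<lambda>z. of_nat (Suc n) powr (f z)) holomorphic_on S" if "f holomorphic_on S" for f :: "complex \<Rightarrow> complex"
  using that by (intro holomorphic_intros) (auto simp del: of_nat_Suc)

lemma open_Re_gt: "open {s. c < Re s}"
  by (simp add: open_halfspace_Re_gt)

lemma cball_Re_gt:
  assumes "c < Re z" obtains d where "0 < d" "cball z d \<subseteq> {s. c < Re s}"
  using open_Re_gt[of c] assms unfolding open_contains_cball by blast

lemma zeta_series_holomorphic: "zeta_series holomorphic_on {s. 1 < Re s}"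
  unfolding zeta_series_def[abs_def]
proof (rule holomorphic_on_suminf[OF open_Re_gt])
  fix z :: complex assume "z \<in> {s. 1 < Re s}"
  define c where "c = (1 + Re z) / 2"
  have c: "1 < c" "c < Re z" using \<open>z \<in> _\<close> by (auto simp: c_def)
  obtain d where d: "0 < d" "cball z d \<subseteq> {s. c < Re s}" using cball_Re_gt[OF c(2)] by blast
  have "norm (of_nat (Suc n) powr (- w) :: complex) \<le> real (Suc n) powr (- c)" if "w \<in> cball z d" for n w
  proof -
    have "c < Re w" using d that by blast
    thus ?thesis unfolding norm_Suc_powr by (intro powr_mono) auto
  qed
  thus "\<exists>d M. 0 < d \<and> summable M \<and> cball z d \<subseteq> {s. 1 < Re s} \<and> (\<forall>n. \<forall>w\<in>cball z d. norm (of_nat (Suc n) powr (- w) :: complex) \<le> M n)"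
    using d summable_Suc_powr[OF c(1)] c(1) by (intro exI[of _ d] exI[of _ "\<lambda>n. real (Suc n) powr (- c)"]) fastforce
qed (intro powr_Suc_holomorphic holomorphic_intros)

text \<open>Taylor expansion of \<open>x powr (1 - s)\<close> at \<open>n + 1\<close>, evaluated at \<open>n + 2\<close>.\<close>

definition ffact :: "nat \<Rightarrow> complex \<Rightarrow> complex" where
  "ffact k a = (\<Prod>i<k. a - of_nat i)"

definition taylor_rem :: "nat \<Rightarrow> nat \<Rightarrow> complex \<Rightarrow> complex" where
  "taylor_rem M n s = of_nat (Suc (Suc n)) powr (1 - s)
     - (\<Sum>k\<le>M. ffact k (1 - s) / fact k * of_nat (Suc n) powr (1 - s - of_nat k))"

lemma taylor_rem_bound:
  assumes "0 \<le> Re s + real M"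
  shows "norm (taylor_rem M n s) \<le> norm (ffact (Suc M) (1 - s)) / fact M * real (Suc n) powr (- Re s - real M)"
proof -
  define a where "a = 1 - s"
  \<comment> \<open>The real segment joining the two integers inside the complex plane: it is
    convex, as the Taylor estimate demands, and avoids the branch cut of
    \<open>powr\<close>.\<close>
  define S where "S = (of_real :: real \<Rightarrow> complex) ` {real (Suc n)..real (Suc (Suc n))}"
  define f where "f = (\<lambda>i x. ffact i a * x powr (a - of_nat i) :: complex)"
  have conv: "convex S" unfolding S_def
    by (intro convex_linear_image) (auto simp: linear_iff scaleR_conv_of_real algebra_simps)
  have nonneg: "x \<notin> \<real>\<^sub>\<le>\<^sub>0" if "x \<in> S" for x
    using that by (auto simp: S_def complex_nonpos_Reals_iff)
  have der: "(f i has_field_derivative f (Suc i) x) (at x within S)" if "x \<in> S" for i x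
  proof -
    have "((\<lambda>x. ffact i a * x powr (a - of_nat i)) has_field_derivative ffact i a * ((a - of_nat i) * x powr (a - of_nat i - 1))) (at x)"
      by (intro DERIV_cmult has_field_derivative_powr nonneg that)
    moreover have "ffact i a * ((a - of_nat i) * x powr (a - of_nat i - 1)) = f (Suc i) x"
      by (simp add: f_def ffact_def algebra_simps)
    ultimately show ?thesis unfolding f_def[of ] by (auto intro: has_field_derivative_at_within simp: f_def)
  qed
  have B: "norm (f (Suc M) x) \<le> norm (ffact (Suc M) a) * real (Suc n) powr (- Re s - real M)" if x: "x \<in> S" for x
  proof -
    obtain t where t: "x = of_real t" "real (Suc n) \<le> t" using x by (auto simp: S_def)
    have "norm (x powr (a - of_nat (Suc M))) = t powr (- Re s - real M)"
      using t by (simp add: norm_powr_real_powr a_def)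
    \<comment> \<open>The exponent is nonpositive by hypothesis, so the maximum over the segment is
      at its left end.\<close>
    also have "\<dots> \<le> real (Suc n) powr (- Re s - real M)"
      using t assms by (intro powr_mono2') auto
    finally show ?thesis unfolding f_def norm_mult by (intro mult_left_mono) auto
  qed
  have "norm (f 0 (of_nat (Suc (Suc n))) - (\<Sum>i\<le>M. f i (of_nat (Suc n)) * (of_nat (Suc (Suc n)) - of_nat (Suc n)) ^ i / fact i))
     \<le> norm (ffact (Suc M) a) * real (Suc n) powr (- Re s - real M) * norm (of_nat (Suc (Suc n)) - of_nat (Suc n) :: complex) ^ Suc M / fact M"
    by (rule complex_Taylor[OF conv der B]) (auto simp: S_def image_iff intro: bexI[of _ "real (Suc (Suc n))"] bexI[of _ "real (Suc n)"])
  also have "f 0 (of_nat (Suc (Suc n))) - (\<Sum>i\<le>M. f i (of_nat (Suc n)) * (of_nat (Suc (Suc n)) - of_nat (Suc n)) ^ i / fact i) = taylor_rem M n s"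
    by (simp add: f_def ffact_def taylor_rem_def a_def)
  finally show ?thesis by (simp add: a_def)
qed

lemma ffact_holomorphic: "f holomorphic_on S \<Longrightarrow> (\<lambda>s. ffact k (f s)) holomorphic_on S"
  unfolding ffact_def by (intro holomorphic_intros)

lemma taylor_rem_holomorphic: "taylor_rem M n holomorphic_on S"
  unfolding taylor_rem_def[abs_def]
  by (intro holomorphic_intros powr_Suc_holomorphic ffact_holomorphic) auto

text \<open>With K + 2 terms of the expansion the exponent -Re s - (K + 2) stays below -2 on this
  half-plane, while the falling factorial is bounded on compact discs. The remainders are thus
  dominated by a convergent series.\<close>

lemma taylor_rem_suminf_holomorphic:
  "(\<lambda>s. \<Sum>n. taylor_rem (K + 2) n s) holomorphic_on {s. - real K < Re s}"
proof (rule holomorphic_on_suminf[OF open_Re_gt taylor_rem_holomorphic])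
  fix z assume "z \<in> {s. - real K < Re s}"
  then obtain d where d: "0 < d" "cball z d \<subseteq> {s. - real K < Re s}" using cball_Re_gt by blast
  have "continuous_on (cball z d) (\<lambda>s. ffact (Suc (K + 2)) (1 - s))"
    by (intro holomorphic_on_imp_continuous_on ffact_holomorphic holomorphic_intros)
  hence "compact ((\<lambda>s. ffact (Suc (K + 2)) (1 - s)) ` cball z d)" by (rule compact_continuous_image) auto
  hence "bounded ((\<lambda>s. ffact (Suc (K + 2)) (1 - s)) ` cball z d)" by (rule compact_imp_bounded)
  then obtain B where B: "\<And>w. w \<in> cball z d \<Longrightarrow> norm (ffact (Suc (K + 2)) (1 - w)) \<le> B" and B0: "B > 0"
    unfolding bounded_pos by blast
  have "norm (taylor_rem (K + 2) n w) \<le> B / fact (K + 2) * real (Suc n) powr (- 2)" if w: "w \<in> cball z d" for n w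
  proof -
    have re: "- real K < Re w" using d(2) w by (simp add: subset_iff)
    have "norm (taylor_rem (K + 2) n w) \<le> norm (ffact (Suc (K + 2)) (1 - w)) / fact (K + 2) * real (Suc n) powr (- Re w - real (K + 2))"
      by (rule taylor_rem_bound) (use re in simp)
    also have "\<dots> \<le> B / fact (K + 2) * real (Suc n) powr (- 2)"
      using B[OF w] re B0 by (intro mult_mono divide_right_mono powr_mono) (auto simp del: fact_Suc)
    finally show ?thesis .
  qed
  moreover have "summable (\<lambda>n. B / fact (K + 2) * real (Suc n) powr (- 2))"
    by (intro summable_mult summable_Suc_powr) simp
  ultimately show "\<exists>d M. 0 < d \<and> summable M \<and> cball z d \<subseteq> {s. - real K < Re s} \<and> (\<forall>n. \<forall>w\<in>cball z d. norm (taylor_rem (K + 2) n w) \<le> M n)"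
    using d by blast
qed

lemma taylor_rem_summable: "- real K < Re s \<Longrightarrow> summable (\<lambda>n. taylor_rem (K + 2) n s)"
proof (rule summable_norm_cancel, rule summable_comparison_test)
  assume re: "- real K < Re s"
  show "\<exists>N. \<forall>n\<ge>N. norm (norm (taylor_rem (K + 2) n s)) \<le> norm (ffact (Suc (K + 2)) (1 - s)) / fact (K + 2) * real (Suc n) powr - (Re s + real (K + 2))"
    using taylor_rem_bound[of s "K + 2"] re by (auto simp: algebra_simps simp del: fact_Suc)
  show "summable (\<lambda>n. norm (ffact (Suc (K + 2)) (1 - s)) / fact (K + 2) * real (Suc n) powr - (Re s + real (K + 2)))"
    by (intro summable_mult summable_Suc_powr) (use re in simp)
qed

text \<open>Summing the Taylor expansions over \<open>n\<close>, the left-hand side telescopes to \<open>- 1\<close>.\<close>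

lemma zeta_series_recursion:
  assumes s: "Re s > 1"
  shows "(s - 1) * zeta_series s = 1 + (\<Sum>k=2..K + 2. ffact k (1 - s) / fact k * zeta_series (s + of_nat k - 1))
           + (\<Sum>n. taylor_rem (K + 2) n s)"
proof -
  let ?p = "\<lambda>n. of_nat (Suc n) powr (1 - s) :: complex"
  have "?p \<longlonglongrightarrow> 0"
  proof (rule tendsto_norm_zero_cancel)
    have "(\<lambda>n. real n powr (1 - Re s)) \<longlonglongrightarrow> 0"
      using s by (intro tendsto_neg_powr filterlim_real_sequentially) auto
    hence "(\<lambda>n. real (Suc n) powr (1 - Re s)) \<longlonglongrightarrow> 0" by (rule LIMSEQ_Suc)
    thus "(\<lambda>n. norm (?p n)) \<longlonglongrightarrow> 0" by (simp add: norm_Suc_powr del: of_nat_Suc)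
  qed
  hence "(\<lambda>n. ?p (Suc n) - ?p n) sums (0 - ?p 0)" by (rule telescope_sums)
  hence L: "(\<lambda>n. ?p (Suc n) - ?p n) sums (- 1)" by simp
  have trm: "(\<lambda>n. ffact k (1 - s) / fact k * of_nat (Suc n) powr (1 - s - of_nat k)) sums
      (ffact k (1 - s) / fact k * zeta_series (s + of_nat k - 1))" if "k \<ge> 1" for k
  proof -
    have k1: "1 \<le> real k" using that by simp
    have e: "1 - s - of_nat k = - (s + of_nat k - 1)" by simp
    show ?thesis unfolding zeta_series_def e
      by (intro sums_mult summable_sums zeta_series_summable) (use s k1 in simp)
  qed
  have "(\<lambda>n. (\<Sum>k=1..K + 2. ffact k (1 - s) / fact k * of_nat (Suc n) powr (1 - s - of_nat k)) + taylor_rem (K + 2) n s)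
     sums ((\<Sum>k=1..K + 2. ffact k (1 - s) / fact k * zeta_series (s + of_nat k - 1)) + (\<Sum>n. taylor_rem (K + 2) n s))"
    by (intro sums_add sums_sum trm summable_sums taylor_rem_summable) (use s in auto)
  also have "(\<lambda>n. (\<Sum>k=1..K + 2. ffact k (1 - s) / fact k * of_nat (Suc n) powr (1 - s - of_nat k)) + taylor_rem (K + 2) n s)
     = (\<lambda>n. ?p (Suc n) - ?p n)"
  proof
    fix n
    have "{..K + 2} = insert 0 {1..K + 2}" by auto
    thus "(\<Sum>k=1..K + 2. ffact k (1 - s) / fact k * of_nat (Suc n) powr (1 - s - of_nat k)) + taylor_rem (K + 2) n s = ?p (Suc n) - ?p n"
      unfolding taylor_rem_def by (simp add: ffact_def)
  qed
  finally have R: "(\<lambda>n. ?p (Suc n) - ?p n) sums ((\<Sum>k=1..K + 2. ffact k (1 - s) / fact k * zeta_series (s + of_nat k - 1)) + (\<Sum>n. taylor_rem (K + 2) n s))" .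
  \<comment> \<open>The term k = 1 is (1 - s) times the zeta series itself; it is the one to be
    solved for.\<close>
  have "{1..K + 2} = insert 1 {2..K + 2}" by auto
  hence "(\<Sum>k=1..K + 2. ffact k (1 - s) / fact k * zeta_series (s + of_nat k - 1))
     = (1 - s) * zeta_series s + (\<Sum>k=2..K + 2. ffact k (1 - s) / fact k * zeta_series (s + of_nat k - 1))"
    by (simp add: ffact_def)
  hence "- 1 = ((1 - s) * zeta_series s + (\<Sum>k=2..K + 2. ffact k (1 - s) / fact k * zeta_series (s + of_nat k - 1)))
      + (\<Sum>n. taylor_rem (K + 2) n s)"
    using sums_unique2[OF L R] by (simp only:)
  moreover have "- 1 = ((1 - s) * Z + Y) + T \<Longrightarrow> (s - 1) * Z = 1 + Y + T" for Z Y T by algebra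
  ultimately show ?thesis by blast
qed

text \<open>On the right of the recursion the zeta series occurs only at s + k - 1 with k at least
  2, that is, shifted to the right by at least one. An extension to one half-plane therefore yields
  one to the next.\<close>

lemma zeta_extension_step:
  "\<exists>g. g holomorphic_on {s. 1 - real K < Re s} \<and> (\<forall>s. Re s > 1 \<longrightarrow> zeta_series s = 1 / (s - 1) + g s)"
proof (induction K)
  case 0
  have "(\<lambda>s. zeta_series s - 1 / (s - 1)) holomorphic_on {s. 1 - real 0 < Re s}"
    by (intro holomorphic_intros) (use zeta_series_holomorphic in auto)
  thus ?case by (intro exI[of _ "\<lambda>s. zeta_series s - 1 / (s - 1)"]) auto
next
  case (Suc K)
  then obtain g where g: "g holomorphic_on {s. 1 - real K < Re s}" "\<And>s. Re s > 1 \<Longrightarrow> zeta_series s = 1 / (s - 1) + g s" by blast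
  \<comment> \<open>W is the continuation of (s - 1) times the zeta series. The pole 1 / (s + k - 2)
    of the k-th shifted series cancels against the last factor of \<open>ffact k (1 - s)\<close>,
    which leaves the summand with \<open>ffact (k - 1)\<close>.\<close>
  define W where "W s = 1 + (\<Sum>k=2..K + 2. - ffact (k - 1) (1 - s) / fact k + ffact k (1 - s) / fact k * g (s + of_nat k - 1))
           + (\<Sum>n. taylor_rem (K + 2) n s)" for s
  define H where "H = {s. - real K < Re s}"
  have gk: "(\<lambda>s. g (s + of_nat k - 1)) holomorphic_on H" if "k \<ge> 2" for k
  proof -
    have k: "2 \<le> real k" using that by simp
    have "(g \<circ> (\<lambda>s. s + of_nat k - 1)) holomorphic_on H"
      by (rule holomorphic_on_compose_gen[OF _ g(1)]) (use k in \<open>auto intro!: holomorphic_intros simp: H_def\<close>)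
    thus ?thesis by (simp add: o_def)
  qed
  have "W holomorphic_on H" unfolding W_def[abs_def]
    by (intro holomorphic_intros ffact_holomorphic gk) (use taylor_rem_suminf_holomorphic in \<open>auto simp: H_def\<close>)
  \<comment> \<open>Subtracting W 1 removes the singularity at 1; that W 1 = 1, shown below, makes
    the residue equal to one.\<close>
  hence hol: "(\<lambda>s. if s = 1 then deriv W 1 else (W s - W 1) / (s - 1)) holomorphic_on H"
    by (rule pole_lemma_open) (simp add: H_def open_Re_gt)
  have f0: "ffact k 0 = 0" if "k \<ge> 1" for k
    unfolding ffact_def using that by (intro prod_zero) auto
  have t0: "taylor_rem (K + 2) n 1 = 0" for n
  proof -
    have "(\<Sum>k\<le>K + 2. ffact k (1 - 1) / fact k * of_nat (Suc n) powr (1 - 1 - of_nat k) :: complex) = (\<Sum>k\<in>{0::nat}. 1)"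
      by (rule sum.mono_neutral_cong_right) (use f0 in \<open>auto simp: ffact_def simp del: of_nat_Suc\<close>)
    thus ?thesis unfolding taylor_rem_def by (simp del: of_nat_Suc)
  qed
  have "(\<Sum>k=2..K + 2. - ffact (k - 1) (1 - 1) / fact k + ffact k (1 - 1) / fact k * g (1 + of_nat k - 1)) = (0::complex)"
    by (rule sum.neutral) (use f0 in auto)
  moreover have "(\<Sum>n. taylor_rem (K + 2) n 1) = 0" by (simp only: t0 suminf_zero)
  ultimately have W1: "W 1 = 1" unfolding W_def by (simp only: add_0_right)
  have "zeta_series s = 1 / (s - 1) + (if s = 1 then deriv W 1 else (W s - W 1) / (s - 1))" if s: "Re s > 1" for s
  proof -
    have s1: "s \<noteq> 1" using s by auto
    have "ffact k (1 - s) / fact k * zeta_series (s + of_nat k - 1)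
        = - ffact (k - 1) (1 - s) / fact k + ffact k (1 - s) / fact k * g (s + of_nat k - 1)" if k: "k \<ge> 2" for k
    proof -
      obtain j where j: "k = Suc j" "j \<ge> 1" using k by (cases k) auto
      have j1: "1 \<le> real j" using j by simp
      have re: "Re (s + of_nat k - 1) > 1" using s j1 by (simp add: j)
      have nz: "s + of_nat j - 1 \<noteq> 0"
      proof
        assume "s + of_nat j - 1 = 0"
        hence "Re (s + of_nat j - 1) = 0" by simp
        thus False using s j1 by simp
      qed
      have "ffact k (1 - s) = - ffact j (1 - s) * (s + of_nat j - 1)" by (simp add: ffact_def j algebra_simps)
      moreover have "s + of_nat k - 1 - 1 = s + of_nat j - 1" by (simp add: j)
      moreover have "k - 1 = j" by (simp add: j)
      ultimately show ?thesis using nz unfolding g(2)[OF re] distrib_left by simp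
    qed
    hence "(\<Sum>k=2..K + 2. ffact k (1 - s) / fact k * zeta_series (s + of_nat k - 1))
       = (\<Sum>k=2..K + 2. - ffact (k - 1) (1 - s) / fact k + ffact k (1 - s) / fact k * g (s + of_nat k - 1))"
      by (intro sum.cong) auto
    hence "(s - 1) * zeta_series s = W s" unfolding W_def zeta_series_recursion[OF s, of K] by simp
    thus ?thesis using s1 W1 by (simp add: field_simps)
  qed
  moreover have "H = {s. 1 - real (Suc K) < Re s}" by (auto simp: H_def)
  ultimately show ?case using hol by blast
qed

text \<open>The extensions to different half-planes coincide with the series for Re s > 1, hence
  agree on their common domain by analytic continuation and glue to an entire function.\<close>

lemma zeta_entire:
  obtains g where "g holomorphic_on UNIV" "\<And>s. Re s > 1 \<Longrightarrow> zeta_series s = 1 / (s - 1) + g s"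
proof -
  obtain g where g: "\<And>K. g K holomorphic_on {s. 1 - real K < Re s}"
      "\<And>K s. Re s > 1 \<Longrightarrow> zeta_series s = 1 / (s - 1) + g K s"
    using zeta_extension_step by metis
  have eq: "g K s = g K' s" if K: "K \<le> K'" and s: "1 - real K < Re s" for K K' s
  proof (rule analytic_continuation_open[where s="{s. 1 < Re s}" and s'="{s. 1 - real K < Re s}" and f="g K" and g="g K'"])
    show "connected {s. 1 - real K < Re s}" by (intro convex_connected convex_halfspace_Re_gt)
    show "g K' holomorphic_on {s. 1 - real K < Re s}" by (rule holomorphic_on_subset[OF g(1)]) (use K in auto)
    show "g K z = g K' z" if "z \<in> {s. 1 < Re s}" for z
    proof -
      have "1 / (z - 1) + g K z = 1 / (z - 1) + g K' z" using that g(2)[of z K] g(2)[of z K'] by simp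
      thus ?thesis by (rule add_left_imp_eq)
    qed
    have "2 \<in> {s. 1 < Re s}" by simp
    thus "{s. 1 < Re s} \<noteq> {}" by blast
  qed (use g(1) s in \<open>auto simp: open_Re_gt\<close>)
  \<comment> \<open>Any index whose half-plane contains s would do; this one is explicit.\<close>
  define k where "k s = Suc (nat \<lceil>1 - Re s\<rceil>)" for s
  have k: "1 - real (k s) < Re s" for s unfolding k_def by linarith
  define G where "G s = g (k s) s" for s
  have GK: "G s = g K s" if "1 - real K < Re s" for K s
  proof (cases "K \<le> k s")
    case True show ?thesis unfolding G_def by (rule eq[OF True that, symmetric])
  next
    case False
    hence "k s \<le> K" by simp
    thus ?thesis unfolding G_def by (rule eq[OF _ k])
  qed
  have "G field_differentiable at s" for s
  proof -
    have "G holomorphic_on {w. 1 - real (k s) < Re w}"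
      by (rule holomorphic_transform[OF g(1)[of "k s"]]) (simp add: GK)
    thus ?thesis using k[of s] by (intro holomorphic_on_imp_differentiable_at[OF _ open_Re_gt]) auto
  qed
  hence "G holomorphic_on UNIV" by (simp add: holomorphic_on_def)
  moreover have "zeta_series s = 1 / (s - 1) + G s" if "Re s > 1" for s
    unfolding GK[of 0 s, simplified, OF that] by (rule g(2)[OF that])
  ultimately show ?thesis using that by blast
qed

text \<open>On Re z at least -m, rapid decrease of order m + 2 leaves terms of order n^-2. As m is
  arbitrary, the sum is holomorphic everywhere.\<close>

lemma entire_Dirichlet_series:
  fixes e :: "nat \<Rightarrow> complex"
  assumes "\<And>M::nat. \<exists>C. \<forall>n. norm (e n) * (1 + real n) ^ M \<le> C"
  shows "(\<lambda>z. \<Sum>n. e (Suc n) * of_nat (Suc n) powr (- z)) holomorphic_on UNIV"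
    and "summable (\<lambda>n. e (Suc n) * of_nat (Suc n) powr (- z))"
proof -
  have *: "\<exists>C\<ge>0. \<forall>n w. - real m \<le> Re w \<longrightarrow> norm (e (Suc n) * of_nat (Suc n) powr (- w)) \<le> C * real (Suc n) powr (- 2)" for m :: nat
  proof -
    obtain C where C: "\<And>n. norm (e n) * (1 + real n) ^ (m + 2) \<le> C" using assms by blast
    have C0: "0 \<le> C" using order_trans[OF _ C[of 0]] by simp
    have "norm (e (Suc n) * of_nat (Suc n) powr (- w)) \<le> C * real (Suc n) powr (- 2)" if "- real m \<le> Re w" for n w
    proof -
      have "norm (e (Suc n)) * real (Suc n) ^ (m + 2) \<le> C"
        by (rule order_trans[OF mult_left_mono[OF power_mono] C[of "Suc n"]]) auto
      hence "norm (e (Suc n)) \<le> C / real (Suc n) ^ (m + 2)"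
        by (subst pos_le_divide_eq) auto
      hence 1: "norm (e (Suc n)) \<le> C * real (Suc n) powr (- real (m + 2))"
        by (subst powr_minus_divide, subst powr_realpow) auto
      have "norm (e (Suc n) * of_nat (Suc n) powr (- w)) = norm (e (Suc n)) * real (Suc n) powr (- Re w)"
        by (simp add: norm_mult norm_Suc_powr del: of_nat_Suc)
      also have "\<dots> \<le> (C * real (Suc n) powr (- real (m + 2))) * real (Suc n) powr (real m)"
        using that C0 1 by (intro mult_mono powr_mono) auto
      also have "\<dots> = C * real (Suc n) powr (- 2)" by (simp add: powr_add[symmetric])
      finally show ?thesis .
    qed
    thus ?thesis using C0 by blast
  qed
  have sm: "summable (\<lambda>n. C * real (Suc n) powr (- 2))" for C
    by (intro summable_mult summable_Suc_powr) simp
  show "(\<lambda>z. \<Sum>n. e (Suc n) * of_nat (Suc n) powr (- z)) holomorphic_on UNIV"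
  proof (rule holomorphic_on_suminf)
    fix z :: complex
    obtain m :: nat where m: "1 + \<bar>Re z\<bar> \<le> real m" using real_arch_simple by blast
    obtain C where C: "\<And>n w. - real m \<le> Re w \<Longrightarrow> norm (e (Suc n) * of_nat (Suc n) powr (- w)) \<le> C * real (Suc n) powr (- 2)"
      using *[of m] by blast
    have "- real m \<le> Re w" if "w \<in> cball z 1" for w
      using that abs_Re_le_cmod[of "z - w"] m by (auto simp: dist_norm)
    thus "\<exists>d M. 0 < d \<and> summable M \<and> cball z d \<subseteq> UNIV \<and> (\<forall>n. \<forall>w\<in>cball z d. norm (e (Suc n) * of_nat (Suc n) powr (- w)) \<le> M n)"
      using C sm by (intro exI[of _ 1] exI[of _ "\<lambda>n. C * real (Suc n) powr (- 2)"]) auto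
  qed (auto intro!: holomorphic_intros powr_Suc_holomorphic simp del: of_nat_Suc)
  obtain m :: nat where m: "\<bar>Re z\<bar> \<le> real m" using real_arch_simple by blast
  obtain C where C: "\<And>n w. - real m \<le> Re w \<Longrightarrow> norm (e (Suc n) * of_nat (Suc n) powr (- w)) \<le> C * real (Suc n) powr (- 2)"
    using *[of m] by blast
  show "summable (\<lambda>n. e (Suc n) * of_nat (Suc n) powr (- z))"
    by (rule summable_norm_cancel, rule summable_comparison_test[OF _ sm[of C]]) (use C m in auto)
qed

section \<open>Counting functions\<close>

text \<open>The geometric series 1 / (1 - X). Its power with exponent \<open>Suc k\<close> is the
  generating function of the number of points of \<nat>^(k+1) with given coordinate sum.\<close>

definition geo :: "complex fps" where "geo = Abs_fps (\<lambda>_. 1)"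

lemma geo_mult: "geo * (1 - fps_X) = 1"
  by (rule fps_ext) (auto simp: geo_def right_diff_distrib)

text \<open>The coefficient is the binomial coefficient of r + k over k, by the hockey-stick
  identity. The Pochhammer form shows it as a polynomial of degree k in r.\<close>

lemma geo_power_nth: "(geo ^ Suc k) $ r = pochhammer (of_nat r + 1) k / fact k"
proof -
  have "(geo ^ Suc k) $ r = of_nat ((r + k) choose k)"
  proof (induction k arbitrary: r)
    case 0 show ?case by (simp add: geo_def)
  next
    case (Suc k)
    have "(geo ^ Suc (Suc k)) $ r = (geo ^ Suc k * geo) $ r" by (simp add: mult.commute)
    also have "\<dots> = (\<Sum>i\<le>r. of_nat ((i + k) choose k))"
      by (simp only: fps_mult_nth Suc.IH atLeast0AtMost) (simp add: geo_def)
    also have "\<dots> = of_nat (\<Sum>i\<le>r. (k + i) choose i)" by (simp add: binomial_symmetric[of k] add.commute)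
    also have "(\<Sum>i\<le>r. (k + i) choose i) = Suc (k + r) choose r" by (rule sum_choose_lower)
    also have "\<dots> = (r + Suc k) choose Suc k" using binomial_symmetric[of r "Suc (k + r)"] by (simp add: add.commute)
    finally show ?case .
  qed
  also have "of_nat ((r + k) choose k) = (pochhammer (of_nat r + 1) k / fact k :: complex)"
    unfolding binomial_gbinomial gbinomial_pochhammer' by (simp add: algebra_simps)
  finally show ?thesis .
qed

text \<open>The leading coefficient is recorded because it determines the residue at the pole k + 1
  of the resulting zeta function.\<close>

lemma pochhammer_poly:
  "\<exists>q :: nat \<Rightarrow> complex. q k = 1 \<and> (\<forall>x. pochhammer (x + 1) k = (\<Sum>i\<le>k. q i * x ^ i))"
proof -
  have "\<exists>P :: complex poly. degree P = k \<and> lead_coeff P = 1 \<and> (\<forall>x. poly P x = pochhammer (x + 1) k)"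
  proof (induction k)
    case 0 show ?case by (intro exI[of _ 1]) auto
  next
    case (Suc k)
    then obtain P :: "complex poly" where P: "degree P = k" "lead_coeff P = 1" "\<And>x. poly P x = pochhammer (x + 1) k" by blast
    have "P \<noteq> 0" using P(2) by auto
    hence "degree (P * [:of_nat k + 1, 1:]) = Suc k" using P(1) by (subst degree_mult_eq) auto
    moreover have "lead_coeff (P * [:of_nat k + 1, 1:]) = 1" using P(2) by (subst lead_coeff_mult) auto
    moreover have "poly (P * [:of_nat k + 1, 1:]) x = pochhammer (x + 1) (Suc k)" for x
      by (simp add: P(3) pochhammer_Suc algebra_simps)
    ultimately show ?case by blast
  qed
  then obtain P :: "complex poly" where P: "degree P = k" "lead_coeff P = 1" "\<And>x. poly P x = pochhammer (x + 1) k" by blast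
  show ?thesis
    by (rule exI[of _ "coeff P"]) (use P in \<open>auto simp: poly_altdef P(3)[symmetric]\<close>)
qed

text \<open>Replacing the counting function by the polynomial \<open>q\<close> that agrees with it on \<open>\<nat>\<close> costs only the
  tail \<open>b > r\<close>, which is rapidly decreasing in \<open>r\<close>.\<close>

lemma rapid_convolution_asymptotics:
  fixes p :: "nat \<Rightarrow> complex"
  assumes p: "\<And>M::nat. summable (\<lambda>b. (1 + real b) ^ M * norm (p b))"
  obtains c e where "c k = (\<Sum>b. p b) / fact k"
    and "\<And>r. (Abs_fps p * geo ^ Suc k) $ r = (\<Sum>i\<le>k. c i * of_nat r ^ i) + e r"
    and "\<And>M::nat. \<exists>C. \<forall>n. norm (e n) * (1 + real n) ^ M \<le> C"
proof -
  obtain q :: "nat \<Rightarrow> complex" where q: "q k = 1" "\<And>x. pochhammer (x + 1) k = (\<Sum>i\<le>k. q i * x ^ i)"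
    using pochhammer_poly by blast
  define Q where "Q x = (\<Sum>i\<le>k. q i * x ^ i) / fact k" for x
  define A where "A = (\<Sum>i\<le>k. norm (q i))"
  have A0: "0 \<le> A" unfolding A_def by (intro sum_nonneg) auto
  have Qb: "norm (Q x) \<le> A * (1 + t) ^ k" if "norm x \<le> t" for x t
  proof -
    have t0: "0 \<le> t" using that norm_ge_zero order_trans by blast
    have "norm (Q x) \<le> norm (\<Sum>i\<le>k. q i * x ^ i) / 1"
      unfolding Q_def norm_divide by (rule divide_left_mono) (auto simp: fact_ge_1)
    also have "\<dots> \<le> (\<Sum>i\<le>k. norm (q i) * (1 + t) ^ k)"
      unfolding div_by_1
    proof (rule order_trans[OF norm_sum sum_mono])
      fix i assume "i \<in> {..k}"
      have "norm x ^ i \<le> (1 + t) ^ i" using that by (intro power_mono) auto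
      also have "\<dots> \<le> (1 + t) ^ k" using \<open>i \<in> _\<close> t0 by (intro power_increasing) auto
      finally show "norm (q i * x ^ i) \<le> norm (q i) * (1 + t) ^ k" by (simp add: norm_mult norm_power mult_left_mono)
    qed
    finally show ?thesis by (simp add: A_def sum_distrib_right)
  qed
  have sumP: "summable (\<lambda>b. p b * f b)" if "\<And>b. norm (f b) \<le> B * (1 + real b) ^ M" for f B M
  proof (rule summable_norm_cancel, rule summable_comparison_test)
    show "summable (\<lambda>b. B * ((1 + real b) ^ M * norm (p b)))" by (intro summable_mult p)
    show "\<exists>N. \<forall>n\<ge>N. norm (norm (p n * f n)) \<le> B * ((1 + real n) ^ M * norm (p n))"
    proof (intro exI[of _ 0] allI impI)
      fix n show "norm (norm (p n * f n)) \<le> B * ((1 + real n) ^ M * norm (p n))"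
        using mult_left_mono[OF that[of n] norm_ge_zero[of "p n"]] by (simp add: norm_mult mult_ac)
    qed
  qed
  \<comment> \<open>The coefficient of r^i in Q(r - b), by the binomial theorem. It grows
    polynomially in b and is therefore summable against p.\<close>
  define d where "d i b = (\<Sum>j\<in>{i..k}. q j * of_nat (j choose i) * (- of_nat b) ^ (j - i)) / fact k" for i b
  have dQ: "Q (of_nat r - of_nat b) = (\<Sum>i\<le>k. d i b * of_nat r ^ i)" for r b
  proof -
    have "Q (of_nat r - of_nat b) = (\<Sum>j\<le>k. \<Sum>i\<le>j. q j * of_nat (j choose i) * (- of_nat b) ^ (j - i) * of_nat r ^ i) / fact k"
      unfolding Q_def diff_conv_add_uminus binomial_ring by (simp add: sum_distrib_left mult_ac)
    also have "(\<Sum>j\<le>k. \<Sum>i\<le>j. q j * of_nat (j choose i) * (- of_nat b) ^ (j - i) * of_nat r ^ i)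
       = (\<Sum>i\<le>k. \<Sum>j\<in>{i..k}. q j * of_nat (j choose i) * (- of_nat b) ^ (j - i) * of_nat r ^ i)"
      unfolding sum.Sigma[OF finite_atMost ballI[OF finite_atMost]] sum.Sigma[OF finite_atMost ballI[OF finite_atLeastAtMost]]
      by (rule sum.reindex_bij_witness[of _ "\<lambda>(a,b). (b,a)" "\<lambda>(a,b). (b,a)"]) auto
    finally show ?thesis by (simp add: d_def sum_distrib_right sum_divide_distrib)
  qed
  have dsum: "summable (\<lambda>b. p b * d i b)" for i
  proof (rule sumP)
    fix b
    have "norm (d i b) \<le> (\<Sum>j\<in>{i..k}. norm (q j) * real (j choose i) * (1 + real b) ^ k) / 1"
      unfolding d_def norm_divide
    proof (rule frac_le)
      show "norm (\<Sum>j\<in>{i..k}. q j * of_nat (j choose i) * (- of_nat b) ^ (j - i)) \<le> (\<Sum>j\<in>{i..k}. norm (q j) * real (j choose i) * (1 + real b) ^ k)"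
      proof (rule order_trans[OF norm_sum sum_mono])
        fix j assume "j \<in> {i..k}"
        have "real b ^ (j - i) \<le> (1 + real b) ^ (j - i)" by (intro power_mono) auto
        also have "\<dots> \<le> (1 + real b) ^ k" using \<open>j \<in> _\<close> by (intro power_increasing) auto
        finally show "norm (q j * of_nat (j choose i) * (- of_nat b) ^ (j - i)) \<le> norm (q j) * real (j choose i) * (1 + real b) ^ k"
          by (simp add: norm_mult norm_power mult_left_mono)
      qed
    qed (auto simp: fact_ge_1 intro!: sum_nonneg)
    thus "norm (d i b) \<le> (\<Sum>j\<in>{i..k}. norm (q j) * real (j choose i)) * (1 + real b) ^ k"
      by (simp add: sum_distrib_right)
  qed
  define c where "c i = (\<Sum>b. p b * d i b)" for i
  define e where "e r = - (\<Sum>b. p (b + Suc r) * Q (of_nat r - of_nat (b + Suc r)))" for r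
  have Qs: "summable (\<lambda>b. p b * Q (of_nat r - of_nat b))" for r
  proof (rule sumP)
    fix b
    have "norm (Q (of_nat r - of_nat b)) \<le> A * (1 + (real r + real b)) ^ k"
      by (rule Qb) (rule order_trans[OF norm_triangle_ineq4], simp)
    also have "\<dots> \<le> A * ((1 + real r) * (1 + real b)) ^ k"
      using A0 by (intro mult_left_mono power_mono) (auto simp: algebra_simps)
    finally show "norm (Q (of_nat r - of_nat b)) \<le> A * (1 + real r) ^ k * (1 + real b) ^ k"
      by (simp add: power_mult_distrib mult.assoc)
  qed
  show ?thesis
  proof (rule that[of c e])
    have "d k b = 1 / fact k" for b by (simp add: d_def q)
    thus "c k = (\<Sum>b. p b) / fact k"
      unfolding c_def using sumP[of "\<lambda>_. 1" 1 0] by (simp add: suminf_divide)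
    show "(Abs_fps p * geo ^ Suc k) $ r = (\<Sum>i\<le>k. c i * of_nat r ^ i) + e r" for r
    proof -
      have "(Abs_fps p * geo ^ Suc k) $ r = (\<Sum>b<Suc r. p b * Q (of_nat r - of_nat b))"
        unfolding fps_mult_nth lessThan_Suc_atMost atLeast0AtMost
        by (rule sum.cong) (auto simp: geo_power_nth Q_def q(2)[symmetric] of_nat_diff simp del: power_Suc)
      also have "\<dots> = (\<Sum>b. p b * Q (of_nat r - of_nat b)) + e r"
        unfolding e_def using suminf_split_initial_segment[OF Qs, of r "Suc r"] by simp
      also have "(\<Sum>b. p b * Q (of_nat r - of_nat b)) = (\<Sum>b. \<Sum>i\<le>k. (p b * d i b) * of_nat r ^ i)"
        by (simp add: dQ sum_distrib_left mult.assoc)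
      also have "\<dots> = (\<Sum>i\<le>k. c i * of_nat r ^ i)"
        unfolding c_def using dsum by (subst suminf_sum) (auto intro!: summable_mult2 sum.cong simp: suminf_mult2[symmetric])
      finally show ?thesis .
    qed
    fix M :: nat
    \<comment> \<open>In the tail every index exceeds r, so the weight (1 + r)^M can be charged to
      the index itself; the growth of Q charges another k powers.\<close>
    define C where "C = A * (\<Sum>b. (1 + real b) ^ (k + M) * norm (p b))"
    have "norm (e r) * (1 + real r) ^ M \<le> C" for r
    proof -
      have bd: "norm (p (b + Suc r) * Q (of_nat r - of_nat (b + Suc r))) * (1 + real r) ^ M
            \<le> A * ((1 + real (b + Suc r)) ^ (k + M) * norm (p (b + Suc r)))" for b
      proof -
        have "norm (of_nat r - of_nat (b + Suc r) :: complex) = real (Suc b)"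
        proof -
          have "(of_nat r - of_nat (b + Suc r) :: complex) = - of_nat (Suc b)" by simp
          thus ?thesis by (simp only: norm_minus_cancel norm_of_nat)
        qed
        hence "norm (Q (of_nat r - of_nat (b + Suc r))) \<le> A * (1 + real (b + Suc r)) ^ k" by (intro Qb) simp
        moreover have "(1 + real r) ^ M \<le> (1 + real (b + Suc r)) ^ M" by (intro power_mono) auto
        ultimately have "norm (Q (of_nat r - of_nat (b + Suc r))) * (1 + real r) ^ M \<le> (A * (1 + real (b + Suc r)) ^ k) * (1 + real (b + Suc r)) ^ M"
          using A0 by (intro mult_mono) auto
        from mult_left_mono[OF this norm_ge_zero[of "p (b + Suc r)"]] show ?thesis
          by (simp add: norm_mult power_add mult_ac)
      qed
      have s1: "summable (\<lambda>b. A * ((1 + real b) ^ (k + M) * norm (p b)))" by (intro summable_mult p)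
      have s2: "summable (\<lambda>b. A * ((1 + real (b + Suc r)) ^ (k + M) * norm (p (b + Suc r))))"
        using summable_ignore_initial_segment[OF s1, of "Suc r"] by simp
      have s3: "summable (\<lambda>b. norm (p (b + Suc r) * Q (of_nat r - of_nat (b + Suc r))) * (1 + real r) ^ M)"
        by (rule summable_comparison_test[OF _ s2]) (use bd in auto)
      have s4: "summable (\<lambda>b. norm (p (b + Suc r) * Q (of_nat r - of_nat (b + Suc r))))"
        using summable_mult2[OF s3, of "1 / (1 + real r) ^ M"] by simp
      have "norm (e r) * (1 + real r) ^ M \<le> (\<Sum>b. norm (p (b + Suc r) * Q (of_nat r - of_nat (b + Suc r)))) * (1 + real r) ^ M"
        unfolding e_def norm_minus_cancel by (intro mult_right_mono summable_norm[OF s4]) auto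
      also have "\<dots> = (\<Sum>b. norm (p (b + Suc r) * Q (of_nat r - of_nat (b + Suc r))) * (1 + real r) ^ M)"
        by (rule suminf_mult2[OF s4])
      also have "\<dots> \<le> (\<Sum>b. A * ((1 + real (b + Suc r)) ^ (k + M) * norm (p (b + Suc r))))"
        by (rule suminf_le[OF bd s3 s2])
      also have "\<dots> \<le> (\<Sum>b. A * ((1 + real b) ^ (k + M) * norm (p b)))"
      proof -
        have "0 \<le> (\<Sum>i<Suc r. A * ((1 + real i) ^ (k + M) * norm (p i)))" using A0 by (intro sum_nonneg) auto
        thus ?thesis using suminf_split_initial_segment[OF s1, of "Suc r"] by linarith
      qed
      also have "\<dots> = C" unfolding C_def by (rule suminf_mult[OF p])
      finally show ?thesis .
    qed
    thus "\<exists>C. \<forall>n. norm (e n) * (1 + real n) ^ M \<le> C" by blast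
  qed
qed

text \<open>Each monomial r^i contributes the zeta function at z - i, hence a pole at i + 1 with
  residue \<open>c i\<close>; the rapidly decreasing rest is entire. The top coefficient is kept
  explicit since it later certifies that a pole is present.\<close>

lemma Dirichlet_series_continuation:
  fixes p :: "nat \<Rightarrow> complex"
  assumes p: "\<And>M::nat. summable (\<lambda>b. (1 + real b) ^ M * norm (p b))"
  obtains c G where "G holomorphic_on UNIV" and "c k = (\<Sum>b. p b) / fact k"
    and "\<And>z. Re z > real (Suc k) \<Longrightarrow> (\<lambda>r. (Abs_fps p * geo ^ Suc k) $ Suc r * of_nat (Suc r) powr (- z)) sums
            ((\<Sum>i\<le>k. c i / (z - of_nat (Suc i))) + G z)"
proof -
  obtain c e where ce: "c k = (\<Sum>b. p b) / fact k"
    "\<And>r. (Abs_fps p * geo ^ Suc k) $ r = (\<Sum>i\<le>k. c i * of_nat r ^ i) + e r"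
    "\<And>M::nat. \<exists>C. \<forall>n. norm (e n) * (1 + real n) ^ M \<le> C"
    using rapid_convolution_asymptotics[OF p, of k] by blast
  obtain g where g: "g holomorphic_on UNIV" "\<And>s. Re s > 1 \<Longrightarrow> zeta_series s = 1 / (s - 1) + g s"
    using zeta_entire by blast
  define G where "G z = (\<Sum>i\<le>k. c i * g (z - of_nat i)) + (\<Sum>n. e (Suc n) * of_nat (Suc n) powr (- z))" for z
  have gi: "(\<lambda>z. g (z - of_nat i)) holomorphic_on UNIV" for i
  proof -
    have "(\<lambda>z. z - of_nat i) holomorphic_on UNIV" by (intro holomorphic_intros)
    from holomorphic_on_compose_gen[OF this g(1)] show ?thesis by (simp add: o_def)
  qed
  show ?thesis
  proof (rule that[of G c])
    show "G holomorphic_on UNIV"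
      unfolding G_def[abs_def] by (intro holomorphic_intros gi entire_Dirichlet_series(1) ce(3))
    fix z :: complex assume z: "Re z > real (Suc k)"
    have "(\<lambda>r. (\<Sum>i\<le>k. c i * of_nat (Suc r) powr (- (z - of_nat i))) + e (Suc r) * of_nat (Suc r) powr (- z)) sums
       ((\<Sum>i\<le>k. c i * zeta_series (z - of_nat i)) + (\<Sum>n. e (Suc n) * of_nat (Suc n) powr (- z)))"
      unfolding zeta_series_def
      by (intro sums_add sums_sum sums_mult summable_sums zeta_series_summable entire_Dirichlet_series(2) ce(3))
         (use z in auto)
    also have "(\<lambda>r. (\<Sum>i\<le>k. c i * of_nat (Suc r) powr (- (z - of_nat i))) + e (Suc r) * of_nat (Suc r) powr (- z))
       = (\<lambda>r. (Abs_fps p * geo ^ Suc k) $ Suc r * of_nat (Suc r) powr (- z))"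
    proof
      fix r
      have "of_nat (Suc r) powr (- (z - of_nat i)) = of_nat (Suc r) ^ i * of_nat (Suc r) powr (- z)" for i
      proof -
        have "- (z - of_nat i) = of_nat i + (- z)" by simp
        thus ?thesis by (simp only: powr_add powr_nat') (simp del: of_nat_Suc)
      qed
      thus "(\<Sum>i\<le>k. c i * of_nat (Suc r) powr (- (z - of_nat i))) + e (Suc r) * of_nat (Suc r) powr (- z)
         = (Abs_fps p * geo ^ Suc k) $ Suc r * of_nat (Suc r) powr (- z)"
        by (simp only: ce(2) distrib_right sum_distrib_right mult.assoc)
    qed
    also have "(\<Sum>i\<le>k. c i * zeta_series (z - of_nat i)) + (\<Sum>n. e (Suc n) * of_nat (Suc n) powr (- z))
       = (\<Sum>i\<le>k. c i / (z - of_nat (Suc i))) + G z"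
    proof -
      have "c i * zeta_series (z - of_nat i) = c i / (z - of_nat (Suc i)) + c i * g (z - of_nat i)" if "i \<in> {..k}" for i
      proof -
        have "Re (z - of_nat i) > 1" using z that by auto
        from g(2)[OF this] show ?thesis by (simp add: distrib_left algebra_simps)
      qed
      thus ?thesis by (simp add: G_def sum.distrib)
    qed
    finally show "(\<lambda>r. (Abs_fps p * geo ^ Suc k) $ Suc r * of_nat (Suc r) powr (- z)) sums
            ((\<Sum>i\<le>k. c i / (z - of_nat (Suc i))) + G z)" .
  qed (rule ce(1))
qed

section \<open>Rapidly convergent sums of translation-invariant kernels\<close>

text \<open>The bounds \<open>s\<close> are an argument and not quantified away: comparing with the
  norms of the smooth algebra requires quantitative control, through the seminorms
  \<open>wsum s m\<close>.\<close>

definition rapid :: "'i set \<Rightarrow> (nat \<Rightarrow> 'i kern set) \<Rightarrow> 'i kern \<Rightarrow> (nat \<Rightarrow> real) \<Rightarrow> bool" where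
  "rapid X \<F> K s \<longleftrightarrow> (\<exists>Ks. (\<forall>n. Ks n \<in> \<F> n \<and> schur X (s n) (Ks n)) \<and>
     (\<forall>m. (\<lambda>n. (1 + real n) ^ m * s n) summable_on UNIV) \<and> (\<forall>x y. K x y = (\<Sum>\<^sub>\<infinity>n. Ks n x y)))"

definition wsum :: "(nat \<Rightarrow> real) \<Rightarrow> nat \<Rightarrow> real" where
  "wsum s m = (\<Sum>\<^sub>\<infinity>n. (1 + real n) ^ m * s n)"

lemma rapid_nonneg: "rapid X \<F> K s \<Longrightarrow> 0 \<le> s n"
  using schur_nonneg unfolding rapid_def by blast

lemma rapid_summable: "rapid X \<F> K s \<Longrightarrow> (\<lambda>n. (1 + real n) ^ m * s n) summable_on UNIV"
  unfolding rapid_def by blast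

lemma wsum_nonneg: "rapid X \<F> K s \<Longrightarrow> 0 \<le> wsum s m"
  unfolding wsum_def by (intro infsum_nonneg mult_nonneg_nonneg) (auto intro: rapid_nonneg)

lemma wsum_mono: "rapid X \<F> K s \<Longrightarrow> m \<le> m' \<Longrightarrow> wsum s m \<le> wsum s m'"
  unfolding wsum_def
  by (intro infsum_mono mult_right_mono power_increasing rapid_summable) (auto intro: rapid_nonneg)

lemma rapid_schur: "rapid X \<F> K s \<Longrightarrow> schur X (wsum s 0) K"
proof -
  assume r: "rapid X \<F> K s"
  then obtain Ks where Ks: "\<And>n. schur X (s n) (Ks n)" "\<And>x y. K x y = (\<Sum>\<^sub>\<infinity>n. Ks n x y)"
    unfolding rapid_def by blast
  have "schur X (infsum s UNIV) (\<lambda>x y. \<Sum>\<^sub>\<infinity>n. Ks n x y)"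
    by (rule schur_infsum(2)) (use Ks rapid_summable[OF r, of 0] in auto)
  moreover have "K = (\<lambda>x y. \<Sum>\<^sub>\<infinity>n. Ks n x y)" using Ks(2) by (intro ext)
  ultimately show ?thesis by (simp add: wsum_def)
qed

text \<open>Members of equal radius are merged into one piece. Schur bounds add over the fibres of
  \<open>r\<close>, and summing fibre by fibre leaves the weighted sums unchanged.\<close>

lemma
  fixes I :: "'j set" and F :: "nat \<Rightarrow> 'i kern set"
  assumes closed: "\<And>n f (I :: 'j set). (\<And>i. i \<in> I \<Longrightarrow> f i \<in> F n) \<Longrightarrow> (\<lambda>x y. \<Sum>\<^sub>\<infinity>i\<in>I. f i x y) \<in> F n"
    and f: "\<And>i. i \<in> I \<Longrightarrow> f i \<in> F (r i)" and s: "\<And>i. i \<in> I \<Longrightarrow> schur X (s i) (f i)"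
    and sm: "\<And>m::nat. (\<lambda>i. (1 + real (r i)) ^ m * s i) summable_on I"
  shows rapid_family: "rapid X F (\<lambda>x y. \<Sum>\<^sub>\<infinity>i\<in>I. f i x y) (\<lambda>n. \<Sum>\<^sub>\<infinity>i\<in>{i\<in>I. r i = n}. s i)"
    and wsum_family: "wsum (\<lambda>n. \<Sum>\<^sub>\<infinity>i\<in>{i\<in>I. r i = n}. s i) m = (\<Sum>\<^sub>\<infinity>i\<in>I. (1 + real (r i)) ^ m * s i)"
proof -
  define In where "In n = {i\<in>I. r i = n}" for n
  have bij: "bij_betw (\<lambda>i. (r i, i)) I (Sigma UNIV In)"
    by (rule bij_betw_byWitness[where f'=snd]) (auto simp: In_def)
  have fib: "(\<lambda>(n, i). g i) summable_on Sigma UNIV In"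
    "infsum g I = (\<Sum>\<^sub>\<infinity>n. \<Sum>\<^sub>\<infinity>i\<in>In n. g i)" if g: "g summable_on I" for g :: "'j \<Rightarrow> 'c :: banach"
  proof -
    show *: "(\<lambda>(n, i). g i) summable_on Sigma UNIV In"
      using summable_on_reindex_bij_betw[OF bij, of "\<lambda>(n, i). g i"] g by simp
    have "infsum g I = infsum (\<lambda>(n, i). g i) (Sigma UNIV In)"
      using infsum_reindex_bij_betw[OF bij, of "\<lambda>(n, i). g i"] by simp
    also have "\<dots> = (\<Sum>\<^sub>\<infinity>n. \<Sum>\<^sub>\<infinity>i\<in>In n. g i)" by (rule infsum_Sigma'_banach[symmetric, OF *])
    finally show "infsum g I = (\<Sum>\<^sub>\<infinity>n. \<Sum>\<^sub>\<infinity>i\<in>In n. g i)" .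
  qed
  have s0: "s summable_on I" using sm[of 0] by simp
  have sIn: "s summable_on In n" for n by (rule summable_on_subset_banach[OF s0]) (auto simp: In_def)
  have w: "(1 + real n) ^ m * (\<Sum>\<^sub>\<infinity>i\<in>In n. s i) = (\<Sum>\<^sub>\<infinity>i\<in>In n. (1 + real (r i)) ^ m * s i)" for n m
  proof -
    have "(\<Sum>\<^sub>\<infinity>i\<in>In n. (1 + real (r i)) ^ m * s i) = (\<Sum>\<^sub>\<infinity>i\<in>In n. (1 + real n) ^ m * s i)"
      by (rule infsum_cong) (simp add: In_def)
    thus ?thesis by (simp add: infsum_cmult_right')
  qed
  have ws: "(\<lambda>n. (1 + real n) ^ m * (\<Sum>\<^sub>\<infinity>i\<in>In n. s i)) summable_on UNIV" for m
    unfolding w by (rule summable_on_Sigma_banach[OF fib(1)[OF sm]])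
  show "wsum (\<lambda>n. \<Sum>\<^sub>\<infinity>i\<in>{i\<in>I. r i = n}. s i) m = (\<Sum>\<^sub>\<infinity>i\<in>I. (1 + real (r i)) ^ m * s i)"
    unfolding wsum_def In_def[symmetric] w by (rule fib(2)[symmetric, OF sm])
  show "rapid X F (\<lambda>x y. \<Sum>\<^sub>\<infinity>i\<in>I. f i x y) (\<lambda>n. \<Sum>\<^sub>\<infinity>i\<in>{i\<in>I. r i = n}. s i)"
    unfolding rapid_def In_def[symmetric]
  proof (intro exI[of _ "\<lambda>n x y. \<Sum>\<^sub>\<infinity>i\<in>In n. f i x y"] conjI allI)
    show "(\<lambda>x y. \<Sum>\<^sub>\<infinity>i\<in>In n. f i x y) \<in> F n" for n
      by (rule closed) (use f in \<open>auto simp: In_def\<close>)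
    show "schur X (infsum s (In n)) (\<lambda>x y. \<Sum>\<^sub>\<infinity>i\<in>In n. f i x y)" for n
      by (rule schur_infsum(2)[OF _ sIn]) (use s in \<open>auto simp: In_def\<close>)
    show "(\<lambda>n. (1 + real n) ^ m * infsum s (In n)) summable_on UNIV" for m by (rule ws)
    show "(\<Sum>\<^sub>\<infinity>i\<in>I. f i x y) = (\<Sum>\<^sub>\<infinity>n. \<Sum>\<^sub>\<infinity>i\<in>In n. f i x y)" for x y
      by (rule fib(2)) (rule schur_infsum(1)[OF s s0])
  qed
qed

text \<open>Common to the index sets of the algebra (d = l + 1) and of the spectral triple (d = 2l +
  1): the coordinate at position l is an integer, the others are natural numbers. Integer-valued
  functions vanishing from d on make differences of points available.\<close>

locale coords =
  fixes X :: "'i set" and co :: "'i \<Rightarrow> nat \<Rightarrow> int" and d l :: nat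
  assumes inj: "inj_on co X"
    and img: "co ` X = {g. (\<forall>i<d. i \<noteq> l \<longrightarrow> 0 \<le> g i) \<and> (\<forall>i\<ge>d. g i = 0)}"
begin

text \<open>The first relation restricts the support; the second tells which columns may be compared
  by translation. Rows need no relation of their own, as they are fixed by the common
  difference.\<close>

definition tker :: "('i \<Rightarrow> 'i \<Rightarrow> bool) \<Rightarrow> ('i \<Rightarrow> 'i \<Rightarrow> bool) \<Rightarrow> 'i kern set" where
  "tker adm rel = {K. (\<forall>x y. K x y \<noteq> 0 \<longrightarrow> x \<in> X \<and> y \<in> X \<and> adm x y) \<and>
     (\<forall>x y x' y'. x \<in> X \<longrightarrow> y \<in> X \<longrightarrow> x' \<in> X \<longrightarrow> y' \<in> X \<longrightarrow> co x - co y = co x' - co y' \<longrightarrow> rel y y' \<longrightarrow> K x y = K x' y')}"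

definition dist1 :: "'i \<Rightarrow> 'i \<Rightarrow> int" where
  "dist1 x y = (\<Sum>i<d. \<bar>co x i - co y i\<bar>)"

definition size1 :: "'i \<Rightarrow> int" where
  "size1 x = (\<Sum>i<d. \<bar>co x i\<bar>)"

lemma tkerD1: "K \<in> tker adm rel \<Longrightarrow> K x y \<noteq> 0 \<Longrightarrow> x \<in> X \<and> y \<in> X \<and> adm x y"
  unfolding tker_def by blast

lemma tkerD2: "K \<in> tker adm rel \<Longrightarrow> x \<in> X \<Longrightarrow> y \<in> X \<Longrightarrow> x' \<in> X \<Longrightarrow> y' \<in> X \<Longrightarrow>
    co x - co y = co x' - co y' \<Longrightarrow> rel y y' \<Longrightarrow> K x y = K x' y'"
  unfolding tker_def by blast

lemma tkerI:
  assumes "\<And>x y. K x y \<noteq> 0 \<Longrightarrow> x \<in> X \<and> y \<in> X \<and> adm x y"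
    and "\<And>x y x' y'. x \<in> X \<Longrightarrow> y \<in> X \<Longrightarrow> x' \<in> X \<Longrightarrow> y' \<in> X \<Longrightarrow> co x - co y = co x' - co y' \<Longrightarrow> rel y y' \<Longrightarrow> K x y = K x' y'"
  shows "K \<in> tker adm rel"
  using assms unfolding tker_def by blast

lemma tker_infsum:
  assumes "\<And>i. i \<in> I \<Longrightarrow> f i \<in> tker adm rel"
  shows "(\<lambda>x y. \<Sum>\<^sub>\<infinity>i\<in>I. f i x y) \<in> tker adm rel"
proof (rule tkerI)
  fix x y assume "(\<Sum>\<^sub>\<infinity>i\<in>I. f i x y) \<noteq> 0"
  hence "\<exists>i\<in>I. f i x y \<noteq> 0" using infsum_0[of I "\<lambda>i. f i x y"] by blast
  then obtain i where "i \<in> I" "f i x y \<noteq> 0" by blast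
  thus "x \<in> X \<and> y \<in> X \<and> adm x y" using tkerD1[OF assms] by simp
next
  fix x y x' y' assume "x \<in> X" "y \<in> X" "x' \<in> X" "y' \<in> X" "co x - co y = co x' - co y'" "rel y y'"
  thus "(\<Sum>\<^sub>\<infinity>i\<in>I. f i x y) = (\<Sum>\<^sub>\<infinity>i\<in>I. f i x' y')"
    by (intro infsum_cong tkerD2[OF assms])
qed

lemma tker_scale: "K \<in> tker adm rel \<Longrightarrow> (\<lambda>x y. c * K x y) \<in> tker adm rel"
proof (rule tkerI)
  fix x y assume "K \<in> tker adm rel" "c * K x y \<noteq> 0"
  thus "x \<in> X \<and> y \<in> X \<and> adm x y" using tkerD1[of K adm rel x y] by simp
next
  fix x y x' y' assume *: "K \<in> tker adm rel"
    "x \<in> X" "y \<in> X" "x' \<in> X" "y' \<in> X" "co x - co y = co x' - co y'" "rel y y'"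
  show "c * K x y = c * K x' y'" using tkerD2[OF *] by simp
qed

lemma tker_add: "K \<in> tker adm rel \<Longrightarrow> L \<in> tker adm rel \<Longrightarrow> K + L \<in> tker adm rel"
proof (rule tkerI)
  fix x y assume "K \<in> tker adm rel" "L \<in> tker adm rel" "(K + L) x y \<noteq> 0"
  moreover from this have "K x y \<noteq> 0 \<or> L x y \<noteq> 0" by auto
  ultimately show "x \<in> X \<and> y \<in> X \<and> adm x y" using tkerD1 by metis
next
  fix x y x' y' assume *: "K \<in> tker adm rel" "L \<in> tker adm rel"
    "x \<in> X" "y \<in> X" "x' \<in> X" "y' \<in> X" "co x - co y = co x' - co y'" "rel y y'"
  have "K x y = K x' y'" "L x y = L x' y'" using tkerD2[OF *(1)] tkerD2[OF *(2)] *(3-) by blast+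
  thus "(K + L) x y = (K + L) x' y'" by simp
qed

section \<open>Distance, size and products in coordinates\<close>

lemma mem_img: "x \<in> X \<Longrightarrow> i < d \<Longrightarrow> i \<noteq> l \<Longrightarrow> 0 \<le> co x i"
  and mem_img0: "x \<in> X \<Longrightarrow> d \<le> i \<Longrightarrow> co x i = 0"
  using imageI[of x X co] by (simp_all add: img)

lemma img_ex: "(\<And>i. i < d \<Longrightarrow> i \<noteq> l \<Longrightarrow> 0 \<le> g i) \<Longrightarrow> (\<And>i. d \<le> i \<Longrightarrow> g i = 0) \<Longrightarrow> \<exists>x\<in>X. co x = g"
proof -
  assume "\<And>i. i < d \<Longrightarrow> i \<noteq> l \<Longrightarrow> 0 \<le> g i" "\<And>i. d \<le> i \<Longrightarrow> g i = 0"
  hence "g \<in> co ` X" by (simp add: img)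
  thus ?thesis by (rule imageE) blast
qed

lemma dist1_bound: "i < d \<Longrightarrow> \<bar>co x i - co y i\<bar> \<le> dist1 x y"
  unfolding dist1_def by (rule member_le_sum) auto

lemma dist1_triangle: "dist1 x y \<le> dist1 x z + dist1 z y"
  unfolding dist1_def sum.distrib[symmetric] by (rule sum_mono) linarith

lemma dist1_sym: "dist1 x y = dist1 y x"
  unfolding dist1_def by (rule sum.cong) auto

lemma dist1_nonneg: "0 \<le> dist1 x y"
  unfolding dist1_def by (rule sum_nonneg) auto

lemma dist1_cong: "co x - co y = co x' - co y' \<Longrightarrow> dist1 x y = dist1 x' y'"
  unfolding dist1_def by (rule sum.cong) (auto simp: fun_eq_iff)

lemma size1_diff: "\<bar>size1 x - size1 y\<bar> \<le> dist1 x y"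
proof -
  have "\<bar>size1 x - size1 y\<bar> = \<bar>\<Sum>i<d. \<bar>co x i\<bar> - \<bar>co y i\<bar>\<bar>" by (simp add: size1_def sum_subtractf)
  also have "\<dots> \<le> (\<Sum>i<d. \<bar>\<bar>co x i\<bar> - \<bar>co y i\<bar>\<bar>)" by (rule sum_abs)
  also have "\<dots> \<le> dist1 x y" unfolding dist1_def by (rule sum_mono) linarith
  finally show ?thesis .
qed

lemma co_diffD: "co x - co y = co x' - co y' \<Longrightarrow> co x i - co y i = co x' i - co y' i"
  by (metis minus_apply)

text \<open>Translating the intermediate point z by y' - y matches the terms of the two sums. The
  last hypothesis is the crux: the translate must be a point of X again and be comparable with z for
  the left factor.\<close>

lemma tker_kcomp:
  assumes K: "K \<in> tker aK rK" and L: "L \<in> tker aL rL"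
    and a: "\<And>x y z. x \<in> X \<Longrightarrow> y \<in> X \<Longrightarrow> z \<in> X \<Longrightarrow> aK x z \<Longrightarrow> aL z y \<Longrightarrow> a x y"
    and r: "\<And>y y'. r y y' \<Longrightarrow> rL y y'" and sym: "\<And>y y'. r y y' \<Longrightarrow> r y' y"
    and tr: "\<And>y y' z. y \<in> X \<Longrightarrow> y' \<in> X \<Longrightarrow> z \<in> X \<Longrightarrow> r y y' \<Longrightarrow> aL z y \<Longrightarrow>
        \<exists>z'\<in>X. co z' = co z + co y' - co y \<and> rK z z'"
  shows "kcomp K L \<in> tker a r"
proof (rule tkerI)
  fix x y assume "kcomp K L x y \<noteq> 0"
  hence "\<exists>z. K x z * L z y \<noteq> 0" using infsum_0[of UNIV "\<lambda>z. K x z * L z y"] unfolding kcomp_def by blast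
  then obtain z where "K x z * L z y \<noteq> 0" by blast
  hence "K x z \<noteq> 0" "L z y \<noteq> 0" by auto
  hence "x \<in> X \<and> z \<in> X \<and> aK x z" "z \<in> X \<and> y \<in> X \<and> aL z y" using tkerD1[OF K, of x z] tkerD1[OF L, of z y] by simp_all
  thus "x \<in> X \<and> y \<in> X \<and> a x y" using a[of x y z] by simp
next
  fix x y x' y' assume m: "x \<in> X" "y \<in> X" "x' \<in> X" "y' \<in> X" and dd: "co x - co y = co x' - co y'" and rr: "r y y'"
  \<comment> \<open>The translate of z; exchanging y and y' gives its inverse, so symmetry of the
    relation makes it a bijection.\<close>
  define h where "h y y' z = inv_into X co (co z + co y' - co y)" for y y' z
  \<comment> \<open>Only points in the support of the right factor are translated, since other
    points may leave X.\<close>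
  define Z where "Z y = {z. L z y \<noteq> 0}" for y
  have h: "h y y' z \<in> X \<and> co (h y y' z) = co z + co y' - co y \<and> rK z (h y y' z) \<and> L (h y y' z) y' = L z y"
    if "y \<in> X" "y' \<in> X" "r y y'" "z \<in> Z y" for y y' z
  proof -
    have z: "z \<in> X" "aL z y" using that(4) tkerD1[OF L, of z y] by (simp_all add: Z_def)
    from tr[OF that(1,2) z(1) that(3) z(2)]
    obtain z' where z': "z' \<in> X" "co z' = co z + co y' - co y" "rK z z'" by blast
    have e: "h y y' z = z'" unfolding h_def z'(2)[symmetric] by (rule inv_into_f_f[OF inj z'(1)])
    have "L z y = L z' y'"
      by (rule tkerD2[OF L z(1) that(1) z'(1) that(2)]) (simp_all add: z'(2) fun_eq_iff r that(3))
    thus ?thesis unfolding e using z' by simp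
  qed
  have hh: "h y' y (h y y' z) = z" if "y \<in> X" "y' \<in> X" "r y y'" "z \<in> Z y" for y y' z
  proof -
    have "co (h y y' z) + co y - co y' = co z" using h[OF that] by (simp add: fun_eq_iff)
    moreover have "z \<in> X" using that(4) tkerD1[OF L, of z y] by (simp add: Z_def)
    ultimately show ?thesis unfolding h_def[of y'] by (simp only: inv_into_f_f[OF inj])
  qed
  have hZ: "h y y' z \<in> Z y'" if "y \<in> X" "y' \<in> X" "r y y'" "z \<in> Z y" for y y' z
    using h[OF that] that(4) by (simp add: Z_def)
  have KK: "K x' (h y y' z) = K x z" if z: "z \<in> Z y" for z
  proof (rule tkerD2[OF K, symmetric])
    show "z \<in> X" using z tkerD1[OF L, of z y] by (simp add: Z_def)
    show "co x - co z = co x' - co (h y y' z)"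
    proof
      fix i
      have "co (h y y' z) i = co z i + co y' i - co y i" using h[OF m(2,4) rr z] by simp
      thus "(co x - co z) i = (co x' - co (h y y' z)) i" using co_diffD[OF dd, of i] by simp
    qed
  qed (use h[OF m(2,4) rr z] m in simp_all)
  have "kcomp K L x y = (\<Sum>\<^sub>\<infinity>z\<in>Z y. K x z * L z y)"
    unfolding kcomp_def by (rule infsum_cong_neutral) (auto simp: Z_def)
  also have "\<dots> = (\<Sum>\<^sub>\<infinity>z\<in>Z y'. K x' z * L z y')"
  proof (rule infsum_reindex_bij_witness[of _ "h y' y" "h y y'"])
    fix z assume z: "z \<in> Z y"
    show "h y' y (h y y' z) = z" by (rule hh[OF m(2,4) rr z])
    show "h y y' z \<in> Z y'" by (rule hZ[OF m(2,4) rr z])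
    show "K x' (h y y' z) * L (h y y' z) y' = K x z * L z y" using KK[OF z] h[OF m(2,4) rr z] by simp
  next
    fix z assume z: "z \<in> Z y'"
    show "h y y' (h y' y z) = z" by (rule hh[OF m(4,2) sym[OF rr] z])
    show "h y' y z \<in> Z y" by (rule hZ[OF m(4,2) sym[OF rr] z])
  qed
  also have "\<dots> = kcomp K L x' y'"
    unfolding kcomp_def by (rule infsum_cong_neutral) (auto simp: Z_def)
  finally show "kcomp K L x y = kcomp K L x' y'" .
qed

text \<open>A matrix-unit term sees only finitely many values of the first coordinate. Beyond them
  just the Toeplitz part acts, which moves this coordinate and no later one; the same is repeated at
  each level.\<close>

definition admA :: "nat \<Rightarrow> 'i \<Rightarrow> 'i \<Rightarrow> bool" where
  "admA R x y \<longleftrightarrow> dist1 x y \<le> int R \<and> (\<forall>i<l. int R \<le> co y i \<longrightarrow> (\<forall>j>i. co x j = co y j))"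

text \<open>Coordinates after the first large one are not compared at all. The choice i = l means
  that none of the natural coordinates is large; then the integer coordinate is free, as the base
  algebra is translation invariant in it.\<close>

definition relA :: "nat \<Rightarrow> 'i \<Rightarrow> 'i \<Rightarrow> bool" where
  "relA R y y' \<longleftrightarrow> (\<exists>i\<le>l. (\<forall>j<i. co y j = co y' j) \<and> (i < l \<longrightarrow> int R \<le> co y i \<and> int R \<le> co y' i))"

definition kerA :: "nat \<Rightarrow> 'i kern set" where "kerA R = tker (admA R) (relA R)"

definition admB :: "nat \<Rightarrow> 'i \<Rightarrow> 'i \<Rightarrow> bool" where "admB R x y \<longleftrightarrow> dist1 x y \<le> int R"

text \<open>Equality after truncation to [-R, R]. The negative side has an effect only for the
  integer coordinate.\<close>

definition relB :: "nat \<Rightarrow> 'i \<Rightarrow> 'i \<Rightarrow> bool" where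
  "relB R y y' \<longleftrightarrow> (\<forall>i<d. co y i = co y' i \<or> (int R \<le> co y i \<and> int R \<le> co y' i) \<or> (co y i \<le> - int R \<and> co y' i \<le> - int R))"

definition kerB :: "nat \<Rightarrow> 'i kern set" where "kerB R = tker (admB R) (relB R)"

lemma kerA_infsum: "(\<And>i. i \<in> I \<Longrightarrow> f i \<in> kerA R) \<Longrightarrow> (\<lambda>x y. \<Sum>\<^sub>\<infinity>i\<in>I. f i x y) \<in> kerA R"
  unfolding kerA_def by (rule tker_infsum)

lemma kerA_scale: "K \<in> kerA R \<Longrightarrow> (\<lambda>x y. c * K x y) \<in> kerA R"
  unfolding kerA_def by (rule tker_scale)

lemma kerA_add: "K \<in> kerA R \<Longrightarrow> L \<in> kerA R \<Longrightarrow> K + L \<in> kerA R"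
  unfolding kerA_def by (rule tker_add)

lemma kerB_scale: "K \<in> kerB R \<Longrightarrow> (\<lambda>x y. c * K x y) \<in> kerB R"
  unfolding kerB_def by (rule tker_scale)

lemma kerB_add: "K \<in> kerB R \<Longrightarrow> L \<in> kerB R \<Longrightarrow> K + L \<in> kerB R"
  unfolding kerB_def by (rule tker_add)

lemma kerB_infsum: "(\<And>i. i \<in> I \<Longrightarrow> f i \<in> kerB R) \<Longrightarrow> (\<lambda>x y. \<Sum>\<^sub>\<infinity>i\<in>I. f i x y) \<in> kerB R"
  unfolding kerB_def by (rule tker_infsum)

lemma relB_D: "relB R y y' \<Longrightarrow> i < d \<Longrightarrow>
    co y i = co y' i \<or> (int R \<le> co y i \<and> int R \<le> co y' i) \<or> (co y i \<le> - int R \<and> co y' i \<le> - int R)"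
  by (simp add: relB_def)

lemma relB_mono: "relB R y y' \<Longrightarrow> R' \<le> R \<Longrightarrow> relB R' y y'"
proof -
  assume r: "relB R y y'" "R' \<le> R"
  show ?thesis unfolding relB_def
  proof (intro allI impI)
    fix i assume "i < d"
    from relB_D[OF r(1) this] r(2)
    show "co y i = co y' i \<or> (int R' \<le> co y i \<and> int R' \<le> co y' i) \<or> (co y i \<le> - int R' \<and> co y' i \<le> - int R')"
      by linarith
  qed
qed

lemma relB_sym: "relB R y y' \<Longrightarrow> relB R y' y"
proof -
  assume r: "relB R y y'"
  show ?thesis unfolding relB_def
  proof (intro allI impI)
    fix i assume "i < d"
    from relB_D[OF r this]
    show "co y' i = co y i \<or> (int R \<le> co y' i \<and> int R \<le> co y i) \<or> (co y' i \<le> - int R \<and> co y i \<le> - int R)"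
      by linarith
  qed
qed

lemma relA_E:
  assumes "relA R y y'"
  obtains i where "i \<le> l" "\<And>j. j < i \<Longrightarrow> co y j = co y' j" "i < l \<Longrightarrow> int R \<le> co y i" "i < l \<Longrightarrow> int R \<le> co y' i"
  using assms unfolding relA_def by metis

lemma relA_I:
  assumes "i \<le> l" "\<And>j. j < i \<Longrightarrow> co y j = co y' j" "i < l \<Longrightarrow> int R \<le> co y i" "i < l \<Longrightarrow> int R \<le> co y' i"
  shows "relA R y y'"
  using assms unfolding relA_def by metis

lemma relA_mono: "relA R y y' \<Longrightarrow> R' \<le> R \<Longrightarrow> relA R' y y'"
  by (elim relA_E, rule relA_I) (assumption | simp)+

lemma relA_sym: "relA R y y' \<Longrightarrow> relA R y' y"
  by (elim relA_E, rule relA_I) (assumption | simp)+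

lemma admA_D: "admA R x y \<Longrightarrow> i < l \<Longrightarrow> int R \<le> co y i \<Longrightarrow> j > i \<Longrightarrow> co x j = co y j"
  and admA_dist: "admA R x y \<Longrightarrow> dist1 x y \<le> int R"
  by (simp_all add: admA_def)

lemma admA_I:
  assumes "dist1 x y \<le> int R" "\<And>i j. i < l \<Longrightarrow> int R \<le> co y i \<Longrightarrow> j > i \<Longrightarrow> co x j = co y j"
  shows "admA R x y"
  using assms by (simp add: admA_def)

text \<open>A coordinate beyond R + R' at y is still beyond R at any z within distance R' of y.
  Hence the radii add.\<close>

lemma kerB_kcomp:
  assumes K: "K \<in> kerB R" and L: "L \<in> kerB R'" shows "kcomp K L \<in> kerB (R + R')"
  unfolding kerB_def
proof (rule tker_kcomp[OF K[unfolded kerB_def] L[unfolded kerB_def]])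
  show "admB R x z \<Longrightarrow> admB R' z y \<Longrightarrow> admB (R + R') x y" for x y z
    using dist1_triangle[of x y z] by (auto simp: admB_def)
  show "relB (R + R') y y' \<Longrightarrow> relB R' y y'" for y y' by (erule relB_mono) simp
  show "relB (R + R') y y' \<Longrightarrow> relB (R + R') y' y" for y y' by (rule relB_sym)
  fix y y' z assume m: "y \<in> X" "y' \<in> X" "z \<in> X" and r: "relB (R + R') y y'" and a: "admB R' z y"
  have b: "\<bar>co z i - co y i\<bar> \<le> int R'" if "i < d" for i using dist1_bound[OF that, of z y] a by (simp add: admB_def)
  have c: "co y i = co y' i \<or> (int R + int R' \<le> co y i \<and> int R + int R' \<le> co y' i) \<or> (co y i \<le> - int R - int R' \<and> co y' i \<le> - int R - int R')"
    if "i < d" for i using relB_D[OF r that] by simp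
  have "\<exists>z'\<in>X. co z' = co z + co y' - co y"
  proof (rule img_ex)
    fix i assume i: "i < d" "i \<noteq> l"
    have "0 \<le> co y i" "0 \<le> co y' i" "0 \<le> co z i" by (intro mem_img m i)+
    hence "0 \<le> co z i + co y' i - co y i" using b[OF i(1)] c[OF i(1)] by linarith
    thus "0 \<le> (co z + co y' - co y) i" by simp
  next
    fix i assume "d \<le> i"
    thus "(co z + co y' - co y) i = 0" by (simp add: mem_img0 m)
  qed
  then obtain z' where z': "z' \<in> X" "co z' = co z + co y' - co y" by blast
  have zi: "co z' i = co z i + co y' i - co y i" for i by (simp add: z'(2))
  have "relB R z z'" unfolding relB_def
  proof (intro allI impI)
    fix i assume i: "i < d"
    show "co z i = co z' i \<or> (int R \<le> co z i \<and> int R \<le> co z' i) \<or> (co z i \<le> - int R \<and> co z' i \<le> - int R)"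
      using b[OF i] c[OF i] zi[of i] by linarith
  qed
  thus "\<exists>z'\<in>X. co z' = co z + co y' - co y \<and> relB R z z'" using z' by blast
qed

text \<open>As before a large coordinate remains large after a step of length R'. In addition the
  coordinates behind it are left alone by both factors, so the translated intermediate point keeps
  them nonnegative.\<close>

lemma kerA_kcomp:
  assumes K: "K \<in> kerA R" and L: "L \<in> kerA R'" and dl: "d = Suc l" shows "kcomp K L \<in> kerA (R + R')"
  unfolding kerA_def
proof (rule tker_kcomp[OF K[unfolded kerA_def] L[unfolded kerA_def]])
  fix x y z assume a: "admA R x z" "admA R' z y"
  have "co x j = co y j" if i: "i < l" "int (R + R') \<le> co y i" and j: "j > i" for i j
  proof -
    have "i < d" using i dl by simp
    hence "\<bar>co z i - co y i\<bar> \<le> int R'" using dist1_bound[of i z y] admA_dist[OF a(2)] by linarith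
    hence "int R \<le> co z i" "int R' \<le> co y i" using i by simp_all
    thus ?thesis using admA_D[OF a(1) i(1) _ j] admA_D[OF a(2) i(1) _ j] by simp
  qed
  moreover have "dist1 x y \<le> int (R + R')" using dist1_triangle[of x y z] admA_dist[OF a(1)] admA_dist[OF a(2)] by simp
  ultimately show "admA (R + R') x y" by (intro admA_I)
next
  show "relA (R + R') y y' \<Longrightarrow> relA R' y y'" for y y' by (erule relA_mono) simp
  show "relA (R + R') y y' \<Longrightarrow> relA (R + R') y' y" for y y' by (rule relA_sym)
  fix y y' z assume m: "y \<in> X" "y' \<in> X" "z \<in> X" and r: "relA (R + R') y y'" and a: "admA R' z y"
  obtain i where i: "i \<le> l" "\<And>j. j < i \<Longrightarrow> co y j = co y' j" "i < l \<Longrightarrow> int (R + R') \<le> co y i" "i < l \<Longrightarrow> int (R + R') \<le> co y' i"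
    using relA_E[OF r] by blast
  have b: "\<bar>co z j - co y j\<bar> \<le> int R'" if "j < d" for j using dist1_bound[OF that, of z y] admA_dist[OF a] by linarith
  have bi: "int R \<le> co z i \<and> int R \<le> co z i + co y' i - co y i" if "i < l"
  proof -
    have "\<bar>co z i - co y i\<bar> \<le> int R'" using b[of i] that dl by simp
    moreover have "int R + int R' \<le> co y i" "int R + int R' \<le> co y' i" using i(3,4)[OF that] by simp_all
    ultimately show ?thesis by linarith
  qed
  \<comment> \<open>Behind a large coordinate z agrees with y, so the translate of z has there the
    coordinates of y'.\<close>
  have tl: "co z j = co y j" if "i < l" "j > i" for j
    by (rule admA_D[OF a that(1) _ that(2)]) (use i(3)[OF that(1)] in simp)
  have "\<exists>z'\<in>X. co z' = co z + co y' - co y"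
  proof (rule img_ex)
    fix j assume j: "j < d" "j \<noteq> l"
    have nn: "0 \<le> co y j" "0 \<le> co y' j" "0 \<le> co z j" by (intro mem_img m j)+
    consider "j < i" | "j = i" "i < l" | "j > i" "i < l" using i(1) j dl by linarith
    thus "0 \<le> (co z + co y' - co y) j"
    proof cases
      case 1 thus ?thesis using i(2)[OF 1] nn by simp
    next
      case 2 thus ?thesis using bi[OF 2(2)] by simp
    next
      case 3 thus ?thesis using tl[OF 3(2,1)] nn by simp
    qed
  next
    fix j assume "d \<le> j"
    thus "(co z + co y' - co y) j = 0" by (simp add: mem_img0 m)
  qed
  then obtain z' where z': "z' \<in> X" "co z' = co z + co y' - co y" by blast
  have "relA R z z'" by (rule relA_I[OF i(1)]) (use i(2) bi in \<open>simp_all add: z'(2)\<close>)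
  thus "\<exists>z'\<in>X. co z' = co z + co y' - co y \<and> relA R z z'" using z' by blast
qed

text \<open>Support and invariance are phrased in terms of columns, which the adjoint turns into
  rows. A coordinate of at least 2R at y is at least R at every x within distance R, whence the
  doubled radius.\<close>

lemma kerA_kadj:
  assumes K: "K \<in> kerA R" and dl: "d = Suc l" shows "kadj K \<in> kerA (2 * R)"
  unfolding kerA_def
proof (rule tkerI)
  fix x y assume "kadj K x y \<noteq> 0"
  hence nz: "K y x \<noteq> 0" by (simp add: kadj_def)
  have m: "y \<in> X \<and> x \<in> X \<and> admA R y x" by (rule tkerD1[OF K[unfolded kerA_def] nz])
  hence dd: "dist1 x y \<le> int R" by (simp add: admA_def dist1_sym[of x y])
  have "co x j = co y j" if "i < l" "int (2 * R) \<le> co y i" "j > i" for i j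
  proof -
    have "\<bar>co x i - co y i\<bar> \<le> int R" using dist1_bound[of i x y] dd that(1) dl by simp
    hence "int R \<le> co x i" using that(2) by simp
    thus ?thesis using admA_D[of R y x i j] m that by simp
  qed
  hence "admA (2 * R) x y" by (intro admA_I) (use dd in simp_all)
  thus "x \<in> X \<and> y \<in> X \<and> admA (2 * R) x y" using m by simp
next
  fix x y x' y' assume m: "x \<in> X" "y \<in> X" "x' \<in> X" "y' \<in> X" and dd: "co x - co y = co x' - co y'" and r: "relA (2 * R) y y'"
  obtain i where i: "i \<le> l" "\<And>j. j < i \<Longrightarrow> co y j = co y' j" "i < l \<Longrightarrow> int (2 * R) \<le> co y i" "i < l \<Longrightarrow> int (2 * R) \<le> co y' i"
    using relA_E[OF r] by blast
  have neg_dd: "co y - co x = co y' - co x'"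
  proof
    fix i show "(co y - co x) i = (co y' - co x') i" using co_diffD[OF dd, of i] by simp
  qed
  have eq: "K y x = K y' x'" if dR: "dist1 y x \<le> int R"
  proof (rule tkerD2[OF K[unfolded kerA_def]])
    have b: "\<bar>co y j - co x j\<bar> \<le> int R \<and> \<bar>co y' j - co x' j\<bar> \<le> int R" if "j < d" for j
      using dist1_bound[OF that, of y x] dR co_diffD[OF dd, of j] by linarith
    show "relA R x x'"
    proof (rule relA_I[OF i(1)])
      show "co x j = co x' j" if "j < i" for j using i(2)[OF that] co_diffD[OF dd, of j] by simp
      assume "i < l"
      hence "int (2 * R) \<le> co y i" "int (2 * R) \<le> co y' i" "\<bar>co y i - co x i\<bar> \<le> int R \<and> \<bar>co y' i - co x' i\<bar> \<le> int R"
        using i(3,4) b[of i] dl by simp_all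
      thus "int R \<le> co x i" "int R \<le> co x' i" by linarith+
    qed
    show "co y - co x = co y' - co x'" by (rule neg_dd)
  qed (rule m)+
  \<comment> \<open>The relation passes from columns to rows only within distance R; outside this
    band both entries vanish.\<close>
  show "kadj K x y = kadj K x' y'"
  proof (cases "dist1 y x \<le> int R")
    case True thus ?thesis using eq by (simp add: kadj_def)
  next
    case False
    hence F': "\<not> dist1 y' x' \<le> int R" using dist1_cong[OF neg_dd] by simp
    have "K y x = 0" using False tkerD1[OF K[unfolded kerA_def], of y x] by (auto simp: admA_def)
    moreover have "K y' x' = 0" using F' tkerD1[OF K[unfolded kerA_def], of y' x'] by (auto simp: admA_def)
    ultimately show ?thesis by (simp add: kadj_def)
  qed
qed

lemma kerA_translation:
  assumes "\<And>x y. K x y \<noteq> 0 \<Longrightarrow> x \<in> X \<and> y \<in> X \<and> dist1 x y \<le> int R \<and> (\<forall>j>0. co x j = co y j)"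
    and "\<And>x y x' y'. x \<in> X \<Longrightarrow> y \<in> X \<Longrightarrow> x' \<in> X \<Longrightarrow> y' \<in> X \<Longrightarrow> co x - co y = co x' - co y' \<Longrightarrow> K x y = K x' y'"
  shows "K \<in> kerA R"
  unfolding kerA_def
proof (rule tkerI)
  fix x y assume "K x y \<noteq> 0"
  from assms(1)[OF this] show "x \<in> X \<and> y \<in> X \<and> admA R x y" by (simp add: admA_def)
qed (rule assms(2))

text \<open>Before the first coordinate of size at least R, equality of truncations is equality.
  This puts the smooth kernels into the larger class.\<close>

lemma relB_relA:
  assumes m: "y \<in> X" "y' \<in> X" and dl: "l < d" and r: "relB R y y'" shows "relA R y y'"
proof (cases "\<exists>i<l. int R \<le> co y i")
  case True
  define i where "i = (LEAST i. i < l \<and> int R \<le> co y i)"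
  have i: "i < l" "int R \<le> co y i" using LeastI_ex[OF True] by (auto simp: i_def)
  have least: "co y j < int R" if "j < i" for j
    using not_less_Least[OF that[unfolded i_def]] i(1) that by simp
  have c: "co y j = co y' j \<or> (int R \<le> co y j \<and> int R \<le> co y' j) \<or> (co y j \<le> - int R \<and> co y' j \<le> - int R)"
    "0 \<le> co y j" "0 \<le> co y' j" if "j < l" for j
    using relB_D[OF r, of j] that dl mem_img[OF m(1), of j] mem_img[OF m(2), of j] by simp_all
  have eq: "co y j = co y' j" if "j < i" for j
  proof -
    have "j < l" using that i by simp
    from c[OF this] least[OF that] show ?thesis by linarith
  qed
  have i2: "int R \<le> co y' i" using c[OF i(1)] i by linarith
  show ?thesis by (rule relA_I[of i]) (use i i2 eq in simp_all)
next
  case False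
  have "co y j = co y' j" if "j < l" for j
  proof -
    have "0 \<le> co y j" "0 \<le> co y' j" using mem_img[OF m(1), of j] mem_img[OF m(2), of j] that dl by simp_all
    moreover have "co y j < int R" using False that by (meson not_le)
    moreover have "co y j = co y' j \<or> (int R \<le> co y j \<and> int R \<le> co y' j) \<or> (co y j \<le> - int R \<and> co y' j \<le> - int R)"
      using relB_D[OF r, of j] that dl by simp
    ultimately show ?thesis by linarith
  qed
  thus ?thesis by (intro relA_I[of l]) simp_all
qed

text \<open>Away from the hyperplanes \<open>\<bar>x - y\<bar>\<close> determines \<open>\<bar>x\<bar> - \<bar>y\<bar>\<close>.\<close>

lemma size1_diff_cong:
  assumes m: "x \<in> X" "y \<in> X" "x' \<in> X" "y' \<in> X" and dd: "co x - co y = co x' - co y'"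
    and r: "relB R y y'" and b: "dist1 x y \<le> int R"
  shows "size1 x - size1 y = size1 x' - size1 y'"
proof -
  have "\<bar>co x i\<bar> - \<bar>co y i\<bar> = \<bar>co x' i\<bar> - \<bar>co y' i\<bar>" if i: "i < d" for i
  proof -
    have "\<bar>co x i - co y i\<bar> \<le> int R" using dist1_bound[OF i, of x y] b by linarith
    moreover have "co y i = co y' i \<or> (int R \<le> co y i \<and> int R \<le> co y' i) \<or> (co y i \<le> - int R \<and> co y' i \<le> - int R)"
      by (rule relB_D[OF r i])
    ultimately show ?thesis using co_diffD[OF dd, of i] by linarith
  qed
  thus ?thesis unfolding size1_def sum_subtractf[symmetric] by (intro sum.cong) auto
qed

lemma kerB_delta:
  assumes K: "K \<in> kerB R" shows "(\<lambda>x y. of_int (size1 x - size1 y) * K x y) \<in> kerB R"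
  unfolding kerB_def
proof (rule tkerI)
  fix x y assume "of_int (size1 x - size1 y) * K x y \<noteq> 0"
  hence "K x y \<noteq> 0" by auto
  thus "x \<in> X \<and> y \<in> X \<and> admB R x y" by (rule tkerD1[OF K[unfolded kerB_def]])
next
  fix x y x' y' assume m: "x \<in> X" "y \<in> X" "x' \<in> X" "y' \<in> X" and dd: "co x - co y = co x' - co y'" and r: "relB R y y'"
  have "K x y = K x' y'" by (rule tkerD2[OF K[unfolded kerB_def] m dd r])
  moreover have "size1 x - size1 y = size1 x' - size1 y'" if "K x y \<noteq> 0"
    using tkerD1[OF K[unfolded kerB_def] that] by (intro size1_diff_cong[OF m dd r]) (simp add: admB_def)
  ultimately show "of_int (size1 x - size1 y) * K x y = of_int (size1 x' - size1 y') * K x' y'"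
    by (cases "K x y = 0") auto
qed

end

section \<open>Algebraic operations on rapidly convergent sums\<close>

lemma rapid_add:
  assumes K: "rapid X F K s" and L: "rapid X F L t"
    and add: "\<And>n K L. K \<in> F n \<Longrightarrow> L \<in> F n \<Longrightarrow> K + L \<in> F n"
  shows "rapid X F (K + L) (\<lambda>n. s n + t n)"
proof -
  obtain Ks where Ks: "\<And>n. Ks n \<in> F n" "\<And>n. schur X (s n) (Ks n)" "\<And>x y. K x y = (\<Sum>\<^sub>\<infinity>n. Ks n x y)" using K unfolding rapid_def by blast
  obtain Ls where Ls: "\<And>n. Ls n \<in> F n" "\<And>n. schur X (t n) (Ls n)" "\<And>x y. L x y = (\<Sum>\<^sub>\<infinity>n. Ls n x y)" using L unfolding rapid_def by blast
  have s0: "s summable_on UNIV" "t summable_on UNIV" using rapid_summable[OF K, of 0] rapid_summable[OF L, of 0] by auto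
  show ?thesis unfolding rapid_def
  proof (intro exI[of _ "\<lambda>n. Ks n + Ls n"] conjI allI)
    show "(\<lambda>n. (1 + real n) ^ m * (s n + t n)) summable_on UNIV" for m
      unfolding distrib_left by (intro summable_on_add rapid_summable[OF K] rapid_summable[OF L])
    show "(K + L) x y = (\<Sum>\<^sub>\<infinity>n. (Ks n + Ls n) x y)" for x y
      unfolding plus_fun_apply Ks(3) Ls(3)
      by (rule infsum_add[symmetric]) (rule schur_infsum(1)[OF Ks(2) s0(1)], rule schur_infsum(1)[OF Ls(2) s0(2)])
  qed (use Ks Ls add in \<open>auto intro: schur_add\<close>)
qed

lemma wsum_add:
  "rapid X F K s \<Longrightarrow> rapid X F L t \<Longrightarrow> wsum (\<lambda>n. s n + t n) m = wsum s m + wsum t m"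
  unfolding wsum_def distrib_left by (intro infsum_add rapid_summable)

lemma summable_on_prod_real:
  fixes f :: "'a \<Rightarrow> real" and g :: "'b \<Rightarrow> real"
  assumes f: "f summable_on A" "\<And>x. x \<in> A \<Longrightarrow> 0 \<le> f x" and g: "g summable_on B" "\<And>x. x \<in> B \<Longrightarrow> 0 \<le> g x"
  shows "(\<lambda>(x, y). f x * g y) summable_on A \<times> B"
proof (rule nonneg_bdd_above_summable_on)
  show "0 \<le> (case p of (x, y) \<Rightarrow> f x * g y)" if "p \<in> A \<times> B" for p using that f g by auto
  have "sum (\<lambda>(x, y). f x * g y) H \<le> infsum f A * infsum g B" if H: "finite H" "H \<subseteq> A \<times> B" for H
  proof -
    have "sum (\<lambda>(x, y). f x * g y) H \<le> sum (\<lambda>(x, y). f x * g y) (fst ` H \<times> snd ` H)"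
      by (rule sum_mono2) (use H f g in \<open>force intro: rev_image_eqI\<close>)+
    also have "\<dots> = sum f (fst ` H) * sum g (snd ` H)" by (simp add: sum_product sum.cartesian_product)
    also have "\<dots> \<le> infsum f A * infsum g B"
      by (intro mult_mono finite_sum_le_infsum infsum_nonneg sum_nonneg) (use H f g in auto)
    finally show ?thesis .
  qed
  thus "bdd_above (sum (\<lambda>(x, y). f x * g y) ` {F. F \<subseteq> A \<times> B \<and> finite F})"
    by (intro bdd_aboveI2[where M="infsum f A * infsum g B"]) auto
qed

lemma rapid_kcomp:
  fixes F :: "nat \<Rightarrow> 'i kern set"
  assumes K: "rapid X F K s" and L: "rapid X F L t"
    and closed: "\<And>n f (I :: (nat \<times> nat) set). (\<And>i. i \<in> I \<Longrightarrow> f i \<in> F n) \<Longrightarrow> (\<lambda>x y. \<Sum>\<^sub>\<infinity>i\<in>I. f i x y) \<in> F n"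
    and comp: "\<And>n m K L. K \<in> F n \<Longrightarrow> L \<in> F m \<Longrightarrow> kcomp K L \<in> F (n + m)"
  shows "\<exists>u. rapid X F (kcomp K L) u"
proof -
  obtain Ks where Ks: "\<And>n. Ks n \<in> F n" "\<And>n. schur X (s n) (Ks n)" "\<And>x y. K x y = (\<Sum>\<^sub>\<infinity>n. Ks n x y)" using K unfolding rapid_def by blast
  obtain Ls where Ls: "\<And>n. Ls n \<in> F n" "\<And>n. schur X (t n) (Ls n)" "\<And>x y. L x y = (\<Sum>\<^sub>\<infinity>n. Ls n x y)" using L unfolding rapid_def by blast
  have s0: "s summable_on UNIV" "t summable_on UNIV" using rapid_summable[OF K, of 0] rapid_summable[OF L, of 0] by auto
  have nn: "0 \<le> s n" "0 \<le> t n" for n using rapid_nonneg[OF K] rapid_nonneg[OF L] by auto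
  let ?f = "\<lambda>(n, m). kcomp (Ks n) (Ls m)" and ?r = "\<lambda>(n, m). n + m" and ?s = "\<lambda>(n, m). s n * t m"
  have sm: "(\<lambda>i. (1 + real (?r i)) ^ k * ?s i) summable_on UNIV \<times> UNIV" for k :: nat
  proof (rule summable_on_comparison_test)
    show "(\<lambda>(n, m). ((1 + real n) ^ k * s n) * ((1 + real m) ^ k * t m)) summable_on UNIV \<times> UNIV"
      by (intro summable_on_prod_real rapid_summable[OF K] rapid_summable[OF L]) (auto simp: nn)
    fix i :: "nat \<times> nat"
    obtain n m where [simp]: "i = (n, m)" by (cases i)
    \<comment> \<open>Polynomial weights are submultiplicative in the radius, so the double series
      is dominated by a product of two convergent ones.\<close>
    have "(1 + real (n + m)) ^ k \<le> ((1 + real n) * (1 + real m)) ^ k" by (intro power_mono) (auto simp: algebra_simps)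
    hence "(1 + real (n + m)) ^ k * (s n * t m) \<le> ((1 + real n) * (1 + real m)) ^ k * (s n * t m)"
      by (rule mult_right_mono) (simp add: nn)
    thus "(1 + real (?r i)) ^ k * ?s i \<le> (case i of (n, m) \<Rightarrow> ((1 + real n) ^ k * s n) * ((1 + real m) ^ k * t m))"
      by (simp add: power_mult_distrib mult_ac)
    show "0 \<le> (1 + real (?r i)) ^ k * ?s i" by (simp add: nn)
  qed
  have "rapid X F (\<lambda>x y. \<Sum>\<^sub>\<infinity>i\<in>UNIV \<times> UNIV. ?f i x y) (\<lambda>n. \<Sum>\<^sub>\<infinity>i\<in>{i\<in>UNIV \<times> UNIV. ?r i = n}. ?s i)"
    by (rule rapid_family) (use closed sm Ks Ls in \<open>auto intro: comp schur_kcomp\<close>)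
  moreover have "(\<Sum>\<^sub>\<infinity>i\<in>UNIV \<times> UNIV. ?f i x y) = kcomp K L x y" for x y
  proof -
    have fin: "(\<lambda>(z, i). case i of (n, m) \<Rightarrow> Ks n x z * Ls m z y) summable_on UNIV \<times> UNIV"
    proof (rule double_summable)
      fix G :: "'i set" and H :: "(nat \<times> nat) set" assume G: "finite G" and H: "finite H"
      have "(\<Sum>z\<in>G. \<Sum>i\<in>H. cmod (case i of (n, m) \<Rightarrow> Ks n x z * Ls m z y)) = (\<Sum>i\<in>H. \<Sum>z\<in>G. cmod (case i of (n, m) \<Rightarrow> Ks n x z * Ls m z y))"
        by (rule sum.swap)
      also have "\<dots> \<le> (\<Sum>i\<in>H. ?s i)"
      proof (rule sum_mono)
        fix i :: "nat \<times> nat" obtain n m where [simp]: "i = (n, m)" by (cases i)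
        have "(\<Sum>z\<in>G. cmod (Ks n x z * Ls m z y)) \<le> (\<Sum>z\<in>G. cmod (Ks n x z) * t m)"
          unfolding norm_mult by (intro sum_mono mult_left_mono schur_entry[OF Ls(2)]) auto
        also have "\<dots> \<le> s n * t m" unfolding sum_distrib_right[symmetric]
          by (intro mult_right_mono schur_row[OF Ks(2) G] nn)
        finally show "(\<Sum>z\<in>G. cmod (case i of (n, m) \<Rightarrow> Ks n x z * Ls m z y)) \<le> ?s i" by simp
      qed
      also have "\<dots> \<le> infsum ?s (UNIV \<times> UNIV)"
        by (rule finite_sum_le_infsum) (use H sm[of 0] nn in \<open>auto simp: case_prod_beta\<close>)
      finally show "(\<Sum>z\<in>G. \<Sum>i\<in>H. cmod (case i of (n, m) \<Rightarrow> Ks n x z * Ls m z y)) \<le> infsum ?s (UNIV \<times> UNIV)" .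
    qed
    have prod: "K x z * L z y = (\<Sum>\<^sub>\<infinity>i. case i of (n, m) \<Rightarrow> Ks n x z * Ls m z y)" for z
    proof -
      have ps: "(\<lambda>(n, m). Ks n x z * Ls m z y) summable_on UNIV \<times> UNIV"
      proof (rule abs_summable_summable[OF norm_summable_comparison])
        show "?s summable_on UNIV \<times> UNIV" using sm[of 0] by (simp add: case_prod_unfold)
        show "norm (case i of (n, m) \<Rightarrow> Ks n x z * Ls m z y) \<le> ?s i" for i
          by (cases i) (auto simp: norm_mult intro!: mult_mono schur_entry[OF Ks(2)] schur_entry[OF Ls(2)] nn)
      qed
      have "K x z * L z y = (\<Sum>\<^sub>\<infinity>n. \<Sum>\<^sub>\<infinity>m. Ks n x z * Ls m z y)"
        unfolding Ks(3) Ls(3) by (simp add: infsum_cmult_right' infsum_cmult_left')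
      also have "\<dots> = (\<Sum>\<^sub>\<infinity>(n, m)\<in>UNIV \<times> UNIV. Ks n x z * Ls m z y)" by (rule infsum_Sigma'_banach[OF ps])
      finally show ?thesis by simp
    qed
    have "kcomp K L x y = (\<Sum>\<^sub>\<infinity>z. \<Sum>\<^sub>\<infinity>i. case i of (n, m) \<Rightarrow> Ks n x z * Ls m z y)" by (simp add: kcomp_def prod)
    also have "\<dots> = (\<Sum>\<^sub>\<infinity>i. \<Sum>\<^sub>\<infinity>z. case i of (n, m) \<Rightarrow> Ks n x z * Ls m z y)"
      by (rule infsum_swap_banach) (use fin in simp)
    also have "\<dots> = (\<Sum>\<^sub>\<infinity>i\<in>UNIV \<times> UNIV. ?f i x y)" by (simp add: case_prod_beta kcomp_def)
    finally show ?thesis by simp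
  qed
  ultimately show ?thesis by auto
qed

text \<open>One statement for scalar multiples, tensoring with the identity and both commutators.
  The multiplier may grow linearly with the radius of the piece, a loss that rapid decrease
  absorbs.\<close>

lemma rapid_multiplier:
  fixes F :: "nat \<Rightarrow> 'i kern set" and G :: "nat \<Rightarrow> 'j kern set"
  assumes K: "rapid X F K s"
    and closed: "\<And>n f (I :: nat set). (\<And>i. i \<in> I \<Longrightarrow> f i \<in> G n) \<Longrightarrow> (\<lambda>x y. \<Sum>\<^sub>\<infinity>i\<in>I. f i x y) \<in> G n"
    and mem: "\<And>n K. K \<in> F n \<Longrightarrow> (\<lambda>x y. \<phi> x y * K (p x) (p y)) \<in> G (r n)"
    and sch: "\<And>n K s. K \<in> F n \<Longrightarrow> schur X s K \<Longrightarrow> schur Y (c * (1 + real n) * s) (\<lambda>x y. \<phi> x y * K (p x) (p y))"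
    and r: "\<And>n. real (r n) \<le> a * (1 + real n)" and a: "0 \<le> a"
  shows "\<exists>u. rapid Y G (\<lambda>x y. \<phi> x y * K (p x) (p y)) u"
proof -
  obtain Ks where Ks: "\<And>n. Ks n \<in> F n" "\<And>n. schur X (s n) (Ks n)" "\<And>x y. K x y = (\<Sum>\<^sub>\<infinity>n. Ks n x y)" using K unfolding rapid_def by blast
  have nn: "0 \<le> s n" for n by (rule rapid_nonneg[OF K])
  let ?f = "\<lambda>n x y. \<phi> x y * Ks n (p x) (p y)"
  have sf: "schur Y (c * (1 + real n) * s n) (?f n)" for n by (rule sch[OF Ks(1) Ks(2)])
  have nn': "0 \<le> c * (1 + real n) * s n" for n using schur_nonneg[OF sf] .
  have "rapid Y G (\<lambda>x y. \<Sum>\<^sub>\<infinity>n\<in>UNIV. ?f n x y) (\<lambda>n. \<Sum>\<^sub>\<infinity>i\<in>{i\<in>UNIV. r i = n}. c * (1 + real i) * s i)"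
  proof (rule rapid_family)
    fix m :: nat
    show "(\<lambda>n. (1 + real (r n)) ^ m * (c * (1 + real n) * s n)) summable_on UNIV"
    proof (rule summable_on_comparison_test)
      show "(\<lambda>n. (1 + a) ^ m * c * ((1 + real n) ^ Suc m * s n)) summable_on UNIV"
        by (intro summable_on_cmult_right rapid_summable[OF K])
      fix n
      have "1 + real (r n) \<le> (1 + a) * (1 + real n)" using r[of n] by (simp add: algebra_simps)
      hence "(1 + real (r n)) ^ m * (c * (1 + real n) * s n) \<le> ((1 + a) * (1 + real n)) ^ m * (c * (1 + real n) * s n)"
        by (intro mult_right_mono power_mono nn') auto
      thus "(1 + real (r n)) ^ m * (c * (1 + real n) * s n) \<le> (1 + a) ^ m * c * ((1 + real n) ^ Suc m * s n)"
        by (simp add: power_mult_distrib mult_ac)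
      show "0 \<le> (1 + real (r n)) ^ m * (c * (1 + real n) * s n)" using nn' by simp
    qed
  qed (use closed mem[OF Ks(1)] sf in auto)
  moreover have "(\<Sum>\<^sub>\<infinity>n\<in>UNIV. ?f n x y) = \<phi> x y * K (p x) (p y)" for x y
    by (simp add: Ks(3) infsum_cmult_right')
  ultimately show ?thesis by auto
qed

lemma rapid_kadj:
  fixes F :: "nat \<Rightarrow> 'i kern set"
  assumes K: "rapid X F K s"
    and closed: "\<And>n f (I :: nat set). (\<And>i. i \<in> I \<Longrightarrow> f i \<in> F n) \<Longrightarrow> (\<lambda>x y. \<Sum>\<^sub>\<infinity>i\<in>I. f i x y) \<in> F n"
    and mem: "\<And>n K. K \<in> F n \<Longrightarrow> kadj K \<in> F (2 * n)"
  shows "\<exists>u. rapid X F (kadj K) u"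
proof -
  obtain Ks where Ks: "\<And>n. Ks n \<in> F n" "\<And>n. schur X (s n) (Ks n)" "\<And>x y. K x y = (\<Sum>\<^sub>\<infinity>n. Ks n x y)" using K unfolding rapid_def by blast
  have nn: "0 \<le> s n" for n by (rule rapid_nonneg[OF K])
  have "rapid X F (\<lambda>x y. \<Sum>\<^sub>\<infinity>n\<in>UNIV. kadj (Ks n) x y) (\<lambda>n. \<Sum>\<^sub>\<infinity>i\<in>{i\<in>UNIV. 2 * i = n}. s i)"
  proof (rule rapid_family)
    fix m :: nat
    show "(\<lambda>n. (1 + real (2 * n)) ^ m * s n) summable_on UNIV"
    proof (rule summable_on_comparison_test)
      show "(\<lambda>n. 2 ^ m * ((1 + real n) ^ m * s n)) summable_on UNIV"
        by (intro summable_on_cmult_right rapid_summable[OF K])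
      fix n
      have "(1 + real (2 * n)) ^ m \<le> (2 * (1 + real n)) ^ m" by (intro power_mono) auto
      hence "(1 + real (2 * n)) ^ m * s n \<le> (2 * (1 + real n)) ^ m * s n" by (intro mult_right_mono nn)
      thus "(1 + real (2 * n)) ^ m * s n \<le> 2 ^ m * ((1 + real n) ^ m * s n)" by (simp only: power_mult_distrib mult.assoc)
    qed (auto simp: nn)
  qed (use closed mem[OF Ks(1)] schur_kadj[OF Ks(2)] in auto)
  moreover have "(\<Sum>\<^sub>\<infinity>n\<in>UNIV. kadj (Ks n) x y) = kadj K x y" for x y
    by (simp add: kadj_def Ks(3) infsum_cnj)
  ultimately show ?thesis by auto
qed

section \<open>The smooth algebras in terms of kernels\<close>

definition cI :: "nat list \<times> int \<Rightarrow> nat \<Rightarrow> int" where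
  "cI p i = (if i < length (fst p) then int (fst p ! i) else if i = length (fst p) then snd p else 0)"

lemma mem_idx: "p \<in> idx l \<longleftrightarrow> length (fst p) = l"
  by (cases p) (simp add: idx_def)

lemma coords_idx: "coords (idx l) cI (Suc l) l"
proof
  show "inj_on cI (idx l)"
  proof (rule inj_onI)
    fix p q assume pq: "p \<in> idx l" "q \<in> idx l" "cI p = cI q"
    have "fst p ! i = fst q ! i" if "i < l" for i
      using fun_cong[OF pq(3), of i] pq(1,2) that by (simp add: cI_def mem_idx)
    hence "fst p = fst q" using pq by (intro nth_equalityI) (auto simp: mem_idx)
    moreover have "snd p = snd q" using fun_cong[OF pq(3), of l] pq(1,2) by (simp add: cI_def mem_idx)
    ultimately show "p = q" by (rule prod_eqI)
  qed
  show "cI ` idx l = {g. (\<forall>i<Suc l. i \<noteq> l \<longrightarrow> 0 \<le> g i) \<and> (\<forall>i\<ge>Suc l. g i = 0)}"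
  proof (intro equalityI subsetI)
    fix g :: "nat \<Rightarrow> int" assume g: "g \<in> {g. (\<forall>i<Suc l. i \<noteq> l \<longrightarrow> 0 \<le> g i) \<and> (\<forall>i\<ge>Suc l. g i = 0)}"
    define p where "p = (map (\<lambda>i. nat (g i)) [0..<l], g l)"
    have "g = cI p" using g by (auto simp: fun_eq_iff cI_def p_def)
    thus "g \<in> cI ` idx l" by (auto simp: mem_idx p_def)
  qed (auto simp: cI_def mem_idx)
qed

interpretation ix: coords "idx l" cI "Suc l" l for l
  by (rule coords_idx)

abbreviation kA :: "nat \<Rightarrow> nat \<Rightarrow> (nat list \<times> int) kern set" where
  "kA l \<equiv> coords.kerA (idx l) cI (Suc l) l"

section \<open>Splitting off the first coordinate\<close>

definition cns :: "nat \<Rightarrow> nat list \<times> int \<Rightarrow> nat list \<times> int" where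
  "cns i p = (i # fst p, snd p)"

lemma cns_inj [simp]: "cns i p = cns j q \<longleftrightarrow> i = j \<and> p = q"
  by (auto simp: cns_def prod_eq_iff)

lemma cns_idx [simp]: "cns i p \<in> idx (Suc l) \<longleftrightarrow> p \<in> idx l"
  by (simp add: cns_def mem_idx)

lemma idx_Suc_cases: "x \<in> idx (Suc l) \<Longrightarrow> (\<And>i p. x = cns i p \<Longrightarrow> p \<in> idx l \<Longrightarrow> thesis) \<Longrightarrow> thesis"
proof -
  assume x: "x \<in> idx (Suc l)" and *: "\<And>i p. x = cns i p \<Longrightarrow> p \<in> idx l \<Longrightarrow> thesis"
  obtain i v where v: "fst x = i # v" "length v = l" using x by (auto simp: mem_idx length_Suc_conv)
  show thesis by (rule *[of i "(v, snd x)"]) (use v in \<open>auto simp: cns_def mem_idx prod_eq_iff\<close>)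
qed

lemma idx_Suc_ex: "x \<in> idx (Suc l) \<Longrightarrow> \<exists>i p. x = cns i p \<and> p \<in> idx l"
  by (meson idx_Suc_cases)

lemma cI_cns_0 [simp]: "cI (cns i p) 0 = int i"
  and cI_cns_Suc [simp]: "cI (cns i p) (Suc j) = cI p j"
  by (simp_all add: cI_def cns_def)

lemma dist1_cns: "ix.dist1 (Suc l) (cns i p) (cns j q) = \<bar>int i - int j\<bar> + ix.dist1 l p q"
  unfolding ix.dist1_def by (subst sum.lessThan_Suc_shift) simp

lemma cI_diff_cns: "cI (cns i p) - cI (cns j q) = cI (cns i' p') - cI (cns j' q') \<longleftrightarrow>
    int i - int j = int i' - int j' \<and> cI p - cI q = cI p' - cI q'"
  (is "?L \<longleftrightarrow> ?R")
proof
  assume L: ?L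
  have "(cI p - cI q) k = (cI p' - cI q') k" for k using ix.co_diffD[OF L, of "Suc k"] by simp
  moreover have "int i - int j = int i' - int j'" using ix.co_diffD[OF L, of 0] by simp
  ultimately show ?R by blast
next
  assume R: ?R
  show ?L
  proof
    fix k show "(cI (cns i p) - cI (cns j q)) k = (cI (cns i' p') - cI (cns j' q')) k"
      using R ix.co_diffD[of p q p' q'] by (cases k) auto
  qed
qed

text \<open>A large first coordinate freezes all the others, that is, forces p = q; otherwise the
  condition is that of the level below. This recursion mirrors the inductive definition of the
  algebra.\<close>

lemma admA_cns:
  assumes "p \<in> idx l" "q \<in> idx l"
  shows "ix.admA (Suc l) R (cns i p) (cns j q) \<longleftrightarrow>
    \<bar>int i - int j\<bar> + ix.dist1 l p q \<le> int R \<and> (R \<le> j \<longrightarrow> p = q) \<and>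
    (\<forall>i<l. int R \<le> cI q i \<longrightarrow> (\<forall>j>i. cI p j = cI q j))"
proof -
  have "(\<forall>k>0. cI (cns i p) k = cI (cns j q) k) \<longleftrightarrow> cI p = cI q"
    by (auto simp: fun_eq_iff gr0_conv_Suc)
  also have "\<dots> \<longleftrightarrow> p = q" using inj_onD[OF ix.inj _ assms] by blast
  finally have 0: "(\<forall>k>0. cI (cns i p) k = cI (cns j q) k) \<longleftrightarrow> p = q" .
  have "(\<forall>a<Suc l. int R \<le> cI (cns j q) a \<longrightarrow> (\<forall>k>a. cI (cns i p) k = cI (cns j q) k)) \<longleftrightarrow>
     (R \<le> j \<longrightarrow> p = q) \<and> (\<forall>a<l. int R \<le> cI q a \<longrightarrow> (\<forall>k>Suc a. cI (cns i p) k = cI (cns j q) k))"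
    unfolding All_less_Suc2 by (simp add: 0)
  also have "(\<forall>a<l. int R \<le> cI q a \<longrightarrow> (\<forall>k>Suc a. cI (cns i p) k = cI (cns j q) k)) \<longleftrightarrow>
      (\<forall>a<l. int R \<le> cI q a \<longrightarrow> (\<forall>k>a. cI p k = cI q k))"
    by (simp add: Suc_less_eq2) (metis Suc_less_eq cI_cns_Suc)
  finally show ?thesis unfolding ix.admA_def dist1_cns by simp
qed

lemma relA_cns:
  "ix.relA (Suc l) R (cns j q) (cns j' q') \<longleftrightarrow> (R \<le> j \<and> R \<le> j') \<or> (j = j' \<and> ix.relA l R q q')"
  (is "?L \<longleftrightarrow> ?R")
proof
  assume ?L
  then obtain i where i: "i \<le> Suc l" "\<And>k. k < i \<Longrightarrow> cI (cns j q) k = cI (cns j' q') k"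
    "i < Suc l \<Longrightarrow> int R \<le> cI (cns j q) i" "i < Suc l \<Longrightarrow> int R \<le> cI (cns j' q') i" using ix.relA_E by blast
  show ?R
  proof (cases i)
    case 0 thus ?thesis using i(3,4) by simp
  next
    case (Suc a)
    have "ix.relA l R q q'"
    proof (rule ix.relA_I)
      show "cI q k = cI q' k" if "k < a" for k using i(2)[of "Suc k"] Suc that by simp
    qed (use i Suc in simp_all)
    moreover have "j = j'" using i(2)[of 0] Suc by simp
    ultimately show ?thesis by blast
  qed
next
  assume ?R
  thus ?L
  proof
    assume "R \<le> j \<and> R \<le> j'"
    thus ?L by (intro ix.relA_I[of 0]) auto
  next
    assume *: "j = j' \<and> ix.relA l R q q'"
    then obtain i where i: "i \<le> l" "\<And>k. k < i \<Longrightarrow> cI q k = cI q' k"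
      "i < l \<Longrightarrow> int R \<le> cI q i" "i < l \<Longrightarrow> int R \<le> cI q' i" using ix.relA_E by blast
    show ?L
    proof (rule ix.relA_I)
      show "cI (cns j q) k = cI (cns j' q') k" if "k < Suc i" for k using * i(2) that by (cases k) auto
    qed (use i in simp_all)
  qed
qed

text \<open>The kernel of the term of the defining series with indices j and k: a block matrix whose
  only nonzero block, in row j and column k, is K.\<close>

definition lift :: "nat \<Rightarrow> nat \<Rightarrow> (nat list \<times> int) kern \<Rightarrow> (nat list \<times> int) kern" where
  "lift j k K x y = (if fst x \<noteq> [] \<and> fst y \<noteq> [] \<and> hd (fst x) = j \<and> hd (fst y) = k
      then K (tl (fst x), snd x) (tl (fst y), snd y) else 0)"

lemma lift_cns [simp]: "lift j k K (cns a p) (cns b q) = (if a = j \<and> b = k then K p q else 0)"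
  by (auto simp: lift_def cns_def)

lemma lift_nonzeroD: "lift j k K x y \<noteq> 0 \<Longrightarrow> \<exists>p q. x = cns j p \<and> y = cns k q \<and> K p q \<noteq> 0"
  by (intro exI[of _ "(tl (fst x), snd x)"] exI[of _ "(tl (fst y), snd y)"])
     (auto simp: lift_def cns_def prod_eq_iff split: if_splits)

text \<open>The kernel of the k-th power of \<open>alpha1\<close> for k >= 0 and of the power -k of
  its adjoint for k < 0.\<close>

definition shk :: "nat \<Rightarrow> int \<Rightarrow> (nat list \<times> int) kern" where
  "shk l k x y = (if x \<in> idx (Suc l) \<and> y \<in> idx (Suc l) \<and> tl (fst x) = tl (fst y) \<and> snd x = snd y \<and>
      int (hd (fst y)) - int (hd (fst x)) = k then 1 else 0)"

lemma shk_cns [simp]: "shk l k (cns i p) (cns j q) = (if p \<in> idx l \<and> p = q \<and> int j - int i = k then 1 else 0)"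
  by (cases p; cases q) (simp add: shk_def cns_def mem_idx conj_commute)

lemma shk_outside: "x \<notin> idx (Suc l) \<or> y \<notin> idx (Suc l) \<Longrightarrow> shk l k x y = 0"
  by (auto simp: shk_def)

lemma schur_pullback:
  assumes K: "schur X S K" and supp: "\<And>x y. L x y \<noteq> 0 \<Longrightarrow> x \<in> Y \<and> y \<in> Y \<and> cmod (L x y) \<le> cmod (K (f x) (g y))"
    and g: "\<And>x y y'. L x y \<noteq> 0 \<Longrightarrow> L x y' \<noteq> 0 \<Longrightarrow> g y = g y' \<Longrightarrow> y = y'"
    and f: "\<And>x x' y. L x y \<noteq> 0 \<Longrightarrow> L x' y \<noteq> 0 \<Longrightarrow> f x = f x' \<Longrightarrow> x = x'"
  shows "schur Y S L"
proof -
  have "(\<Sum>y\<in>F. cmod (L x y)) \<le> S" if F: "finite F" for F x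
  proof -
    define G where "G = {y\<in>F. L x y \<noteq> 0}"
    have "(\<Sum>y\<in>F. cmod (L x y)) = (\<Sum>y\<in>G. cmod (L x y))"
      by (rule sum.mono_neutral_right) (use F in \<open>auto simp: G_def\<close>)
    also have "\<dots> \<le> (\<Sum>y\<in>G. cmod (K (f x) (g y)))" using supp by (intro sum_mono) (auto simp: G_def)
    also have "\<dots> = (\<Sum>z\<in>g ` G. cmod (K (f x) z))"
      by (rule sum.reindex_cong[symmetric, of g]) (auto simp: G_def inj_on_def intro: g)
    also have "\<dots> \<le> S" by (rule schur_row[OF K]) (use F in \<open>simp add: G_def\<close>)
    finally show ?thesis .
  qed
  moreover have "(\<Sum>x\<in>F. cmod (L x y)) \<le> S" if F: "finite F" for F y
  proof -
    define G where "G = {x\<in>F. L x y \<noteq> 0}"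
    have "(\<Sum>x\<in>F. cmod (L x y)) = (\<Sum>x\<in>G. cmod (L x y))"
      by (rule sum.mono_neutral_right) (use F in \<open>auto simp: G_def\<close>)
    also have "\<dots> \<le> (\<Sum>x\<in>G. cmod (K (f x) (g y)))" using supp by (intro sum_mono) (auto simp: G_def)
    also have "\<dots> = (\<Sum>z\<in>f ` G. cmod (K z (g y)))"
      by (rule sum.reindex_cong[symmetric, of f]) (auto simp: G_def inj_on_def intro: f)
    also have "\<dots> \<le> S" by (rule schur_col[OF K]) (use F in \<open>simp add: G_def\<close>)
    finally show ?thesis .
  qed
  ultimately show ?thesis unfolding schur_def using supp by blast
qed

lemma schur_lift: "schur (idx l) S K \<Longrightarrow> schur (idx (Suc l)) S (lift j k K)"
proof (rule schur_pullback[where f="\<lambda>x. (tl (fst x), snd x)" and g="\<lambda>x. (tl (fst x), snd x)"])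
  assume K: "schur (idx l) S K"
  fix x y assume nz: "lift j k K x y \<noteq> 0"
  then obtain p q where pq: "x = cns j p" "y = cns k q" "K p q \<noteq> 0" using lift_nonzeroD by blast
  show "x \<in> idx (Suc l) \<and> y \<in> idx (Suc l) \<and> cmod (lift j k K x y) \<le> cmod (K (tl (fst x), snd x) (tl (fst y), snd y))"
  proof -
    have "p \<in> idx l" "q \<in> idx l" using pq(3) schur_supp[OF K, of p q] by blast+
    thus ?thesis unfolding pq(1,2) by simp (simp add: cns_def)
  qed
next
  fix x y y' assume "lift j k K x y \<noteq> 0" "lift j k K x y' \<noteq> 0" "(tl (fst y), snd y) = (tl (fst y'), snd y')"
  thus "y = y'" using lift_nonzeroD[of j k K x y] lift_nonzeroD[of j k K x y'] by (auto simp: cns_def prod_eq_iff)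
next
  fix x x' y assume "lift j k K x y \<noteq> 0" "lift j k K x' y \<noteq> 0" "(tl (fst x), snd x) = (tl (fst x'), snd x')"
  thus "x = x'" using lift_nonzeroD[of j k K x y] lift_nonzeroD[of j k K x' y] by (auto simp: cns_def prod_eq_iff)
qed

lemma shk_nonzeroD: "shk l k x y \<noteq> 0 \<Longrightarrow> \<exists>i j p. x = cns i p \<and> y = cns j p \<and> p \<in> idx l \<and> int j - int i = k"
proof -
  assume nz: "shk l k x y \<noteq> 0"
  hence "x \<in> idx (Suc l)" "y \<in> idx (Suc l)" using shk_outside by blast+
  then obtain i p j q where "x = cns i p" "y = cns j q" using idx_Suc_ex by meson
  thus ?thesis using nz by (auto split: if_splits)
qed

lemma schur_shk: "schur (idx (Suc l)) 1 (shk l k)"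
proof (rule schur_partial_injection)
  show "shk l k x y \<noteq> 0 \<Longrightarrow> x \<in> idx (Suc l) \<and> y \<in> idx (Suc l) \<and> cmod (shk l k x y) \<le> 1" for x y
    by (auto simp: shk_def split: if_splits)
next
  fix x y y' assume "shk l k x y \<noteq> 0" "shk l k x y' \<noteq> 0"
  from shk_nonzeroD[OF this(1)] shk_nonzeroD[OF this(2)] show "y = y'" by auto
next
  fix x x' y assume "shk l k x y \<noteq> 0" "shk l k x' y \<noteq> 0"
  from shk_nonzeroD[OF this(1)] shk_nonzeroD[OF this(2)] show "x = x'" by auto
qed simp

section \<open>The terms of the defining series as kernel operators\<close>

lemma shk_apply:
  assumes \<xi>: "\<xi> \<in> ell2 (idx (Suc l))" and p: "p \<in> idx l"
  shows "kop (idx (Suc l)) (shk l k) \<xi> (cns i p) = (if 0 \<le> int i + k then \<xi> (cns (nat (int i + k)) p) else 0)"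
proof -
  have "kop (idx (Suc l)) (shk l k) \<xi> (cns i p) = (\<Sum>\<^sub>\<infinity>y\<in>(if 0 \<le> int i + k then {cns (nat (int i + k)) p} else {}). \<xi> y)"
    unfolding kop_apply[OF \<xi>]
  proof (rule infsum_cong_neutral)
    fix y assume y: "y \<in> UNIV - (if 0 \<le> int i + k then {cns (nat (int i + k)) p} else {})"
    show "shk l k (cns i p) y * \<xi> y = 0"
    proof (rule ccontr)
      assume "shk l k (cns i p) y * \<xi> y \<noteq> 0"
      hence "shk l k (cns i p) y \<noteq> 0" by simp
      from shk_nonzeroD[OF this] obtain j where "y = cns j p" "int j - int i = k" by auto
      thus False using y by (auto split: if_splits)
    qed
  qed (use p in \<open>auto split: if_splits\<close>)
  thus ?thesis by simp
qed

lemma ell2_idx_eqI: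
  assumes "\<xi> \<in> ell2 (idx (Suc l))" "\<eta> \<in> ell2 (idx (Suc l))" "\<And>i p. p \<in> idx l \<Longrightarrow> \<xi> (cns i p) = \<eta> (cns i p)"
  shows "\<xi> = \<eta>"
proof
  fix x show "\<xi> x = \<eta> x"
  proof (cases "x \<in> idx (Suc l)")
    case True thus ?thesis by (rule idx_Suc_cases) (simp add: assms(3))
  qed (use assms in \<open>simp add: ell2_outside\<close>)
qed

text \<open>\<open>alpha1\<close> after its adjoint is the identity, whereas the opposite order
  loses a projection. The hypothesis excludes exactly that order.\<close>

lemma shk_comp:
  assumes "0 \<le> a \<or> b \<le> 0" "\<xi> \<in> ell2 (idx (Suc l))"
  shows "kop (idx (Suc l)) (shk l a) (kop (idx (Suc l)) (shk l b) \<xi>) = kop (idx (Suc l)) (shk l (a + b)) \<xi>"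
proof (rule ell2_idx_eqI)
  have m: "kop (idx (Suc l)) (shk l b) \<xi> \<in> ell2 (idx (Suc l))" by (rule kop_ell2[OF schur_shk assms(2)])
  show "kop (idx (Suc l)) (shk l a) (kop (idx (Suc l)) (shk l b) \<xi>) \<in> ell2 (idx (Suc l))" by (rule kop_ell2[OF schur_shk m])
  show "kop (idx (Suc l)) (shk l (a + b)) \<xi> \<in> ell2 (idx (Suc l))" by (rule kop_ell2[OF schur_shk assms(2)])
  show "kop (idx (Suc l)) (shk l a) (kop (idx (Suc l)) (shk l b) \<xi>) (cns i p) = kop (idx (Suc l)) (shk l (a + b)) \<xi> (cns i p)"
    if "p \<in> idx l" for i p
    using assms(1) by (auto simp: shk_apply[OF m that] shk_apply[OF assms(2) that] add.assoc)
qed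

lemma alpha1_kop: "alpha1 (Suc l) = kop (idx (Suc l)) (shk l 1)"
proof
  fix \<xi> show "alpha1 (Suc l) \<xi> = kop (idx (Suc l)) (shk l 1) \<xi>"
  proof (cases "\<xi> \<in> ell2 (idx (Suc l))")
    case True
    have a: "alpha1 (Suc l) \<xi> x = (case fst x of [] \<Rightarrow> 0 | k # w \<Rightarrow> \<xi> (Suc k # w, snd x))" for x
      using True by (cases x) (auto simp: alpha1_def restrict_op_def split: list.split)
    show ?thesis
    proof
      fix x show "alpha1 (Suc l) \<xi> x = kop (idx (Suc l)) (shk l 1) \<xi> x"
      proof (cases "x \<in> idx (Suc l)")
        case x: True
        then obtain i p where ip: "x = cns i p" "p \<in> idx l" by (rule idx_Suc_cases)
        have "nat (int i + 1) = Suc i" by simp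
        thus ?thesis unfolding a ip(1) shk_apply[OF True ip(2)] by (simp add: cns_def)
      next
        case False
        have "kop (idx (Suc l)) (shk l 1) \<xi> x = 0"
          using ell2_outside[OF kop_ell2[OF schur_shk True] False] .
        moreover have "alpha1 (Suc l) \<xi> x = 0"
          unfolding a using False ell2_outside[OF True] by (auto simp: mem_idx split: list.split)
        ultimately show ?thesis by simp
      qed
    qed
  qed (simp add: alpha1_def kop_def restrict_op_def)
qed

lemma kadj_shk: "kadj (shk l k) = shk l (- k)"
  by (auto simp: kadj_def shk_def fun_eq_iff)

lemma adj_alpha1: "adj (idx (Suc l)) (alpha1 (Suc l)) = kop (idx (Suc l)) (shk l (- 1))"
  unfolding alpha1_kop adj_kop[OF schur_shk] kadj_shk ..

lemma shk_0: "\<xi> \<in> ell2 (idx (Suc l)) \<Longrightarrow> kop (idx (Suc l)) (shk l 0) \<xi> = \<xi>"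
  by (rule ell2_idx_eqI) (auto simp: shk_apply intro: kop_ell2[OF schur_shk])

lemma alpha1_power: "\<xi> \<in> ell2 (idx (Suc l)) \<Longrightarrow> (alpha1 (Suc l) ^^ k) \<xi> = kop (idx (Suc l)) (shk l (int k)) \<xi>"
proof (induction k)
  case (Suc k)
  have "(alpha1 (Suc l) ^^ Suc k) \<xi> = kop (idx (Suc l)) (shk l 1) (kop (idx (Suc l)) (shk l (int k)) \<xi>)"
    using Suc.IH[OF Suc.prems] by (simp only: funpow.simps(2) o_apply alpha1_kop)
  also have "\<dots> = kop (idx (Suc l)) (shk l (1 + int k)) \<xi>" by (rule shk_comp) (use Suc in auto)
  finally show ?case by simp
qed (simp add: shk_0)

lemma adj_alpha1_power:
  "\<xi> \<in> ell2 (idx (Suc l)) \<Longrightarrow> (adj (idx (Suc l)) (alpha1 (Suc l)) ^^ k) \<xi> = kop (idx (Suc l)) (shk l (- int k)) \<xi>"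
proof (induction k)
  case (Suc k)
  have "(adj (idx (Suc l)) (alpha1 (Suc l)) ^^ Suc k) \<xi> = kop (idx (Suc l)) (shk l (- 1)) (kop (idx (Suc l)) (shk l (- int k)) \<xi>)"
    using Suc.IH[OF Suc.prems] by (simp only: funpow.simps(2) o_apply adj_alpha1)
  also have "\<dots> = kop (idx (Suc l)) (shk l (- 1 + - int k)) \<xi>" by (rule shk_comp) (use Suc in auto)
  finally show ?case by simp
qed (simp add: shk_0)

lemma slice_ell2:
  assumes \<xi>: "\<xi> \<in> ell2 X" and inj: "inj f" and X: "\<And>x. f x \<in> X \<Longrightarrow> x \<in> Y"
  shows "(\<lambda>x. \<xi> (f x)) \<in> ell2 Y"
proof (rule ell2_intro(1)[where c="l2norm \<xi>"])
  show "\<xi> (f x) = 0" if "x \<notin> Y" for x using X[of x] that by (intro ell2_outside[OF \<xi>]) metis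
  fix F :: "'b set" assume F: "finite F"
  have "L2_set (\<lambda>x. cmod (\<xi> (f x))) F = L2_set (\<lambda>x. cmod (\<xi> x)) (f ` F)"
    unfolding L2_set_def sum.reindex[OF inj_on_subset[OF inj subset_UNIV]] o_def ..
  also have "\<dots> \<le> l2norm \<xi>" by (rule ell2_finite_bound[OF \<xi>]) (use F in simp)
  finally show "L2_set (\<lambda>x. cmod (\<xi> (f x))) F \<le> l2norm \<xi>" .
qed

lemma lift_apply:
  assumes \<xi>: "\<xi> \<in> ell2 (idx (Suc l))"
  shows "kop (idx (Suc l)) (lift j k K) \<xi> (cns i p) = (if i = j then \<Sum>\<^sub>\<infinity>q. K p q * \<xi> (cns k q) else 0)"
proof -
  have "kop (idx (Suc l)) (lift j k K) \<xi> (cns i p) = (\<Sum>\<^sub>\<infinity>y\<in>range (cns k). lift j k K (cns i p) y * \<xi> y)"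
    unfolding kop_apply[OF \<xi>]
  proof (rule infsum_cong_neutral)
    fix y assume "y \<in> UNIV - range (cns k)"
    hence "lift j k K (cns i p) y = 0" using lift_nonzeroD[of j k K "cns i p" y] by (metis Diff_iff rangeI)
    thus "lift j k K (cns i p) y * \<xi> y = 0" by simp
  qed auto
  also have "\<dots> = (\<Sum>\<^sub>\<infinity>q. lift j k K (cns i p) (cns k q) * \<xi> (cns k q))"
    by (subst infsum_reindex) (auto simp: inj_on_def o_def)
  finally show ?thesis by simp
qed

lemma p0_tensor_kop:
  assumes K: "schur (idx l) S K"
  shows "p0_tensor l (kop (idx l) K) = kop (idx (Suc l)) (lift 0 0 K)"
proof
  fix \<xi> show "p0_tensor l (kop (idx l) K) \<xi> = kop (idx (Suc l)) (lift 0 0 K) \<xi>"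
  proof (cases "\<xi> \<in> ell2 (idx (Suc l))")
    case True
    have sl: "(\<lambda>q. \<xi> (cns 0 q)) \<in> ell2 (idx l)"
      by (rule slice_ell2[OF True]) (auto simp: inj_on_def)
    have "(\<lambda>(w', n'). \<xi> (0 # w', n')) = (\<lambda>q. \<xi> (cns 0 q))" by (auto simp: cns_def)
    hence a: "p0_tensor l (kop (idx l) K) \<xi> x = (case fst x of [] \<Rightarrow> 0
        | k # w \<Rightarrow> if k = 0 then kop (idx l) K (\<lambda>q. \<xi> (cns 0 q)) (w, snd x) else 0)" for x
      using True by (cases x) (simp add: p0_tensor_def restrict_op_def split: list.split)
    show ?thesis
    proof
      fix x show "p0_tensor l (kop (idx l) K) \<xi> x = kop (idx (Suc l)) (lift 0 0 K) \<xi> x"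
      proof (cases "x \<in> idx (Suc l)")
        case x: True
        then obtain i p where ip: "x = cns i p" "p \<in> idx l" by (rule idx_Suc_cases)
        thus ?thesis unfolding a ip(1) lift_apply[OF True] by (simp add: cns_def kop_apply[OF sl[unfolded cns_def]])
      next
        case False
        have "kop (idx (Suc l)) (lift 0 0 K) \<xi> x = 0"
          using ell2_outside[OF kop_ell2[OF schur_lift[OF K] True] False] .
        moreover have "p0_tensor l (kop (idx l) K) \<xi> x = 0"
          unfolding a using False ell2_outside[OF kop_ell2[OF K sl]] by (auto simp: mem_idx split: list.split)
        ultimately show ?thesis by simp
      qed
    qed
  qed (simp add: p0_tensor_def kop_def restrict_op_def)
qed

lemma step_term_kop:
  assumes K: "schur (idx l) S K" and \<xi>: "\<xi> \<in> ell2 (idx (Suc l))"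
  shows "((adj (idx (Suc l)) (alpha1 (Suc l)) ^^ j) \<circ> p0_tensor l (kop (idx l) K) \<circ> (alpha1 (Suc l) ^^ k)) \<xi>
     = kop (idx (Suc l)) (lift j k K) \<xi>"
proof -
  let ?X = "idx (Suc l)"
  have m1: "kop ?X (shk l (int k)) \<xi> \<in> ell2 ?X" by (rule kop_ell2[OF schur_shk \<xi>])
  have m2: "kop ?X (lift 0 0 K) (kop ?X (shk l (int k)) \<xi>) \<in> ell2 ?X" by (rule kop_ell2[OF schur_lift[OF K] m1])
  have "kop ?X (shk l (- int j)) (kop ?X (lift 0 0 K) (kop ?X (shk l (int k)) \<xi>)) = kop ?X (lift j k K) \<xi>"
  proof (rule ell2_idx_eqI)
    fix i p assume p: "p \<in> idx l"
    have e: "K p q * kop ?X (shk l (int k)) \<xi> (cns 0 q) = K p q * \<xi> (cns k q)" for q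
      using schur_supp[OF K, of p q] by (cases "q \<in> idx l") (auto simp: shk_apply[OF \<xi>])
    show "kop ?X (shk l (- int j)) (kop ?X (lift 0 0 K) (kop ?X (shk l (int k)) \<xi>)) (cns i p) = kop ?X (lift j k K) \<xi> (cns i p)"
      unfolding shk_apply[OF m2 p] lift_apply[OF m1] lift_apply[OF \<xi>] e by auto
  qed (use kop_ell2[OF schur_shk m2] kop_ell2[OF schur_lift[OF K] \<xi>] in auto)
  thus ?thesis by (simp add: p0_tensor_kop[OF K] alpha1_power[OF \<xi>] adj_alpha1_power[OF m2])
qed

definition zk :: "int \<Rightarrow> (nat list \<times> int) kern" where
  "zk k x y = (if x \<in> idx 0 \<and> y \<in> idx 0 \<and> snd x - snd y = k then 1 else 0)"

lemma schur_zk: "schur (idx 0) 1 (zk k)"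
  by (rule schur_partial_injection) (auto simp: zk_def mem_idx prod_eq_iff split: if_splits)

lemma z_pow_kop: "z_pow k = kop (idx 0) (zk k)"
proof
  fix \<xi> show "z_pow k \<xi> = kop (idx 0) (zk k) \<xi>"
  proof (cases "\<xi> \<in> ell2 (idx 0)")
    case True
    show ?thesis
    proof
      fix x
      have "kop (idx 0) (zk k) \<xi> x = (\<Sum>\<^sub>\<infinity>y\<in>{(fst x, snd x - k)}. \<xi> y)"
        unfolding kop_apply[OF True]
        by (rule infsum_cong_neutral) (use ell2_outside[OF True] in \<open>auto simp: zk_def mem_idx prod_eq_iff\<close>)
      thus "z_pow k \<xi> x = kop (idx 0) (zk k) \<xi> x"
        using True by (cases x) (simp add: z_pow_def restrict_op_def)
    qed
  qed (simp add: z_pow_def kop_def restrict_op_def)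
qed

lemma kA_shk: "shk l k \<in> kA (Suc l) (nat \<bar>k\<bar>)"
proof (rule ix.kerA_translation)
  fix x y assume "shk l k x y \<noteq> 0"
  from shk_nonzeroD[OF this] obtain i j p where h: "x = cns i p" "y = cns j p" "p \<in> idx l" "int j - int i = k" by blast
  have "ix.dist1 l p p = 0" by (simp add: ix.dist1_def)
  hence "ix.dist1 (Suc l) x y \<le> int (nat \<bar>k\<bar>)" unfolding h(1,2) dist1_cns using h(4) by linarith
  moreover have "\<forall>m>0. cI x m = cI y m" by (simp add: h gr0_conv_Suc) (metis cI_cns_Suc)
  ultimately show "x \<in> idx (Suc l) \<and> y \<in> idx (Suc l) \<and> ix.dist1 (Suc l) x y \<le> int (nat \<bar>k\<bar>) \<and> (\<forall>m>0. cI x m = cI y m)"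
    using h by simp
next
  fix x y x' y' assume m: "x \<in> idx (Suc l)" "y \<in> idx (Suc l)" "x' \<in> idx (Suc l)" "y' \<in> idx (Suc l)"
    and dd: "cI x - cI y = cI x' - cI y'"
  have aux: "(p = q) = (cI p - cI q = (\<lambda>_. 0))" if "p \<in> idx l" "q \<in> idx l" for p q
    using inj_onD[OF ix.inj _ that] by (auto simp: fun_eq_iff)
  obtain i p j q i' p' j' q' where h: "x = cns i p" "y = cns j q" "x' = cns i' p'" "y' = cns j' q'"
    "p \<in> idx l" "q \<in> idx l" "p' \<in> idx l" "q' \<in> idx l"
    using m[THEN idx_Suc_ex] by (elim exE conjE)
  show "shk l k x y = shk l k x' y'"
    using dd aux[of p q] aux[of p' q'] h unfolding h(1-4) cI_diff_cns by auto
qed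

text \<open>The summands j + k cover the distance between the two block indices. The extra 1 puts k
  strictly below the threshold, so points with a large first coordinate never meet the
  block.\<close>

lemma kA_lift:
  assumes K: "K \<in> kA l R" shows "lift j k K \<in> kA (Suc l) (R + j + k + 1)"
  unfolding ix.kerA_def
proof (rule ix.tkerI)
  fix x y assume "lift j k K x y \<noteq> 0"
  from lift_nonzeroD[OF this] obtain p q where h: "x = cns j p" "y = cns k q" "K p q \<noteq> 0" by blast
  have m: "p \<in> idx l" "q \<in> idx l" "ix.admA l R p q" using ix.tkerD1[OF K[unfolded ix.kerA_def] h(3)] by auto
  have "\<forall>a<l. int (R + j + k + 1) \<le> cI q a \<longrightarrow> (\<forall>b>a. cI p b = cI q b)"
    using ix.admA_D[OF m(3)] by auto
  thus "x \<in> idx (Suc l) \<and> y \<in> idx (Suc l) \<and> ix.admA (Suc l) (R + j + k + 1) x y"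
    unfolding h(1,2) admA_cns[OF m(1,2)] using m ix.admA_dist[OF m(3)] by auto
next
  fix x y x' y' assume m: "x \<in> idx (Suc l)" "y \<in> idx (Suc l)" "x' \<in> idx (Suc l)" "y' \<in> idx (Suc l)"
    and dd: "cI x - cI y = cI x' - cI y'" and r: "ix.relA (Suc l) (R + j + k + 1) y y'"
  obtain a p b q a' p' b' q' where h: "x = cns a p" "y = cns b q" "x' = cns a' p'" "y' = cns b' q'"
    "p \<in> idx l" "q \<in> idx l" "p' \<in> idx l" "q' \<in> idx l"
    using m[THEN idx_Suc_ex] by (elim exE conjE)
  have d: "int a - int b = int a' - int b'" "cI p - cI q = cI p' - cI q'" using dd unfolding h(1-4) cI_diff_cns by auto
  have r': "(R + j + k + 1 \<le> b \<and> R + j + k + 1 \<le> b') \<or> (b = b' \<and> ix.relA l (R + j + k + 1) q q')"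
    using r unfolding h(2,4) relA_cns .
  show "lift j k K x y = lift j k K x' y'"
  proof (cases "b = b' \<and> ix.relA l (R + j + k + 1) q q'")
    case True
    have "ix.relA l R q q'" using True by (intro ix.relA_mono[of l "R + j + k + 1" q q' R]) auto
    hence "K p q = K p' q'" using ix.tkerD2[OF K[unfolded ix.kerA_def] h(5-8) d(2)] by blast
    thus ?thesis using True d(1) by (auto simp: h(1-4))
  next
    case False
    hence "b \<noteq> k" "b' \<noteq> k" using r' by auto
    thus ?thesis by (simp add: h(1-4))
  qed
qed

lemma kA_zk: "zk k \<in> kA 0 (nat \<bar>k\<bar>)"
  unfolding ix.kerA_def
proof (rule ix.tkerI)
  fix x y assume "zk k x y \<noteq> 0"
  thus "x \<in> idx 0 \<and> y \<in> idx 0 \<and> ix.admA 0 (nat \<bar>k\<bar>) x y"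
    by (auto simp: zk_def ix.admA_def ix.dist1_def mem_idx cI_def split: if_splits)
next
  fix x y x' y' assume "x \<in> idx 0" "y \<in> idx 0" "x' \<in> idx 0" "y' \<in> idx 0" "cI x - cI y = cI x' - cI y'"
  thus "zk k x y = zk k x' y'" using ix.co_diffD[of x y x' y' 0] by (auto simp: zk_def mem_idx cI_def)
qed

section \<open>Smooth elements have rapidly convergent kernels\<close>

lemma summable_on_nat_inverse_square: "(\<lambda>n::nat. 1 / (1 + real n) ^ 2) summable_on UNIV"
proof -
  have "summable (\<lambda>n. real (Suc n) powr (- 2))" by (rule summable_Suc_powr) simp
  also have "(\<lambda>n. real (Suc n) powr (- 2)) = (\<lambda>n. 1 / (1 + real n) ^ 2)"
    by (auto simp: powr_minus_divide powr_numeral add.commute)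
  finally show ?thesis by (subst summable_on_UNIV_nonneg_real_iff) auto
qed

lemma summable_on_int_inverse_square: "(\<lambda>n::int. 1 / (1 + \<bar>real_of_int n\<bar>) ^ 2) summable_on UNIV"
proof -
  let ?f = "\<lambda>n::int. 1 / (1 + \<bar>real_of_int n\<bar>) ^ 2"
  have "?f summable_on range int"
    by (subst summable_on_reindex) (use summable_on_nat_inverse_square in \<open>auto simp: o_def\<close>)
  moreover have "?f summable_on (\<lambda>n. - int n) ` UNIV"
    by (subst summable_on_reindex) (use summable_on_nat_inverse_square in \<open>auto simp: o_def inj_on_def\<close>)
  ultimately have "?f summable_on range int \<union> (\<lambda>n. - int n) ` UNIV" by (rule summable_on_union)
  moreover have "range int \<union> (\<lambda>n. - int n) ` UNIV = UNIV"
  proof (intro equalityI subsetI UNIV_I)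
    fix k :: int show "k \<in> range int \<union> (\<lambda>n. - int n) ` UNIV" by (cases k rule: int_cases2) (auto intro: rev_image_eqI)
  qed
  ultimately show ?thesis by simp
qed

text \<open>Two further powers of the weight turn a supremum bound into a summable one.\<close>

lemma rapidly_decreasing_summable:
  assumes "rapidly_decreasing c"
  shows "(\<lambda>n. (1 + \<bar>real_of_int n\<bar>) ^ m * cmod (c n)) summable_on UNIV"
proof -
  obtain C where C: "\<And>n. (1 + \<bar>real_of_int n\<bar>) ^ (m + 2) * cmod (c n) \<le> C"
    using assms unfolding rapidly_decreasing_def by blast
  show ?thesis
  proof (rule summable_on_comparison_test)
    show "(\<lambda>n::int. C * (1 / (1 + \<bar>real_of_int n\<bar>) ^ 2)) summable_on UNIV"
      by (intro summable_on_cmult_right summable_on_int_inverse_square)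
    fix n :: int
    have "(1 + \<bar>real_of_int n\<bar>) ^ m * cmod (c n) * (1 + \<bar>real_of_int n\<bar>) ^ 2 \<le> C"
      using C[of n] by (simp add: power_add power2_eq_square mult_ac)
    thus "(1 + \<bar>real_of_int n\<bar>) ^ m * cmod (c n) \<le> C * (1 / (1 + \<bar>real_of_int n\<bar>) ^ 2)"
      by (simp add: pos_le_divide_eq add_pos_nonneg)
  qed auto
qed

lemma smooth_elem_nonneg: "smooth_elem l a N \<Longrightarrow> 0 \<le> N m"
proof (induction arbitrary: m rule: smooth_elem.induct)
  case (base c a)
  show ?case by (intro infsum_nonneg) auto
next
  case (step l A N c a0 a1 a2)
  let ?S = "(\<lambda>(r, s). \<Sum>\<^sub>\<infinity>(j, k). (1 + real j + real k) ^ r * N j k s) ` ({..m} \<times> {..m})"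
  have "0 \<le> (\<Sum>\<^sub>\<infinity>(j, k). (1 + real j + real k) ^ 0 * N j k 0)"
    by (rule infsum_nonneg) (use step.IH in auto)
  also have "\<dots> \<le> Max ?S" by (rule Max_ge) (auto intro!: image_eqI[of _ _ "(0,0)"])
  finally have "0 \<le> Max ?S" .
  moreover have "0 \<le> (\<Sum>\<^sub>\<infinity>k. (1 + \<bar>real_of_int k\<bar>) ^ m * cmod (c k))" by (intro infsum_nonneg) auto
  ultimately show ?case by simp
qed

lemma prod_summable_iterated:
  fixes f :: "'a \<times> 'b \<Rightarrow> real"
  assumes "\<And>x y. 0 \<le> f (x, y)" "\<And>x. (\<lambda>y. f (x, y)) summable_on UNIV" "(\<lambda>x. \<Sum>\<^sub>\<infinity>y. f (x, y)) summable_on UNIV"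
  shows "f summable_on UNIV" and "infsum f UNIV = (\<Sum>\<^sub>\<infinity>x. \<Sum>\<^sub>\<infinity>y. f (x, y))"
proof -
  have "f summable_on (SIGMA x:UNIV. UNIV)"
    by (rule summable_on_SigmaI[where g="\<lambda>x. \<Sum>\<^sub>\<infinity>y. f (x, y)"]) (use assms in auto)
  thus s: "f summable_on UNIV" by simp
  have "(\<Sum>\<^sub>\<infinity>x. \<Sum>\<^sub>\<infinity>y. (\<lambda>x y. f (x, y)) x y) = infsum (\<lambda>(x, y). (\<lambda>x y. f (x, y)) x y) (UNIV \<times> UNIV)"
    by (rule infsum_Sigma'_banach) (use s in simp)
  thus "infsum f UNIV = (\<Sum>\<^sub>\<infinity>x. \<Sum>\<^sub>\<infinity>y. f (x, y))" by simp
qed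

lemma schur_c_shk: "schur (idx (Suc l)) (cmod c) (\<lambda>x y. c * shk l k x y)"
  using schur_scale[OF schur_shk, of l c k] by simp

text \<open>Treats the two one-sided Toeplitz series at once: \<open>g\<close> is the inclusion of
  \<nat> for the powers of \<open>alpha1\<close> and its negative for those of the adjoint, and J
  leaves out the index 0 in the second case.\<close>

lemma toeplitz_part:
  fixes J :: "nat set" and l :: nat
  assumes c: "rapidly_decreasing c" and g: "\<And>k. \<bar>g k\<bar> = int k" "inj g"
  defines "K \<equiv> (\<lambda>x y. \<Sum>\<^sub>\<infinity>k\<in>J. c (g k) * shk l (g k) x y)"
  shows "\<exists>s. rapid (idx (Suc l)) (kA (Suc l)) K s \<and>
           (\<forall>m. wsum s m \<le> (\<Sum>\<^sub>\<infinity>k. (1 + \<bar>real_of_int k\<bar>) ^ m * cmod (c k)))"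
    and "(\<And>k \<xi>. \<xi> \<in> ell2 (idx (Suc l)) \<Longrightarrow> T k \<xi> = kop (idx (Suc l)) (shk l (g k)) \<xi>) \<Longrightarrow>
           has_op_sum (idx (Suc l)) (\<lambda>k. c (g k) *\<^sub>o T k) J (kop (idx (Suc l)) K)"
proof -
  have rg: "real k = \<bar>real_of_int (g k)\<bar>" for k using g(1)[of k] by (metis of_int_abs of_int_of_nat_eq)
  have sm: "(\<lambda>k. (1 + real k) ^ m * cmod (c (g k))) summable_on J" for m
  proof (rule summable_on_subset_banach)
    have "(\<lambda>n. (1 + \<bar>real_of_int n\<bar>) ^ m * cmod (c n)) summable_on range g"
      by (rule summable_on_subset_banach[OF rapidly_decreasing_summable[OF c]]) simp
    thus "(\<lambda>k. (1 + real k) ^ m * cmod (c (g k))) summable_on UNIV"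
      unfolding summable_on_reindex[OF g(2)] by (simp add: o_def rg)
  qed simp
  have r: "rapid (idx (Suc l)) (kA (Suc l)) K (\<lambda>n. \<Sum>\<^sub>\<infinity>k\<in>{k\<in>J. k = n}. cmod (c (g k)))"
    unfolding K_def
  proof (rule rapid_family)
    show "(\<lambda>x y. c (g k) * shk l (g k) x y) \<in> kA (Suc l) k" for k
      using ix.kerA_scale[OF kA_shk[of l "g k"]] by (simp add: g(1))
  qed (auto intro: ix.kerA_infsum schur_c_shk sm)
  have "wsum (\<lambda>n. \<Sum>\<^sub>\<infinity>k\<in>{k\<in>J. k = n}. cmod (c (g k))) m \<le> (\<Sum>\<^sub>\<infinity>k. (1 + \<bar>real_of_int k\<bar>) ^ m * cmod (c k))" for m
  proof -
    have "wsum (\<lambda>n. \<Sum>\<^sub>\<infinity>k\<in>{k\<in>J. k = n}. cmod (c (g k))) m = (\<Sum>\<^sub>\<infinity>k\<in>J. (1 + real k) ^ m * cmod (c (g k)))"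
    proof (rule wsum_family[where F="kA (Suc l)" and f="\<lambda>k x y. c (g k) * shk l (g k) x y" and X="idx (Suc l)"])
      show "(\<lambda>x y. c (g k) * shk l (g k) x y) \<in> kA (Suc l) k" for k
        using ix.kerA_scale[OF kA_shk[of l "g k"]] by (simp add: g(1))
    qed (auto intro: ix.kerA_infsum schur_c_shk sm)
    also have "\<dots> = (\<Sum>\<^sub>\<infinity>k\<in>g ` J. (1 + \<bar>real_of_int k\<bar>) ^ m * cmod (c k))"
      by (subst infsum_reindex) (use g(2) in \<open>auto simp: o_def rg inj_on_def\<close>)
    also have "\<dots> \<le> (\<Sum>\<^sub>\<infinity>k. (1 + \<bar>real_of_int k\<bar>) ^ m * cmod (c k))"
      by (rule infsum_mono_neutral)
         (auto intro: rapidly_decreasing_summable[OF c] summable_on_subset_banach[OF rapidly_decreasing_summable[OF c]])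
    finally show ?thesis .
  qed
  thus "\<exists>s. rapid (idx (Suc l)) (kA (Suc l)) K s \<and>
           (\<forall>m. wsum s m \<le> (\<Sum>\<^sub>\<infinity>k. (1 + \<bar>real_of_int k\<bar>) ^ m * cmod (c k)))" using r by blast
  assume T: "\<And>k \<xi>. \<xi> \<in> ell2 (idx (Suc l)) \<Longrightarrow> T k \<xi> = kop (idx (Suc l)) (shk l (g k)) \<xi>"
  show "has_op_sum (idx (Suc l)) (\<lambda>k. c (g k) *\<^sub>o T k) J (kop (idx (Suc l)) K)"
    unfolding K_def
  proof (rule has_op_sum_kop)
    show "schur (idx (Suc l)) (cmod (c (g k))) (\<lambda>x y. c (g k) * shk l (g k) x y)" for k by (rule schur_c_shk)
    show "(\<lambda>k. cmod (c (g k))) summable_on J" using sm[of 0] by simp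
    show "(c (g k) *\<^sub>o T k) \<xi> = kop (idx (Suc l)) (\<lambda>x y. c (g k) * shk l (g k) x y) \<xi>" if "\<xi> \<in> ell2 (idx (Suc l))" for k \<xi>
      unfolding kop_scale using T[OF that] by (simp add: osmul_def)
  qed
qed

lemma smul_ell2_op: "\<xi> \<in> ell2 X \<Longrightarrow> T \<xi> \<in> ell2 X \<Longrightarrow> (c *\<^sub>o T) \<xi> \<in> ell2 X"
  by (simp add: osmul_def ell2_smul)

lemma smooth_rapid_base:
  assumes "smooth_elem 0 a N"
  shows "\<exists>K s. a = kop (idx 0) K \<and> rapid (idx 0) (kA 0) K s \<and> (\<forall>m. wsum s m \<le> N m)"
proof -
  obtain c where c: "rapidly_decreasing c" and a: "has_op_sum (idx 0) (\<lambda>n. c n *\<^sub>o z_pow n) UNIV a"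
    and N: "N = (\<lambda>m. \<Sum>\<^sub>\<infinity>n. (1 + \<bar>real_of_int n\<bar>) ^ m * cmod (c n))"
    using assms by (cases rule: smooth_elem.cases) auto
  let ?f = "\<lambda>n x y. c n * zk n x y"
  have sch: "schur (idx 0) (cmod (c n)) (?f n)" for n using schur_scale[OF schur_zk, of "c n" n] by simp
  have sm: "(\<lambda>n. (1 + real (nat \<bar>n\<bar>)) ^ m * cmod (c n)) summable_on UNIV" for m
    using rapidly_decreasing_summable[OF c, of m] by simp
  have sm0: "(\<lambda>n. cmod (c n)) summable_on UNIV" using sm[of 0] by simp
  have mem: "?f n \<in> kA 0 (nat \<bar>n\<bar>)" for n by (rule ix.kerA_scale[OF kA_zk])
  have z: "z_pow n \<xi> \<in> ell2 (idx 0)" if "\<xi> \<in> ell2 (idx 0)" for n \<xi>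
    unfolding z_pow_kop by (rule kop_ell2[OF schur_zk that])
  have "has_op_sum (idx 0) (\<lambda>n. c n *\<^sub>o z_pow n) UNIV (kop (idx 0) (\<lambda>x y. \<Sum>\<^sub>\<infinity>n\<in>UNIV. ?f n x y))"
    by (rule has_op_sum_kop[OF sch sm0]) (simp add: kop_scale z_pow_kop)
  hence "a = kop (idx 0) (\<lambda>x y. \<Sum>\<^sub>\<infinity>n\<in>UNIV. ?f n x y)"
    by (rule has_op_sum_unique[OF a]) (intro smul_ell2_op z)
  moreover have "rapid (idx 0) (kA 0) (\<lambda>x y. \<Sum>\<^sub>\<infinity>n\<in>UNIV. ?f n x y) (\<lambda>k. \<Sum>\<^sub>\<infinity>n\<in>{n\<in>UNIV. nat \<bar>n\<bar> = k}. cmod (c n))"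
    by (rule rapid_family) (auto intro: ix.kerA_infsum sch mem sm[simplified])
  moreover have "wsum (\<lambda>k. \<Sum>\<^sub>\<infinity>n\<in>{n\<in>UNIV. nat \<bar>n\<bar> = k}. cmod (c n)) m \<le> N m" for m
  proof -
    have "wsum (\<lambda>k. \<Sum>\<^sub>\<infinity>n\<in>{n\<in>UNIV. nat \<bar>n\<bar> = k}. cmod (c n)) m = (\<Sum>\<^sub>\<infinity>n. (1 + real (nat \<bar>n\<bar>)) ^ m * cmod (c n))"
      by (rule wsum_family[where F="kA 0" and f="?f" and X="idx 0"]) (auto intro: ix.kerA_infsum sch mem sm[simplified])
    thus ?thesis by (simp add: N)
  qed
  ultimately show ?thesis by blast
qed

lemma lift_infsum: "lift j k (\<lambda>p q. \<Sum>\<^sub>\<infinity>n\<in>I. f n p q) x y = (\<Sum>\<^sub>\<infinity>n\<in>I. lift j k (f n) x y)"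
  by (auto simp: lift_def)

lemma infsum_lift_cns: "(\<Sum>\<^sub>\<infinity>i. lift (fst i) (snd i) (K (fst i) (snd i)) (cns a p) (cns b q)) = K a b p q"
proof -
  have "(\<Sum>\<^sub>\<infinity>i. lift (fst i) (snd i) (K (fst i) (snd i)) (cns a p) (cns b q)) = (\<Sum>\<^sub>\<infinity>i\<in>{(a, b)}. K a b p q)"
    by (rule infsum_cong_neutral) auto
  thus ?thesis by simp
qed

lemma has_op_sum_matrix:
  assumes K: "\<And>j k. schur (idx l) (u j k) (K j k)" and u: "(\<lambda>i. u (fst i) (snd i)) summable_on UNIV"
  shows "has_op_sum (idx (Suc l)) (\<lambda>(j, k). (adj (idx (Suc l)) (alpha1 (Suc l)) ^^ j) \<circ> p0_tensor l (kop (idx l) (K j k)) \<circ> (alpha1 (Suc l) ^^ k))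
     UNIV (kop (idx (Suc l)) (\<lambda>x y. \<Sum>\<^sub>\<infinity>i. lift (fst i) (snd i) (K (fst i) (snd i)) x y))"
proof (rule has_op_sum_kop)
  show "schur (idx (Suc l)) (u (fst i) (snd i)) (lift (fst i) (snd i) (K (fst i) (snd i)))" for i by (rule schur_lift[OF K])
  show "(case i of (j, k) \<Rightarrow> (adj (idx (Suc l)) (alpha1 (Suc l)) ^^ j) \<circ> p0_tensor l (kop (idx l) (K j k)) \<circ> (alpha1 (Suc l) ^^ k)) \<xi>
     = kop (idx (Suc l)) (lift (fst i) (snd i) (K (fst i) (snd i))) \<xi>" if "\<xi> \<in> ell2 (idx (Suc l))" for i \<xi>
    using step_term_kop[OF K that, of "fst i" "fst i" "snd i" "snd i"] by (cases i) simp
qed (rule u)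

lemma abs_int_le_real: "\<bar>k\<bar> \<le> int n \<Longrightarrow> \<bar>real_of_int k\<bar> \<le> real n"
  by (metis of_int_abs of_int_le_iff of_int_of_nat_eq)

lemma smooth_elem_SucD:
  assumes "smooth_elem (Suc l) a N"
  shows "\<exists>A Nf c a0 a1 a2. (\<forall>j k. smooth_elem l (A j k) (Nf j k)) \<and>
    (\<forall>n m. (\<lambda>(j, k). (1 + real j + real k) ^ n * Nf j k m) summable_on UNIV) \<and>
    rapidly_decreasing c \<and>
    has_op_sum (idx (Suc l)) (\<lambda>(j, k). (adj (idx (Suc l)) (alpha1 (Suc l)) ^^ j) \<circ> p0_tensor l (A j k) \<circ> (alpha1 (Suc l) ^^ k)) UNIV a0 \<and>
    has_op_sum (idx (Suc l)) (\<lambda>k. c (int k) *\<^sub>o (alpha1 (Suc l) ^^ k)) UNIV a1 \<and>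
    has_op_sum (idx (Suc l)) (\<lambda>k. c (- int k) *\<^sub>o (adj (idx (Suc l)) (alpha1 (Suc l)) ^^ k)) {k. k > 0} a2 \<and>
    a = a0 + a1 + a2 \<and>
    N = (\<lambda>m. Max ((\<lambda>(r, s). \<Sum>\<^sub>\<infinity>(j, k). (1 + real j + real k) ^ r * Nf j k s) ` ({..m} \<times> {..m}))
           + (\<Sum>\<^sub>\<infinity>k. (1 + \<bar>real_of_int k\<bar>) ^ m * cmod (c k)))"
  using assms
proof (cases rule: smooth_elem.cases)
  case (step A N' c a0 a1 a2)
  show ?thesis
    by (intro exI[of _ A] exI[of _ N'] exI[of _ c] exI[of _ a0] exI[of _ a1] exI[of _ a2] conjI allI) (fact step)+
qed

text \<open>Each coefficient is replaced by its decomposition according to the hypothesis, and the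
  resulting family, indexed by the block and the inner radius, is regrouped by total radius. The
  summand 2 in the constant pays for the two Toeplitz halves.\<close>

lemma smooth_rapid_step:
  assumes C0: "\<And>m. 0 \<le> C m"
    and IH: "\<And>a N. smooth_elem l a N \<Longrightarrow> \<exists>K s. a = kop (idx l) K \<and> rapid (idx l) (kA l) K s \<and> (\<forall>m. wsum s m \<le> C m * N m)"
    and a: "smooth_elem (Suc l) a N"
  shows "\<exists>K s. a = kop (idx (Suc l)) K \<and> rapid (idx (Suc l)) (kA (Suc l)) K s \<and> (\<forall>m. wsum s m \<le> (2 ^ m * C m + 2) * N m)"
proof -
  let ?X = "idx (Suc l)" and ?S = "adj (idx (Suc l)) (alpha1 (Suc l))"
  obtain A Nf c a0 a1 a2 where sA: "\<And>j k. smooth_elem l (A j k) (Nf j k)"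
    and smN: "\<And>n m. (\<lambda>(j, k). (1 + real j + real k) ^ n * Nf j k m) summable_on UNIV"
    and c: "rapidly_decreasing c"
    and a0: "has_op_sum ?X (\<lambda>(j, k). (?S ^^ j) \<circ> p0_tensor l (A j k) \<circ> (alpha1 (Suc l) ^^ k)) UNIV a0"
    and a1: "has_op_sum ?X (\<lambda>k. c (int k) *\<^sub>o (alpha1 (Suc l) ^^ k)) UNIV a1"
    and a2: "has_op_sum ?X (\<lambda>k. c (- int k) *\<^sub>o (?S ^^ k)) {k. k > 0} a2"
    and aa: "a = a0 + a1 + a2"
    and N: "N = (\<lambda>m. Max ((\<lambda>(r, s). \<Sum>\<^sub>\<infinity>(j, k). (1 + real j + real k) ^ r * Nf j k s) ` ({..m} \<times> {..m}))
           + (\<Sum>\<^sub>\<infinity>k. (1 + \<bar>real_of_int k\<bar>) ^ m * cmod (c k)))"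
    using smooth_elem_SucD[OF a] by blast
  have "\<forall>j k. \<exists>K s. A j k = kop (idx l) K \<and> rapid (idx l) (kA l) K s \<and> (\<forall>m. wsum s m \<le> C m * Nf j k m)"
    using IH sA by blast
  then obtain K s where Ajk: "\<And>j k. A j k = kop (idx l) (K j k)"
    and K: "\<And>j k. rapid (idx l) (kA l) (K j k) (s j k)" and sN: "\<And>j k m. wsum (s j k) m \<le> C m * Nf j k m" by metis
  have "\<forall>j k. \<exists>Ks. (\<forall>n. Ks n \<in> kA l n \<and> schur (idx l) (s j k n) (Ks n)) \<and> (\<forall>x y. K j k x y = (\<Sum>\<^sub>\<infinity>n. Ks n x y))"
    using K unfolding rapid_def by blast
  then obtain Ks where Ks: "\<And>j k n. Ks j k n \<in> kA l n" "\<And>j k n. schur (idx l) (s j k n) (Ks j k n)"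
     "\<And>j k x y. K j k x y = (\<Sum>\<^sub>\<infinity>n. Ks j k n x y)" by metis
  have s0: "0 \<le> s j k n" for j k n by (rule rapid_nonneg[OF K])
  let ?f = "\<lambda>i. lift (fst (fst i)) (snd (fst i)) (Ks (fst (fst i)) (snd (fst i)) (snd i))"
  let ?r = "\<lambda>i :: (nat \<times> nat) \<times> nat. snd i + fst (fst i) + snd (fst i) + 1"
  let ?s = "\<lambda>i. s (fst (fst i)) (snd (fst i)) (snd i)"
  let ?M = "\<lambda>m. \<Sum>\<^sub>\<infinity>i. (1 + real (fst i) + real (snd i)) ^ m * Nf (fst i) (snd i) m"
  have smN': "(\<lambda>i. (1 + real (fst i) + real (snd i)) ^ n * Nf (fst i) (snd i) m) summable_on UNIV" for n m
    using smN[of n m] by (simp add: case_prod_unfold)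
  have fam: "(\<lambda>i. (1 + real (?r i)) ^ m * ?s i) summable_on UNIV \<and> (\<Sum>\<^sub>\<infinity>i. (1 + real (?r i)) ^ m * ?s i) \<le> 2 ^ m * C m * ?M m" for m
  proof -
    define h where "h i n = (1 + real (?r (i, n))) ^ m * ?s (i, n)" for i n
    define b where "b i = 2 ^ m * C m * ((1 + real (fst i) + real (snd i)) ^ m * Nf (fst i) (snd i) m)" for i
    have h0: "0 \<le> h i n" for i n by (simp add: h_def s0)
    have hle: "h i n \<le> 2 ^ m * (1 + real (fst i) + real (snd i)) ^ m * ((1 + real n) ^ m * s (fst i) (snd i) n)" for i n
    proof -
      \<comment> \<open>The total radius is at most a product of a block weight and an inner weight;
        its factor 2 is the origin of 2^m.\<close>
      have "1 + real (?r (i, n)) \<le> 2 * (1 + real (fst i) + real (snd i)) * (1 + real n)"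
        by (simp add: algebra_simps)
      hence "(1 + real (?r (i, n))) ^ m \<le> (2 * (1 + real (fst i) + real (snd i)) * (1 + real n)) ^ m" by (intro power_mono) auto
      from mult_right_mono[OF this s0[of "fst i" "snd i" n]] show ?thesis
        unfolding h_def fst_conv snd_conv by (simp only: power_mult_distrib mult.assoc)
    qed
    have bs: "(\<lambda>n. 2 ^ m * (1 + real (fst i) + real (snd i)) ^ m * ((1 + real n) ^ m * s (fst i) (snd i) n)) summable_on UNIV" for i
      by (intro summable_on_cmult_right rapid_summable[OF K])
    have hs: "(\<lambda>n. h i n) summable_on UNIV" for i
      by (rule summable_on_comparison_test[OF bs[of i]]) (use hle h0 in auto)
    have hb: "(\<Sum>\<^sub>\<infinity>n. h i n) \<le> b i" for i
    proof -
      have "(\<Sum>\<^sub>\<infinity>n. h i n) \<le> (\<Sum>\<^sub>\<infinity>n. 2 ^ m * (1 + real (fst i) + real (snd i)) ^ m * ((1 + real n) ^ m * s (fst i) (snd i) n))"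
        by (rule infsum_mono[OF hs bs hle])
      also have "\<dots> = 2 ^ m * (1 + real (fst i) + real (snd i)) ^ m * wsum (s (fst i) (snd i)) m"
        unfolding wsum_def by (rule infsum_cmult_right')
      also have "\<dots> \<le> 2 ^ m * (1 + real (fst i) + real (snd i)) ^ m * (C m * Nf (fst i) (snd i) m)"
        by (intro mult_left_mono sN) auto
      finally show ?thesis by (simp add: b_def mult_ac)
    qed
    have bsum: "b summable_on UNIV" unfolding b_def by (intro summable_on_cmult_right smN')
    have hS: "(\<lambda>i. \<Sum>\<^sub>\<infinity>n. h i n) summable_on UNIV"
      by (rule summable_on_comparison_test[OF bsum hb]) (auto intro!: infsum_nonneg h0)
    have it: "(\<lambda>i. h (fst i) (snd i)) summable_on UNIV" "infsum (\<lambda>i. h (fst i) (snd i)) UNIV = (\<Sum>\<^sub>\<infinity>i. \<Sum>\<^sub>\<infinity>n. h i n)"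
      using prod_summable_iterated[of "\<lambda>i. h (fst i) (snd i)"] h0 hs hS by auto
    have "(\<Sum>\<^sub>\<infinity>i. \<Sum>\<^sub>\<infinity>n. h i n) \<le> infsum b UNIV" by (rule infsum_mono[OF hS bsum hb])
    also have "\<dots> = 2 ^ m * C m * ?M m" unfolding b_def by (rule infsum_cmult_right')
    finally show ?thesis using it unfolding h_def by simp
  qed
  define K0 where "K0 = (\<lambda>x y. \<Sum>\<^sub>\<infinity>i. ?f i x y)"
  define s0' where "s0' = (\<lambda>n. \<Sum>\<^sub>\<infinity>i\<in>{i\<in>UNIV. ?r i = n}. ?s i)"
  have fmem: "?f i \<in> kA (Suc l) (?r i)" "schur ?X (?s i) (?f i)" for i
    using kA_lift[OF Ks(1)] schur_lift[OF Ks(2)] by blast+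
  have K0: "rapid ?X (kA (Suc l)) K0 s0'" unfolding K0_def s0'_def
    by (rule rapid_family) (use fmem fam in \<open>auto intro: ix.kerA_infsum\<close>)
  have ws0: "wsum s0' m \<le> 2 ^ m * C m * ?M m" for m
  proof -
    have "wsum s0' m = (\<Sum>\<^sub>\<infinity>i. (1 + real (?r i)) ^ m * ?s i)" unfolding s0'_def
      by (rule wsum_family[where F="kA (Suc l)" and f="?f" and X="?X"]) (use fmem fam in \<open>auto intro: ix.kerA_infsum\<close>)
    thus ?thesis using fam[of m] by simp
  qed
  have K0eq: "K0 = (\<lambda>x y. \<Sum>\<^sub>\<infinity>i. lift (fst i) (snd i) (K (fst i) (snd i)) x y)"
  proof (intro ext)
    fix x y
    have sm: "(\<lambda>i. ?f i x y) summable_on UNIV"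
      by (rule schur_infsum(1)[OF fmem(2)]) (use fam[of 0] in simp)
    have "(\<Sum>\<^sub>\<infinity>i. \<Sum>\<^sub>\<infinity>n. ?f (i, n) x y) = (\<Sum>\<^sub>\<infinity>(i, n)\<in>UNIV \<times> UNIV. ?f (i, n) x y)"
      by (rule infsum_Sigma'_banach) (use sm in \<open>simp add: case_prod_unfold\<close>)
    hence "K0 x y = (\<Sum>\<^sub>\<infinity>i. \<Sum>\<^sub>\<infinity>n. ?f (i, n) x y)" by (simp add: K0_def case_prod_unfold)
    also have "\<dots> = (\<Sum>\<^sub>\<infinity>i. lift (fst i) (snd i) (K (fst i) (snd i)) x y)"
    proof -
      have "K j k = (\<lambda>p q. \<Sum>\<^sub>\<infinity>n. Ks j k n p q)" for j k by (intro ext Ks(3))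
      thus ?thesis by (simp add: lift_infsum)
    qed
    finally show "K0 x y = (\<Sum>\<^sub>\<infinity>i. lift (fst i) (snd i) (K (fst i) (snd i)) x y)" .
  qed
  have schK: "schur (idx l) (wsum (s j k) 0) (K j k)" for j k by (rule rapid_schur[OF K])
  have "(\<lambda>i. wsum (s (fst i) (snd i)) 0) summable_on UNIV"
  proof (rule summable_on_comparison_test)
    show "(\<lambda>i. C 0 * ((1 + real (fst i) + real (snd i)) ^ 0 * Nf (fst i) (snd i) 0)) summable_on UNIV"
      by (intro summable_on_cmult_right smN')
  qed (use sN wsum_nonneg[OF K] in auto)
  from has_op_sum_matrix[OF schK this]
  have h0: "has_op_sum ?X (\<lambda>(j, k). (?S ^^ j) \<circ> p0_tensor l (A j k) \<circ> (alpha1 (Suc l) ^^ k)) UNIV (kop ?X K0)"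
    unfolding K0eq Ajk .
  have e0: "a0 = kop ?X K0"
  proof (rule has_op_sum_unique[OF a0 h0])
    fix i \<xi> assume \<xi>: "\<xi> \<in> ell2 ?X"
    show "(case i of (j, k) \<Rightarrow> (?S ^^ j) \<circ> p0_tensor l (A j k) \<circ> (alpha1 (Suc l) ^^ k)) \<xi> \<in> ell2 ?X"
      using step_term_kop[OF schK \<xi>, of "fst i" "fst i" "snd i" "snd i"] kop_ell2[OF schur_lift[OF schK] \<xi>, of "fst i" "snd i" "fst i" "snd i"]
      by (cases i) (simp add: Ajk)
  qed
  obtain s1 where K1: "rapid ?X (kA (Suc l)) (\<lambda>x y. \<Sum>\<^sub>\<infinity>k\<in>UNIV. c (int k) * shk l (int k) x y) s1"
    "\<And>m. wsum s1 m \<le> (\<Sum>\<^sub>\<infinity>k. (1 + \<bar>real_of_int k\<bar>) ^ m * cmod (c k))"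
    using toeplitz_part(1)[OF c, where g=int and J=UNIV and l=l] by auto
  obtain s2 where K2: "rapid ?X (kA (Suc l)) (\<lambda>x y. \<Sum>\<^sub>\<infinity>k\<in>{k. k > 0}. c (- int k) * shk l (- int k) x y) s2"
    "\<And>m. wsum s2 m \<le> (\<Sum>\<^sub>\<infinity>k. (1 + \<bar>real_of_int k\<bar>) ^ m * cmod (c k))"
    using toeplitz_part(1)[OF c, where g="\<lambda>k. - int k" and J="{k. k > 0}" and l=l] by (auto simp: inj_on_def)
  define k1 where "k1 = (\<lambda>x y. \<Sum>\<^sub>\<infinity>k\<in>UNIV. c (int k) * shk l (int k) x y)"
  define k2 where "k2 = (\<lambda>x y. \<Sum>\<^sub>\<infinity>k\<in>{k. k > 0}. c (- int k) * shk l (- int k) x y)"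
  have e1: "a1 = kop ?X k1"
  proof (rule has_op_sum_unique[OF a1])
    show "has_op_sum ?X (\<lambda>k. c (int k) *\<^sub>o (alpha1 (Suc l) ^^ k)) UNIV (kop ?X k1)"
      unfolding k1_def by (rule toeplitz_part(2)[OF c]) (auto simp: alpha1_power)
  qed (auto intro!: smul_ell2_op simp: alpha1_power kop_ell2[OF schur_shk])
  have e2: "a2 = kop ?X k2"
  proof (rule has_op_sum_unique[OF a2])
    show "has_op_sum ?X (\<lambda>k. c (- int k) *\<^sub>o (?S ^^ k)) {k. k > 0} (kop ?X k2)"
      unfolding k2_def by (rule toeplitz_part(2)[OF c, where g="\<lambda>k. - int k"]) (auto simp: adj_alpha1_power inj_on_def)
  qed (auto intro!: smul_ell2_op simp: adj_alpha1_power kop_ell2[OF schur_shk])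
  note R1 = K1(1)[folded k1_def] and R2 = K2(1)[folded k2_def]
  have R01: "rapid ?X (kA (Suc l)) (K0 + k1) (\<lambda>n. s0' n + s1 n)"
    by (rule rapid_add[OF K0 R1]) (rule ix.kerA_add)
  have R: "rapid ?X (kA (Suc l)) (K0 + k1 + k2) (\<lambda>n. s0' n + s1 n + s2 n)"
    by (rule rapid_add[OF R01 R2]) (rule ix.kerA_add)
  have aK: "a = kop ?X (K0 + k1 + k2)"
    unfolding aa e0 e1 e2 kop_add[OF rapid_schur[OF R01] rapid_schur[OF R2]] kop_add[OF rapid_schur[OF K0] rapid_schur[OF R1]] ..
  have "wsum (\<lambda>n. s0' n + s1 n + s2 n) m \<le> (2 ^ m * C m + 2) * N m" for m
  proof -
    define Z where "Z = (\<Sum>\<^sub>\<infinity>k. (1 + \<bar>real_of_int k\<bar>) ^ m * cmod (c k))"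
    define Mx where "Mx = Max ((\<lambda>(r, s). \<Sum>\<^sub>\<infinity>(j, k). (1 + real j + real k) ^ r * Nf j k s) ` ({..m} \<times> {..m}))"
    have Z0: "0 \<le> Z" unfolding Z_def by (intro infsum_nonneg) auto
    \<comment> \<open>The sum with both exponents equal to m is one of the members of the maximum in
      the m-th norm.\<close>
    have "?M m = (case (m, m) of (r, s) \<Rightarrow> \<Sum>\<^sub>\<infinity>(j, k). (1 + real j + real k) ^ r * Nf j k s)" by (simp add: case_prod_unfold)
    hence M: "?M m \<le> Mx" unfolding Mx_def by (intro Max_ge) (auto intro!: image_eqI[of _ _ "(m, m)"])
    have "0 \<le> ?M m" by (intro infsum_nonneg) (auto intro!: mult_nonneg_nonneg smooth_elem_nonneg[OF sA])
    hence Mx0: "0 \<le> Mx" using M by simp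
    have "wsum (\<lambda>n. s0' n + s1 n + s2 n) m = wsum s0' m + wsum s1 m + wsum s2 m"
      by (simp add: wsum_add[OF R01 R2] wsum_add[OF K0 R1])
    also have "\<dots> \<le> 2 ^ m * C m * Mx + Z + Z"
      unfolding Z_def
      by (intro add_mono K1(2) K2(2) order_trans[OF ws0]) (use M C0 in \<open>auto intro!: mult_left_mono\<close>)
    also have "\<dots> \<le> (2 ^ m * C m + 2) * (Mx + Z)" using Z0 Mx0 C0[of m] by (simp add: algebra_simps)
    also have "Mx + Z = N m" by (simp add: N Mx_def Z_def)
    finally show ?thesis .
  qed
  thus ?thesis using aK R by blast
qed

text \<open>The induction needs constants that do not depend on the element: at the next level the
  estimate is applied to all coefficients simultaneously and then summed.\<close>

theorem smooth_rapid: "a \<in> A_smooth l \<Longrightarrow> \<exists>K s. a = kop (idx l) K \<and> rapid (idx l) (kA l) K s"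
proof -
  have *: "\<exists>C. (\<forall>m. 0 \<le> C m) \<and> (\<forall>a N. smooth_elem l a N \<longrightarrow>
      (\<exists>K s. a = kop (idx l) K \<and> rapid (idx l) (kA l) K s \<and> (\<forall>m. wsum s m \<le> C m * N m)))"
  proof (induction l)
    case 0
    show ?case using smooth_rapid_base by (intro exI[of _ "\<lambda>_. 1"]) auto
  next
    case (Suc l)
    then obtain C where C: "\<And>m. 0 \<le> C m" "\<And>a N. smooth_elem l a N \<Longrightarrow>
      \<exists>K s. a = kop (idx l) K \<and> rapid (idx l) (kA l) K s \<and> (\<forall>m. wsum s m \<le> C m * N m)" by blast
    show ?case using smooth_rapid_step[OF C] C(1) by (intro exI[of _ "\<lambda>m. 2 ^ m * C m + 2"]) auto
  qed
  assume "a \<in> A_smooth l"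
  then obtain N where "smooth_elem l a N" by (auto simp: A_smooth_def)
  thus ?thesis using * by blast
qed

section \<open>Rapidly convergent kernels define smooth elements\<close>

text \<open>A quantity of size t is met only by pieces whose radius is at least of order t, so the
  weight t^m can be traded for powers of the radius. Fourier, Toeplitz and generating-function
  coefficients are all estimated like this.\<close>

lemma weighted_entry_bound:
  assumes r: "rapid X F K s" and u: "\<And>n. cmod (u n) \<le> B * s n" "\<And>n. u n \<noteq> 0 \<Longrightarrow> t \<le> b * (1 + real n)"
    and nn: "0 \<le> t" "0 \<le> B" "0 \<le> b"
  shows "t ^ m * cmod (\<Sum>\<^sub>\<infinity>n. u n) \<le> B * b ^ m * wsum s m"
proof -
  have s: "(\<lambda>n. B * b ^ m * ((1 + real n) ^ m * s n)) summable_on UNIV"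
    by (intro summable_on_cmult_right rapid_summable[OF r])
  have le: "norm (complex_of_real (t ^ m) * u n) \<le> B * b ^ m * ((1 + real n) ^ m * s n)" for n
  proof (cases "u n = 0")
    case True thus ?thesis using nn rapid_nonneg[OF r, of n] by simp
  next
    case False
    have "t ^ m * cmod (u n) \<le> (b * (1 + real n)) ^ m * (B * s n)"
      by (intro mult_mono power_mono u(1) u(2)[OF False]) (use nn in auto)
    thus ?thesis using nn by (simp add: norm_mult norm_power power_mult_distrib mult_ac)
  qed
  have "t ^ m * cmod (\<Sum>\<^sub>\<infinity>n. u n) = cmod (\<Sum>\<^sub>\<infinity>n. complex_of_real (t ^ m) * u n)"
    unfolding infsum_cmult_right' using nn by (simp add: norm_mult norm_power)
  also have "\<dots> \<le> (\<Sum>\<^sub>\<infinity>n. B * b ^ m * ((1 + real n) ^ m * s n))"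
    by (rule norm_infsum_le[OF has_sum_infsum has_sum_infsum])
       (use le s abs_summable_summable[OF norm_summable_comparison[OF s le]] in simp_all)
  also have "\<dots> = B * b ^ m * wsum s m" unfolding wsum_def by (rule infsum_cmult_right')
  finally show ?thesis .
qed

definition inv_sq_int :: real where "inv_sq_int = (\<Sum>\<^sub>\<infinity>n::int. 1 / (1 + \<bar>real_of_int n\<bar>) ^ 2)"
definition inv_sq_nat :: real where "inv_sq_nat = (\<Sum>\<^sub>\<infinity>n::nat. 1 / (1 + real n) ^ 2)"

lemma inv_sq_int_nonneg: "0 \<le> inv_sq_int" unfolding inv_sq_int_def by (intro infsum_nonneg) auto

lemma int_weight_bound:
  assumes "\<And>k. (1 + \<bar>real_of_int k\<bar>) ^ (m + 2) * cmod (c k) \<le> B"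
  shows "(\<lambda>k. (1 + \<bar>real_of_int k\<bar>) ^ m * cmod (c k)) summable_on UNIV"
    and "(\<Sum>\<^sub>\<infinity>k. (1 + \<bar>real_of_int k\<bar>) ^ m * cmod (c k)) \<le> inv_sq_int * B"
proof -
  have s: "(\<lambda>k::int. (1 / (1 + \<bar>real_of_int k\<bar>) ^ 2) * B) summable_on UNIV"
    by (intro summable_on_cmult_left summable_on_int_inverse_square)
  have le: "(1 + \<bar>real_of_int k\<bar>) ^ m * cmod (c k) \<le> (1 / (1 + \<bar>real_of_int k\<bar>) ^ 2) * B" for k
  proof -
    have "(1 + \<bar>real_of_int k\<bar>) ^ m * cmod (c k) * (1 + \<bar>real_of_int k\<bar>) ^ 2 \<le> B"
      using assms[of k] by (simp add: power_add power2_eq_square mult_ac)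
    hence "(1 + \<bar>real_of_int k\<bar>) ^ m * cmod (c k) \<le> B / (1 + \<bar>real_of_int k\<bar>) ^ 2"
      by (simp add: pos_le_divide_eq add_pos_nonneg)
    thus ?thesis by simp
  qed
  show s1: "(\<lambda>k. (1 + \<bar>real_of_int k\<bar>) ^ m * cmod (c k)) summable_on UNIV"
    by (rule summable_on_comparison_test[OF s le]) auto
  have "(\<Sum>\<^sub>\<infinity>k. (1 + \<bar>real_of_int k\<bar>) ^ m * cmod (c k)) \<le> (\<Sum>\<^sub>\<infinity>k::int. (1 / (1 + \<bar>real_of_int k\<bar>) ^ 2) * B)"
    by (rule infsum_mono[OF s1 s le])
  thus "(\<Sum>\<^sub>\<infinity>k. (1 + \<bar>real_of_int k\<bar>) ^ m * cmod (c k)) \<le> inv_sq_int * B"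
    unfolding inv_sq_int_def infsum_cmult_left' .
qed

text \<open>Four further powers of 1 + i + j dominate the square of (1 + i) * (1 + j), which pays
  for summation over both indices.\<close>

lemma nat_pair_weight_bound:
  fixes w :: "nat \<Rightarrow> nat \<Rightarrow> real"
  assumes w0: "\<And>i j. 0 \<le> w i j" and w: "\<And>i j. (1 + real i + real j) ^ (r + 4) * w i j \<le> B"
  shows "(\<lambda>i. (1 + real (fst i) + real (snd i)) ^ r * w (fst i) (snd i)) summable_on UNIV"
    and "(\<Sum>\<^sub>\<infinity>i. (1 + real (fst i) + real (snd i)) ^ r * w (fst i) (snd i)) \<le> inv_sq_nat ^ 2 * B"
proof -
  let ?q = "\<lambda>n::nat. 1 / (1 + real n) ^ 2"
  have q: "(\<lambda>i. ?q (fst i) * ?q (snd i)) summable_on UNIV"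
    using summable_on_prod_real[OF summable_on_nat_inverse_square _ summable_on_nat_inverse_square]
    by (simp add: case_prod_unfold)
  have s: "(\<lambda>i. ?q (fst i) * ?q (snd i) * B) summable_on UNIV" by (rule summable_on_cmult_left[OF q])
  have le: "(1 + real i + real j) ^ r * w i j \<le> ?q i * ?q j * B" for i j
  proof -
    have "((1 + real i) ^ 2 * (1 + real j) ^ 2) * ((1 + real i + real j) ^ r * w i j) \<le> ((1 + real i + real j) ^ 2 * (1 + real i + real j) ^ 2) * ((1 + real i + real j) ^ r * w i j)"
      by (intro mult_right_mono mult_mono power_mono) (auto simp: w0)
    also have "\<dots> = (1 + real i + real j) ^ (r + 4) * w i j" by (simp add: power_add[symmetric] mult.assoc[symmetric] add.commute)
    also have "\<dots> \<le> B" by (rule w)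
    finally show ?thesis by (simp add: field_simps add_pos_nonneg)
  qed
  show s1: "(\<lambda>i. (1 + real (fst i) + real (snd i)) ^ r * w (fst i) (snd i)) summable_on UNIV"
    by (rule summable_on_comparison_test[OF s le]) (auto simp: w0)
  have "(\<Sum>\<^sub>\<infinity>i. (1 + real (fst i) + real (snd i)) ^ r * w (fst i) (snd i)) \<le> (\<Sum>\<^sub>\<infinity>i. ?q (fst i) * ?q (snd i) * B)"
    by (rule infsum_mono[OF s1 s le])
  also have "\<dots> = (\<Sum>\<^sub>\<infinity>i. ?q (fst i) * ?q (snd i)) * B" by (rule infsum_cmult_left')
  also have "(\<Sum>\<^sub>\<infinity>i. ?q (fst i) * ?q (snd i)) = (\<Sum>\<^sub>\<infinity>i. \<Sum>\<^sub>\<infinity>j. ?q i * ?q j)"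
    using infsum_Sigma'_banach[of "\<lambda>i j. ?q i * ?q j" UNIV "\<lambda>_. UNIV"] q by (simp add: case_prod_unfold)
  also have "\<dots> = inv_sq_nat ^ 2"
    unfolding infsum_cmult_right' infsum_cmult_left' inv_sq_nat_def power2_eq_square ..
  finally show "(\<Sum>\<^sub>\<infinity>i. (1 + real (fst i) + real (snd i)) ^ r * w (fst i) (snd i)) \<le> inv_sq_nat ^ 2 * B" .
qed

lemma rapid_smooth_base:
  assumes r: "rapid (idx 0) (kA 0) K s"
  shows "\<exists>N. smooth_elem 0 (kop (idx 0) K) N \<and> (\<forall>m. N m \<le> inv_sq_int * wsum s (m + 4))"
proof -
  obtain Ks where Ks: "\<And>n. Ks n \<in> kA 0 n" "\<And>n. schur (idx 0) (s n) (Ks n)" "\<And>x y. K x y = (\<Sum>\<^sub>\<infinity>n. Ks n x y)"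
    using r unfolding rapid_def by blast
  define c where "c k = K ([], k) ([], 0)" for k
  have idx0: "([], k) \<in> idx 0" for k by (simp add: mem_idx)
  have cb: "(1 + \<bar>real_of_int k\<bar>) ^ m * cmod (c k) \<le> wsum s m" for k m
  proof -
    have "(1 + \<bar>real_of_int k\<bar>) ^ m * cmod (\<Sum>\<^sub>\<infinity>n. Ks n ([], k) ([], 0)) \<le> 1 * 1 ^ m * wsum s m"
    proof (rule weighted_entry_bound[OF r])
      show "cmod (Ks n ([], k) ([], 0)) \<le> 1 * s n" for n using schur_entry[OF Ks(2)] by simp
      fix n assume "Ks n ([], k) ([], 0) \<noteq> 0"
      hence "ix.admA 0 n ([], k) ([], 0)" using ix.tkerD1[OF Ks(1)[unfolded ix.kerA_def]] by blast
      hence "\<bar>k\<bar> \<le> int n" using ix.dist1_bound[of 0 0 "([], k)" "([], 0)"] ix.admA_dist[of 0 n] by (fastforce simp: cI_def)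
      from abs_int_le_real[OF this] show "1 + \<bar>real_of_int k\<bar> \<le> 1 * (1 + real n)" by simp
    qed auto
    thus ?thesis by (simp add: c_def Ks(3))
  qed
  have rd: "rapidly_decreasing c" unfolding rapidly_decreasing_def using cb by blast
  have Kc: "K ([], i) ([], j) = c (i - j)" for i j
  proof -
    have "Ks n ([], i) ([], j) = Ks n ([], i - j) ([], 0)" for n
    proof (rule ix.tkerD2[OF Ks(1)[unfolded ix.kerA_def]])
      show "ix.relA 0 n ([], j) ([], 0)" by (rule ix.relA_I[of 0]) auto
      show "cI ([], i) - cI ([], j) = cI ([], i - j) - cI ([], 0)" by (auto simp: cI_def fun_eq_iff)
    qed (simp_all add: idx0)
    thus ?thesis by (simp add: c_def Ks(3))
  qed
  have KK: "K = (\<lambda>x y. \<Sum>\<^sub>\<infinity>n\<in>UNIV. c n * zk n x y)"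
  proof (intro ext)
    fix x y
    show "K x y = (\<Sum>\<^sub>\<infinity>n\<in>UNIV. c n * zk n x y)"
    proof (cases "x \<in> idx 0 \<and> y \<in> idx 0")
      case True
      have "(\<Sum>\<^sub>\<infinity>n\<in>UNIV. c n * zk n x y) = (\<Sum>\<^sub>\<infinity>n\<in>{snd x - snd y}. c n)"
        by (rule infsum_cong_neutral) (use True in \<open>auto simp: zk_def\<close>)
      moreover have "x = ([], snd x)" "y = ([], snd y)" using True by (auto simp: mem_idx prod_eq_iff)
      ultimately show ?thesis using Kc[of "snd x" "snd y"] by simp
    next
      case False
      hence "(\<Sum>\<^sub>\<infinity>n\<in>UNIV. c n * zk n x y) = 0" by (intro infsum_0) (auto simp: zk_def)
      moreover have "K x y = 0" using schur_supp[OF rapid_schur[OF r]] False by blast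
      ultimately show ?thesis by simp
    qed
  qed
  have sch: "schur (idx 0) (cmod (c n)) (\<lambda>x y. c n * zk n x y)" for n using schur_scale[OF schur_zk, of "c n" n] by simp
  have sm0: "(\<lambda>n. cmod (c n)) summable_on UNIV" using rapidly_decreasing_summable[OF rd, of 0] by simp
  have "has_op_sum (idx 0) (\<lambda>n. c n *\<^sub>o z_pow n) UNIV (kop (idx 0) K)"
    unfolding KK by (rule has_op_sum_kop[OF sch sm0]) (simp add: kop_scale z_pow_kop)
  from smooth_elem.base[OF rd this]
  have sm: "smooth_elem 0 (kop (idx 0) K) (\<lambda>m. \<Sum>\<^sub>\<infinity>n. (1 + \<bar>real_of_int n\<bar>) ^ m * cmod (c n))" .
  have "(\<Sum>\<^sub>\<infinity>n. (1 + \<bar>real_of_int n\<bar>) ^ m * cmod (c n)) \<le> inv_sq_int * wsum s (m + 4)" for m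
  proof (rule int_weight_bound(2))
    \<comment> \<open>Weight m + 2 is enlarged to m + 4 to fit the general exponent (m + 4) * (l +
      1) at l = 0.\<close>
    fix k show "(1 + \<bar>real_of_int k\<bar>) ^ (m + 2) * cmod (c k) \<le> wsum s (m + 4)"
      by (rule order_trans[OF cb wsum_mono[OF r]]) simp
  qed
  thus ?thesis using sm by blast
qed

text \<open>The Toeplitz coefficient \<open>\<lambda>\<^sub>k\<close> is read off far out, at column \<open>2 n\<close>, where a kernel of radius \<open>n\<close>
  has become translation invariant.\<close>

lemma rapid_smooth_step:
  assumes C0: "\<And>m. 0 \<le> C m"
    and IH: "\<And>K s. rapid (idx l) (kA l) K s \<Longrightarrow> \<exists>N. smooth_elem l (kop (idx l) K) N \<and> (\<forall>m. N m \<le> C m * wsum s ((m + 4) * (l + 1)))"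
    and r: "rapid (idx (Suc l)) (kA (Suc l)) K s"
  shows "\<exists>N. smooth_elem (Suc l) (kop (idx (Suc l)) K) N \<and>
     (\<forall>m. N m \<le> ((\<Sum>k\<le>m. C k) * (inv_sq_nat ^ 2 * (2 * 3 ^ (((m + 4) * (l + 1)) + (m + 4)))) + inv_sq_int) * wsum s ((m + 4) * (Suc l + 1)))"
proof -
  let ?X = "idx (Suc l)" and ?S = "adj (idx (Suc l)) (alpha1 (Suc l))"
  obtain Ks where Ks: "\<And>n. Ks n \<in> kA (Suc l) n" "\<And>n. schur ?X (s n) (Ks n)" "\<And>x y. K x y = (\<Sum>\<^sub>\<infinity>n. Ks n x y)"
    using r unfolding rapid_def by blast
  have s0: "0 \<le> s n" for n by (rule rapid_nonneg[OF r])
  note Kt = Ks(1)[unfolded ix.kerA_def]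
  \<comment> \<open>An arbitrary base point in the remaining coordinates.\<close>
  define o' where "o' = (replicate l (0::nat), 0::int)"
  have o': "o' \<in> idx l" by (simp add: o'_def mem_idx)
  \<comment> \<open>Within the band the row index 2n - k is at least n, so passing to natural
    numbers loses nothing.\<close>
  define lam where "lam n k = (if \<bar>k\<bar> \<le> int n then Ks n (cns (nat (2 * int n - k)) o') (cns (2 * n) o') else 0)" for n k
  have lam_b: "cmod (lam n k) \<le> s n" for n k
    unfolding lam_def using schur_entry[OF Ks(2)] s0 by auto
  \<comment> \<open>From column n on, a piece of radius n is a Toeplitz matrix tensored with the
    identity.\<close>
  have far: "Ks n (cns i p) (cns j q) = (if p = q then lam n (int j - int i) else 0)"
    if j: "n \<le> j" and pq: "p \<in> idx l" "q \<in> idx l" for n i j p q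
  proof (cases "p = q")
    case False
    have "\<not> ix.admA (Suc l) n (cns i p) (cns j q)" unfolding admA_cns[OF pq] using False j by simp
    thus ?thesis using ix.tkerD1[OF Kt, of n "cns i p" "cns j q"] False by auto
  next
    case True
    show ?thesis
    proof (cases "\<bar>int j - int i\<bar> \<le> int n")
      case in_band: True
      have "Ks n (cns i p) (cns j p) = Ks n (cns (nat (2 * int n - (int j - int i))) o') (cns (2 * n) o')"
      proof (rule ix.tkerD2[OF Kt])
        show "cI (cns i p) - cI (cns j p) = cI (cns (nat (2 * int n - (int j - int i))) o') - cI (cns (2 * n) o')"
          unfolding cI_diff_cns using in_band by auto
        show "ix.relA (Suc l) n (cns j p) (cns (2 * n) o')" unfolding relA_cns using j by simp
      qed (use pq o' in auto)
      thus ?thesis using in_band True by (simp add: lam_def)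
    next
      case False
      have "\<not> ix.admA (Suc l) n (cns i p) (cns j q)" unfolding admA_cns[OF pq]
        using False ix.dist1_nonneg[of l p q] by linarith
      hence "Ks n (cns i p) (cns j q) = 0" using ix.tkerD1[OF Kt, of n "cns i p" "cns j q"] by auto
      thus ?thesis using False by (simp add: lam_def)
    qed
  qed
  \<comment> \<open>The block in row i and column j of the n-th piece, with the Toeplitz part
    removed.\<close>
  define A where "A i j n p q = (if p \<in> idx l \<and> q \<in> idx l then Ks n (cns i p) (cns j q) - (if p = q then lam n (int j - int i) else 0) else 0)" for i j n p q
  \<comment> \<open>Columns from n on have just been made zero, and in earlier columns the band
    reaches only to rows below 2n.\<close>
  have A_far: "A i j n = (\<lambda>p q. 0)" if "\<not> (i < 2 * n \<and> j < n)" for i j n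
  proof (intro ext)
    fix p q
    show "A i j n p q = 0"
    proof (cases "p \<in> idx l \<and> q \<in> idx l")
      case pq: True
      show ?thesis
      proof (cases "n \<le> j")
        case True thus ?thesis using far[OF True] pq by (simp add: A_def)
      next
        case False
        hence big: "\<not> \<bar>int i - int j\<bar> \<le> int n" using that by linarith
        hence "\<not> ix.admA (Suc l) n (cns i p) (cns j q)" unfolding admA_cns[OF conjunct1[OF pq] conjunct2[OF pq]]
          using ix.dist1_nonneg[of l p q] by linarith
        hence "Ks n (cns i p) (cns j q) = 0" using ix.tkerD1[OF Kt, of n "cns i p" "cns j q"] by auto
        moreover have "lam n (int j - int i) = 0" using big by (auto simp: lam_def)
        ultimately show ?thesis by (simp add: A_def)
      qed
    qed (auto simp: A_def)
  qed
  \<comment> \<open>One s n bounds the block itself, the other the subtracted Toeplitz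
    coefficient.\<close>
  define t where "t i j n = (if i < 2 * n \<and> j < n then 2 * s n else 0)" for i j n :: nat
  have t0: "0 \<le> t i j n" for i j n using s0 by (simp add: t_def)
  have A_schur: "schur (idx l) (t i j n) (A i j n)" for i j n
  proof (cases "i < 2 * n \<and> j < n")
    case False thus ?thesis unfolding A_far[OF False] by (intro schur_zero t0)
  next
    case True
    have 1: "schur (idx l) (s n) (\<lambda>p q. if p \<in> idx l \<and> q \<in> idx l then Ks n (cns i p) (cns j q) else 0)"
      by (rule schur_pullback[OF Ks(2)[of n], where f="cns i" and g="cns j"]) (auto split: if_splits)
    have 2: "schur (idx l) (s n) (\<lambda>p q. if p \<in> idx l \<and> p = q then - lam n (int j - int i) else 0)"
      by (rule schur_partial_injection) (use lam_b s0 in \<open>auto split: if_splits\<close>)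
    have "A i j n = (\<lambda>p q. if p \<in> idx l \<and> q \<in> idx l then Ks n (cns i p) (cns j q) else 0) + (\<lambda>p q. if p \<in> idx l \<and> p = q then - lam n (int j - int i) else 0)"
      by (auto simp: A_def fun_eq_iff)
    thus ?thesis using schur_add[OF 1 2] True by (simp add: t_def)
  qed
  have A_mem: "A i j n \<in> kA l n" for i j n
    unfolding ix.kerA_def
  proof (rule ix.tkerI)
    fix p q assume nz: "A i j n p q \<noteq> 0"
    hence pq: "p \<in> idx l" "q \<in> idx l" by (auto simp: A_def split: if_splits)
    have "ix.admA l n p q"
    proof (cases "p = q")
      case True thus ?thesis by (auto simp: ix.dist1_def intro!: ix.admA_I)
    next
      case False
      hence "Ks n (cns i p) (cns j q) \<noteq> 0" using nz by (auto simp: A_def split: if_splits)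
      hence "ix.admA (Suc l) n (cns i p) (cns j q)" using ix.tkerD1[OF Kt, of n "cns i p" "cns j q"] by blast
      note this[unfolded admA_cns[OF pq]]
      thus ?thesis by (intro ix.admA_I) auto
    qed
    thus "p \<in> idx l \<and> q \<in> idx l \<and> ix.admA l n p q" using pq by blast
  next
    fix p q p' q' assume m: "p \<in> idx l" "q \<in> idx l" "p' \<in> idx l" "q' \<in> idx l"
      and dd: "cI p - cI q = cI p' - cI q'" and rl: "ix.relA l n q q'"
    have "Ks n (cns i p) (cns j q) = Ks n (cns i p') (cns j q')"
    proof (rule ix.tkerD2[OF Kt])
      show "cI (cns i p) - cI (cns j q) = cI (cns i p') - cI (cns j q')" unfolding cI_diff_cns using dd by simp
      show "ix.relA (Suc l) n (cns j q) (cns j q')" unfolding relA_cns using rl by simp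
    qed (use m in auto)
    moreover have "p = q \<longleftrightarrow> p' = q'"
    proof -
      have "p = q \<longleftrightarrow> cI p - cI q = (\<lambda>_. 0)" using inj_onD[OF ix.inj _ m(1,2)] by (auto simp: fun_eq_iff)
      moreover have "p' = q' \<longleftrightarrow> cI p' - cI q' = (\<lambda>_. 0)" using inj_onD[OF ix.inj _ m(3,4)] by (auto simp: fun_eq_iff)
      ultimately show ?thesis using dd by simp
    qed
    ultimately show "A i j n p q = A i j n p' q'" using m by (simp add: A_def)
  qed
  define Kij where "Kij i j = (\<lambda>p q. \<Sum>\<^sub>\<infinity>n. A i j n p q)" for i j
  have t_sm: "(\<lambda>n. (1 + real n) ^ m * t i j n) summable_on UNIV" for i j m
    by (rule summable_on_comparison_test[OF summable_on_cmult_right[OF rapid_summable[OF r, of m], of 2]])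
       (use s0 in \<open>auto simp: t_def\<close>)
  have Kij: "rapid (idx l) (kA l) (Kij i j) (t i j)" for i j
    unfolding rapid_def Kij_def using A_mem A_schur t_sm by blast
  have "\<forall>i j. \<exists>N. smooth_elem l (kop (idx l) (Kij i j)) N \<and> (\<forall>m. N m \<le> C m * wsum (t i j) ((m + 4) * (l + 1)))"
    using IH[OF Kij] by blast
  then obtain N where N: "\<And>i j. smooth_elem l (kop (idx l) (Kij i j)) (N i j)"
     "\<And>i j m. N i j m \<le> C m * wsum (t i j) ((m + 4) * (l + 1))" by metis
  have N0: "0 \<le> N i j m" for i j m by (rule smooth_elem_nonneg[OF N(1)])
  \<comment> \<open>A piece contributes to the block only if i < 2n and j < n, so 1 + i + j is at
    most 3 (1 + n): weights in the block indices become weights in the radius.\<close>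
  have wt: "(1 + real i + real j) ^ k * wsum (t i j) m \<le> 2 * 3 ^ k * wsum s (m + k)" for i j k m
  proof -
    have "(1 + real i + real j) ^ k * wsum (t i j) m = (\<Sum>\<^sub>\<infinity>n. (1 + real i + real j) ^ k * ((1 + real n) ^ m * t i j n))"
      unfolding wsum_def by (rule infsum_cmult_right'[symmetric])
    also have "\<dots> \<le> (\<Sum>\<^sub>\<infinity>n. 2 * 3 ^ k * ((1 + real n) ^ (m + k) * s n))"
    proof (rule infsum_mono)
      show "(\<lambda>n. (1 + real i + real j) ^ k * ((1 + real n) ^ m * t i j n)) summable_on UNIV"
        by (intro summable_on_cmult_right t_sm)
      show "(\<lambda>n. 2 * 3 ^ k * ((1 + real n) ^ (m + k) * s n)) summable_on UNIV"
        by (intro summable_on_cmult_right rapid_summable[OF r])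
      fix n
      show "(1 + real i + real j) ^ k * ((1 + real n) ^ m * t i j n) \<le> 2 * 3 ^ k * ((1 + real n) ^ (m + k) * s n)"
      proof (cases "i < 2 * n \<and> j < n")
        case True
        hence "(1 + real i + real j) ^ k \<le> (3 * (1 + real n)) ^ k" by (intro power_mono) auto
        hence "(1 + real i + real j) ^ k * ((1 + real n) ^ m * (2 * s n)) \<le> (3 * (1 + real n)) ^ k * ((1 + real n) ^ m * (2 * s n))"
          by (rule mult_right_mono) (use s0 in auto)
        also have "(3 * (1 + real n)) ^ k * ((1 + real n) ^ m * (2 * s n)) = 2 * 3 ^ k * ((1 + real n) ^ (m + k) * s n)"
          by (simp only: power_mult_distrib power_add mult_ac)
        finally show ?thesis using True by (simp only: t_def if_True simp_thms)
      qed (use s0 in \<open>auto simp: t_def\<close>)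
    qed
    also have "\<dots> = 2 * 3 ^ k * wsum s (m + k)" unfolding wsum_def by (rule infsum_cmult_right')
    finally show ?thesis .
  qed
  have Nw: "(1 + real i + real j) ^ k * N i j m \<le> C m * (2 * 3 ^ k * wsum s ((m + 4) * (l + 1) + k))" for i j k m
  proof -
    have "(1 + real i + real j) ^ k * N i j m \<le> (1 + real i + real j) ^ k * (C m * wsum (t i j) ((m + 4) * (l + 1)))"
      by (intro mult_left_mono N(2)) auto
    also have "\<dots> = C m * ((1 + real i + real j) ^ k * wsum (t i j) ((m + 4) * (l + 1)))" by simp
    also have "\<dots> \<le> C m * (2 * 3 ^ k * wsum s ((m + 4) * (l + 1) + k))" by (intro mult_left_mono wt C0)
    finally show ?thesis .
  qed
  have smN: "(\<lambda>(i, j). (1 + real i + real j) ^ k * N i j m) summable_on UNIV" for k m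
    using nat_pair_weight_bound(1)[of "\<lambda>i j. N i j m" k, OF N0 Nw] by (simp add: case_prod_unfold)
  define c where "c k = (\<Sum>\<^sub>\<infinity>n. lam n k)" for k
  have cb: "(1 + \<bar>real_of_int k\<bar>) ^ m * cmod (c k) \<le> wsum s m" for k m
  proof -
    have "(1 + \<bar>real_of_int k\<bar>) ^ m * cmod (\<Sum>\<^sub>\<infinity>n. lam n k) \<le> 1 * 1 ^ m * wsum s m"
    proof (rule weighted_entry_bound[OF r])
      fix n assume "lam n k \<noteq> 0"
      hence "\<bar>k\<bar> \<le> int n" by (auto simp: lam_def split: if_splits)
      from abs_int_le_real[OF this] show "1 + \<bar>real_of_int k\<bar> \<le> 1 * (1 + real n)" by simp
    qed (use lam_b in auto)
    thus ?thesis by (simp add: c_def)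
  qed
  have rd: "rapidly_decreasing c" unfolding rapidly_decreasing_def using cb by blast
  define K0 where "K0 = (\<lambda>x y. \<Sum>\<^sub>\<infinity>i. lift (fst i) (snd i) (Kij (fst i) (snd i)) x y)"
  define k1 where "k1 = (\<lambda>x y. \<Sum>\<^sub>\<infinity>k\<in>UNIV. c (int k) * shk l (int k) x y)"
  define k2 where "k2 = (\<lambda>x y. \<Sum>\<^sub>\<infinity>k\<in>{k. k > 0}. c (- int k) * shk l (- int k) x y)"
  have u: "(\<lambda>i. wsum (t (fst i) (snd i)) 0) summable_on UNIV"
    using nat_pair_weight_bound(1)[of "\<lambda>i j. wsum (t i j) 0" 0, OF wsum_nonneg[OF Kij] wt] by simp
  have schK0: "schur ?X (\<Sum>\<^sub>\<infinity>i. wsum (t (fst i) (snd i)) 0) K0" unfolding K0_def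
    by (rule schur_infsum(2)[OF schur_lift[OF rapid_schur[OF Kij]] u])
  have h0: "has_op_sum ?X (\<lambda>(j, k). (?S ^^ j) \<circ> p0_tensor l (kop (idx l) (Kij j k)) \<circ> (alpha1 (Suc l) ^^ k)) UNIV (kop ?X K0)"
    unfolding K0_def by (rule has_op_sum_matrix[OF rapid_schur[OF Kij] u])
  have h1: "has_op_sum ?X (\<lambda>k. c (int k) *\<^sub>o (alpha1 (Suc l) ^^ k)) UNIV (kop ?X k1)"
    unfolding k1_def by (rule toeplitz_part(2)[OF rd]) (auto simp: alpha1_power)
  have h2: "has_op_sum ?X (\<lambda>k. c (- int k) *\<^sub>o (?S ^^ k)) {k. k > 0} (kop ?X k2)"
    unfolding k2_def by (rule toeplitz_part(2)[OF rd, where g="\<lambda>k. - int k"]) (auto simp: adj_alpha1_power inj_on_def)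
  obtain s1 where K1: "rapid ?X (kA (Suc l)) k1 s1"
    using toeplitz_part(1)[OF rd, where g=int and J=UNIV and l=l] unfolding k1_def by auto
  obtain s2 where K2: "rapid ?X (kA (Suc l)) k2 s2"
    using toeplitz_part(1)[OF rd, where g="\<lambda>k. - int k" and J="{k. k > 0}" and l=l] unfolding k2_def by (auto simp: inj_on_def)
  have K012: "K = K0 + k1 + k2"
  proof (intro ext)
    fix x y
    show "K x y = (K0 + k1 + k2) x y"
    proof (cases "x \<in> ?X \<and> y \<in> ?X")
      case False
      have "K x y = 0" by (rule schur_supp[OF rapid_schur[OF r]]) (use False in blast)
      moreover have "K0 x y = 0" by (rule schur_supp[OF schK0]) (use False in blast)
      moreover have "k1 x y = 0" by (rule schur_supp[OF rapid_schur[OF K1]]) (use False in blast)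
      moreover have "k2 x y = 0" by (rule schur_supp[OF rapid_schur[OF K2]]) (use False in blast)
      ultimately show ?thesis by simp
    next
      case True
      then obtain i p j q where h: "x = cns i p" "y = cns j q" "p \<in> idx l" "q \<in> idx l" using idx_Suc_ex by meson
      have e0: "K0 x y = Kij i j p q" unfolding K0_def h(1,2) by (rule infsum_lift_cns)
      have e1: "k1 x y = (if p = q \<and> i \<le> j then c (int j - int i) else 0)"
      proof -
        have "k1 x y = (\<Sum>\<^sub>\<infinity>k\<in>(if p = q \<and> i \<le> j then {j - i} else {}). c (int k))"
          unfolding k1_def h(1,2) by (rule infsum_cong_neutral) (use h in \<open>auto split: if_splits\<close>)
        thus ?thesis by (simp add: of_nat_diff)
      qed
      have e2: "k2 x y = (if p = q \<and> j < i then c (int j - int i) else 0)"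
      proof -
        have "k2 x y = (\<Sum>\<^sub>\<infinity>k\<in>(if p = q \<and> j < i then {i - j} else {}). c (- int k))"
          unfolding k2_def h(1,2) by (rule infsum_cong_neutral) (use h in \<open>auto split: if_splits\<close>)
        thus ?thesis by (simp add: of_nat_diff)
      qed
      have "K x y = (\<Sum>\<^sub>\<infinity>n. A i j n p q + (if p = q then lam n (int j - int i) else 0))"
        unfolding Ks(3) h(1,2) using h by (intro infsum_cong) (simp add: A_def)
      also have "\<dots> = Kij i j p q + (\<Sum>\<^sub>\<infinity>n. if p = q then lam n (int j - int i) else 0)"
        unfolding Kij_def
      proof (rule infsum_add)
        show "(\<lambda>n. A i j n p q) summable_on UNIV" by (rule schur_infsum(1)[OF A_schur]) (use t_sm[of 0] in simp)
        show "(\<lambda>n. if p = q then lam n (int j - int i) else 0) summable_on UNIV"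
          by (rule abs_summable_summable[OF norm_summable_comparison[where g=s]])
             (use rapid_summable[OF r, of 0] lam_b s0 in auto)
      qed
      also have "\<dots> = (K0 + k1 + k2) x y" by (auto simp: e0 e1 e2 c_def)
      finally show ?thesis .
    qed
  qed
  have kopK: "kop ?X K = kop ?X K0 + kop ?X k1 + kop ?X k2"
    unfolding K012 kop_add[OF schur_add[OF schK0 rapid_schur[OF K1]] rapid_schur[OF K2]] kop_add[OF schK0 rapid_schur[OF K1]] ..
  let ?N = "\<lambda>m. Max ((\<lambda>(r, s). \<Sum>\<^sub>\<infinity>(j, k). (1 + real j + real k) ^ r * N j k s) ` ({..m} \<times> {..m}))
           + (\<Sum>\<^sub>\<infinity>k. (1 + \<bar>real_of_int k\<bar>) ^ m * cmod (c k))"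
  have sm: "smooth_elem (Suc l) (kop ?X K) ?N"
    unfolding kopK by (rule smooth_elem.step[OF N(1) smN rd h0 h1 h2])
  have "?N m \<le> ((\<Sum>k\<le>m. C k) * (inv_sq_nat ^ 2 * (2 * 3 ^ (((m + 4) * (l + 1)) + (m + 4)))) + inv_sq_int) * wsum s ((m + 4) * (Suc l + 1))" for m
  proof -
    define W where "W = wsum s ((m + 4) * (Suc l + 1))"
    \<comment> \<open>The level below costs the exponent (m + 4) * (l + 1); the weight of order at
      most m in the block indices and its summation cost m + 4 more.\<close>
    define E where "E = (m + 4) * (l + 1) + (m + 4)"
    have E: "(m + 4) * (Suc l + 1) = E" by (simp add: E_def)
    have W0: "0 \<le> W" unfolding W_def by (rule wsum_nonneg[OF r])
    have cl: "C k \<le> (\<Sum>k\<le>m. C k)" if "k \<le> m" for k by (rule member_le_sum) (use that C0 in auto)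
    have "Max ((\<lambda>(r, s). \<Sum>\<^sub>\<infinity>(j, k). (1 + real j + real k) ^ r * N j k s) ` ({..m} \<times> {..m})) \<le> (\<Sum>k\<le>m. C k) * (inv_sq_nat ^ 2 * (2 * 3 ^ E)) * W"
    proof (rule Max.boundedI)
      fix v assume "v \<in> (\<lambda>(r, s). \<Sum>\<^sub>\<infinity>(j, k). (1 + real j + real k) ^ r * N j k s) ` ({..m} \<times> {..m})"
      then obtain r' s' where v: "r' \<le> m" "s' \<le> m" "v = (\<Sum>\<^sub>\<infinity>(j, k). (1 + real j + real k) ^ r' * N j k s')" by auto
      have "(s' + 4) * (l + 1) + (r' + 4) \<le> E" unfolding E_def using v by (intro add_mono mult_mono) auto
      hence wl: "wsum s ((s' + 4) * (l + 1) + (r' + 4)) \<le> W" unfolding W_def E by (rule wsum_mono[OF r])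
      have "r' + 4 \<le> E" using v by (simp add: E_def)
      hence p3: "(3::real) ^ (r' + 4) \<le> 3 ^ E" by (intro power_increasing) auto
      have "v \<le> inv_sq_nat ^ 2 * (C s' * (2 * 3 ^ (r' + 4) * wsum s ((s' + 4) * (l + 1) + (r' + 4))))"
        unfolding v(3) using nat_pair_weight_bound(2)[of "\<lambda>i j. N i j s'" r', OF N0 Nw] by (simp add: case_prod_unfold)
      also have "\<dots> \<le> inv_sq_nat ^ 2 * ((\<Sum>k\<le>m. C k) * (2 * 3 ^ E * W))"
        by (intro mult_left_mono mult_mono cl[OF v(2)] wl p3)
           (use wsum_nonneg[OF r] C0 in \<open>auto intro!: sum_nonneg mult_nonneg_nonneg\<close>)
      finally show "v \<le> (\<Sum>k\<le>m. C k) * (inv_sq_nat ^ 2 * (2 * 3 ^ E)) * W" by (simp only: mult_ac)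
    qed auto
    moreover have "(\<Sum>\<^sub>\<infinity>k. (1 + \<bar>real_of_int k\<bar>) ^ m * cmod (c k)) \<le> inv_sq_int * W"
    proof (rule int_weight_bound(2))
      fix k show "(1 + \<bar>real_of_int k\<bar>) ^ (m + 2) * cmod (c k) \<le> W"
        unfolding W_def E by (rule order_trans[OF cb wsum_mono[OF r]]) (simp add: E_def)
    qed
    ultimately show ?thesis unfolding W_def[symmetric] E_def[symmetric] distrib_right[of _ inv_sq_int W] by (rule add_mono)
  qed
  thus ?thesis using sm by blast
qed

theorem rapid_smooth: "rapid (idx l) (kA l) K s \<Longrightarrow> kop (idx l) K \<in> A_smooth l"
proof -
  have *: "\<exists>C. (\<forall>m. 0 \<le> C m) \<and> (\<forall>K s. rapid (idx l) (kA l) K s \<longrightarrow>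
      (\<exists>N. smooth_elem l (kop (idx l) K) N \<and> (\<forall>m. N m \<le> C m * wsum s ((m + 4) * (l + 1)))))"
  proof (induction l)
    case 0
    show ?case using rapid_smooth_base inv_sq_int_nonneg by (intro exI[of _ "\<lambda>_. inv_sq_int"]) auto
  next
    case (Suc l)
    then obtain C where C: "\<And>m. 0 \<le> C m" "\<And>K s. rapid (idx l) (kA l) K s \<Longrightarrow>
      \<exists>N. smooth_elem l (kop (idx l) K) N \<and> (\<forall>m. N m \<le> C m * wsum s ((m + 4) * (l + 1)))" by blast
    show ?case
      by (intro exI[of _ "\<lambda>m. (\<Sum>k\<le>m. C k) * (inv_sq_nat ^ 2 * (2 * 3 ^ (((m + 4) * (l + 1)) + (m + 4)))) + inv_sq_int"] conjI allI impI
          rapid_smooth_step[OF C] add_nonneg_nonneg mult_nonneg_nonneg sum_nonneg inv_sq_int_nonneg C(1)) auto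
  qed
  assume "rapid (idx l) (kA l) K s"
  thus ?thesis using * unfolding A_smooth_def by blast
qed

section \<open>The spectral triple\<close>

type_synonym pt = "(nat list \<times> int) \<times> nat list"

definition cG :: "pt \<Rightarrow> nat \<Rightarrow> int" where
  "cG g i = (let k = length (fst (fst g)) in
     if i \<le> k then cI (fst g) i else if i - Suc k < length (snd g) then int (snd g ! (i - Suc k)) else 0)"

lemma mem_Gam: "g \<in> Gam l \<longleftrightarrow> fst g \<in> idx l \<and> length (snd g) = l"
  by (cases g) (auto simp: Gam_def)

lemma cG_low: "g \<in> Gam l \<Longrightarrow> i \<le> l \<Longrightarrow> cG g i = cI (fst g) i"
  and cG_high: "g \<in> Gam l \<Longrightarrow> j < l \<Longrightarrow> cG g (Suc (l + j)) = int (snd g ! j)"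
  and cG_zero: "g \<in> Gam l \<Longrightarrow> Suc (2 * l) \<le> i \<Longrightarrow> cG g i = 0"
  by (auto simp: cG_def mem_Gam mem_idx Let_def)

lemma snd_eq_iff: "g \<in> Gam l \<Longrightarrow> h \<in> Gam l \<Longrightarrow> snd g = snd h \<longleftrightarrow> (\<forall>j<l. cG g (Suc (l + j)) = cG h (Suc (l + j)))"
proof -
  assume g: "g \<in> Gam l" "h \<in> Gam l"
  have "snd g = snd h \<longleftrightarrow> (\<forall>j<l. snd g ! j = snd h ! j)" using g by (auto simp: mem_Gam list_eq_iff_nth_eq)
  also have "\<dots> \<longleftrightarrow> (\<forall>j<l. cG g (Suc (l + j)) = cG h (Suc (l + j)))" using cG_high[OF g(1)] cG_high[OF g(2)] by simp
  finally show ?thesis .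
qed

lemma coords_Gam: "coords (Gam l) cG (Suc (2 * l)) l"
proof
  show "inj_on cG (Gam l)"
  proof (rule inj_onI)
    fix g h assume gh: "g \<in> Gam l" "h \<in> Gam l" "cG g = cG h"
    have "cI (fst g) i = cI (fst h) i" for i
    proof (cases "i \<le> l")
      case True
      thus ?thesis using cG_low[OF gh(1) True] cG_low[OF gh(2) True] gh(3) by simp
    next
      case False
      thus ?thesis using gh(1,2) ix.mem_img0[of "fst g" l i] ix.mem_img0[of "fst h" l i] by (simp add: mem_Gam)
    qed
    hence "fst g = fst h" using gh by (intro inj_onD[OF ix.inj, of "fst g" "fst h"]) (auto simp: mem_Gam)
    moreover have "snd g = snd h" using snd_eq_iff[OF gh(1,2)] gh(3) by simp
    ultimately show "g = h" by (rule prod_eqI)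
  qed
  show "cG ` Gam l = {g. (\<forall>i<Suc (2 * l). i \<noteq> l \<longrightarrow> 0 \<le> g i) \<and> (\<forall>i\<ge>Suc (2 * l). g i = 0)}"
  proof (intro equalityI subsetI)
    fix f assume "f \<in> cG ` Gam l"
    then obtain g where g: "g \<in> Gam l" "f = cG g" by blast
    have "0 \<le> cG g i" if "i < Suc (2 * l)" "i \<noteq> l" for i
    proof (cases "i \<le> l")
      case True thus ?thesis using cG_low[OF g(1) True] ix.mem_img[of "fst g" l i] g(1) that by (simp add: mem_Gam)
    next
      case False thus ?thesis using cG_high[OF g(1), of "i - Suc l"] that by simp
    qed
    thus "f \<in> {g. (\<forall>i<Suc (2 * l). i \<noteq> l \<longrightarrow> 0 \<le> g i) \<and> (\<forall>i\<ge>Suc (2 * l). g i = 0)}"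
      using cG_zero[OF g(1)] g(2) by simp
  next
    fix f :: "nat \<Rightarrow> int" assume f: "f \<in> {g. (\<forall>i<Suc (2 * l). i \<noteq> l \<longrightarrow> 0 \<le> g i) \<and> (\<forall>i\<ge>Suc (2 * l). g i = 0)}"
    define g where "g = ((map (\<lambda>i. nat (f i)) [0..<l], f l), map (\<lambda>j. nat (f (Suc (l + j)))) [0..<l])"
    have g: "g \<in> Gam l" by (simp add: g_def mem_Gam mem_idx)
    have "cG g i = f i" for i
    proof -
      consider "i < l" | "i = l" | "l < i" "i < Suc (2 * l)" | "Suc (2 * l) \<le> i" by linarith
      thus ?thesis
      proof cases
        case 1 thus ?thesis using cG_low[OF g, of i] f by (simp add: g_def cI_def)
      next
        case 2 thus ?thesis using cG_low[OF g, of i] by (simp add: g_def cI_def)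
      next
        case 3 thus ?thesis using cG_high[OF g, of "i - Suc l"] f by (simp add: g_def)
      next
        case 4 thus ?thesis using cG_zero[OF g] f by simp
      qed
    qed
    hence "cG g = f" by (rule ext)
    thus "f \<in> cG ` Gam l" using g by blast
  qed
qed

interpretation gm: coords "Gam l" cG "Suc (2 * l)" l for l
  by (rule coords_Gam)

abbreviation kB :: "nat \<Rightarrow> nat \<Rightarrow> pt kern set" where
  "kB l \<equiv> coords.kerB (Gam l) cG (Suc (2 * l))"

section \<open>The eigenvalues of D and the action on the larger space\<close>

definition sz :: "pt \<Rightarrow> nat" where
  "sz g = sum_list (fst (fst g)) + nat \<bar>snd (fst g)\<bar> + sum_list (snd g)"

definition sgn_eq :: "pt \<Rightarrow> bool" where
  "sgn_eq g \<longleftrightarrow> 0 \<le> snd (fst g) \<and> (\<forall>i\<in>set (snd g). i = 0)"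

lemma d_eq_sz: "d_eq g = (if sgn_eq g then real (sz g) else - real (sz g))"
  by (cases g) (auto simp: d_eq_def sz_def sgn_eq_def Let_def split: prod.splits)

lemma abs_d_eq: "\<bar>d_eq g\<bar> = real (sz g)"
  by (simp add: d_eq_sz)

lemma D_eq_diag: "D_eq l = diag_uop (Gam l) d_eq"
  by (simp add: D_eq_def diag_uop_def)

lemma sum_split_coords: "(\<Sum>i<Suc (2 * l). f i) = (\<Sum>i<Suc l. f i) + (\<Sum>j<l. f (Suc (l + j)))" for f :: "nat \<Rightarrow> int"
proof -
  have "(\<Sum>i<Suc (2 * l). f i) = (\<Sum>i\<in>{0..<Suc l}. f i) + (\<Sum>i\<in>{Suc l..<Suc (2 * l)}. f i)"
    unfolding lessThan_atLeast0 by (rule sum.atLeastLessThan_concat[symmetric]) auto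
  also have "(\<Sum>i\<in>{Suc l..<Suc (2 * l)}. f i) = (\<Sum>j\<in>{0..<l}. f (j + Suc l))"
    using sum.shift_bounds_nat_ivl[of f 0 "Suc l" l] by (simp add: mult_2 add.commute)
  finally show ?thesis by (simp add: lessThan_atLeast0 add.commute)
qed

lemma size1_sz: "g \<in> Gam l \<Longrightarrow> gm.size1 l g = int (sz g)"
proof -
  assume g: "g \<in> Gam l"
  have len: "length (fst (fst g)) = l" "length (snd g) = l" using g by (auto simp: mem_Gam mem_idx)
  have "(\<Sum>i<Suc l. \<bar>cG g i\<bar>) = (\<Sum>i<l. int (fst (fst g) ! i)) + \<bar>snd (fst g)\<bar>"
    using cG_low[OF g] len by (simp add: cI_def)
  also have "(\<Sum>i<l. int (fst (fst g) ! i)) = int (sum_list (fst (fst g)))"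
    by (simp add: sum_list_sum_nth len lessThan_atLeast0)
  finally have 1: "(\<Sum>i<Suc l. \<bar>cG g i\<bar>) = int (sum_list (fst (fst g))) + \<bar>snd (fst g)\<bar>" .
  have "(\<Sum>j<l. \<bar>cG g (Suc (l + j))\<bar>) = (\<Sum>j<l. int (snd g ! j))" using cG_high[OF g] by (intro sum.cong) auto
  also have "\<dots> = int (sum_list (snd g))" by (simp add: sum_list_sum_nth len lessThan_atLeast0)
  finally show ?thesis unfolding gm.size1_def sum_split_coords 1 by (simp add: sz_def)
qed

text \<open>The kernel of the tensor product with the identity, written as a multiplier times a
  pulled-back kernel to fit \<open>rapid_multiplier\<close>.\<close>

definition tens :: "nat \<Rightarrow> (nat list \<times> int) kern \<Rightarrow> pt kern" where
  "tens l K x y = (if snd x = snd y \<and> length (snd x) = l then 1 else 0) * K (fst x) (fst y)"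

lemma tens_nonzeroD: "tens l K x y \<noteq> 0 \<Longrightarrow> snd x = snd y \<and> length (snd x) = l \<and> length (snd y) = l \<and> K (fst x) (fst y) \<noteq> 0 \<and> tens l K x y = K (fst x) (fst y)"
  by (auto simp: tens_def split: if_splits)

lemma schur_tens: "schur (idx l) S K \<Longrightarrow> schur (Gam l) S (tens l K)"
proof (rule schur_pullback[where f=fst and g=fst])
  assume K: "schur (idx l) S K"
  show "tens l K x y \<noteq> 0 \<Longrightarrow> x \<in> Gam l \<and> y \<in> Gam l \<and> cmod (tens l K x y) \<le> cmod (K (fst x) (fst y))" for x y
    using tens_nonzeroD[of l K x y] schur_supp[OF K, of "fst x" "fst y"] by (auto simp: mem_Gam)
  show "tens l K x y \<noteq> 0 \<Longrightarrow> tens l K x y' \<noteq> 0 \<Longrightarrow> fst y = fst y' \<Longrightarrow> y = y'" for x y y'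
    using tens_nonzeroD[of l K x y] tens_nonzeroD[of l K x y'] by (simp add: prod_eq_iff)
  show "tens l K x y \<noteq> 0 \<Longrightarrow> tens l K x' y \<noteq> 0 \<Longrightarrow> fst x = fst x' \<Longrightarrow> x = x'" for x x' y
    using tens_nonzeroD[of l K x y] tens_nonzeroD[of l K x' y] by (simp add: prod_eq_iff)
qed

lemma infsum_slice:
  fixes f :: "'a \<times> 'b \<Rightarrow> complex"
  assumes "\<And>y :: 'a \<times> 'b. snd y \<noteq> w \<Longrightarrow> f y = 0"
  shows "(\<Sum>\<^sub>\<infinity>y. f y) = (\<Sum>\<^sub>\<infinity>x. f (x, w))"
proof -
  have "(\<Sum>\<^sub>\<infinity>y. f y) = (\<Sum>\<^sub>\<infinity>y\<in>range (\<lambda>x. (x, w)). f y)"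
  proof (rule infsum_cong_neutral)
    fix y :: "'a \<times> 'b" assume y: "y \<in> UNIV - range (\<lambda>x. (x, w))"
    have "snd y \<noteq> w"
    proof
      assume "snd y = w"
      hence "y = (fst y, w)" by (simp add: prod_eq_iff)
      thus False using y by (metis DiffE rangeI)
    qed
    thus "f y = 0" by (rule assms)
  qed auto
  also have "\<dots> = (\<Sum>\<^sub>\<infinity>x. f (x, w))" by (subst infsum_reindex) (auto simp: inj_on_def o_def)
  finally show ?thesis .
qed

lemma tensor_id_kop:
  assumes K: "schur (idx l) S K"
  shows "tensor_id l (kop (idx l) K) = kop (Gam l) (tens l K)"
proof
  fix \<xi> show "tensor_id l (kop (idx l) K) \<xi> = kop (Gam l) (tens l K) \<xi>"
  proof (cases "\<xi> \<in> ell2 (Gam l)")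
    case True
    have sl: "(\<lambda>x'. \<xi> (x', w)) \<in> ell2 (idx l)" for w
      by (rule slice_ell2[OF True]) (auto simp: inj_on_def mem_Gam)
    show ?thesis
    proof
      fix x
      have "kop (Gam l) (tens l K) \<xi> x = (\<Sum>\<^sub>\<infinity>x'. tens l K x (x', snd x) * \<xi> (x', snd x))"
        unfolding kop_apply[OF True] by (rule infsum_slice) (auto simp: tens_def)
      also have "\<dots> = (\<Sum>\<^sub>\<infinity>x'. K (fst x) x' * \<xi> (x', snd x))"
        by (rule infsum_cong) (use ell2_outside[OF True] in \<open>auto simp: tens_def mem_Gam\<close>)
      finally show "tensor_id l (kop (idx l) K) \<xi> x = kop (Gam l) (tens l K) \<xi> x"
        using True by (cases x) (simp add: tensor_id_def restrict_op_def kop_apply[OF sl])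
    qed
  qed (simp add: tensor_id_def kop_def restrict_op_def)
qed

lemma kcomp_tens: "kcomp (tens l K) (tens l L) = tens l (kcomp K L)"
proof (intro ext)
  fix x y
  have "kcomp (tens l K) (tens l L) x y = (\<Sum>\<^sub>\<infinity>z. tens l K x (z, snd x) * tens l L (z, snd x) y)"
    unfolding kcomp_def by (rule infsum_slice) (auto simp: tens_def)
  also have "\<dots> = tens l (kcomp K L) x y"
    by (auto simp: tens_def kcomp_def)
  finally show "kcomp (tens l K) (tens l L) x y = tens l (kcomp K L) x y" .
qed

section \<open>The two classes of kernels and the star algebra\<close>

definition smooth_kernel :: "nat \<Rightarrow> (nat list \<times> int) kern \<Rightarrow> bool" where
  "smooth_kernel l K \<longleftrightarrow> (\<exists>s. rapid (idx l) (kA l) K s)"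

definition eq_kernel :: "nat \<Rightarrow> pt kern \<Rightarrow> bool" where
  "eq_kernel l K \<longleftrightarrow> (\<exists>s. rapid (Gam l) (kB l) K s)"

lemma smooth_kernel_schur: "smooth_kernel l K \<Longrightarrow> \<exists>S. schur (idx l) S K"
  using rapid_schur unfolding smooth_kernel_def by blast

lemma eq_kernel_schur: "eq_kernel l K \<Longrightarrow> \<exists>S. schur (Gam l) S K"
  using rapid_schur unfolding eq_kernel_def by blast

text \<open>Both inclusions are essential: one brings elements of the algebra into the kernel
  calculus, the other certifies that sums, products and adjoints computed there are again
  elements.\<close>

lemma C_eq_iff: "a \<in> C_eq l \<longleftrightarrow> (\<exists>K. smooth_kernel l K \<and> a = kop (Gam l) (tens l K))"
proof
  assume "a \<in> C_eq l"
  then obtain b where b: "b \<in> A_smooth l" "a = tensor_id l b" by (auto simp: C_eq_def)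
  obtain K s where K: "b = kop (idx l) K" "rapid (idx l) (kA l) K s" using smooth_rapid[OF b(1)] by blast
  have "a = kop (Gam l) (tens l K)" unfolding b(2) K(1) by (rule tensor_id_kop[OF rapid_schur[OF K(2)]])
  thus "\<exists>K. smooth_kernel l K \<and> a = kop (Gam l) (tens l K)" using K(2) by (auto simp: smooth_kernel_def)
next
  assume "\<exists>K. smooth_kernel l K \<and> a = kop (Gam l) (tens l K)"
  then obtain K s where K: "rapid (idx l) (kA l) K s" "a = kop (Gam l) (tens l K)" by (auto simp: smooth_kernel_def)
  have "a = tensor_id l (kop (idx l) K)" unfolding K(2) by (rule tensor_id_kop[OF rapid_schur[OF K(1)], symmetric])
  thus "a \<in> C_eq l" using rapid_smooth[OF K(1)] by (auto simp: C_eq_def)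
qed

lemma smooth_kernel_single:
  assumes "K \<in> kA l m" "schur (idx l) S K" shows "smooth_kernel l K"
proof -
  have "rapid (idx l) (kA l) (\<lambda>x y. \<Sum>\<^sub>\<infinity>i\<in>{()}. K x y) (\<lambda>n. \<Sum>\<^sub>\<infinity>i\<in>{i\<in>{()}. m = n}. S)"
  proof (rule rapid_family, goal_cases)
    case 1 thus ?case by (rule ix.kerA_infsum)
  qed (use assms in auto)
  thus ?thesis by (auto simp: smooth_kernel_def)
qed

lemma smooth_kernel_add: "smooth_kernel l K \<Longrightarrow> smooth_kernel l L \<Longrightarrow> smooth_kernel l (K + L)"
  unfolding smooth_kernel_def by (blast intro: rapid_add ix.kerA_add)

lemma smooth_kernel_kcomp: "smooth_kernel l K \<Longrightarrow> smooth_kernel l L \<Longrightarrow> smooth_kernel l (kcomp K L)"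
  unfolding smooth_kernel_def
  by (elim exE, rule rapid_kcomp) (auto intro: ix.kerA_infsum ix.kerA_kcomp)

lemma smooth_kernel_kadj: "smooth_kernel l K \<Longrightarrow> smooth_kernel l (kadj K)"
  unfolding smooth_kernel_def
  by (elim exE, rule rapid_kadj) (auto intro: ix.kerA_infsum ix.kerA_kadj)

lemma smooth_kernel_scale: "smooth_kernel l K \<Longrightarrow> smooth_kernel l (\<lambda>x y. c * K x y)"
  unfolding smooth_kernel_def
proof (elim exE)
  fix s assume "rapid (idx l) (kA l) K s"
  thus "\<exists>s. rapid (idx l) (kA l) (\<lambda>x y. c * K x y) s"
  proof (rule rapid_multiplier[where p="\<lambda>x. x" and r="\<lambda>n. n" and a=1 and c="cmod c"])
    fix n s and K :: "(nat list \<times> int) kern" assume "K \<in> kA l n" "schur (idx l) s K"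
    show "schur (idx l) (cmod c * (1 + real n) * s) (\<lambda>x y. c * K x y)"
      by (rule schur_mono[OF schur_scale[OF \<open>schur (idx l) s K\<close>]])
         (use schur_nonneg[OF \<open>schur (idx l) s K\<close>] in \<open>auto intro!: mult_right_mono simp: mult_le_cancel_left1\<close>)
  qed (auto intro: ix.kerA_infsum ix.kerA_scale)
qed

lemma diag_kern_id: "id_op X = kop X (diag_kern X (\<lambda>_. 1))"
  by (simp add: id_op_kop diag_kern_def)

lemma tens_diag: "tens l (diag_kern (idx l) f) = diag_kern (Gam l) (\<lambda>g. f (fst g))"
  by (auto simp: tens_def diag_kern_def fun_eq_iff mem_Gam prod_eq_iff)

text \<open>Radius 1 suffices, because truncation at 1 already tells zero from positive. For i = 0
  the kernel is that of the identity.\<close>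

lemma smooth_kernel_corner:
  assumes "i \<le> l" shows "smooth_kernel l (diag_kern (idx l) (\<lambda>p. if \<forall>j<i. cI p j = 0 then 1 else 0))"
proof (rule smooth_kernel_single)
  let ?f = "\<lambda>p. if \<forall>j<i. cI p j = 0 then 1 else 0 :: complex"
  show "schur (idx l) 1 (diag_kern (idx l) ?f)" by (rule schur_diag_kern) auto
  show "diag_kern (idx l) ?f \<in> kA l 1" unfolding ix.kerA_def
  proof (rule ix.tkerI)
    fix x y assume "diag_kern (idx l) ?f x y \<noteq> 0"
    hence "x = y \<and> x \<in> idx l" by (auto simp: diag_kern_def split: if_splits)
    thus "x \<in> idx l \<and> y \<in> idx l \<and> ix.admA l 1 x y" by (auto simp: ix.admA_def ix.dist1_def)
  next
    fix x y x' y' assume m: "x \<in> idx l" "y \<in> idx l" "x' \<in> idx l" "y' \<in> idx l"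
      and dd: "cI x - cI y = cI x' - cI y'" and rl: "ix.relA l 1 y y'"
    have e: "x = y \<longleftrightarrow> x' = y'"
    proof -
      have "x = y \<longleftrightarrow> cI x - cI y = (\<lambda>_. 0)" using inj_onD[OF ix.inj _ m(1,2)] by (auto simp: fun_eq_iff)
      moreover have "x' = y' \<longleftrightarrow> cI x' - cI y' = (\<lambda>_. 0)" using inj_onD[OF ix.inj _ m(3,4)] by (auto simp: fun_eq_iff)
      ultimately show ?thesis using dd by simp
    qed
    obtain a where a: "a \<le> l" "\<And>j. j < a \<Longrightarrow> cI y j = cI y' j" "a < l \<Longrightarrow> int 1 \<le> cI y a" "a < l \<Longrightarrow> int 1 \<le> cI y' a"
      using ix.relA_E[OF rl] by blast
    have "(\<forall>j<i. cI y j = 0) \<longleftrightarrow> (\<forall>j<i. cI y' j = 0)"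
    proof (cases "a < i")
      case True
      hence "1 \<le> cI y a" "1 \<le> cI y' a" using a assms by auto
      hence "cI y a \<noteq> 0" "cI y' a \<noteq> 0" by linarith+
      thus ?thesis using True by blast
    next
      case False thus ?thesis using a(2) by simp
    qed
    thus "diag_kern (idx l) ?f x y = diag_kern (idx l) ?f x' y'" using e m
      by (cases "x = y") (auto simp: diag_kern_def)
  qed
qed

lemma unital_star_algebra_C_eq: "unital_star_algebra (Gam l) (C_eq l)"
proof -
  have one: "id_op (Gam l) \<in> C_eq l"
    unfolding C_eq_iff diag_kern_id
    using smooth_kernel_corner[of 0 l] tens_diag[of l "\<lambda>_. 1"] by auto
  have "a \<in> bop (Gam l) \<and> c *\<^sub>o a \<in> C_eq l \<and> adj (Gam l) a \<in> C_eq l" if aC: "a \<in> C_eq l" for a c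
  proof -
    obtain K where K: "smooth_kernel l K" "a = kop (Gam l) (tens l K)" using aC C_eq_iff by blast
    obtain S where S: "schur (idx l) S K" using smooth_kernel_schur[OF K(1)] by blast
    have "c *\<^sub>o a = kop (Gam l) (tens l (\<lambda>x y. c * K x y))"
      unfolding K(2) kop_scale[symmetric] by (rule arg_cong[of _ _ "kop (Gam l)"]) (auto simp: tens_def fun_eq_iff)
    hence 1: "c *\<^sub>o a \<in> C_eq l" using smooth_kernel_scale[OF K(1)] C_eq_iff by blast
    have "kadj (tens l K) = tens l (kadj K)" by (auto simp: kadj_def tens_def fun_eq_iff)
    hence "adj (Gam l) a = kop (Gam l) (tens l (kadj K))" unfolding K(2) adj_kop[OF schur_tens[OF S]] by simp
    hence "adj (Gam l) a \<in> C_eq l" using smooth_kernel_kadj[OF K(1)] C_eq_iff by blast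
    thus ?thesis using 1 kop_bop[OF schur_tens[OF S]] K(2) by blast
  qed
  moreover have "a + b \<in> C_eq l \<and> a \<circ> b \<in> C_eq l" if aC: "a \<in> C_eq l" "b \<in> C_eq l" for a b
  proof -
    obtain K where K: "smooth_kernel l K" "a = kop (Gam l) (tens l K)" using aC C_eq_iff by blast
    obtain S where S: "schur (idx l) S K" using smooth_kernel_schur[OF K(1)] by blast
    obtain L where L: "smooth_kernel l L" "b = kop (Gam l) (tens l L)" using aC C_eq_iff by blast
    obtain S' where S': "schur (idx l) S' L" using smooth_kernel_schur[OF L(1)] by blast
    have "tens l K + tens l L = tens l (K + L)" by (auto simp: tens_def fun_eq_iff)
    hence "a + b = kop (Gam l) (tens l (K + L))"
      unfolding K(2) L(2) kop_add[OF schur_tens[OF S] schur_tens[OF S'], symmetric] by simp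
    moreover have "a \<circ> b = kop (Gam l) (tens l (kcomp K L))"
      unfolding K(2) L(2) kop_kcomp[OF schur_tens[OF S] schur_tens[OF S']] kcomp_tens ..
    ultimately show ?thesis using smooth_kernel_add[OF K(1) L(1)] smooth_kernel_kcomp[OF K(1) L(1)] C_eq_iff by blast
  qed
  ultimately show ?thesis unfolding unital_star_algebra_def using one by blast
qed

section \<open>Counting eigenvalues\<close>

lemma sum_list_bound_lists: "{xs :: nat list. length xs = m \<and> sum_list xs < r} \<subseteq> {xs. set xs \<subseteq> {..<r} \<and> length xs = m}"
  using member_le_sum_list by fastforce

lemma Gam_ball_subset:
  "{g\<in>Gam l. \<bar>d_eq g\<bar> < real r} \<subseteq> ({xs. set xs \<subseteq> {..<r} \<and> length xs = l} \<times> {- int r..int r}) \<times> {xs. set xs \<subseteq> {..<r} \<and> length xs = l}"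
proof
  fix g assume "g \<in> {g\<in>Gam l. \<bar>d_eq g\<bar> < real r}"
  hence g: "g \<in> Gam l" and s: "sz g < r" by (auto simp: abs_d_eq)
  have "fst (fst g) \<in> {xs. length xs = l \<and> sum_list xs < r}" "snd g \<in> {xs. length xs = l \<and> sum_list xs < r}"
    using g s by (auto simp: mem_Gam mem_idx sz_def)
  hence "fst (fst g) \<in> {xs. set xs \<subseteq> {..<r} \<and> length xs = l}" "snd g \<in> {xs. set xs \<subseteq> {..<r} \<and> length xs = l}"
    using sum_list_bound_lists[of l r] by blast+
  moreover have "snd (fst g) \<in> {- int r..int r}" using s by (auto simp: sz_def)
  ultimately show "g \<in> ({xs. set xs \<subseteq> {..<r} \<and> length xs = l} \<times> {- int r..int r}) \<times> {xs. set xs \<subseteq> {..<r} \<and> length xs = l}"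
    by (cases g) auto
qed

lemma
  shows Gam_ball_finite: "finite {g\<in>Gam l. \<bar>d_eq g\<bar> < real r}"
    and Gam_ball_card: "card {g\<in>Gam l. \<bar>d_eq g\<bar> < real r} \<le> (2 * r + 1) ^ (Suc (2 * l))"
proof -
  let ?L = "{xs :: nat list. set xs \<subseteq> {..<r} \<and> length xs = l}"
  have f: "finite ?L" by (rule finite_lists_length_eq) simp
  have c: "card ?L = r ^ l" by (subst card_lists_length_eq) auto
  have fin: "finite ((?L \<times> {- int r..int r}) \<times> ?L)" using f by simp
  show "finite {g\<in>Gam l. \<bar>d_eq g\<bar> < real r}" by (rule finite_subset[OF Gam_ball_subset fin])
  have "card {g\<in>Gam l. \<bar>d_eq g\<bar> < real r} \<le> card ((?L \<times> {- int r..int r}) \<times> ?L)"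
    by (rule card_mono[OF fin Gam_ball_subset])
  also have "\<dots> = r ^ l * (2 * r + 1) * r ^ l"
  proof -
    have "card {- int r..int r} = 2 * r + 1" by (simp add: nat_add_distrib)
    thus ?thesis by (simp only: card_cartesian_product c)
  qed
  also have "\<dots> \<le> (2 * r + 1) ^ l * (2 * r + 1) * (2 * r + 1) ^ l"
    by (intro mult_mono power_mono) auto
  also have "\<dots> = (2 * r + 1) ^ (l + 1 + l)" by (simp only: power_add power_one_right)
  also have "l + 1 + l = Suc (2 * l)" by simp
  finally show "card {g\<in>Gam l. \<bar>d_eq g\<bar> < real r} \<le> (2 * r + 1) ^ (Suc (2 * l))" .
qed

section \<open>Smooth kernels and their commutators in the larger class\<close>

lemma kA_kB_rel: 
  assumes "x \<in> Gam l" "y \<in> Gam l" "x' \<in> Gam l" "y' \<in> Gam l" and dd: "cG x - cG y = cG x' - cG y'"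
  shows "snd x = snd y \<longleftrightarrow> snd x' = snd y'" and "cI (fst x) - cI (fst y) = cI (fst x') - cI (fst y')"
proof -
  have d: "cG x i - cG y i = cG x' i - cG y' i" for i by (rule gm.co_diffD[OF dd])
  show "snd x = snd y \<longleftrightarrow> snd x' = snd y'"
    unfolding snd_eq_iff[OF assms(1,2)] snd_eq_iff[OF assms(3,4)] using d by (metis diff_eq_diff_eq)
  show "cI (fst x) - cI (fst y) = cI (fst x') - cI (fst y')"
  proof
    fix i
    show "(cI (fst x) - cI (fst y)) i = (cI (fst x') - cI (fst y')) i"
    proof (cases "i \<le> l")
      case True thus ?thesis using d[of i] assms(1-4) by (simp add: cG_low)
    next
      case False
      hence "cI (fst g) i = 0" if "g \<in> Gam l" for g using ix.mem_img0[of "fst g" l i] that by (simp add: mem_Gam)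
      thus ?thesis using assms by simp
    qed
  qed
qed

lemma relB_relA_fst: "y \<in> Gam l \<Longrightarrow> y' \<in> Gam l \<Longrightarrow> gm.relB l R y y' \<Longrightarrow> ix.relA l R (fst y) (fst y')"
proof (rule ix.relB_relA)
  assume m: "y \<in> Gam l" "y' \<in> Gam l" and r: "gm.relB l R y y'"
  show "fst y \<in> idx l" "fst y' \<in> idx l" using m by (auto simp: mem_Gam)
  show "ix.relB l R (fst y) (fst y')" unfolding ix.relB_def
  proof (intro allI impI)
    fix i assume "i < Suc l"
    thus "cI (fst y) i = cI (fst y') i \<or> int R \<le> cI (fst y) i \<and> int R \<le> cI (fst y') i \<or> cI (fst y) i \<le> - int R \<and> cI (fst y') i \<le> - int R"
      using gm.relB_D[OF r, of i] m by (simp add: cG_low)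
  qed
qed simp

lemma dist1_fst:
  assumes "x \<in> Gam l" "y \<in> Gam l" "snd x = snd y" shows "gm.dist1 l x y = ix.dist1 l (fst x) (fst y)"
proof -
  have "(\<Sum>j<l. \<bar>cG x (Suc (l + j)) - cG y (Suc (l + j))\<bar>) = 0"
    by (rule sum.neutral) (use assms in \<open>auto simp: cG_high\<close>)
  moreover have "(\<Sum>i<Suc l. \<bar>cG x i - cG y i\<bar>) = (\<Sum>i<Suc l. \<bar>cI (fst x) i - cI (fst y) i\<bar>)"
    by (rule sum.cong) (use assms in \<open>auto simp: cG_low\<close>)
  ultimately show ?thesis unfolding gm.dist1_def sum_split_coords ix.dist1_def by simp
qed

lemma tens_mem:
  assumes K: "K \<in> kA l n" and nz: "tens l K x y \<noteq> 0"
  shows "x \<in> Gam l" "y \<in> Gam l" "snd x = snd y" "ix.admA l n (fst x) (fst y)" "gm.dist1 l x y \<le> int n"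
proof -
  have t: "snd x = snd y" "length (snd x) = l" "length (snd y) = l" "K (fst x) (fst y) \<noteq> 0" using tens_nonzeroD[OF nz] by auto
  have m: "fst x \<in> idx l" "fst y \<in> idx l" "ix.admA l n (fst x) (fst y)" using ix.tkerD1[OF K[unfolded ix.kerA_def] t(4)] by auto
  show 1: "x \<in> Gam l" "y \<in> Gam l" using m t by (auto simp: mem_Gam)
  show "snd x = snd y" "ix.admA l n (fst x) (fst y)" using t m by auto
  show "gm.dist1 l x y \<le> int n" unfolding dist1_fst[OF 1 t(1)] by (rule ix.admA_dist[OF m(3)])
qed

lemma tens_kB: "K \<in> kA l n \<Longrightarrow> tens l K \<in> kB l n"
  unfolding gm.kerB_def
proof (rule gm.tkerI)
  assume K: "K \<in> kA l n"
  show "x \<in> Gam l \<and> y \<in> Gam l \<and> gm.admB l n x y" if "tens l K x y \<noteq> 0" for x y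
    using tens_mem[OF K that] by (simp add: gm.admB_def)
  fix x y x' y' assume m: "x \<in> Gam l" "y \<in> Gam l" "x' \<in> Gam l" "y' \<in> Gam l"
    and dd: "cG x - cG y = cG x' - cG y'" and r: "gm.relB l n y y'"
  have "K (fst x) (fst y) = K (fst x') (fst y')"
    by (rule ix.tkerD2[OF K[unfolded ix.kerA_def] _ _ _ _ kA_kB_rel(2)[OF m dd] relB_relA_fst[OF m(2,4) r]])
       (use m in \<open>auto simp: mem_Gam\<close>)
  thus "tens l K x y = tens l K x' y'" using kA_kB_rel(1)[OF m dd] m by (auto simp: tens_def mem_Gam)
qed

lemma eq_kernel_tens: "smooth_kernel l K \<Longrightarrow> eq_kernel l (tens l K)"
proof -
  assume "smooth_kernel l K"
  then obtain s where K: "rapid (idx l) (kA l) K s" by (auto simp: smooth_kernel_def)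
  have "\<exists>u. rapid (Gam l) (kB l) (\<lambda>x y. (if snd x = snd y \<and> length (snd x) = l then 1 else 0) * K (fst x) (fst y)) u"
  proof (rule rapid_multiplier[OF K, where r="\<lambda>n. n" and a=1 and c=1])
    fix n s and K :: "(nat list \<times> int) kern" assume K: "K \<in> kA l n"
    show "(\<lambda>x y. (if snd x = snd y \<and> length (snd x) = l then 1 else 0) * K (fst x) (fst y)) \<in> kB l n"
      using tens_kB[OF K] unfolding tens_def[abs_def] .
    assume s: "schur (idx l) s K"
    have "schur (Gam l) (1 * (1 + real n) * s) (tens l K)"
      by (rule schur_mono[OF schur_tens[OF s]]) (use schur_nonneg[OF s] in \<open>simp add: mult_le_cancel_right1\<close>)
    thus "schur (Gam l) (1 * (1 + real n) * s) (\<lambda>x y. (if snd x = snd y \<and> length (snd x) = l then 1 else 0) * K (fst x) (fst y))"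
      unfolding tens_def[abs_def] .
  qed (auto intro: gm.kerB_infsum)
  thus ?thesis unfolding eq_kernel_def tens_def[abs_def] .
qed

text \<open>If the sign of \<open>D\<close> changes between \<open>y\<close> and \<open>x\<close> then the \<open>\<int>\<close>-coordinate changes, which
  a kernel of radius \<open>n\<close> in the smooth algebra allows only at points whose other coordinates are below \<open>n\<close>.\<close>

lemma sign_change_small:
  assumes K: "K \<in> kA l n" and nz: "tens l K x y \<noteq> 0" and ch: "sgn_eq x \<noteq> sgn_eq y"
  shows "\<And>i. i < l \<Longrightarrow> cG y i < int n" "\<And>i. l < i \<Longrightarrow> cG y i = 0" "\<bar>cG y l\<bar> \<le> int n"
    "int (sz y) \<le> (int l + 1) * int n"
proof -
  note t = tens_mem[OF K nz]
  have nx: "cI (fst g) l = snd (fst g)" if "g \<in> Gam l" for g using that by (simp add: cI_def mem_Gam mem_idx)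
  have w0: "\<forall>i\<in>set (snd y). i = 0" using ch t(3) by (auto simp: sgn_eq_def)
  have sg: "(0 \<le> snd (fst x)) \<noteq> (0 \<le> snd (fst y))" using ch t(3) by (auto simp: sgn_eq_def)
  hence ne: "cI (fst x) l \<noteq> cI (fst y) l" using nx t(1,2) by auto
  show 1: "cG y i < int n" if "i < l" for i
  proof (rule ccontr)
    assume "\<not> cG y i < int n"
    hence "int n \<le> cI (fst y) i" using cG_low[OF t(2), of i] that by simp
    hence "cI (fst x) l = cI (fst y) l" using ix.admA_D[OF t(4) that _ that] by simp
    thus False using ne by simp
  qed
  show 2: "cG y i = 0" if "l < i" for i
  proof (cases "i < Suc (2 * l)")
    case True
    have len: "i - Suc l < length (snd y)" using True that t(2) by (simp add: mem_Gam)
    have "cG y i = int (snd y ! (i - Suc l))" using cG_high[OF t(2), of "i - Suc l"] True that by simp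
    thus ?thesis using w0 nth_mem[OF len] by simp
  qed (use cG_zero[OF t(2)] in simp)
  have "\<bar>cG x l - cG y l\<bar> \<le> int n" using gm.dist1_bound[of l l x y] t(5) by simp
  moreover have "cG x l = snd (fst x)" "cG y l = snd (fst y)" using nx t(1,2) by (auto simp: cG_low)
  ultimately show 3: "\<bar>cG y l\<bar> \<le> int n" using sg by linarith
  have "int (sz y) = (\<Sum>i<l. \<bar>cG y i\<bar>) + \<bar>cG y l\<bar> + (\<Sum>j<l. \<bar>cG y (Suc (l + j))\<bar>)"
    unfolding size1_sz[OF t(2), symmetric] gm.size1_def sum_split_coords by simp
  also have "(\<Sum>j<l. \<bar>cG y (Suc (l + j))\<bar>) = 0" by (rule sum.neutral) (simp add: 2)
  also have "(\<Sum>i<l. \<bar>cG y i\<bar>) \<le> (\<Sum>i<l. int n)"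
  proof (rule sum_mono)
    fix i assume "i \<in> {..<l}"
    thus "\<bar>cG y i\<bar> \<le> int n" using 1[of i] gm.mem_img[OF t(2), of i] by simp
  qed
  finally show "int (sz y) \<le> (int l + 1) * int n" using 3 by (simp add: algebra_simps)
qed

text \<open>Without a sign change the sizes differ by at most n. With one, the size at y is at most
  (l + 1) n and the size at x exceeds it by at most n, so the eigenvalues differ by at most n + 2 (l
  + 1) n.\<close>

lemma d_eq_diff_bound:
  assumes K: "K \<in> kA l n" and nz: "tens l K x y \<noteq> 0"
  shows "\<bar>d_eq x - d_eq y\<bar> \<le> (2 * real l + 3) * (1 + real n)"
proof -
  note t = tens_mem[OF K nz]
  have "\<bar>int (sz x) - int (sz y)\<bar> \<le> int n"
    using gm.size1_diff[of l x y] t(5) by (simp add: size1_sz t(1,2))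
  hence s: "\<bar>real (sz x) - real (sz y)\<bar> \<le> real n" by linarith
  show ?thesis
  proof (cases "sgn_eq x = sgn_eq y")
    case True
    hence "\<bar>d_eq x - d_eq y\<bar> = \<bar>real (sz x) - real (sz y)\<bar>" by (auto simp: d_eq_sz)
    also have "\<dots> \<le> 1 * (1 + real n)" using s by simp
    also have "\<dots> \<le> (2 * real l + 3) * (1 + real n)" by (intro mult_right_mono) auto
    finally show ?thesis .
  next
    case False
    have "real_of_int (int (sz y)) \<le> real_of_int ((int l + 1) * int n)"
      using sign_change_small(4)[OF K nz False] by (simp only: of_int_le_iff)
    hence y: "real (sz y) \<le> (real l + 1) * real n" by simp
    have "\<bar>d_eq x - d_eq y\<bar> \<le> real (sz x) + real (sz y)" by (auto simp: d_eq_sz)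
    also have "\<dots> \<le> real n + 2 * real (sz y)" using s by linarith
    also have "\<dots> \<le> real n + 2 * ((real l + 1) * real n)" using y by simp
    also have "\<dots> \<le> (2 * real l + 3) * (1 + real n)" by (simp add: algebra_simps)
    finally show ?thesis .
  qed
qed

text \<open>Raising the threshold to n + 1 makes truncation faithful at the columns where the sign
  can change, and keeps the sign visible elsewhere.\<close>

lemma dirac_kB:
  assumes K: "K \<in> kA l n"
  shows "(\<lambda>x y. complex_of_real (d_eq x - d_eq y) * tens l K x y) \<in> kB l (Suc n)"
  unfolding gm.kerB_def
proof (rule gm.tkerI)
  fix x y assume "complex_of_real (d_eq x - d_eq y) * tens l K x y \<noteq> 0"
  hence "tens l K x y \<noteq> 0" by auto
  from tens_mem[OF K this] show "x \<in> Gam l \<and> y \<in> Gam l \<and> gm.admB l (Suc n) x y" by (simp add: gm.admB_def)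
next
  fix x y x' y' assume m: "x \<in> Gam l" "y \<in> Gam l" "x' \<in> Gam l" "y' \<in> Gam l"
    and dd: "cG x - cG y = cG x' - cG y'" and r: "gm.relB l (Suc n) y y'"
  have r': "gm.relB l n y y'" by (rule gm.relB_mono[OF r]) simp
  have KK: "tens l K x y = tens l K x' y'"
    by (rule gm.tkerD2[OF tens_kB[OF K, unfolded gm.kerB_def] m dd r'])
  show "complex_of_real (d_eq x - d_eq y) * tens l K x y = complex_of_real (d_eq x' - d_eq y') * tens l K x' y'"
  proof (cases "tens l K x y = 0")
    case False
    note t = tens_mem[OF K False]
    have False': "tens l K x' y' \<noteq> 0" using False KK by simp
    note t' = tens_mem[OF K False']
    have sd: "int (sz x) - int (sz y) = int (sz x') - int (sz y')"
      using gm.size1_diff_cong[OF m dd r' t(5)] by (simp add: size1_sz m)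
    have nn: "cG g l = snd (fst g)" if "g \<in> Gam l" for g
      using that by (simp add: cG_low) (simp add: cI_def mem_Gam mem_idx)
    have rl: "cG y l = cG y' l \<or> (int (Suc n) \<le> cG y l \<and> int (Suc n) \<le> cG y' l) \<or> (cG y l \<le> - int (Suc n) \<and> cG y' l \<le> - int (Suc n))"
      using gm.relB_D[OF r, of l] by simp
    have xy: "\<bar>cG x l - cG y l\<bar> \<le> int n" using gm.dist1_bound[of l l x y] t(5) by simp
    have dl: "cG x l - cG y l = cG x' l - cG y' l" by (rule gm.co_diffD[OF dd])
    \<comment> \<open>The threshold is at least 1 even for n = 0, so truncation distinguishes a zero
      entry from a positive one.\<close>
    have w: "(\<forall>i\<in>set (snd y). i = 0) \<longleftrightarrow> (\<forall>i\<in>set (snd y'). i = 0)"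
    proof -
      have e: "(\<forall>i\<in>set (snd g). i = 0) \<longleftrightarrow> (\<forall>j<l. cG g (Suc (l + j)) = 0)" if "g \<in> Gam l" for g
        using that by (auto simp: cG_high all_set_conv_all_nth mem_Gam)
      have "cG y (Suc (l + j)) = 0 \<longleftrightarrow> cG y' (Suc (l + j)) = 0" if "j < l" for j
        using gm.relB_D[OF r, of "Suc (l + j)"] that by auto
      thus ?thesis unfolding e[OF m(2)] e[OF m(4)] by simp
    qed
    have sy: "sgn_eq y = sgn_eq y'" using w rl by (auto simp: sgn_eq_def nn[OF m(2), symmetric] nn[OF m(4), symmetric])
    have sx: "sgn_eq x = sgn_eq x'"
    proof -
      \<comment> \<open>Beyond n + 1 a step of length at most n cannot cross zero.\<close>
      have "(0 \<le> cG x l) = (0 \<le> cG x' l)" using rl xy dl by linarith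
      thus ?thesis using w t(3) t'(3) by (auto simp: sgn_eq_def nn[OF m(1), symmetric] nn[OF m(3), symmetric])
    qed
    have "d_eq x - d_eq y = d_eq x' - d_eq y'"
    proof (cases "sgn_eq x = sgn_eq y")
      case True
      have "real (sz x) - real (sz y) = real (sz x') - real (sz y')" using sd by linarith
      thus ?thesis using True sx sy by (auto simp: d_eq_sz)
    next
      case ch: False
      \<comment> \<open>The column y lies where truncation at n + 1 is the identity. Hence y = y',
        then x = x', and nothing remains to be compared.\<close>
      note sm = sign_change_small[OF K False ch]
      have "cG y i = cG y' i" for i
      proof (cases "i < Suc (2 * l)")
        case i: True
        consider "i < l" | "i = l" | "l < i" by linarith
        thus ?thesis
        proof cases
          case 1
          have "0 \<le> cG y i" using gm.mem_img[OF m(2) i] 1 by simp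
          thus ?thesis using sm(1)[OF 1] gm.relB_D[OF r i] by auto
        next
          case 2 thus ?thesis using sm(3) rl by auto
        next
          case 3 thus ?thesis using sm(2)[OF 3] gm.relB_D[OF r i] by auto
        qed
      qed (use gm.mem_img0 m in simp)
      hence "cG y = cG y'" by (rule ext)
      hence e: "y = y'" by (rule inj_onD[OF gm.inj _ m(2,4)])
      have "cG x i = cG x' i" for i using gm.co_diffD[OF dd, of i] e by simp
      hence "cG x = cG x'" by (rule ext)
      hence "x = x'" by (rule inj_onD[OF gm.inj _ m(1,3)])
      thus ?thesis using e by simp
    qed
    thus ?thesis using KK by simp
  qed (use KK in simp)
qed

lemma eq_kernel_dirac:
  assumes "smooth_kernel l K" shows "eq_kernel l (\<lambda>x y. complex_of_real (d_eq x - d_eq y) * tens l K x y)"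
proof -
  obtain s where K: "rapid (idx l) (kA l) K s" using assms by (auto simp: smooth_kernel_def)
  let ?\<phi> = "\<lambda>x y. complex_of_real (d_eq x - d_eq y) * (if snd x = snd y \<and> length (snd x) = l then 1 else 0)"
  have eq: "(\<lambda>x y. ?\<phi> x y * K (fst x) (fst y)) = (\<lambda>x y. complex_of_real (d_eq x - d_eq y) * tens l K x y)" for K
    by (simp add: tens_def mult.assoc)
  have "\<exists>u. rapid (Gam l) (kB l) (\<lambda>x y. ?\<phi> x y * K (fst x) (fst y)) u"
  proof (rule rapid_multiplier[OF K, where r=Suc and a=1 and c="2 * real l + 3"])
    fix n s and K :: "(nat list \<times> int) kern" assume K: "K \<in> kA l n"
    show "(\<lambda>x y. ?\<phi> x y * K (fst x) (fst y)) \<in> kB l (Suc n)" unfolding eq by (rule dirac_kB[OF K])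
    assume s: "schur (idx l) s K"
    show "schur (Gam l) ((2 * real l + 3) * (1 + real n) * s) (\<lambda>x y. ?\<phi> x y * K (fst x) (fst y))"
      unfolding eq
    proof (rule schur_dominated[OF schur_tens[OF s]])
      show "cmod (complex_of_real (d_eq x - d_eq y) * tens l K x y) \<le> (2 * real l + 3) * (1 + real n) * cmod (tens l K x y)" for x y
        using d_eq_diff_bound[OF K, of x y] by (cases "tens l K x y = 0") (auto simp: norm_mult simp del: of_real_diff intro!: mult_right_mono)
    qed simp
  qed (auto intro: gm.kerB_infsum)
  thus ?thesis unfolding eq eq_kernel_def .
qed

lemma eq_kernel_delta:
  assumes "eq_kernel l K" shows "eq_kernel l (\<lambda>x y. complex_of_real (\<bar>d_eq x\<bar> - \<bar>d_eq y\<bar>) * K x y)"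
proof -
  obtain s where K: "rapid (Gam l) (kB l) K s" using assms by (auto simp: eq_kernel_def)
  have eq: "(\<lambda>x y. complex_of_real (\<bar>d_eq x\<bar> - \<bar>d_eq y\<bar>) * K x y) = (\<lambda>x y. of_int (gm.size1 l x - gm.size1 l y) * K x y)"
    if K: "K \<in> kB l n" for K n
  proof (intro ext)
    fix x y
    show "complex_of_real (\<bar>d_eq x\<bar> - \<bar>d_eq y\<bar>) * K x y = of_int (gm.size1 l x - gm.size1 l y) * K x y"
    proof (cases "K x y = 0")
      case False
      hence "x \<in> Gam l" "y \<in> Gam l" using gm.tkerD1[OF K[unfolded gm.kerB_def]] by blast+
      thus ?thesis by (simp add: size1_sz abs_d_eq)
    qed simp
  qed
  have "\<exists>u. rapid (Gam l) (kB l) (\<lambda>x y. complex_of_real (\<bar>d_eq x\<bar> - \<bar>d_eq y\<bar>) * K x y) u"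
  proof (rule rapid_multiplier[OF K, where r="\<lambda>n. n" and a=1 and c=1 and p="\<lambda>x. x"])
    fix n s and K :: "pt kern" assume K: "K \<in> kB l n"
    show "(\<lambda>x y. complex_of_real (\<bar>d_eq x\<bar> - \<bar>d_eq y\<bar>) * K x y) \<in> kB l n"
      unfolding eq[OF K] by (rule gm.kerB_delta[OF K])
    assume s: "schur (Gam l) s K"
    show "schur (Gam l) (1 * (1 + real n) * s) (\<lambda>x y. complex_of_real (\<bar>d_eq x\<bar> - \<bar>d_eq y\<bar>) * K x y)"
      unfolding mult_1 eq[OF K]
    proof (rule schur_dominated[OF s])
      fix x y
      show "cmod (of_int (gm.size1 l x - gm.size1 l y) * K x y) \<le> (1 + real n) * cmod (K x y)"
      proof (cases "K x y = 0")
        case False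
        hence "gm.dist1 l x y \<le> int n" using gm.tkerD1[OF K[unfolded gm.kerB_def]] by (auto simp: gm.admB_def)
        hence "\<bar>gm.size1 l x - gm.size1 l y\<bar> \<le> int n" using gm.size1_diff[of l x y] by linarith
        from abs_int_le_real[OF this] show ?thesis
          by (simp add: norm_mult norm_of_int del: of_int_diff) (intro mult_right_mono, auto)
      qed simp
    qed simp
  qed (auto intro: gm.kerB_infsum)
  thus ?thesis unfolding eq_kernel_def .
qed

section \<open>Regularity and the algebra generated by derivatives\<close>

lemma eq_kernel_add: "eq_kernel l K \<Longrightarrow> eq_kernel l L \<Longrightarrow> eq_kernel l (K + L)"
  unfolding eq_kernel_def by (blast intro: rapid_add gm.kerB_add)

lemma eq_kernel_kcomp: "eq_kernel l K \<Longrightarrow> eq_kernel l L \<Longrightarrow> eq_kernel l (kcomp K L)"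
  unfolding eq_kernel_def
  by (elim exE, rule rapid_kcomp) (auto intro: gm.kerB_infsum gm.kerB_kcomp)

lemma eq_kernel_scale: "eq_kernel l K \<Longrightarrow> eq_kernel l (\<lambda>x y. c * K x y)"
  unfolding eq_kernel_def
proof (elim exE)
  fix s assume "rapid (Gam l) (kB l) K s"
  thus "\<exists>s. rapid (Gam l) (kB l) (\<lambda>x y. c * K x y) s"
  proof (rule rapid_multiplier[where p="\<lambda>x. x" and r="\<lambda>n. n" and a=1 and c="cmod c"])
    fix n s and K :: "pt kern" assume "K \<in> kB l n" "schur (Gam l) s K"
    show "schur (Gam l) (cmod c * (1 + real n) * s) (\<lambda>x y. c * K x y)"
      by (rule schur_mono[OF schur_scale[OF \<open>schur (Gam l) s K\<close>]])
         (use schur_nonneg[OF \<open>schur (Gam l) s K\<close>] in \<open>auto intro!: mult_right_mono simp: mult_le_cancel_left1\<close>)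
  qed (auto intro: gm.kerB_infsum gm.kerB_scale)
qed

lemma commutator_D_eq:
  assumes "smooth_kernel l K"
  shows "is_commutator (Gam l) (D_eq l) (kop (Gam l) (tens l K)) (kop (Gam l) (\<lambda>x y. complex_of_real (d_eq x - d_eq y) * tens l K x y))"
    and "commutator (Gam l) (D_eq l) (kop (Gam l) (tens l K)) = kop (Gam l) (\<lambda>x y. complex_of_real (d_eq x - d_eq y) * tens l K x y)"
proof -
  obtain S where S: "schur (Gam l) S (tens l K)" using smooth_kernel_schur[OF assms] schur_tens by blast
  obtain S' where S': "schur (Gam l) S' (\<lambda>x y. complex_of_real (d_eq x - d_eq y) * tens l K x y)"
    using eq_kernel_schur[OF eq_kernel_dirac[OF assms]] by blast
  show "is_commutator (Gam l) (D_eq l) (kop (Gam l) (tens l K)) (kop (Gam l) (\<lambda>x y. complex_of_real (d_eq x - d_eq y) * tens l K x y))"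
    unfolding D_eq_diag by (rule is_commutator_diag[OF S S'])
  show "commutator (Gam l) (D_eq l) (kop (Gam l) (tens l K)) = kop (Gam l) (\<lambda>x y. complex_of_real (d_eq x - d_eq y) * tens l K x y)"
    unfolding D_eq_diag by (rule commutator_diag[OF S S'])
qed

lemma delta_eq_kernel:
  assumes "eq_kernel l K"
  shows "kop (Gam l) K \<in> delta_dom (Gam l) (D_eq l)"
    and "delta (Gam l) (D_eq l) (kop (Gam l) K) = kop (Gam l) (\<lambda>x y. complex_of_real (\<bar>d_eq x\<bar> - \<bar>d_eq y\<bar>) * K x y)"
proof -
  obtain S where S: "schur (Gam l) S K" using eq_kernel_schur[OF assms] by blast
  obtain S' where S': "schur (Gam l) S' (\<lambda>x y. complex_of_real (\<bar>d_eq x\<bar> - \<bar>d_eq y\<bar>) * K x y)"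
    using eq_kernel_schur[OF eq_kernel_delta[OF assms]] by blast
  show "kop (Gam l) K \<in> delta_dom (Gam l) (D_eq l)"
    unfolding delta_dom_def D_eq_diag abs_uop_diag using is_commutator_diag[OF S S'] kop_bop[OF S] by blast
  show "delta (Gam l) (D_eq l) (kop (Gam l) K) = kop (Gam l) (\<lambda>x y. complex_of_real (\<bar>d_eq x\<bar> - \<bar>d_eq y\<bar>) * K x y)"
    unfolding delta_def D_eq_diag abs_uop_diag by (rule commutator_diag[OF S S'])
qed

lemma eq_kernel_OP0:
  assumes "eq_kernel l K" shows "kop (Gam l) K \<in> OP0 (Gam l) (D_eq l)"
proof -
  have "eq_kernel l K \<Longrightarrow> kop (Gam l) K \<in> delta_pow_dom (Gam l) (D_eq l) n" for n K
  proof (induction n arbitrary: K)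
    case 0
    thus ?case using eq_kernel_schur kop_bop by fastforce
  next
    case (Suc n)
    show ?case using delta_eq_kernel[OF Suc.prems] Suc.IH[OF eq_kernel_delta[OF Suc.prems]] by simp
  qed
  thus ?thesis using assms by (simp add: OP0_def)
qed

text \<open>Elements of the algebra and their commutators with D lie in the larger class, which is
  stable under \<open>delta\<close> and under the algebra operations.\<close>

lemma B_alg_eq_kernel:
  assumes "b \<in> B_alg (Gam l) (C_eq l) (D_eq l)" shows "\<exists>K. eq_kernel l K \<and> b = kop (Gam l) K"
proof -
  have pow: "\<exists>K. eq_kernel l K \<and> (delta (Gam l) (D_eq l) ^^ n) a = kop (Gam l) K" if "\<exists>K. eq_kernel l K \<and> a = kop (Gam l) K" for a n
  proof (induction n)
    case (Suc n)
    then obtain K where K: "eq_kernel l K" "(delta (Gam l) (D_eq l) ^^ n) a = kop (Gam l) K" by blast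
    have "(delta (Gam l) (D_eq l) ^^ Suc n) a = delta (Gam l) (D_eq l) (kop (Gam l) K)"
      by (simp only: funpow.simps(2) o_apply K(2))
    thus ?case using delta_eq_kernel(2)[OF K(1)] eq_kernel_delta[OF K(1)] by auto
  qed (use that in simp)
  show ?thesis using assms unfolding B_alg_def
  proof (induction rule: generated_algebra.induct)
    case (gen a)
    hence "\<exists>n c. c \<in> C_eq l \<and> (a = (delta (Gam l) (D_eq l) ^^ n) c \<or> a = (delta (Gam l) (D_eq l) ^^ n) (commutator (Gam l) (D_eq l) c))"
      by (elim UN_E UnE imageE) blast+
    then obtain n c where c: "c \<in> C_eq l" "a = (delta (Gam l) (D_eq l) ^^ n) c \<or> a = (delta (Gam l) (D_eq l) ^^ n) (commutator (Gam l) (D_eq l) c)"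
      by blast
    obtain K where K: "smooth_kernel l K" "c = kop (Gam l) (tens l K)" using c(1) C_eq_iff by blast
    have "\<exists>L. eq_kernel l L \<and> c = kop (Gam l) L" using eq_kernel_tens[OF K(1)] K(2) by blast
    moreover have "\<exists>L. eq_kernel l L \<and> commutator (Gam l) (D_eq l) c = kop (Gam l) L"
      using eq_kernel_dirac[OF K(1)] commutator_D_eq(2)[OF K(1)] K(2) by blast
    ultimately show ?case using pow[of c n] pow[of "commutator (Gam l) (D_eq l) c" n] c(2) by metis
  next
    case (add a b)
    then obtain K L where KL: "eq_kernel l K" "a = kop (Gam l) K" "eq_kernel l L" "b = kop (Gam l) L" by blast
    obtain S S' where S: "schur (Gam l) S K" "schur (Gam l) S' L" using eq_kernel_schur KL by blast
    show ?case using eq_kernel_add[OF KL(1,3)] kop_add[OF S] KL by metis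
  next
    case (scale a c)
    then obtain K where K: "eq_kernel l K" "a = kop (Gam l) K" by blast
    show ?case using eq_kernel_scale[OF K(1), of c] kop_scale[of "Gam l" c K] K(2) by metis
  next
    case (mult a b)
    then obtain K L where KL: "eq_kernel l K" "a = kop (Gam l) K" "eq_kernel l L" "b = kop (Gam l) L" by blast
    obtain S S' where S: "schur (Gam l) S K" "schur (Gam l) S' L" using eq_kernel_schur KL by blast
    show ?case using eq_kernel_kcomp[OF KL(1,3)] kop_kcomp[OF S] KL by metis
  qed
qed

lemma spectral_triple_eq: "spectral_triple (Gam l) (C_eq l) (D_eq l)"
  unfolding spectral_triple_def
proof (intro conjI ballI)
  show cnt: "countable (Gam l)" by (rule countable_subset[OF subset_UNIV]) simp
  show "unital_star_algebra (Gam l) (C_eq l)" by (rule unital_star_algebra_C_eq)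
  show "selfadjoint (Gam l) (D_eq l)" unfolding D_eq_diag by (rule selfadjoint_diag)
  show "compact_resolvent (Gam l) (D_eq l)" unfolding D_eq_diag
  proof (rule compact_resolvent_diag[OF cnt])
    fix r :: real
    obtain n :: nat where n: "r < real n" using reals_Archimedean2 by blast
    show "finite {x\<in>Gam l. \<bar>d_eq x\<bar> \<le> r}" by (rule finite_subset[OF _ Gam_ball_finite[of l n]]) (use n in auto)
  qed
  fix a assume "a \<in> C_eq l"
  then obtain K where "smooth_kernel l K" "a = kop (Gam l) (tens l K)" using C_eq_iff by blast
  thus "\<exists>T. is_commutator (Gam l) (D_eq l) a T" using commutator_D_eq(1) by blast
qed

lemma regular_triple_eq: "regular_triple (Gam l) (C_eq l) (D_eq l)"
  unfolding regular_triple_def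
proof (intro ballI)
  fix a assume "a \<in> C_eq l"
  then obtain K where K: "smooth_kernel l K" "a = kop (Gam l) (tens l K)" using C_eq_iff by blast
  show "a \<in> OP0 (Gam l) (D_eq l) \<and> commutator (Gam l) (D_eq l) a \<in> OP0 (Gam l) (D_eq l)"
    unfolding K(2) commutator_D_eq(2)[OF K(1)]
    using eq_kernel_OP0[OF eq_kernel_tens[OF K(1)]] eq_kernel_OP0[OF eq_kernel_dirac[OF K(1)]] by blast
qed

section \<open>The dimension spectrum\<close>

definition level :: "nat \<Rightarrow> nat \<Rightarrow> nat list set" where
  "level m r = {xs. length xs = m \<and> sum_list xs = r}"

definition lvl :: "nat \<Rightarrow> (nat list \<Rightarrow> complex) \<Rightarrow> complex fps" where
  "lvl m f = Abs_fps (\<lambda>r. \<Sum>xs\<in>level m r. f xs)"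

lemma finite_level: "finite (level m r)"
proof (rule finite_subset)
  show "level m r \<subseteq> {xs. set xs \<subseteq> {..r} \<and> length xs = m}" using member_le_sum_list by (fastforce simp: level_def)
qed (rule finite_lists_length_eq, simp)

lemma lvl_nth: "lvl m f $ r = (\<Sum>xs\<in>level m r. f xs)" by (simp add: lvl_def)

lemma lvl_cong: "(\<And>xs. length xs = m \<Longrightarrow> f xs = g xs) \<Longrightarrow> lvl m f = lvl m g"
  unfolding lvl_def by (rule arg_cong[of _ _ Abs_fps], rule ext, rule sum.cong) (auto simp: level_def)

lemma lvl_zero: "lvl m (\<lambda>_. 0) = 0"
  by (simp add: lvl_def fps_eq_iff)

lemma lvl_0: "lvl 0 f = fps_const (f [])"
proof -
  have "level 0 r = (if r = 0 then {[]} else {})" for r by (auto simp: level_def)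
  thus ?thesis by (simp add: lvl_def fps_eq_iff)
qed

lemma lvl_Suc_nth: "lvl (Suc m) f $ r = (\<Sum>i=0..r. lvl m (\<lambda>xs. f (i # xs)) $ (r - i))"
proof -
  have e: "level (Suc m) r = (\<lambda>(i, xs). i # xs) ` (SIGMA i:{0..r}. level m (r - i))"
  proof (intro equalityI subsetI)
    fix ys assume "ys \<in> level (Suc m) r"
    then obtain i xs where "ys = i # xs" "length xs = m" "i + sum_list xs = r"
      by (auto simp: level_def length_Suc_conv)
    thus "ys \<in> (\<lambda>(i, xs). i # xs) ` (SIGMA i:{0..r}. level m (r - i))"
      by (intro image_eqI[of _ _ "(i, xs)"]) (auto simp: level_def)
  qed (auto simp: level_def)
  show ?thesis unfolding lvl_nth e
    by (subst sum.reindex) (auto simp: inj_on_def sum.Sigma finite_level split_beta)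
qed

text \<open>Split by the first entry: from R on the inner generating function is constant, and the
  geometric series starting at X^R collects these entries.\<close>

lemma lvl_Suc:
  assumes "\<And>i xs. R \<le> i \<Longrightarrow> length xs = m \<Longrightarrow> f (i # xs) = f (R # xs)"
  shows "lvl (Suc m) f = (\<Sum>i<R. fps_X ^ i * lvl m (\<lambda>xs. f (i # xs))) + fps_X ^ R * geo * lvl m (\<lambda>xs. f (R # xs))"
proof (rule fps_ext)
  fix r
  let ?F = "\<lambda>i. lvl m (\<lambda>xs. f (i # xs))"
  have F: "?F i = ?F R" if "R \<le> i" for i by (rule lvl_cong) (rule assms[OF that])
  have gR: "(fps_X ^ R * geo) $ j = (if j < R then 0 else 1)" for j by (simp add: fps_X_power_mult_nth geo_def)
  have "lvl (Suc m) f $ r = (\<Sum>j=0..r. (if j < R then ?F j $ (r - j) else 0) + (if j < R then 0 else ?F R $ (r - j)))"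
    unfolding lvl_Suc_nth
  proof (rule sum.cong[OF refl])
    fix j
    show "?F j $ (r - j) = (if j < R then ?F j $ (r - j) else 0) + (if j < R then 0 else ?F R $ (r - j))"
    proof (cases "j < R")
      case False
      hence "?F j = ?F R" by (intro F) simp
      thus ?thesis using False by simp
    qed simp
  qed
  also have "\<dots> = (\<Sum>j=0..r. if j < R then ?F j $ (r - j) else 0) + (\<Sum>j=0..r. if j < R then 0 else ?F R $ (r - j))"
    by (rule sum.distrib)
  also have "(\<Sum>j=0..r. if j < R then ?F j $ (r - j) else 0) = (\<Sum>j\<in>{0..r} \<inter> {..<R}. ?F j $ (r - j))"
    unfolding sum.inter_restrict[OF finite_atLeastAtMost] lessThan_iff ..
  also have "\<dots> = (\<Sum>j\<in>{..<R}. if r < j then 0 else ?F j $ (r - j))"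
    unfolding Int_commute[of "{0..r}"] by (subst sum.inter_restrict, simp) (rule sum.cong, auto)
  also have "\<dots> = (\<Sum>i<R. fps_X ^ i * ?F i) $ r" by (simp add: fps_sum_nth fps_X_power_mult_nth)
  also have "(\<Sum>j=0..r. if j < R then 0 else ?F R $ (r - j)) = (fps_X ^ R * geo * ?F R) $ r"
    unfolding fps_mult_nth[of "fps_X ^ R * geo"] gR by (rule sum.cong) auto
  finally show "lvl (Suc m) f $ r = ((\<Sum>i<R. fps_X ^ i * ?F i) + fps_X ^ R * geo * ?F R) $ r" by simp
qed

text \<open>Every coordinate contributes one geometric factor and a numerator. The bound per
  coordinate is 2R + 1: for each of the R small values of the entry two terms, for the constant tail
  one.\<close>

lemma lvl_eventually_const:
  assumes "\<And>xs. length xs = m \<Longrightarrow> cmod (f xs) \<le> s"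
    and "\<And>xs ys. length xs = m \<Longrightarrow> length ys = m \<Longrightarrow>
      (\<And>i. i < m \<Longrightarrow> xs ! i = ys ! i \<or> R \<le> xs ! i \<and> R \<le> ys ! i) \<Longrightarrow> f xs = f ys"
  shows "\<exists>P. (\<forall>b>m * R. P $ b = 0) \<and> (\<forall>b. cmod (P $ b) \<le> s * (2 * real R + 1) ^ m) \<and> lvl m f = P * geo ^ m"
  using assms
proof (induction m arbitrary: f)
  case 0
  have "0 \<le> s" using order_trans[OF norm_ge_zero 0(1)[of "[]"]] by simp
  thus ?case using 0(1)[of "[]"] by (intro exI[of _ "fps_const (f [])"]) (auto simp: lvl_0)
next
  case (Suc m)
  have "\<exists>P. (\<forall>b>m * R. P $ b = 0) \<and> (\<forall>b. cmod (P $ b) \<le> s * (2 * real R + 1) ^ m) \<and>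
      lvl m (\<lambda>xs. f (i # xs)) = P * geo ^ m" for i
  proof (rule Suc.IH)
    show "cmod (f (i # xs)) \<le> s" if "length xs = m" for xs using Suc.prems(1)[of "i # xs"] that by simp
    fix xs ys assume a: "length xs = m" "length ys = m" "\<And>j. j < m \<Longrightarrow> xs ! j = ys ! j \<or> R \<le> xs ! j \<and> R \<le> ys ! j"
    show "f (i # xs) = f (i # ys)"
      by (rule Suc.prems(2)) (use a in \<open>auto simp: nth_Cons split: nat.splits\<close>)
  qed
  then obtain P :: "nat \<Rightarrow> complex fps" where P: "\<And>i b. m * R < b \<Longrightarrow> P i $ b = 0" "\<And>i b. cmod (P i $ b) \<le> s * (2 * real R + 1) ^ m"
    "\<And>i. lvl m (\<lambda>xs. f (i # xs)) = P i * geo ^ m" by metis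
  \<comment> \<open>The small entries come without a geometric factor and are multiplied by 1 - X to
    supply it. This raises the degree by one, for which i < R leaves room.\<close>
  define Q where "Q = (\<Sum>i<R. fps_X ^ i * (P i - fps_X * P i)) + fps_X ^ R * P R"
  have S0: "0 \<le> s * (2 * real R + 1) ^ m" using P(2)[of 0 0] norm_ge_zero order_trans by blast
  have Qn: "Q $ b = (\<Sum>i<R. if b < i then 0 else P i $ (b - i) - (if b - i = 0 then 0 else P i $ (b - i - 1)))
      + (if b < R then 0 else P R $ (b - R))" for b
    unfolding Q_def by (simp add: fps_sum_nth fps_X_power_mult_nth) (rule sum.cong, auto)
  have "Q $ b = 0" if "b > Suc m * R" for b
    unfolding Qn using that P(1) by (auto intro!: sum.neutral)
  moreover have "cmod (Q $ b) \<le> s * (2 * real R + 1) ^ Suc m" for b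
  proof -
    let ?S = "s * (2 * real R + 1) ^ m"
    have "cmod (if b < i then 0 else P i $ (b - i) - (if b - i = 0 then 0 else P i $ (b - i - 1))) \<le> 2 * ?S" for i
      using S0 P(2)[of i "b - i"] P(2)[of i "b - i - 1"] norm_triangle_ineq4[of "P i $ (b - i)" "P i $ (b - i - 1)"] by auto
    hence "cmod (\<Sum>i<R. if b < i then 0 else P i $ (b - i) - (if b - i = 0 then 0 else P i $ (b - i - 1))) \<le> real R * (2 * ?S)"
      by (intro sum_norm_bound[of "{..<R}" _ "2 * ?S", simplified])
    moreover have "cmod (if b < R then 0 else P R $ (b - R)) \<le> ?S" using P(2) S0 by auto
    ultimately have "cmod (Q $ b) \<le> real R * (2 * ?S) + ?S" unfolding Qn by (intro order_trans[OF norm_triangle_ineq] add_mono)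
    thus ?thesis by (simp add: algebra_simps)
  qed
  moreover have "lvl (Suc m) f = Q * geo ^ Suc m"
  proof -
    have "lvl (Suc m) f = (\<Sum>i<R. fps_X ^ i * (P i * geo ^ m)) + fps_X ^ R * geo * (P R * geo ^ m)"
      unfolding P(3)[symmetric]
    proof (rule lvl_Suc, rule Suc.prems(2))
      fix i j xs assume "R \<le> i" "length (xs :: nat list) = m"
      show "(i # xs) ! j = (R # xs) ! j \<or> R \<le> (i # xs) ! j \<and> R \<le> (R # xs) ! j"
        using \<open>R \<le> i\<close> by (cases j) auto
    qed auto
    also have "\<dots> = (\<Sum>i<R. fps_X ^ i * (P i * geo ^ m)) * (geo * (1 - fps_X)) + fps_X ^ R * geo * (P R * geo ^ m)"
      by (simp add: geo_mult)
    also have "\<dots> = Q * geo ^ Suc m" unfolding Q_def by (simp add: algebra_simps sum_distrib_left sum_subtractf)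
    finally show ?thesis .
  qed
  ultimately show ?case by blast
qed

text \<open>A coordinate forced to be zero contributes the factor 1, a free coordinate the factor
  \<open>geo\<close>.\<close>

lemma lvl_corner:
  "lvl m (\<lambda>xs. if \<forall>j<m. j \<in> A \<longrightarrow> xs ! j = 0 then 1 else 0) = geo ^ card ({..<m} - A)"
proof (induction m arbitrary: A)
  case 0 thus ?case by (simp add: lvl_0)
next
  case (Suc m)
  let ?A = "{j. Suc j \<in> A}"
  have all: "(\<forall>j<Suc m. j \<in> A \<longrightarrow> (i # xs) ! j = 0) \<longleftrightarrow> (0 \<in> A \<longrightarrow> i = 0) \<and> (\<forall>j<m. j \<in> ?A \<longrightarrow> xs ! j = 0)" for i xs
    unfolding All_less_Suc2 by simp
  have "lvl (Suc m) (\<lambda>xs. if \<forall>j<Suc m. j \<in> A \<longrightarrow> xs ! j = 0 then 1 else 0) =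
      geo ^ card ({..<m} - ?A) + (if 0 \<in> A then 0 else fps_X * geo * geo ^ card ({..<m} - ?A))"
    by (subst lvl_Suc[where R=1]) (auto simp: all lvl_zero Suc.IH[of ?A, simplified])
  moreover have "{..<Suc m} - A = (if 0 \<in> A then {} else {0}) \<union> Suc ` ({..<m} - ?A)"
    by (auto simp: lessThan_Suc_eq_insert_0)
  hence "card ({..<Suc m} - A) = (if 0 \<in> A then 0 else 1) + card ({..<m} - ?A)"
    by (auto simp: card_image)
  moreover have "1 + fps_X * geo = geo" using geo_mult by (simp add: algebra_simps)
  hence "F + fps_X * geo * F = geo * F" for F by (metis distrib_right mult_1)
  ultimately show ?case by simp
qed

text \<open>\<open>Gam l\<close> consists of two copies of \<open>\<nat>\<^sup>2\<^sup>l\<^sup>+\<^sup>1\<close>, one for each sign of the \<open>\<int>\<close>-coordinate; on the negative one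
  \<^const>\<open>sum_list\<close> falls short of the size by one.\<close>

definition ptp :: "nat \<Rightarrow> nat list \<Rightarrow> pt" where
  "ptp l xs = ((take l xs, int (xs ! l)), drop (Suc l) xs)"

definition ptn :: "nat \<Rightarrow> nat list \<Rightarrow> pt" where
  "ptn l xs = ((take l xs, - int (xs ! l) - 1), drop (Suc l) xs)"

definition glv :: "nat \<Rightarrow> (pt \<Rightarrow> complex) \<Rightarrow> complex fps" where
  "glv l f = Abs_fps (\<lambda>r. \<Sum>g\<in>{g\<in>Gam l. sz g = r}. f g)"

lemma sum_list_split: "l < length xs \<Longrightarrow> sum_list xs = sum_list (take l xs) + xs ! l + sum_list (drop (Suc l) xs)" for xs :: "nat list"
  using arg_cong[OF id_take_nth_drop[of l xs], of sum_list] by simp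

lemma pt_Gam: "length xs = Suc (2 * l) \<Longrightarrow> ptp l xs \<in> Gam l" "length xs = Suc (2 * l) \<Longrightarrow> ptn l xs \<in> Gam l"
  and sz_pt: "length xs = Suc (2 * l) \<Longrightarrow> sz (ptp l xs) = sum_list xs" "length xs = Suc (2 * l) \<Longrightarrow> sz (ptn l xs) = Suc (sum_list xs)"
  by (auto simp: ptp_def ptn_def mem_Gam mem_idx sz_def sum_list_split[of l xs])

lemma pt_inj: "inj_on (ptp l) (level (Suc (2 * l)) r)" "inj_on (ptn l) (level (Suc (2 * l)) r)"
proof -
  have "xs = ys" if "length xs = Suc (2 * l)" "length ys = Suc (2 * l)" "take l xs = take l ys" "xs ! l = ys ! l" "drop (Suc l) xs = drop (Suc l) ys" for xs ys :: "nat list"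
    using id_take_nth_drop[of l xs] id_take_nth_drop[of l ys] that by simp
  thus "inj_on (ptp l) (level (Suc (2 * l)) r)" "inj_on (ptn l) (level (Suc (2 * l)) r)"
    by (auto simp: inj_on_def level_def ptp_def ptn_def)
qed

lemma pt_cases:
  assumes "g \<in> Gam l"
  obtains xs where "length xs = Suc (2 * l)" "g = ptp l xs" | xs where "length xs = Suc (2 * l)" "g = ptn l xs"
proof -
  obtain v n w where g: "g = ((v, n), w)" "length v = l" "length w = l" using assms by (auto simp: Gam_def idx_def)
  show ?thesis
  proof (cases "0 \<le> n")
    case True thus ?thesis using that(1)[of "v @ nat n # w"] g by (simp add: ptp_def nth_append)
  next
    case False thus ?thesis using that(2)[of "v @ nat (- n - 1) # w"] g by (simp add: ptn_def nth_append)
  qed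
qed

lemma sz_level:
  "{g\<in>Gam l. sz g = r} = ptp l ` level (Suc (2 * l)) r \<union> ptn l ` (if r = 0 then {} else level (Suc (2 * l)) (r - 1))"
proof (intro equalityI subsetI)
  fix g assume "g \<in> {g\<in>Gam l. sz g = r}"
  hence g: "g \<in> Gam l" "sz g = r" by auto
  from g(1) show "g \<in> ptp l ` level (Suc (2 * l)) r \<union> ptn l ` (if r = 0 then {} else level (Suc (2 * l)) (r - 1))"
  proof (cases rule: pt_cases)
    case (1 xs) thus ?thesis using g(2) by (auto simp: level_def sz_pt)
  next
    case (2 xs) thus ?thesis using g(2) by (auto simp: level_def sz_pt)
  qed
qed (auto simp: level_def sz_pt pt_Gam split: if_splits)

lemma finite_sz_level: "finite {g\<in>Gam l. sz g = r}"
  unfolding sz_level by (simp add: finite_level)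

lemma glv_lvl: "glv l f = lvl (Suc (2 * l)) (\<lambda>xs. f (ptp l xs)) + fps_X * lvl (Suc (2 * l)) (\<lambda>xs. f (ptn l xs))"
proof (rule fps_ext)
  fix r
  let ?d = "Suc (2 * l)"
  let ?N = "if r = 0 then {} else level ?d (r - 1)"
  have "glv l f $ r = (\<Sum>g\<in>ptp l ` level ?d r. f g) + (\<Sum>g\<in>ptn l ` ?N. f g)"
    unfolding glv_def fps_nth_Abs_fps sz_level
    by (rule sum.union_disjoint) (auto simp: finite_level ptp_def ptn_def)
  also have "\<dots> = (\<Sum>xs\<in>level ?d r. f (ptp l xs)) + (\<Sum>xs\<in>?N. f (ptn l xs))"
    by (subst (1 2) sum.reindex) (auto simp: pt_inj)
  also have "\<dots> = (lvl ?d (\<lambda>xs. f (ptp l xs)) + fps_X * lvl ?d (\<lambda>xs. f (ptn l xs))) $ r"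
    by (simp add: lvl_nth)
  finally show "glv l f $ r = (lvl ?d (\<lambda>xs. f (ptp l xs)) + fps_X * lvl ?d (\<lambda>xs. f (ptn l xs))) $ r" .
qed

lemma cG_pt:
  assumes "length xs = Suc (2 * l)" "i < Suc (2 * l)"
  shows "cG (ptp l xs) i = int (xs ! i)" and "cG (ptn l xs) i = (if i = l then - int (xs ! i) - 1 else int (xs ! i))"
proof -
  note g = pt_Gam[OF assms(1)]
  have "cG (ptp l xs) i = int (xs ! i) \<and> cG (ptn l xs) i = (if i = l then - int (xs ! i) - 1 else int (xs ! i))"
  proof (cases "i \<le> l")
    case True
    thus ?thesis using cG_low[OF g(1) True] cG_low[OF g(2) True] assms by (auto simp: cI_def ptp_def ptn_def)
  next
    case False
    then obtain j where j: "i = Suc (l + j)" using less_imp_Suc_add by (metis not_le)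
    hence "j < l" using assms by simp
    thus ?thesis using cG_high[OF g(1), of j] cG_high[OF g(2), of j] assms j by (auto simp: ptp_def ptn_def)
  qed
  thus "cG (ptp l xs) i = int (xs ! i)" "cG (ptn l xs) i = (if i = l then - int (xs ! i) - 1 else int (xs ! i))" by auto
qed

text \<open>Along the diagonal the difference of row and column is zero, so invariance says that the
  diagonal is constant on classes of equal truncation. The negative copy carries a factor X: hence
  the 2 in the bound and the 1 in the degree.\<close>

lemma kB_level:
  assumes K: "K \<in> kB l n" and s: "schur (Gam l) s K"
  shows "\<exists>P. (\<forall>b>Suc (2 * l) * n + 1. P $ b = 0) \<and> (\<forall>b. cmod (P $ b) \<le> 2 * (2 * real n + 1) ^ Suc (2 * l) * s) \<and>
    glv l (\<lambda>g. K g g) = P * geo ^ Suc (2 * l)"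
proof -
  let ?d = "Suc (2 * l)"
  have inv: "K g g = K h h" if "g \<in> Gam l" "h \<in> Gam l" "gm.relB l n g h" for g h
    by (rule gm.tkerD2[OF K[unfolded gm.kerB_def] that(1,1,2,2)]) (use that(3) in \<open>auto simp: fun_eq_iff\<close>)
  have "\<exists>P. (\<forall>b>?d * n. P $ b = 0) \<and> (\<forall>b. cmod (P $ b) \<le> s * (2 * real n + 1) ^ ?d) \<and>
    lvl ?d (\<lambda>xs. K (ptp l xs) (ptp l xs)) = P * geo ^ ?d"
  proof (rule lvl_eventually_const)
    fix xs ys :: "nat list" assume a: "length xs = ?d" "length ys = ?d"
      "\<And>i. i < ?d \<Longrightarrow> xs ! i = ys ! i \<or> n \<le> xs ! i \<and> n \<le> ys ! i"
    have "gm.relB l n (ptp l xs) (ptp l ys)" unfolding gm.relB_def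
      using a by (auto simp: cG_pt)
    thus "K (ptp l xs) (ptp l xs) = K (ptp l ys) (ptp l ys)" by (rule inv[OF pt_Gam(1)[OF a(1)] pt_Gam(1)[OF a(2)]])
  qed (rule schur_entry[OF s])
  then obtain P :: "complex fps" where P: "\<And>b. b > ?d * n \<Longrightarrow> P $ b = 0" "\<And>b. cmod (P $ b) \<le> s * (2 * real n + 1) ^ ?d"
    "lvl ?d (\<lambda>xs. K (ptp l xs) (ptp l xs)) = P * geo ^ ?d" by blast
  have "\<exists>P. (\<forall>b>?d * n. P $ b = 0) \<and> (\<forall>b. cmod (P $ b) \<le> s * (2 * real n + 1) ^ ?d) \<and>
    lvl ?d (\<lambda>xs. K (ptn l xs) (ptn l xs)) = P * geo ^ ?d"
  proof (rule lvl_eventually_const)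
    fix xs ys :: "nat list" assume a: "length xs = ?d" "length ys = ?d"
      "\<And>i. i < ?d \<Longrightarrow> xs ! i = ys ! i \<or> n \<le> xs ! i \<and> n \<le> ys ! i"
    have "gm.relB l n (ptn l xs) (ptn l ys)" unfolding gm.relB_def
    proof (intro allI impI)
      fix i assume i: "i < ?d"
      show "cG (ptn l xs) i = cG (ptn l ys) i \<or> int n \<le> cG (ptn l xs) i \<and> int n \<le> cG (ptn l ys) i \<or>
         cG (ptn l xs) i \<le> - int n \<and> cG (ptn l ys) i \<le> - int n"
        \<comment> \<open>An entry of at least n gives the integer coordinate -entry - 1 <= -n, so
          the same threshold serves the negative copy.\<close>
        using a(3)[OF i] by (auto simp: cG_pt[OF a(1) i] cG_pt[OF a(2) i])
    qed
    thus "K (ptn l xs) (ptn l xs) = K (ptn l ys) (ptn l ys)" by (rule inv[OF pt_Gam(2)[OF a(1)] pt_Gam(2)[OF a(2)]])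
  qed (rule schur_entry[OF s])
  then obtain N :: "complex fps" where N: "\<And>b. b > ?d * n \<Longrightarrow> N $ b = 0" "\<And>b. cmod (N $ b) \<le> s * (2 * real n + 1) ^ ?d"
    "lvl ?d (\<lambda>xs. K (ptn l xs) (ptn l xs)) = N * geo ^ ?d" by blast
  show ?thesis
  proof (intro exI[of _ "P + fps_X * N"] conjI allI impI)
    show "glv l (\<lambda>g. K g g) = (P + fps_X * N) * geo ^ ?d" unfolding glv_lvl P(3) N(3) by (simp add: algebra_simps)
    show "(P + fps_X * N) $ b = 0" if "b > ?d * n + 1" for b
      using P(1)[of b] N(1)[of "b - 1"] that by simp
    fix b
    have "cmod ((P + fps_X * N) $ b) \<le> s * (2 * real n + 1) ^ ?d + s * (2 * real n + 1) ^ ?d"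
      unfolding fps_add_nth
    proof (intro order_trans[OF norm_triangle_ineq] add_mono P(2))
      show "cmod ((fps_X * N) $ b) \<le> s * (2 * real n + 1) ^ ?d"
        using N(2)[of "b - 1"] order_trans[OF norm_ge_zero N(2)] by simp
    qed
    thus "cmod ((P + fps_X * N) $ b) \<le> 2 * (2 * real n + 1) ^ ?d * s" by (simp add: mult_ac)
  qed
qed

lemma infsum_sum_complex:
  fixes f :: "'a \<Rightarrow> 'b \<Rightarrow> complex"
  assumes "finite A" "\<And>a. a \<in> A \<Longrightarrow> f a summable_on UNIV"
  shows "(\<Sum>\<^sub>\<infinity>n. \<Sum>a\<in>A. f a n) = (\<Sum>a\<in>A. \<Sum>\<^sub>\<infinity>n. f a n)"
proof -
  have "((\<lambda>n. \<Sum>a\<in>A. f a n) has_sum (\<Sum>a\<in>A. \<Sum>\<^sub>\<infinity>n. f a n)) UNIV"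
    using assms by (induction A rule: finite_induct) (auto intro!: has_sum_add has_sum_0)
  thus ?thesis by (rule infsumI)
qed

text \<open>The numerators of the pieces are added up coefficientwise. Their degrees grow linearly
  with the radius and their bounds polynomially, so the coefficients of the sum decrease
  rapidly.\<close>

lemma eq_kernel_level:
  assumes "eq_kernel l K"
  shows "\<exists>p. (\<forall>M. summable (\<lambda>b. (1 + real b) ^ M * norm (p b))) \<and> glv l (\<lambda>g. K g g) = Abs_fps p * geo ^ Suc (2 * l)"
proof -
  let ?d = "Suc (2 * l)"
  obtain s where r: "rapid (Gam l) (kB l) K s" using assms by (auto simp: eq_kernel_def)
  then obtain Ks where Ks: "\<And>n. Ks n \<in> kB l n" "\<And>n. schur (Gam l) (s n) (Ks n)" "\<And>x y. K x y = (\<Sum>\<^sub>\<infinity>n. Ks n x y)"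
    unfolding rapid_def by blast
  have "\<exists>P. \<forall>n. (\<forall>b>?d * n + 1. P n $ b = 0) \<and> (\<forall>b. cmod (P n $ b) \<le> 2 * (2 * real n + 1) ^ ?d * s n) \<and>
    glv l (\<lambda>g. Ks n g g) = P n * geo ^ ?d"
    by (rule choice, rule allI, rule kB_level[OF Ks(1,2)])
  then obtain P :: "nat \<Rightarrow> complex fps" where P: "\<And>n b. b > ?d * n + 1 \<Longrightarrow> P n $ b = 0"
    "\<And>n b. cmod (P n $ b) \<le> 2 * (2 * real n + 1) ^ ?d * s n" "\<And>n. glv l (\<lambda>g. Ks n g g) = P n * geo ^ ?d"
    by blast
  \<comment> \<open>The numerator bounds serve as new Schur bounds: the polynomial factor is
    absorbed by rapid decrease.\<close>
  define t where "t n = 2 * (2 * real n + 1) ^ ?d * s n" for n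
  note s0 = rapid_nonneg[OF r]
  have tm: "(\<lambda>n. (1 + real n) ^ m * t n) summable_on UNIV" for m
  proof (rule summable_on_comparison_test)
    show "(\<lambda>n. 2 * 2 ^ ?d * ((1 + real n) ^ (m + ?d) * s n)) summable_on UNIV"
      by (intro summable_on_cmult_right rapid_summable[OF r])
    fix n
    have "(2 * real n + 1) ^ ?d \<le> (2 * (1 + real n)) ^ ?d" by (rule power_mono) auto
    hence "2 * ((2 * real n + 1) ^ ?d * ((1 + real n) ^ m * s n)) \<le> 2 * ((2 * (1 + real n)) ^ ?d * ((1 + real n) ^ m * s n))"
      using s0[of n] by (intro mult_left_mono mult_right_mono) auto
    thus "(1 + real n) ^ m * t n \<le> 2 * 2 ^ ?d * ((1 + real n) ^ (m + ?d) * s n)"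
      unfolding t_def power_add power_mult_distrib by (simp only: mult_ac)
    show "0 \<le> (1 + real n) ^ m * t n" using s0[of n] by (simp add: t_def)
  qed
  have "s n \<le> t n" for n
  proof -
    have "1 \<le> (2 * real n + 1) ^ ?d" by (rule one_le_power) simp
    hence "1 \<le> 2 * (2 * real n + 1) ^ ?d" by linarith
    thus ?thesis unfolding t_def using s0[of n] mult_right_mono[of 1 _ "s n"] by simp
  qed
  hence rt: "rapid (Gam l) (kB l) K t" unfolding rapid_def
    using Ks tm by (intro exI[of _ Ks]) (blast intro: schur_mono)
  define p where "p b = (\<Sum>\<^sub>\<infinity>n. P n $ b)" for b
  have sumP: "(\<lambda>n. P n $ b) summable_on UNIV" for b
    using abs_summable_summable[OF norm_summable_comparison[OF tm[of 0], of "\<lambda>n. P n $ b"]] P(2) by (simp add: t_def)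
  have sumK: "(\<lambda>n. Ks n g h) summable_on UNIV" for g h
    using abs_summable_summable[OF norm_summable_comparison[OF rapid_summable[OF r, of 0], of "\<lambda>n. Ks n g h"]] schur_entry[OF Ks(2)] by simp
  have "summable (\<lambda>b. (1 + real b) ^ M * norm (p b))" for M
  proof -
    \<comment> \<open>The b-th coefficient of a piece vanishes unless b is at most the degree (2l +
      1) n + 1; two weights beyond M are spent on summability.\<close>
    let ?C = "1 * (real ?d + 2) ^ (M + 2) * wsum t (M + 2)"
    have b: "(1 + real b) ^ (M + 2) * norm (p b) \<le> ?C" for b
      unfolding p_def
    proof (rule weighted_entry_bound[OF rt])
      show "cmod (P n $ b) \<le> 1 * t n" for n using P(2) by (simp add: t_def)
      fix n assume "P n $ b \<noteq> 0"
      hence "b \<le> ?d * n + 1" using P(1)[where b=b and n=n] by (meson not_le)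
      hence "real b \<le> real ?d * real n + 1" by (metis of_nat_1 of_nat_add of_nat_le_iff of_nat_mult)
      thus "1 + real b \<le> (real ?d + 2) * (1 + real n)" by (simp add: algebra_simps)
    qed auto
    have "(\<lambda>b. ?C * (1 / (1 + real b) ^ 2)) summable_on UNIV"
      by (intro summable_on_cmult_right summable_on_nat_inverse_square)
    hence "(\<lambda>b. (1 + real b) ^ M * norm (p b)) summable_on UNIV"
    proof (rule summable_on_comparison_test)
      fix b
      have "(1 + real b) ^ M * norm (p b) * (1 + real b) ^ 2 \<le> ?C" using b[of b] by (simp add: power_add mult_ac power2_eq_square)
      thus "(1 + real b) ^ M * norm (p b) \<le> ?C * (1 / (1 + real b) ^ 2)" by (simp add: field_simps)
    qed auto
    thus ?thesis by (rule summable_on_imp_summable)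
  qed
  moreover have "glv l (\<lambda>g. K g g) = Abs_fps p * geo ^ ?d"
  proof (rule fps_ext)
    fix r
    have "glv l (\<lambda>g. K g g) $ r = (\<Sum>\<^sub>\<infinity>n. \<Sum>g\<in>{g\<in>Gam l. sz g = r}. Ks n g g)"
      unfolding infsum_sum_complex[OF finite_sz_level sumK] glv_def Ks(3) by simp
    also have "\<dots> = (\<Sum>\<^sub>\<infinity>n. glv l (\<lambda>g. Ks n g g) $ r)" by (simp add: glv_def)
    also have "\<dots> = (\<Sum>\<^sub>\<infinity>n. \<Sum>j=0..r. P n $ j * (geo ^ ?d) $ (r - j))" by (simp only: P(3) fps_mult_nth)
    also have "\<dots> = (\<Sum>j=0..r. \<Sum>\<^sub>\<infinity>n. P n $ j * (geo ^ ?d) $ (r - j))"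
      by (rule infsum_sum_complex) (auto intro: summable_on_cmult_left sumP)
    also have "\<dots> = (Abs_fps p * geo ^ ?d) $ r"
      unfolding fps_mult_nth p_def fps_nth_Abs_fps infsum_cmult_left' ..
    finally show "glv l (\<lambda>g. K g g) $ r = (Abs_fps p * geo ^ ?d) $ r" .
  qed
  ultimately show ?thesis by blast
qed

section \<open>Partial fractions and uniqueness of the continuation\<close>

definition partial_fractions :: "nat \<Rightarrow> (nat \<Rightarrow> complex) \<Rightarrow> (complex \<Rightarrow> complex) \<Rightarrow> complex \<Rightarrow> complex" where
  "partial_fractions k c G z = (\<Sum>i\<le>k. c i / (z - of_nat (Suc i))) + G z"

lemma partial_fractions_meromorphic:
  assumes "G holomorphic_on UNIV" shows "partial_fractions k c G meromorphic_on UNIV"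
proof -
  have "G meromorphic_on UNIV" using assms by (intro analytic_on_imp_meromorphic_on) (simp add: analytic_on_open)
  hence "(\<lambda>z. (\<Sum>i\<le>k. c i / (z - of_nat (Suc i))) + G z) meromorphic_on UNIV" by (intro meromorphic_intros)
  thus ?thesis by (simp add: partial_fractions_def[abs_def])
qed

lemma partial_fractions_local:
  assumes G: "G holomorphic_on UNIV" and i: "i \<le> k"
  obtains S H where "open S" "of_nat (Suc i) \<in> S" "H holomorphic_on S"
    "\<And>z. partial_fractions k c G z = c i / (z - of_nat (Suc i)) + H z"
proof
  let ?S = "- ((\<lambda>j. of_nat (Suc j) :: complex) ` ({..k} - {i}))"
  let ?H = "\<lambda>z. (\<Sum>j\<in>{..k} - {i}. c j / (z - of_nat (Suc j))) + G z"
  show "open ?S" by (intro open_Compl finite_imp_closed) simp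
  show "of_nat (Suc i) \<in> ?S" by (auto simp del: of_nat_Suc)
  show "?H holomorphic_on ?S"
    by (intro holomorphic_intros holomorphic_on_subset[OF G]) (auto simp del: of_nat_Suc)
  show "partial_fractions k c G z = c i / (z - of_nat (Suc i)) + ?H z" for z
    using i by (simp add: partial_fractions_def sum.remove[of "{..k}" i])
qed

lemma partial_fractions_pole:
  assumes G: "G holomorphic_on UNIV" and p: "is_pole (partial_fractions k c G) s"
  shows "s \<in> (\<lambda>i. of_nat (Suc i)) ` {..k}" and "zorder (partial_fractions k c G) s = -1"
proof -
  let ?F = "partial_fractions k c G"
  have "s \<in> (\<lambda>i. of_nat (Suc i)) ` {..k}"
  proof (rule ccontr)
    let ?S = "- ((\<lambda>j. of_nat (Suc j) :: complex) ` {..k})"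
    assume s: "s \<notin> (\<lambda>i. of_nat (Suc i)) ` {..k}"
    have "(\<lambda>z. (\<Sum>j\<le>k. c j / (z - of_nat (Suc j))) + G z) holomorphic_on ?S"
      by (intro holomorphic_intros holomorphic_on_subset[OF G]) (auto simp del: of_nat_Suc)
    hence "?F holomorphic_on ?S" by (simp add: partial_fractions_def[abs_def])
    hence "\<not> is_pole ?F s" by (rule not_is_pole_holomorphic[rotated 2]) (use s in \<open>auto intro!: finite_imp_closed simp: open_Compl\<close>)
    thus False using p by simp
  qed
  thus "s \<in> (\<lambda>i. of_nat (Suc i)) ` {..k}" .
  then obtain i where i: "i \<le> k" "s = of_nat (Suc i)" by auto
  obtain S H where S: "open S" "s \<in> S" "H holomorphic_on S" "\<And>z. ?F z = c i / (z - s) + H z"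
    using partial_fractions_local[OF G i(1), where c=c] unfolding i(2)[symmetric] by blast
  \<comment> \<open>If the coefficient vanished, the function would be holomorphic near s and could
    not have a pole there.\<close>
  have c: "c i \<noteq> 0"
  proof
    assume "c i = 0"
    hence "?F = H" using S(4) by auto
    thus False using p not_is_pole_holomorphic[OF S(1-3)] by simp
  qed
  show "zorder ?F s = -1"
  proof (rule zorder_eqI[OF S(1,2)])
    show "(\<lambda>z. c i + (z - s) * H z) holomorphic_on S" by (intro holomorphic_intros S(3))
    show "?F w = (c i + (w - s) * H w) * (w - s) powi - 1" if "w \<in> S" "w \<noteq> s" for w
      using that by (simp add: S(4) field_simps power_int_minus)
  qed (use c in simp)
qed

lemma partial_fractions_is_pole:
  assumes G: "G holomorphic_on UNIV" and i: "i \<le> k" and c: "c i \<noteq> 0"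
  shows "is_pole (partial_fractions k c G) (of_nat (Suc i))"
proof -
  let ?s = "of_nat (Suc i) :: complex"
  obtain S H where S: "open S" "?s \<in> S" "H holomorphic_on S" "\<And>z. partial_fractions k c G z = c i / (z - ?s) + H z"
    using partial_fractions_local[OF G i, where c=c] by blast
  have "is_pole (\<lambda>w. (c i + (w - ?s) * H w) / (w - ?s) ^ 1) ?s"
    by (rule is_pole_basic[OF _ S(1,2)]) (use c in \<open>auto intro!: holomorphic_intros S(3)\<close>)
  moreover have "eventually (\<lambda>w. (c i + (w - ?s) * H w) / (w - ?s) ^ 1 = partial_fractions k c G w) (at ?s)"
    by (rule eventually_at_filter[THEN iffD2], rule always_eventually) (simp add: S(4) add_divide_distrib)
  ultimately show ?thesis by (rule is_pole_transform) simp
qed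

text \<open>Simplicity concerns every extension, and meromorphic functions may take odd values on a
  sparse set. The identity theorem therefore gives equality only on punctured neighbourhoods, which
  is enough for poles and their orders.\<close>

lemma meromorphic_eq_of_half_plane:
  assumes f: "f meromorphic_on UNIV" and g: "g meromorphic_on UNIV" and eq: "\<And>z. Re z > x \<Longrightarrow> f z = g z"
  shows "\<forall>\<^sub>F z in at s. f z = g z"
proof -
  have m: "(\<lambda>z. f z - g z) meromorphic_on UNIV" by (intro meromorphic_intros f g)
  let ?w = "of_real (x + 1) :: complex"
  have "\<forall>\<^sub>F z in at ?w. f z - g z = 0"
    by (rule eventually_mono[OF eventually_at_in_open'[OF open_Re_gt[of x], of ?w]]) (auto simp: eq)
  hence "\<not> (\<forall>\<^sub>F z in at ?w. f z - g z \<noteq> 0)"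
    using eventually_elim2[of "\<lambda>z. f z - g z = 0" "at ?w" "\<lambda>z. f z - g z \<noteq> 0" "\<lambda>_. False"] by auto
  hence "\<not> (\<forall>\<^sub>F z in cosparse UNIV. f z - g z \<noteq> 0)" using eventually_cosparse_imp_eventually_at[of _ UNIV ?w UNIV] by blast
  hence "\<forall>\<^sub>F z in cosparse UNIV. f z - g z = 0" using meromorphic_imp_constant_or_avoid[OF m, of 0] by auto
  hence "\<forall>\<^sub>F z in at s. f z - g z = 0" by (rule eventually_cosparse_imp_eventually_at) simp
  thus ?thesis by simp
qed

section \<open>The trace as a Dirichlet series\<close>

lemma neg_power_d_eq: "neg_power_symbol d_eq z g = (if sz g = 0 then 0 else of_nat (sz g) powr (- z))"
  by (simp add: neg_power_symbol_def abs_d_eq d_eq_sz)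

lemma d_eq_gap: "d_eq g = 0 \<or> 1 \<le> \<bar>d_eq g\<bar>"
  unfolding abs_d_eq by (auto simp: d_eq_sz)

lemma card_sz_level: "real (card {g\<in>Gam l. sz g = r}) \<le> (2 * real r + 3) ^ Suc (2 * l)"
proof -
  have "card {g\<in>Gam l. sz g = r} \<le> card {g\<in>Gam l. \<bar>d_eq g\<bar> < real (Suc r)}"
    by (rule card_mono[OF Gam_ball_finite]) (auto simp: abs_d_eq)
  also have "\<dots> \<le> (2 * Suc r + 1) ^ Suc (2 * l)" by (rule Gam_ball_card)
  finally have "real (card {g\<in>Gam l. sz g = r}) \<le> real ((2 * Suc r + 1) ^ Suc (2 * l))" by (rule of_nat_mono)
  also have "\<dots> = (2 * real r + 3) ^ Suc (2 * l)" by (simp add: algebra_simps)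
  finally show ?thesis .
qed

text \<open>The diagonal sum is grouped by spheres, which needs absolute convergence: a sphere has
  at most (2r + 3)^(2l + 1) points by the crude count, so Re z > 2l + 2 suffices. The sphere r = 0
  is the kernel of D and drops out.\<close>

lemma op_trace_sums:
  assumes K: "schur (Gam l) S K" and z: "Re z > 2 * real l + 2"
  shows "(\<lambda>r. glv l (\<lambda>g. K g g) $ Suc r * of_nat (Suc r) powr (- z)) sums
     op_trace (Gam l) (kop (Gam l) K \<circ> abs_neg_power (Gam l) (D_eq l) z)"
proof -
  let ?d = "Suc (2 * l)" and ?L = "\<lambda>r. {g\<in>Gam l. sz g = r}"
  let ?n = "\<lambda>r. if r = 0 then 0 else of_nat r powr (- z) :: complex"
  let ?f = "\<lambda>(r, g). K g g * ?n r"
  have S: "0 \<le> S" by (rule schur_nonneg[OF K])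
  have nn: "norm (?n (Suc r)) = real (Suc r) powr (- Re z)" for r using norm_Suc_powr[of r "- z"] by simp
  have bij: "bij_betw (\<lambda>g. (sz g, g)) (Gam l) (SIGMA r:UNIV. ?L r)"
    by (rule bij_betwI[where g=snd]) auto
  have lev: "(\<Sum>\<^sub>\<infinity>g\<in>?L r. norm (?f (r, g))) \<le> (2 * real r + 3) ^ ?d * (S * norm (?n r))" for r
  proof -
    have "(\<Sum>\<^sub>\<infinity>g\<in>?L r. norm (?f (r, g))) = (\<Sum>g\<in>?L r. norm (K g g) * norm (?n r))"
      by (simp add: infsum_finite[OF finite_sz_level] norm_mult)
    also have "\<dots> \<le> real (card (?L r)) * (S * norm (?n r))"
      by (rule sum_bounded_above) (intro mult_right_mono schur_entry[OF K] norm_ge_zero)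
    also have "\<dots> \<le> (2 * real r + 3) ^ ?d * (S * norm (?n r))"
      by (intro mult_right_mono card_sz_level mult_nonneg_nonneg S norm_ge_zero)
    finally show ?thesis .
  qed
  have "summable (\<lambda>r. (2 * real r + 3) ^ ?d * (S * norm (?n r)))"
  proof (subst summable_Suc_iff[symmetric], rule summable_comparison_test)
    show "summable (\<lambda>r. 5 ^ ?d * S * real (Suc r) powr (- (Re z - real ?d)))"
      by (intro summable_mult summable_Suc_powr) (use z in simp)
    have "norm ((2 * real (Suc r) + 3) ^ ?d * (S * norm (?n (Suc r)))) \<le> 5 ^ ?d * S * real (Suc r) powr (- (Re z - real ?d))" for r
    proof -
      have "(2 * real (Suc r) + 3) ^ ?d \<le> (5 * real (Suc r)) ^ ?d" by (rule power_mono) auto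
      hence "(2 * real (Suc r) + 3) ^ ?d * (S * norm (?n (Suc r))) \<le> (5 * real (Suc r)) ^ ?d * (S * norm (?n (Suc r)))"
        using S by (intro mult_right_mono) auto
      also have "\<dots> = 5 ^ ?d * S * (real (Suc r) powr real ?d * real (Suc r) powr (- Re z))"
        unfolding nn power_mult_distrib powr_realpow[OF of_nat_0_less_iff[THEN iffD2, OF zero_less_Suc]] by (simp only: mult_ac)
      also have "\<dots> = 5 ^ ?d * S * real (Suc r) powr (- (Re z - real ?d))"
        unfolding powr_add[symmetric] by simp
      finally show ?thesis using S by simp
    qed
    thus "\<exists>N. \<forall>r\<ge>N. norm ((2 * real (Suc r) + 3) ^ ?d * (S * norm (?n (Suc r)))) \<le> 5 ^ ?d * S * real (Suc r) powr (- (Re z - real ?d))"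
      by blast
  qed
  hence sumL: "(\<lambda>r. (2 * real r + 3) ^ ?d * (S * norm (?n r))) summable_on UNIV"
    by (subst summable_on_UNIV_nonneg_real_iff) (use S in auto)
  have "(\<lambda>x. norm (?f x)) summable_on (SIGMA r:UNIV. ?L r)" unfolding Infinite_Sum.abs_summable_on_Sigma_iff
  proof (intro conjI ballI)
    show "(\<lambda>g. norm (?f (r, g))) summable_on ?L r" for r by (rule summable_on_finite[OF finite_sz_level])
    show "(\<lambda>r. norm (\<Sum>\<^sub>\<infinity>g\<in>?L r. norm (?f (r, g)))) summable_on UNIV"
      by (rule norm_summable_comparison[OF sumL]) (use lev infsum_nonneg in \<open>simp add: infsum_nonneg\<close>)
  qed
  hence sumf: "?f summable_on (SIGMA r:UNIV. ?L r)" by (rule abs_summable_summable)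
  have "op_trace (Gam l) (kop (Gam l) K \<circ> abs_neg_power (Gam l) (D_eq l) z) = (\<Sum>\<^sub>\<infinity>g\<in>Gam l. K g g * neg_power_symbol d_eq z g)"
    unfolding D_eq_diag
  proof (subst abs_neg_power_diag[OF d_eq_gap], goal_cases)
    case 2
    show ?case
    proof (rule op_trace_kop_diag[OF K])
      show "cmod (neg_power_symbol d_eq z g) \<le> 1" for g
        using d_eq_gap[of g] powr_mono[of "- Re z" 0 "\<bar>d_eq g\<bar>"] z by (auto simp: norm_neg_power_symbol)
    qed
  qed (use z in simp)
  also have "\<dots> = (\<Sum>\<^sub>\<infinity>g\<in>Gam l. ?f (sz g, g))" by (simp add: neg_power_d_eq)
  also have "\<dots> = infsum ?f (SIGMA r:UNIV. ?L r)" by (rule infsum_reindex_bij_betw[OF bij])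
  also have "\<dots> = (\<Sum>\<^sub>\<infinity>r. \<Sum>\<^sub>\<infinity>g\<in>?L r. ?f (r, g))" by (rule infsum_Sigma_banach[OF sumf, symmetric])
  also have "\<dots> = (\<Sum>\<^sub>\<infinity>r. glv l (\<lambda>g. K g g) $ r * ?n r)"
    by (simp only: infsum_finite[OF finite_sz_level] glv_def fps_nth_Abs_fps sum_distrib_right split)
  finally have tr: "op_trace (Gam l) (kop (Gam l) K \<circ> abs_neg_power (Gam l) (D_eq l) z) = (\<Sum>\<^sub>\<infinity>r. glv l (\<lambda>g. K g g) $ r * ?n r)" .
  have "(\<lambda>r. \<Sum>\<^sub>\<infinity>g\<in>?L r. ?f (r, g)) summable_on UNIV" by (rule summable_on_Sigma_banach) (use sumf in simp)
  hence "(\<lambda>r. glv l (\<lambda>g. K g g) $ r * ?n r) summable_on UNIV"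
    by (simp only: infsum_finite[OF finite_sz_level] glv_def fps_nth_Abs_fps sum_distrib_right split)
  hence "(\<lambda>r. glv l (\<lambda>g. K g g) $ r * ?n r) sums op_trace (Gam l) (kop (Gam l) K \<circ> abs_neg_power (Gam l) (D_eq l) z)"
    unfolding tr by (intro has_sum_imp_sums has_sum_infsum)
  hence "(\<lambda>r. glv l (\<lambda>g. K g g) $ Suc r * ?n (Suc r)) sums op_trace (Gam l) (kop (Gam l) K \<circ> abs_neg_power (Gam l) (D_eq l) z)"
    using sums_Suc_iff[of "\<lambda>r. glv l (\<lambda>g. K g g) $ r * ?n r"] by simp
  thus ?thesis by (simp only: nat.distinct if_False)
qed

text \<open>The exponent k + 1 of the geometric series is left variable. A diagonal that lives on
  fewer coordinates has a smaller k, and its top coefficient then governs the pole at k + 1.\<close>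

lemma trace_partial_fractions:
  assumes K: "schur (Gam l) S K" and k: "k \<le> 2 * l" and p: "\<And>M. summable (\<lambda>b. (1 + real b) ^ M * norm (p b))"
    and h: "glv l (\<lambda>g. K g g) = Abs_fps p * geo ^ Suc k"
  obtains c G where "G holomorphic_on UNIV" "c k = (\<Sum>b. p b) / fact k"
    "\<And>q. 2 * real l + 2 \<le> q \<Longrightarrow> zeta_extension (Gam l) (D_eq l) q (kop (Gam l) K) (partial_fractions k c G)"
proof -
  obtain c G where cG: "G holomorphic_on UNIV" "c k = (\<Sum>b. p b) / fact k"
    "\<And>z. Re z > real (Suc k) \<Longrightarrow> (\<lambda>r. (Abs_fps p * geo ^ Suc k) $ Suc r * of_nat (Suc r) powr (- z)) sums
            ((\<Sum>i\<le>k. c i / (z - of_nat (Suc i))) + G z)"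
    using Dirichlet_series_continuation[OF p, of k] by blast
  show thesis
  proof (rule that[of G c, OF cG(1,2)])
    fix q assume q: "2 * real l + 2 \<le> q"
    show "zeta_extension (Gam l) (D_eq l) q (kop (Gam l) K) (partial_fractions k c G)"
      unfolding zeta_extension_def
    proof (intro conjI allI impI partial_fractions_meromorphic cG(1))
      fix z :: complex assume "q < Re z"
      hence z: "2 * real l + 2 < Re z" using q by linarith
      show "trace_class (Gam l) (kop (Gam l) K \<circ> abs_neg_power (Gam l) (D_eq l) z)" unfolding D_eq_diag
      proof (subst abs_neg_power_diag[OF d_eq_gap], goal_cases)
        case 2
        show ?case
          by (rule trace_class_neg_power[where N="Suc (2 * l)", OF _ K _ d_eq_gap Gam_ball_finite Gam_ball_card])
             (use z in \<open>auto intro: countable_subset[OF subset_UNIV]\<close>)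
      qed (use z in simp)
      show "partial_fractions k c G z = op_trace (Gam l) (kop (Gam l) K \<circ> abs_neg_power (Gam l) (D_eq l) z)"
        unfolding partial_fractions_def
        by (rule sums_unique2[OF cG(3) op_trace_sums[OF K z, unfolded h]]) (use z k in linarith)
    qed
  qed
qed

lemma eq_kernel_zeta:
  assumes "eq_kernel l K"
  obtains c G where "G holomorphic_on UNIV"
    "\<And>q. 2 * real l + 2 \<le> q \<Longrightarrow> zeta_extension (Gam l) (D_eq l) q (kop (Gam l) K) (partial_fractions (2 * l) c G)"
proof -
  obtain S where S: "schur (Gam l) S K" using eq_kernel_schur[OF assms] by blast
  obtain p where p: "\<And>M. summable (\<lambda>b. (1 + real b) ^ M * norm (p b))" "glv l (\<lambda>g. K g g) = Abs_fps p * geo ^ Suc (2 * l)"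
    using eq_kernel_level[OF assms] by blast
  show thesis by (rule trace_partial_fractions[OF S order_refl p]) (rule that)
qed

text \<open>The residue at k + 1 is a multiple of the sum of the numerator coefficients, here u +
  v.\<close>

lemma pole_exists:
  assumes K: "schur (Gam l) S K" and k: "k \<le> 2 * l" and uv: "u + v \<noteq> 0"
    and h: "glv l (\<lambda>g. K g g) = (fps_const u + fps_const v * fps_X) * geo ^ Suc k"
  shows "\<exists>f. zeta_extension (Gam l) (D_eq l) (2 * real l + 2) (kop (Gam l) K) f \<and> is_pole f (of_nat (Suc k))"
proof -
  define p where "p = (\<lambda>b :: nat. if b = 0 then u else if b = 1 then v else 0)"
  have "summable (\<lambda>b. (1 + real b) ^ M * norm (p b))" for M
    by (rule summable_finite[of "{0, 1}"]) (auto simp: p_def)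
  moreover have "Abs_fps p = fps_const u + fps_const v * fps_X"
    by (auto simp: fps_eq_iff p_def fps_X_def)
  hence "glv l (\<lambda>g. K g g) = Abs_fps p * geo ^ Suc k" using h by simp
  ultimately obtain c G where cG: "G holomorphic_on UNIV" "c k = (\<Sum>b. p b) / fact k"
    "\<And>q. 2 * real l + 2 \<le> q \<Longrightarrow> zeta_extension (Gam l) (D_eq l) q (kop (Gam l) K) (partial_fractions k c G)"
    using trace_partial_fractions[OF K k, where p=p] by blast
  have "(\<Sum>b. p b) = (\<Sum>b\<in>{0, 1}. p b)" by (rule suminf_finite) (auto simp: p_def)
  hence "c k \<noteq> 0" using uv by (simp add: cG(2) p_def)
  thus ?thesis using cG(3) partial_fractions_is_pole[OF cG(1) order_refl] by blast
qed

section \<open>Elements with prescribed poles\<close>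

lemma B_alg_smooth: "smooth_kernel l K \<Longrightarrow> kop (Gam l) (tens l K) \<in> B_alg (Gam l) (C_eq l) (D_eq l)"
  unfolding B_alg_def by (intro generated_algebra.gen UN_I[of 0]) (auto simp: C_eq_iff)

lemma B_alg_commutator:
  assumes "smooth_kernel l K"
  shows "kop (Gam l) (\<lambda>x y. complex_of_real (d_eq x - d_eq y) * tens l K x y) \<in> B_alg (Gam l) (C_eq l) (D_eq l)"
proof -
  have "kop (Gam l) (tens l K) \<in> C_eq l" using assms C_eq_iff by blast
  thus ?thesis unfolding B_alg_def commutator_D_eq(2)[OF assms, symmetric]
    by (intro generated_algebra.gen UN_I[of 0]) auto
qed

definition corner :: "nat \<Rightarrow> pt \<Rightarrow> complex" where
  "corner i g = (if \<forall>j<i. cI (fst g) j = 0 then 1 else 0)"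

lemma B_alg_corner: "i \<le> l \<Longrightarrow> kop (Gam l) (diag_kern (Gam l) (corner i)) \<in> B_alg (Gam l) (C_eq l) (D_eq l)"
  using B_alg_smooth[OF smooth_kernel_corner[of i l]] unfolding tens_diag corner_def[abs_def] .

text \<open>Raising the first coordinate increases the size by one and leaves the sign of D
  unchanged, since at level at least 1 this coordinate is a natural one of the first l. The
  commutator is thus \<open>alpha1\<close> weighted by minus the sign, and the adjoint of
  \<open>alpha1\<close> cancels the shift.\<close>

lemma sgn_commutator:
  "kcomp (\<lambda>x y. complex_of_real (d_eq x - d_eq y) * tens (Suc l) (shk l 1) x y) (tens (Suc l) (shk l (- 1)))
    = diag_kern (Gam (Suc l)) (\<lambda>g. if sgn_eq g then -1 else 1)" (is "kcomp ?C ?T = _")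
proof (intro ext)
  fix x y
  show "kcomp ?C ?T x y = diag_kern (Gam (Suc l)) (\<lambda>g. if sgn_eq g then -1 else 1) x y"
  proof (cases "x \<in> Gam (Suc l)")
    case False
    have "tens (Suc l) (shk l 1) x z = 0" for z
      using False shk_outside[of "fst x" l "fst z"] by (auto simp: tens_def mem_Gam)
    hence "kcomp ?C ?T x y = 0" unfolding kcomp_def by (intro infsum_0) simp
    thus ?thesis using False by (simp add: diag_kern_def)
  next
    case True
    then obtain i p where ip: "fst x = cns i p" "p \<in> idx l" using idx_Suc_ex[of "fst x" l] unfolding mem_Gam by blast
    have w: "length (snd x) = Suc l" using True by (simp add: mem_Gam)
    let ?z = "(cns (Suc i) p, snd x)"
    have "kcomp ?C ?T x y = (\<Sum>\<^sub>\<infinity>z\<in>{?z}. ?C x z * ?T z y)" unfolding kcomp_def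
    proof (rule infsum_cong_neutral)
      fix z assume z: "z \<in> UNIV - {?z}"
      have "tens (Suc l) (shk l 1) x z = 0"
      proof (rule ccontr)
        assume "tens (Suc l) (shk l 1) x z \<noteq> 0"
        note t = tens_nonzeroD[OF this]
        then obtain i' j p' where s: "fst x = cns i' p'" "fst z = cns j p'" "int j - int i' = 1" using shk_nonzeroD by blast
        hence "cns i p = cns i' p'" using ip by simp
        hence "j = Suc i" "p' = p" using s(3) by auto
        hence "z = ?z" using s(2) t by (intro prod_eqI) auto
        thus False using z by simp
      qed
      thus "?C x z * ?T z y = 0" by simp
    qed auto
    also have "\<dots> = ?C x ?z * ?T ?z y" by simp
    also have "?C x ?z = complex_of_real (d_eq x - d_eq ?z)" using ip w by (simp add: tens_def)
    also have "sz ?z = Suc (sz x)" "sgn_eq ?z = sgn_eq x" using ip by (auto simp: sz_def sgn_eq_def cns_def)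
    hence "complex_of_real (d_eq x - d_eq ?z) = (if sgn_eq x then -1 else 1)" by (simp add: d_eq_sz)
    also have "?T ?z y = (if x = y then 1 else 0)"
    proof (cases "x = y")
      case True thus ?thesis using ip w by (auto simp: tens_def)
    next
      case False
      have "?T ?z y = 0"
      proof (rule ccontr)
        assume "?T ?z y \<noteq> 0"
        note t = tens_nonzeroD[OF this]
        then obtain i' j p' where s: "fst ?z = cns i' p'" "fst y = cns j p'" "int j - int i' = - 1" using shk_nonzeroD by blast
        hence "cns (Suc i) p = cns i' p'" by simp
        hence "j = i" "p' = p" using s(3) by auto
        hence "x = y" using s(2) ip(1) t by (intro prod_eqI) auto
        thus False using False by simp
      qed
      thus ?thesis using False by simp
    qed
    finally show ?thesis using True by (simp add: diag_kern_def)
  qed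
qed

lemma schur_diag_bounded: "(\<And>g. cmod (f g) \<le> 1) \<Longrightarrow> schur X 1 (diag_kern X f)"
  by (rule schur_diag_kern) auto

lemma kop_diag_mult:
  assumes "\<And>g. cmod (f g) \<le> 1" "\<And>g. cmod (h g) \<le> 1"
  shows "kop X (diag_kern X f) \<circ> kop X (diag_kern X h) = kop X (diag_kern X (\<lambda>g. f g * h g))"
  unfolding kop_kcomp[OF schur_diag_bounded[OF assms(1)] schur_diag_bounded[OF assms(2)]]
    kcomp_diag_right[OF schur_diag_bounded[OF assms(1)]]
  by (rule arg_cong[of _ _ "kop X"]) (auto simp: diag_kern_def fun_eq_iff)

lemma B_alg_sgn:
  assumes "1 \<le> l"
  shows "kop (Gam l) (diag_kern (Gam l) (\<lambda>g. of_bool (sgn_eq g))) \<in> B_alg (Gam l) (C_eq l) (D_eq l)"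
proof -
  obtain l' where l: "l = Suc l'" using assms by (cases l) auto
  let ?B = "B_alg (Gam l) (C_eq l) (D_eq l)" and ?F = "\<lambda>g. if sgn_eq g then -1 else 1 :: complex"
  have sm: "smooth_kernel l (shk l' k)" for k
    unfolding l by (rule smooth_kernel_single[OF kA_shk schur_shk])
  obtain S where C: "schur (Gam l) S (\<lambda>x y. complex_of_real (d_eq x - d_eq y) * tens l (shk l' 1) x y)"
    using eq_kernel_schur[OF eq_kernel_dirac[OF sm]] by blast
  have T: "schur (Gam l) 1 (tens l (shk l' (- 1)))" unfolding l by (rule schur_tens[OF schur_shk])
  have "kop (Gam l) (diag_kern (Gam l) ?F) \<in> ?B"
    using generated_algebra.mult[OF B_alg_commutator[OF sm, of 1, unfolded B_alg_def] B_alg_smooth[OF sm, of "- 1", unfolded B_alg_def]]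
    unfolding kop_kcomp[OF C T] B_alg_def[symmetric] unfolding l sgn_commutator .
  moreover have "kop (Gam l) (diag_kern (Gam l) (corner 0)) \<in> ?B" by (rule B_alg_corner) simp
  \<comment> \<open>The corner for i = 0 is the identity and ?F is minus the sign, so half of their
    difference is the projection onto positive sign.\<close>
  ultimately have "(1 / 2) *\<^sub>o (kop (Gam l) (diag_kern (Gam l) (corner 0)) + (- 1) *\<^sub>o kop (Gam l) (diag_kern (Gam l) ?F)) \<in> ?B"
    unfolding B_alg_def by (intro generated_algebra.scale generated_algebra.add)
  also have "(1 / 2) *\<^sub>o (kop (Gam l) (diag_kern (Gam l) (corner 0)) + (- 1) *\<^sub>o kop (Gam l) (diag_kern (Gam l) ?F))
      = kop (Gam l) (diag_kern (Gam l) (\<lambda>g. of_bool (sgn_eq g)))"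
  proof -
    have 1: "schur (Gam l) 1 (diag_kern (Gam l) (corner 0))" by (rule schur_diag_bounded) (simp add: corner_def)
    have 2: "schur (Gam l) (cmod (- 1) * 1) (\<lambda>x y. - 1 * diag_kern (Gam l) ?F x y)"
      by (rule schur_scale[OF schur_diag_bounded]) simp
    show ?thesis unfolding kop_scale[symmetric] kop_add[OF 1 2, symmetric]
      by (rule arg_cong[of _ _ "kop (Gam l)"]) (auto simp: diag_kern_def fun_eq_iff corner_def)
  qed
  finally show ?thesis .
qed

lemma glv_cong: "(\<And>g. g \<in> Gam l \<Longrightarrow> f g = h g) \<Longrightarrow> glv l f = glv l h"
  by (simp add: glv_def)

lemma corner_pt:
  assumes "length xs = Suc (2 * l)" "i \<le> l"
  shows "corner i (ptp l xs) = (if \<forall>j<i. xs ! j = 0 then 1 else 0)" "corner i (ptn l xs) = (if \<forall>j<i. xs ! j = 0 then 1 else 0)"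
  using assms by (auto simp: corner_def ptp_def ptn_def cI_def)

text \<open>Both copies of \<nat>^(2l+1) have 2l + 1 - i free coordinates; the numerator 1 + X
  accounts for the shift by one on the negative copy.\<close>

lemma glv_corner:
  assumes "i \<le> l"
  shows "glv l (\<lambda>g. diag_kern (Gam l) (corner i) g g) = (fps_const 1 + fps_const 1 * fps_X) * geo ^ Suc (2 * l - i)"
proof -
  let ?d = "Suc (2 * l)"
  have e: "(\<forall>j<?d. j \<in> {..<i} \<longrightarrow> xs ! j = 0) \<longleftrightarrow> (\<forall>j<i. xs ! j = 0)" for xs :: "nat list" using assms by auto
  have "card ({..<?d} - {..<i}) = Suc (2 * l - i)" using assms by (subst card_Diff_subset) auto
  hence c: "lvl ?d (\<lambda>xs. if \<forall>j<i. xs ! j = 0 then 1 else 0) = geo ^ Suc (2 * l - i)"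
    using lvl_corner[of ?d "{..<i}"] unfolding e by simp
  have "glv l (\<lambda>g. diag_kern (Gam l) (corner i) g g) = glv l (corner i)" by (rule glv_cong) (simp add: diag_kern_def)
  also have "\<dots> = lvl ?d (\<lambda>xs. if \<forall>j<i. xs ! j = 0 then 1 else 0) + fps_X * lvl ?d (\<lambda>xs. if \<forall>j<i. xs ! j = 0 then 1 else 0)"
    unfolding glv_lvl by (intro arg_cong2[of _ _ _ _ "(+)"] arg_cong[of _ _ "\<lambda>t. fps_X * t"] lvl_cong) (simp_all add: corner_pt assms)
  also have "\<dots> = (fps_const 1 + fps_const 1 * fps_X) * geo ^ Suc (2 * l - i)" unfolding c by (simp add: algebra_simps)
  finally show ?thesis .
qed

lemma sgn_eq_pt:
  assumes "length xs = Suc (2 * l)"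
  shows "sgn_eq (ptp l xs) \<longleftrightarrow> (\<forall>j<Suc (2 * l). l < j \<longrightarrow> xs ! j = 0)" "\<not> sgn_eq (ptn l xs)"
proof -
  have "(\<forall>e\<in>set (drop (Suc l) xs). e = 0) \<longleftrightarrow> (\<forall>k<l. xs ! (Suc l + k) = 0)"
    using assms by (simp add: all_set_conv_all_nth)
  also have "\<dots> \<longleftrightarrow> (\<forall>j<Suc (2 * l). l < j \<longrightarrow> xs ! j = 0)"
  proof (intro iffI allI impI)
    fix j assume "\<forall>k<l. xs ! (Suc l + k) = 0" "j < Suc (2 * l)" "l < j"
    thus "xs ! j = 0" by (auto dest!: spec[of _ "j - Suc l"])
  qed auto
  finally show "sgn_eq (ptp l xs) \<longleftrightarrow> (\<forall>j<Suc (2 * l). l < j \<longrightarrow> xs ! j = 0)" by (simp add: sgn_eq_def ptp_def)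
  show "\<not> sgn_eq (ptn l xs)" by (simp add: sgn_eq_def ptn_def)
qed

text \<open>Positive sign excludes the negative copy and annihilates the last l coordinates, so only
  the coordinates i to l remain free.\<close>

lemma glv_sgn_corner:
  assumes "i \<le> l"
  shows "glv l (\<lambda>g. diag_kern (Gam l) (\<lambda>g. of_bool (sgn_eq g) * corner i g) g g) = (fps_const 1 + fps_const 0 * fps_X) * geo ^ Suc (l - i)"
proof -
  let ?d = "Suc (2 * l)" and ?A = "{..<i} \<union> {l<..}"
  have e: "(\<forall>j<?d. j \<in> ?A \<longrightarrow> xs ! j = 0) \<longleftrightarrow> (\<forall>j<?d. l < j \<longrightarrow> xs ! j = 0) \<and> (\<forall>j<i. xs ! j = 0)" for xs :: "nat list"
    using assms by auto
  have "{..<?d} - ?A = {i..l}" using assms by auto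
  hence c: "lvl ?d (\<lambda>xs. if \<forall>j<?d. j \<in> ?A \<longrightarrow> xs ! j = 0 then 1 else 0) = geo ^ Suc (l - i)"
    unfolding lvl_corner using assms by (simp add: Suc_diff_le)
  have "glv l (\<lambda>g. diag_kern (Gam l) (\<lambda>g. of_bool (sgn_eq g) * corner i g) g g) = glv l (\<lambda>g. of_bool (sgn_eq g) * corner i g)"
    by (rule glv_cong) (simp add: diag_kern_def)
  also have "\<dots> = lvl ?d (\<lambda>xs. if \<forall>j<?d. j \<in> ?A \<longrightarrow> xs ! j = 0 then 1 else 0) + fps_X * lvl ?d (\<lambda>_. 0)"
    unfolding glv_lvl e
    by (intro arg_cong2[of _ _ _ _ "(+)"] arg_cong[of _ _ "\<lambda>t. fps_X * t"] lvl_cong) (auto simp: corner_pt assms sgn_eq_pt)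
  also have "\<dots> = (fps_const 1 + fps_const 0 * fps_X) * geo ^ Suc (l - i)" unfolding c by (simp add: lvl_zero)
  finally show ?thesis .
qed

lemma B_alg_pole:
  assumes l: "1 \<le> l" and k: "k \<le> 2 * l"
  shows "\<exists>b\<in>B_alg (Gam l) (C_eq l) (D_eq l). \<exists>f. zeta_extension (Gam l) (D_eq l) (2 * real l + 2) b f \<and> is_pole f (of_nat (Suc k))"
proof (cases "l \<le> k")
  case True
  \<comment> \<open>Leaves k + 1 of the 2l + 1 coordinates free. As at most l coordinates can be
    made zero by a corner, this reaches down to k = l.\<close>
  let ?i = "2 * l - k"
  have i: "?i \<le> l" "2 * l - ?i = k" using True k by auto
  have "\<exists>f. zeta_extension (Gam l) (D_eq l) (2 * real l + 2) (kop (Gam l) (diag_kern (Gam l) (corner ?i))) f \<and> is_pole f (of_nat (Suc k))"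
    by (rule pole_exists[where u=1 and v=1 and S=1, OF schur_diag_bounded k _ glv_corner[OF i(1), unfolded i(2)]]) (auto simp: corner_def)
  thus ?thesis using B_alg_corner[OF i(1)] by blast
next
  case False
  \<comment> \<open>The positive projection leaves l + 1 coordinates; removing l - k of them leaves
    k + 1.\<close>
  let ?i = "l - k" and ?q = "\<lambda>g. of_bool (sgn_eq g) :: complex"
  have i: "?i \<le> l" "l - ?i = k" using False by auto
  have "\<exists>f. zeta_extension (Gam l) (D_eq l) (2 * real l + 2) (kop (Gam l) (diag_kern (Gam l) (\<lambda>g. ?q g * corner ?i g))) f
      \<and> is_pole f (of_nat (Suc k))"
    by (rule pole_exists[where u=1 and v=0 and S=1, OF schur_diag_bounded k _ glv_sgn_corner[OF i(1), unfolded i(2)]]) (auto simp: corner_def)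
  moreover have "kop (Gam l) (diag_kern (Gam l) ?q) \<circ> kop (Gam l) (diag_kern (Gam l) (corner ?i)) \<in> B_alg (Gam l) (C_eq l) (D_eq l)"
    using B_alg_sgn[OF l] B_alg_corner[OF i(1)] unfolding B_alg_def by (rule generated_algebra.mult)
  moreover have "kop (Gam l) (diag_kern (Gam l) ?q) \<circ> kop (Gam l) (diag_kern (Gam l) (corner ?i)) = kop (Gam l) (diag_kern (Gam l) (\<lambda>g. ?q g * corner ?i g))"
    by (rule kop_diag_mult) (auto simp: corner_def)
  ultimately show ?thesis by (metis (no_types, lifting))
qed

lemma finitely_summable_eq: "finitely_summable (Gam l) (D_eq l) (2 * real l + 2)"
proof -
  let ?K = "diag_kern (Gam l) (\<lambda>_. 1)" and ?z = "of_real (2 * real l + 2) :: complex"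
  have K: "schur (Gam l) 1 ?K" by (rule schur_diag_bounded) simp
  let ?N = "diag_kern (Gam l) (neg_power_symbol d_eq ?z)"
  have N: "schur (Gam l) 1 ?N"
  proof (rule schur_diag_bounded)
    show "cmod (neg_power_symbol d_eq ?z g) \<le> 1" for g
      using d_eq_gap[of g] powr_mono[of "- (2 * real l + 2)" 0 "\<bar>d_eq g\<bar>"] by (auto simp: norm_neg_power_symbol)
  qed
  have "trace_class (Gam l) (kop (Gam l) ?K \<circ> kop (Gam l) ?N)"
    by (rule trace_class_neg_power[where N="Suc (2 * l)", OF _ K _ d_eq_gap Gam_ball_finite Gam_ball_card])
       (auto intro: countable_subset[OF subset_UNIV])
  moreover have "kop (Gam l) ?K \<circ> kop (Gam l) ?N = abs_neg_power (Gam l) (D_eq l) ?z"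
  proof -
    have "(\<lambda>x y. ?K x y * neg_power_symbol d_eq ?z y) = ?N" by (intro ext) (auto simp: diag_kern_def)
    thus ?thesis unfolding D_eq_diag kop_kcomp[OF K N] kcomp_diag_right[OF K]
      by (subst abs_neg_power_diag[OF d_eq_gap]) simp_all
  qed
  ultimately show ?thesis unfolding finitely_summable_def using dixmier_ideal_trace_class by fastforce
qed

lemma finite_discrete: "finite S \<Longrightarrow> discrete (S :: complex set)"
  by (rule discreteI) (simp add: isolated_in_islimpt_iff islimpt_finite)

theorem theorem4p11:
  fixes l :: nat
  assumes "l \<ge> 1"
  shows "spectral_triple (Gam l) (C_eq l) (D_eq l) \<and>
         regular_triple (Gam l) (C_eq l) (D_eq l) \<and>
         has_dimension_spectrum (Gam l) (C_eq l) (D_eq l) (of_nat ` {1..2 * l + 1}) \<and>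
         simple_dimension_spectrum (Gam l) (C_eq l) (D_eq l)"
proof (intro conjI spectral_triple_eq regular_triple_eq)
  let ?q = "2 * real l + 2"
  have poles: "(\<lambda>i. of_nat (Suc i) :: complex) ` {..2 * l} = of_nat ` {1..2 * l + 1}"
  proof -
    have "{1..2 * l + 1} = Suc ` {..2 * l}" by (simp add: image_Suc_atMost)
    thus ?thesis by (simp add: image_image)
  qed
  show "has_dimension_spectrum (Gam l) (C_eq l) (D_eq l) (of_nat ` {1..2 * l + 1})"
    unfolding has_dimension_spectrum_def
  proof (intro conjI finite_discrete exI[of _ ?q] finitely_summable_eq ballI)
    fix b assume "b \<in> B_alg (Gam l) (C_eq l) (D_eq l)"
    then obtain K where K: "eq_kernel l K" "b = kop (Gam l) K" using B_alg_eq_kernel by blast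
    obtain c G where "G holomorphic_on UNIV"
      "zeta_extension (Gam l) (D_eq l) ?q b (partial_fractions (2 * l) c G)"
      using eq_kernel_zeta[OF K(1)] unfolding K(2) by blast
    thus "\<exists>f. zeta_extension (Gam l) (D_eq l) ?q b f \<and> {z. is_pole f z} \<subseteq> of_nat ` {1..2 * l + 1}"
      using partial_fractions_pole(1) poles by blast
  next
    fix s :: complex assume "s \<in> of_nat ` {1..2 * l + 1}"
    then obtain k where "k \<le> 2 * l" "s = of_nat (Suc k)" unfolding poles[symmetric] by auto
    thus "\<exists>b\<in>B_alg (Gam l) (C_eq l) (D_eq l). \<exists>f. zeta_extension (Gam l) (D_eq l) ?q b f \<and> is_pole f s"
      using B_alg_pole[OF assms] by blast
  qed simp
  show "simple_dimension_spectrum (Gam l) (C_eq l) (D_eq l)"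
    unfolding simple_dimension_spectrum_def
  proof (intro allI impI ballI)
    fix p b f s
    assume b: "b \<in> B_alg (Gam l) (C_eq l) (D_eq l)" and f: "zeta_extension (Gam l) (D_eq l) p b f" and s: "is_pole f s"
    obtain K where K: "eq_kernel l K" "b = kop (Gam l) K" using B_alg_eq_kernel[OF b] by blast
    obtain c G where G: "G holomorphic_on UNIV"
      "zeta_extension (Gam l) (D_eq l) ?q b (partial_fractions (2 * l) c G)"
      using eq_kernel_zeta[OF K(1)] unfolding K(2) by blast
    \<comment> \<open>To the right of both abscissas f and the partial fraction are the same trace,
      so an arbitrary extension inherits the simple poles.\<close>
    have ev: "\<forall>\<^sub>F z in at s. f z = partial_fractions (2 * l) c G z"
      by (rule meromorphic_eq_of_half_plane[where x="max p ?q"]) (use f G(2) in \<open>auto simp: zeta_extension_def\<close>)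
    have "is_pole (partial_fractions (2 * l) c G) s" by (rule is_pole_transform[OF s ev refl])
    thus "zorder f s = -1" using partial_fractions_pole(2)[OF G(1)] zorder_cong[OF ev refl] by simp
  qed
qed

end
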